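(* Let $Q\subset\mathbb{R}^2$ be a convex polygon. For the dynamical system on $Q^n$ $$\dot p_i=\operatorname{CC}(V_i(P))-p_i,\quad i\in\{1,\dots,n\}$$ (respectively, for the differential inclusion $\dot p_i\in\operatorname{IC}(V_i(P))-p_i$, $i\in\{1,\dots,n\}$), the generators' location $P=(p_1,\dots,p_n)$ converges asymptotically (as $t\to+\infty$) to the largest weakly invariant set contained in the closure of $A_{\mathrm{DC}}(Q)$ (respectively, in the closure of $A_{\mathrm{SP}}(Q)$), where $$A_{\mathrm{DC}}(Q)=\{P\in Q^n : i\in I_{\mathrm{DC}}(P)\implies p_i=\operatorname{CC}(V_i(P))\},$$ $$A_{\mathrm{SP}}(Q)=\{P\in Q^n : i\in I_{\mathrm{SP}}(P)\implies p_i\in\operatorname{IC}(V_i(P))\}.$$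
   Context: $\|\cdot\|$ is the Euclidean norm; $\operatorname{Ed}(Q)$ is the set of edges of $Q$; $\operatorname{D}_e$ is the distance to $e$. For $P=(p_1,\dots,p_n)\in Q^n$, the Voronoi cells are $V_i(P)=\{q\in Q : \|q-p_i\|\le\|q-p_j\|\ \forall j\ne i\}$. The circumcenter $\operatorname{CC}(W)$ of a polygon $W$ is the center of the minimum-radius disk containing $W$; the incenter set $\operatorname{IC}(W)$ is the set of centers of maximum-radius disks contained in $W$. Let $G_i(P)=\max_{q\in V_i(P)}\|q-p_i\|$, $\mathcal{H}_{\mathrm{DC}}(P)=\max_{q\in Q}\min_i\|q-p_i\|=\max_iG_i(P)$, $F_i(P)=\min_{q\notin\operatorname{int}(V_i(P))}\|q-p_i\|$, and $\mathcal{H}_{\mathrm{SP}}(P)=\min\{\tfrac12\|p_i-p_j\|,\ \operatorname{D}_e(p_i) : i\ne j,\ e\in\operatorname{Ed}(Q)\}$ (also written $\min_iF_i(P)$). The sets of active indices are $I_{\mathrm{DC}}(P)=\{i : G_i(P)=\mathcal{H}_{\mathrm{DC}}(P)\}$ and $I_{\mathrm{SP}}(P)=\{i : F_i(P)=\mathcal{H}_{\mathrm{SP}}(P)\}$. A solution of a differential inclusion $\dot x\in F(x)$ is an absolutely continuous curve with $\dot x(t)\in F(x(t))$ for almost all $t$. A set $M$ is weakly invariant if for each $x_0\in M$, $M$ contains a maximal solution starting at $x_0$. *)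

theory Defs
  imports "HOL-Analysis.Analysis"
begin

section \<open>Differential inclusions\<close>

text \<open>
  Absolute continuity of a curve on a compact interval \<open>I\<close>. A set \<open>d\<close> with
  \<open>d division_of \<Union>d\<close> is a finite family of nonoverlapping compact intervals
  \<open>k = {Inf k..Sup k}\<close>.
\<close>

definition abs_cont_on :: "real set \<Rightarrow> (real \<Rightarrow> 'a::real_normed_vector) \<Rightarrow> bool" where
  "abs_cont_on I f \<longleftrightarrow>
     (\<forall>\<epsilon>>0. \<exists>\<delta>>0. \<forall>d. d division_of \<Union>d \<and> \<Union>d \<subseteq> I \<and> (\<Sum>k\<in>d. Sup k - Inf k) < \<delta>
        \<longrightarrow> (\<Sum>k\<in>d. norm (f (Sup k) - f (Inf k))) < \<epsilon>)"

text \<open>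
  Solutions of \<open>\<gamma>' \<in> F \<gamma>\<close> with state space \<open>X\<close>, starting at time 0, on a time
  interval \<open>J\<close> (bounded or not, with or without its right end point). A differential
  equation is the case of singleton values of \<open>F\<close>.
\<close>

definition di_solution ::
    "('a::real_normed_vector \<Rightarrow> 'a set) \<Rightarrow> 'a set \<Rightarrow> real set \<Rightarrow> (real \<Rightarrow> 'a) \<Rightarrow> bool" where
  "di_solution F X J \<gamma> \<longleftrightarrow>
     is_interval J \<and> 0 \<in> J \<and> J \<subseteq> {0..} \<and> (\<forall>t\<in>J. \<gamma> t \<in> X) \<and>
     (\<forall>a b. {a..b} \<subseteq> J \<longrightarrow> abs_cont_on {a..b} \<gamma>) \<and>
     (AE t in lebesgue. t \<in> J \<longrightarrow> (\<exists>v\<in>F (\<gamma> t). (\<gamma> has_vector_derivative v) (at t within J)))"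

definition maximal_di_solution ::
    "('a::real_normed_vector \<Rightarrow> 'a set) \<Rightarrow> 'a set \<Rightarrow> real set \<Rightarrow> (real \<Rightarrow> 'a) \<Rightarrow> bool" where
  "maximal_di_solution F X J \<gamma> \<longleftrightarrow> di_solution F X J \<gamma> \<and>
     (\<forall>J' \<gamma>'. di_solution F X J' \<gamma>' \<and> J \<subseteq> J' \<and> (\<forall>t\<in>J. \<gamma>' t = \<gamma> t) \<longrightarrow> J' = J)"

definition weakly_invariant ::
    "('a::real_normed_vector \<Rightarrow> 'a set) \<Rightarrow> 'a set \<Rightarrow> 'a set \<Rightarrow> bool" where
  "weakly_invariant F X M \<longleftrightarrow>
     (\<forall>x\<in>M. \<exists>J \<gamma>. maximal_di_solution F X J \<gamma> \<and> \<gamma> 0 = x \<and> (\<forall>t\<in>J. \<gamma> t \<in> M))"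

definition largest_weakly_invariant ::
    "('a::real_normed_vector \<Rightarrow> 'a set) \<Rightarrow> 'a set \<Rightarrow> 'a set \<Rightarrow> 'a set" where
  "largest_weakly_invariant F X S = \<Union>{M. M \<subseteq> S \<and> weakly_invariant F X M}"

lemma largest_weakly_invariant_is_greatest:
  "largest_weakly_invariant F X S \<subseteq> S"
  "weakly_invariant F X (largest_weakly_invariant F X S)"
  "M \<subseteq> S \<Longrightarrow> weakly_invariant F X M \<Longrightarrow> M \<subseteq> largest_weakly_invariant F X S"
proof -
  show "weakly_invariant F X (largest_weakly_invariant F X S)"
    unfolding weakly_invariant_def
  proof
    fix x assume "x \<in> largest_weakly_invariant F X S"
    then obtain M where M: "x \<in> M" "M \<subseteq> S" "weakly_invariant F X M"
      by (auto simp: largest_weakly_invariant_def)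
    then obtain J \<gamma> where "maximal_di_solution F X J \<gamma>" "\<gamma> 0 = x" "\<forall>t\<in>J. \<gamma> t \<in> M"
      unfolding weakly_invariant_def by blast
    moreover have "M \<subseteq> largest_weakly_invariant F X S"
      using M by (auto simp: largest_weakly_invariant_def)
    ultimately show "\<exists>J \<gamma>. maximal_di_solution F X J \<gamma> \<and> \<gamma> 0 = x \<and>
        (\<forall>t\<in>J. \<gamma> t \<in> largest_weakly_invariant F X S)"
      by blast
  qed
qed (auto simp: largest_weakly_invariant_def)

text \<open>
  Convergence of a curve to a set as time tends to infinity. The conjunct \<open>M \<noteq> {}\<close> is
  needed because \<open>infdist x {} = 0\<close>.
\<close>

definition converges_to_set :: "(real \<Rightarrow> 'a::metric_space) \<Rightarrow> 'a set \<Rightarrow> bool" where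
  "converges_to_set \<gamma> M \<longleftrightarrow> M \<noteq> {} \<and> ((\<lambda>t. infdist (\<gamma> t) M) \<longlongrightarrow> 0) at_top"


section \<open>Circumcenter and incenter set\<close>

definition circumcenter :: "'a::metric_space set \<Rightarrow> 'a" where
  "circumcenter W = (THE c. \<exists>r. W \<subseteq> cball c r \<and> (\<forall>c' r'. W \<subseteq> cball c' r' \<longrightarrow> r \<le> r'))"

text \<open>
  The condition \<open>0 \<le> r\<close> excludes the empty ball; empty balls of negative radius are
  harmless in the maximality clause.
\<close>

definition incenter_set :: "'a::metric_space set \<Rightarrow> 'a set" where
  "incenter_set W =
     {c. \<exists>r\<ge>0. cball c r \<subseteq> W \<and> (\<forall>c' r'. cball c' r' \<subseteq> W \<longrightarrow> r' \<le> r)}"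


section \<open>Voronoi partitions and multicenter functions\<close>

definition convex_polygon :: "(real^2) set \<Rightarrow> bool" where
  "convex_polygon Q \<longleftrightarrow> polytope Q \<and> interior Q \<noteq> {}"

text \<open>The space \<open>Q^n\<close> of generator locations; the generators are indexed by a finite type.\<close>

definition configurations :: "(real^2) set \<Rightarrow> ((real^2)^'n) set" where
  "configurations Q = {P. \<forall>i. P $ i \<in> Q}"

definition voronoi_cell :: "(real^2) set \<Rightarrow> (real^2)^'n \<Rightarrow> 'n \<Rightarrow> (real^2) set" where
  "voronoi_cell Q P i = {q\<in>Q. \<forall>j. j \<noteq> i \<longrightarrow> norm (q - P $ i) \<le> norm (q - P $ j)}"

text \<open>
  The suprema and infima below stand for maxima and minima: they are attained when \<open>Q\<close> is
  a convex polygon and \<open>P\<close> lies in \<open>configurations Q\<close>, since the cells are then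
  nonempty and compact and the complement of the interior of a cell is nonempty and closed.
\<close>

definition G_fun :: "(real^2) set \<Rightarrow> (real^2)^'n \<Rightarrow> 'n \<Rightarrow> real" where
  "G_fun Q P i = (SUP q\<in>voronoi_cell Q P i. norm (q - P $ i))"

definition F_fun :: "(real^2) set \<Rightarrow> (real^2)^'n \<Rightarrow> 'n \<Rightarrow> real" where
  "F_fun Q P i = (INF q\<in>- interior (voronoi_cell Q P i). norm (q - P $ i))"

definition H_DC :: "(real^2) set \<Rightarrow> (real^2)^'n::finite \<Rightarrow> real" where
  "H_DC Q P = (SUP q\<in>Q. MIN i. norm (q - P $ i))"

definition H_SP :: "(real^2) set \<Rightarrow> (real^2)^'n::finite \<Rightarrow> real" where
  "H_SP Q P = Min ({norm (P $ i - P $ j) / 2 | i j. i \<noteq> j} \<union>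
                   {infdist (P $ i) e | i e. e edge_of Q})"

definition I_DC :: "(real^2) set \<Rightarrow> (real^2)^'n::finite \<Rightarrow> 'n set" where
  "I_DC Q P = {i. G_fun Q P i = H_DC Q P}"

definition I_SP :: "(real^2) set \<Rightarrow> (real^2)^'n::finite \<Rightarrow> 'n set" where
  "I_SP Q P = {i. F_fun Q P i = H_SP Q P}"

definition A_DC :: "(real^2) set \<Rightarrow> ((real^2)^'n::finite) set" where
  "A_DC Q = {P \<in> configurations Q. \<forall>i\<in>I_DC Q P. P $ i = circumcenter (voronoi_cell Q P i)}"

definition A_SP :: "(real^2) set \<Rightarrow> ((real^2)^'n::finite) set" where
  "A_SP Q = {P \<in> configurations Q. \<forall>i\<in>I_SP Q P. P $ i \<in> incenter_set (voronoi_cell Q P i)}"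


section \<open>The two dynamical systems\<close>

definition DC_dynamics :: "(real^2) set \<Rightarrow> (real^2)^'n::finite \<Rightarrow> ((real^2)^'n) set" where
  "DC_dynamics Q P = {\<chi> i. circumcenter (voronoi_cell Q P i) - P $ i}"

definition SP_dynamics :: "(real^2) set \<Rightarrow> (real^2)^'n::finite \<Rightarrow> ((real^2)^'n) set" where
  "SP_dynamics Q P = {v. \<forall>i. \<exists>c\<in>incenter_set (voronoi_cell Q P i). v $ i = c - P $ i}"

end

theory Submission
  imports Defs "HOL-Complex_Analysis.Great_Picard"
begin

text \<open>
  Along a circumcenter curve each \<open>q\<close> in a cell sees its generator move towards a point at
  distance at most \<open>H_DC\<close> from \<open>q\<close>, so \<open>H_DC\<close> does not increase; along an incenter curve the
  constraints that attain the minimum in \<open>H_SP\<close> do not decrease. By LaSalle's argument the limits of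
  translates of a solution lie on a level set, and it remains to show that they are
  solutions and that they meet \<open>A_DC\<close>, respectively \<open>A_SP\<close>, at a dense set of times.

  The obstacle is that the fields are discontinuous where generators coincide. In both
  systems \<open>exp t * norm (p\<^sub>i - p\<^sub>j)\<close> is nondecreasing, so generators never merge in finite time.
  For the incenter dynamics, noncoincident generators even stay uniformly apart, and the
  limit inclusion follows from upper semicontinuity and convexity. For the circumcenter dynamics generators may
  merge in the limit; but as long as their limits coincide, the increments of
  \<open>exp t * norm (p\<^sub>i - p\<^sub>j)\<close> tend to zero, which forces the circumcenters of
  their cells onto the separating lines. Then each nondegenerate cell has the circumcenter
  of the merged cell, and so has the cell of the generator closest to a generic
  point \<open>x\<close>. The derivative of the distance to \<open>x\<close>, for several \<open>x\<close>,
  determines the velocity of the limit.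
\<close>

text \<open>Cells jump when generators coincide, so a closed-graph argument cannot identify the
  limits of circumcenter curves. A charging argument replaces it. Summed over a merged cluster, the
  terms \<open>sgn (p_i - p_j) \<bullet> (c_i - c_j)\<close> are nonnegative, since bisectors
  separate cells, and \<open>exp t\<close> times this sum is the derivative of the cluster's
  distances weighted by \<open>exp t\<close>. At times when the sum is not small, nothing is known
  about the circumcenters, but the velocity error is at most a constant times the sum. It is
  therefore absorbed by the increments of the weighted distances, which vanish in the limit. A
  single generator cannot be followed, because a sliver cell may pull it elsewhere. The minimum of
  the squared distances to \<open>x\<close> over the cluster can: up to the charged error it has the
  right slope almost everywhere, and it converges to the squared distance of the common limit.
  Everything is phrased by slope bounds outside null sets, which pass to limits without integrating
  velocities. An incenter limit is known only to be Lipschitz, hence the detour through almost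
  everywhere differentiability.\<close>

section \<open>Monotonicity from almost everywhere slope bounds\<close>

text \<open>The quotient straddles \<open>t\<close>, with \<open>u\<close> and \<open>v\<close> on
  either side, because the fine divisions in \<open>ae_lower_slope_mono\<close> deliver intervals
  around their tags. Unlike a derivative, the notion survives finite minima.\<close>

definition lower_slope :: "(real \<Rightarrow> real) \<Rightarrow> real \<Rightarrow> real \<Rightarrow> bool" where
  "lower_slope f t m \<longleftrightarrow>
     (\<forall>\<epsilon>>0. \<exists>\<delta>>0. \<forall>u v. t - \<delta> < u \<and> u \<le> t \<and> t \<le> v \<and> v < t + \<delta> \<longrightarrow> (m - \<epsilon>) * (v - u) \<le> f v - f u)"

lemma lower_slopeD:
  assumes "lower_slope f t m" "\<epsilon> > 0"
  obtains \<delta> where "\<delta> > 0"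
    "\<And>u v. t - \<delta> < u \<Longrightarrow> u \<le> t \<Longrightarrow> t \<le> v \<Longrightarrow> v < t + \<delta> \<Longrightarrow> (m - \<epsilon>) * (v - u) \<le> f v - f u"
  using assms unfolding lower_slope_def by blast

lemma lower_slope_mono:
  assumes "lower_slope f t m" "m' \<le> m"
  shows "lower_slope f t m'"
  unfolding lower_slope_def
proof (intro allI impI)
  fix \<epsilon> :: real assume "\<epsilon> > 0"
  obtain \<delta> where d: "\<delta> > 0"
    "\<And>u v. t - \<delta> < u \<Longrightarrow> u \<le> t \<Longrightarrow> t \<le> v \<Longrightarrow> v < t + \<delta> \<Longrightarrow> (m - \<epsilon>) * (v - u) \<le> f v - f u"
    using lower_slopeD[OF assms(1) \<open>\<epsilon> > 0\<close>] by blast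
  show "\<exists>\<delta>>0. \<forall>u v. t - \<delta> < u \<and> u \<le> t \<and> t \<le> v \<and> v < t + \<delta> \<longrightarrow> (m' - \<epsilon>) * (v - u) \<le> f v - f u"
  proof (intro exI[of _ \<delta>] conjI allI impI d(1))
    fix u v assume a: "t - \<delta> < u \<and> u \<le> t \<and> t \<le> v \<and> v < t + \<delta>"
    have "(m' - \<epsilon>) * (v - u) \<le> (m - \<epsilon>) * (v - u)"
      by (rule mult_right_mono) (use a assms(2) in auto)
    then show "(m' - \<epsilon>) * (v - u) \<le> f v - f u" using d(2)[of u v] a by linarith
  qed
qed

lemma lower_slope_add:
  assumes "lower_slope f t m" "lower_slope g t n"
  shows "lower_slope (\<lambda>s. f s + g s) t (m + n)"
  unfolding lower_slope_def
proof (intro allI impI)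
  fix \<epsilon> :: real assume "\<epsilon> > 0"
  then have e: "\<epsilon>/2 > 0" by simp
  obtain \<delta> where d: "\<delta> > 0"
    "\<And>u v. t - \<delta> < u \<Longrightarrow> u \<le> t \<Longrightarrow> t \<le> v \<Longrightarrow> v < t + \<delta> \<Longrightarrow> (m - \<epsilon>/2) * (v - u) \<le> f v - f u"
    using lower_slopeD[OF assms(1) e] by blast
  obtain \<delta>' where d': "\<delta>' > 0"
    "\<And>u v. t - \<delta>' < u \<Longrightarrow> u \<le> t \<Longrightarrow> t \<le> v \<Longrightarrow> v < t + \<delta>' \<Longrightarrow> (n - \<epsilon>/2) * (v - u) \<le> g v - g u"
    using lower_slopeD[OF assms(2) e] by blast
  show "\<exists>\<delta>>0. \<forall>u v. t - \<delta> < u \<and> u \<le> t \<and> t \<le> v \<and> v < t + \<delta> \<longrightarrow>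
      (m + n - \<epsilon>) * (v - u) \<le> f v + g v - (f u + g u)"
  proof (intro exI[of _ "min \<delta> \<delta>'"] conjI allI impI)
    fix u v assume a: "t - min \<delta> \<delta>' < u \<and> u \<le> t \<and> t \<le> v \<and> v < t + min \<delta> \<delta>'"
    have "(m - \<epsilon>/2) * (v - u) \<le> f v - f u" "(n - \<epsilon>/2) * (v - u) \<le> g v - g u"
      by (rule d(2) d'(2); use a in linarith)+
    then show "(m + n - \<epsilon>) * (v - u) \<le> f v + g v - (f u + g u)"
      by (simp add: field_simps)
  qed (use d d' in auto)
qed

lemma lower_slope_cmult:
  assumes "lower_slope f t m" "c \<ge> 0"
  shows "lower_slope (\<lambda>s. c * f s) t (c * m)"
proof (cases "c = 0")
  case True
  then show ?thesis unfolding lower_slope_def by (auto intro!: exI[of _ 1] mult_nonneg_nonneg)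
next
  case False
  then have c: "c > 0" using assms by simp
  show ?thesis unfolding lower_slope_def
  proof (intro allI impI)
    fix \<epsilon> :: real assume "\<epsilon> > 0"
    then have e: "\<epsilon>/c > 0" using c by simp
    obtain \<delta> where d: "\<delta> > 0"
      "\<And>u v. t - \<delta> < u \<Longrightarrow> u \<le> t \<Longrightarrow> t \<le> v \<Longrightarrow> v < t + \<delta> \<Longrightarrow> (m - \<epsilon>/c) * (v - u) \<le> f v - f u"
      using lower_slopeD[OF assms(1) e] by blast
    show "\<exists>\<delta>>0. \<forall>u v. t - \<delta> < u \<and> u \<le> t \<and> t \<le> v \<and> v < t + \<delta> \<longrightarrow>
        (c * m - \<epsilon>) * (v - u) \<le> c * f v - c * f u"
    proof (intro exI[of _ \<delta>] conjI allI impI d(1))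
      fix u v assume a: "t - \<delta> < u \<and> u \<le> t \<and> t \<le> v \<and> v < t + \<delta>"
      have "c * ((m - \<epsilon>/c) * (v - u)) \<le> c * (f v - f u)"
        using d(2)[of u v] a c by (intro mult_left_mono) auto
      moreover have "c * ((m - \<epsilon>/c) * (v - u)) = (c * m - \<epsilon>) * (v - u)"
        using c by (simp add: field_simps)
      ultimately show "(c * m - \<epsilon>) * (v - u) \<le> c * f v - c * f u"
        by (simp add: algebra_simps)
    qed
  qed
qed

lemma lower_slope_sum:
  assumes "finite A" "\<And>a. a \<in> A \<Longrightarrow> lower_slope (f a) t (m a)"
  shows "lower_slope (\<lambda>s. \<Sum>a\<in>A. f a s) t (\<Sum>a\<in>A. m a)"
  using assms
proof (induction A rule: finite_induct)
  case empty
  then show ?case unfolding lower_slope_def by (auto intro!: exI[of _ 1] mult_nonneg_nonneg)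
next
  case (insert x F)
  then show ?case by (simp add: lower_slope_add)
qed

lemma lower_slope_has_derivative:
  assumes "(f has_real_derivative m) (at t)"
  shows "lower_slope f t m"
  unfolding lower_slope_def
proof (intro allI impI)
  fix \<epsilon> :: real assume "\<epsilon> > 0"
  have "(f has_derivative (\<lambda>h. m * h)) (at t)"
    using assms by (simp add: has_field_derivative_def)
  then obtain \<delta> where d: "\<delta> > 0" "\<And>y. \<bar>y - t\<bar> < \<delta> \<Longrightarrow> \<bar>f y - f t - m * (y - t)\<bar> \<le> \<epsilon> * \<bar>y - t\<bar>"
    unfolding has_derivative_at_alt using \<open>\<epsilon> > 0\<close> by (auto simp: real_norm_def)
  show "\<exists>\<delta>>0. \<forall>u v. t - \<delta> < u \<and> u \<le> t \<and> t \<le> v \<and> v < t + \<delta> \<longrightarrow> (m - \<epsilon>) * (v - u) \<le> f v - f u"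
  proof (intro exI[of _ \<delta>] conjI allI impI d(1))
    fix u v assume a: "t - \<delta> < u \<and> u \<le> t \<and> t \<le> v \<and> v < t + \<delta>"
    have 1: "\<bar>f u - f t - m * (u - t)\<bar> \<le> \<epsilon> * \<bar>u - t\<bar>" by (rule d(2)) (use a in auto)
    have 2: "\<bar>f v - f t - m * (v - t)\<bar> \<le> \<epsilon> * \<bar>v - t\<bar>" by (rule d(2)) (use a in auto)
    have "f v - f t \<ge> m * (v - t) - \<epsilon> * (v - t)" using 2 a by auto
    moreover have "f u - f t \<le> m * (u - t) + \<epsilon> * (t - u)" using 1 a by auto
    ultimately show "(m - \<epsilon>) * (v - u) \<le> f v - f u" by (simp add: algebra_simps)
  qed
qed

text \<open>Different functions may represent \<open>f\<close> to the left and to the right of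
  \<open>t\<close>. All those selected have the value \<open>f t\<close> at \<open>t\<close>, so the
  bounds on \<open>[u, t]\<close> and \<open>[t, v]\<close> can be added there.\<close>

lemma lower_slope_selection:
  assumes A: "finite A" and \<delta>: "\<delta> > 0"
    and sel: "\<And>s. \<bar>s - t\<bar> < \<delta> \<Longrightarrow> \<exists>a\<in>A. f s = g a s \<and> f t = g a t"
    and g: "\<And>a. a \<in> A \<Longrightarrow> f t = g a t \<Longrightarrow> lower_slope (g a) t m"
  shows "lower_slope f t m"
  unfolding lower_slope_def
proof (intro allI impI)
  fix \<epsilon> :: real assume e: "\<epsilon> > 0"
  define B where "B = {a\<in>A. f t = g a t}"
  have B: "finite B" "B \<noteq> {}" using A sel[of t] \<delta> by (auto simp: B_def)
  have "\<forall>a\<in>B. \<exists>d>0. \<forall>u v. t - d < u \<and> u \<le> t \<and> t \<le> v \<and> v < t + d \<longrightarrow> (m - \<epsilon>) * (v - u) \<le> g a v - g a u"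
    using g e unfolding B_def lower_slope_def by auto
  then obtain D where D: "\<And>a. a \<in> B \<Longrightarrow> D a > 0" 
     "\<And>a u v. a \<in> B \<Longrightarrow> t - D a < u \<Longrightarrow> u \<le> t \<Longrightarrow> t \<le> v \<Longrightarrow> v < t + D a \<Longrightarrow> (m - \<epsilon>) * (v - u) \<le> g a v - g a u"
    by metis
  define d where "d = min \<delta> (Min (D ` B))"
  have d0: "d > 0" using B D \<delta> by (auto simp: d_def)
  have dD: "d \<le> D a" if "a \<in> B" for a using B that by (auto simp: d_def min_le_iff_disj)
  show "\<exists>\<delta>>0. \<forall>u v. t - \<delta> < u \<and> u \<le> t \<and> t \<le> v \<and> v < t + \<delta> \<longrightarrow> (m - \<epsilon>) * (v - u) \<le> f v - f u"
  proof (intro exI[of _ d] conjI allI impI d0)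
    fix u v assume a: "t - d < u \<and> u \<le> t \<and> t \<le> v \<and> v < t + d"
    have dd: "d \<le> \<delta>" by (simp add: d_def)
    obtain p where p: "p \<in> B" "f u = g p u" "f t = g p t" using sel[of u] a dd by (auto simp: B_def)
    obtain q where q: "q \<in> B" "f v = g q v" "f t = g q t" using sel[of v] a dd by (auto simp: B_def)
    have "(m - \<epsilon>) * (t - u) \<le> g p t - g p u" by (rule D(2)[OF p(1)]) (use a dD[OF p(1)] d0 in auto)
    moreover have "(m - \<epsilon>) * (v - t) \<le> g q v - g q t" by (rule D(2)[OF q(1)]) (use a dD[OF q(1)] d0 in auto)
    ultimately show "(m - \<epsilon>) * (v - u) \<le> f v - f u" using p q by (simp add: algebra_simps)
  qed
qed

text \<open>By continuity an index that is not minimal at \<open>t\<close> stays strictly above a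
  fixed minimal one near \<open>t\<close>; so a minimizer at a nearby time is also a minimizer at
  \<open>t\<close>.\<close>

lemma Min_locally_active:
  fixes g :: "'a \<Rightarrow> real \<Rightarrow> real"
  assumes A: "finite A" "A \<noteq> {}" and c: "\<And>a. a \<in> A \<Longrightarrow> isCont (g a) t"
  obtains \<delta> where "\<delta> > 0"
    "\<And>s. \<bar>s - t\<bar> < \<delta> \<Longrightarrow> \<exists>a\<in>A. Min ((\<lambda>a. g a s) ` A) = g a s \<and> Min ((\<lambda>a. g a t) ` A) = g a t"
proof -
  define m where "m = Min ((\<lambda>a. g a t) ` A)"
  define B where "B = {a\<in>A. g a t = m}"
  have "m \<in> (\<lambda>a. g a t) ` A" unfolding m_def using A by (intro Min_in) auto
  then obtain b where b: "b \<in> B" by (auto simp: B_def)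
  have "\<forall>\<^sub>F s in at t. g b s < g a s" if "a \<in> A - B" for a
  proof -
    have "m \<le> g a t" using that A by (auto simp: m_def)
    then have "g b t < g a t" using that b by (auto simp: B_def)
    moreover have "((\<lambda>s. g a s - g b s) \<longlongrightarrow> g a t - g b t) (at t)"
      using c[of a] c[of b] that b by (intro tendsto_intros) (auto simp: B_def isCont_def)
    ultimately have "\<forall>\<^sub>F s in at t. g a s - g b s > 0" by (intro order_tendstoD) auto
    then show ?thesis by simp
  qed
  then have "\<forall>\<^sub>F s in at t. \<forall>a\<in>A - B. g b s < g a s"
    using A by (subst eventually_ball_finite_distrib) auto
  then obtain \<delta> where d: "\<delta> > 0" "\<And>s. s \<noteq> t \<Longrightarrow> \<bar>s - t\<bar> < \<delta> \<Longrightarrow> \<forall>a\<in>A - B. g b s < g a s"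
    unfolding eventually_at by (auto simp: dist_real_def)
  show thesis
  proof (rule that[OF d(1)])
    fix s assume s: "\<bar>s - t\<bar> < \<delta>"
    show "\<exists>a\<in>A. Min ((\<lambda>a. g a s) ` A) = g a s \<and> Min ((\<lambda>a. g a t) ` A) = g a t"
    proof (cases "s = t")
      case True
      then show ?thesis using b by (intro bexI[of _ b]) (auto simp: B_def m_def)
    next
      case False
      have "Min ((\<lambda>a. g a s) ` A) \<in> (\<lambda>a. g a s) ` A" using A by (intro Min_in) auto
      then obtain a where a: "a \<in> A" "Min ((\<lambda>a. g a s) ` A) = g a s" by auto
      have "g a s \<le> g b s" using a A b by (metis (mono_tags, lifting) B_def Min_le finite_imageI image_eqI mem_Collect_eq)
      then have "a \<in> B" using d(2)[OF False s] a(1) by (meson DiffI linorder_not_le)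
      then show ?thesis using a by (auto simp: B_def m_def)
    qed
  qed
qed

lemma lower_slope_Min:
  fixes g :: "'a \<Rightarrow> real \<Rightarrow> real"
  assumes A: "finite A" "A \<noteq> {}" and c: "\<And>a. a \<in> A \<Longrightarrow> isCont (g a) t"
    and g: "\<And>a. a \<in> A \<Longrightarrow> g a t = Min ((\<lambda>a. g a t) ` A) \<Longrightarrow> lower_slope (g a) t m"
  shows "lower_slope (\<lambda>s. Min ((\<lambda>a. g a s) ` A)) t m"
proof -
  obtain \<delta> where d: "\<delta> > 0"
    "\<And>s. \<bar>s - t\<bar> < \<delta> \<Longrightarrow> \<exists>a\<in>A. Min ((\<lambda>a. g a s) ` A) = g a s \<and> Min ((\<lambda>a. g a t) ` A) = g a t"
    using Min_locally_active[where A = A and g = g and t = t] A c by blast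
  show ?thesis by (rule lower_slope_selection[OF A(1) d(1), where g = g]) (use g d(2) in auto)
qed

text \<open>Local activity concerns values and not signs, so it bounds the slope of the minimum from
  above as well. Together with \<open>lower_slope_Min\<close> this makes the minimum almost
  differentiable when the active functions have nearly equal slopes.\<close>

lemma lower_slope_uminus_Min:
  fixes g :: "'a \<Rightarrow> real \<Rightarrow> real"
  assumes A: "finite A" "A \<noteq> {}" and c: "\<And>a. a \<in> A \<Longrightarrow> isCont (g a) t"
    and g: "\<And>a. a \<in> A \<Longrightarrow> g a t = Min ((\<lambda>a. g a t) ` A) \<Longrightarrow> lower_slope (\<lambda>s. - g a s) t m"
  shows "lower_slope (\<lambda>s. - Min ((\<lambda>a. g a s) ` A)) t m"
proof -
  obtain \<delta> where d: "\<delta> > 0"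
    "\<And>s. \<bar>s - t\<bar> < \<delta> \<Longrightarrow> \<exists>a\<in>A. Min ((\<lambda>a. g a s) ` A) = g a s \<and> Min ((\<lambda>a. g a t) ` A) = g a t"
    using Min_locally_active[where A = A and g = g and t = t] A c by blast
  show ?thesis by (rule lower_slope_selection[OF A(1) d(1), where g = "\<lambda>a s. - g a s"]) (use g d(2) in auto)
qed

text \<open>Below the level \<open>\<kappa>\<close> the truncated function is locally constant.
  Truncation thus hides the points where \<open>g\<close> is small, which matters where
  \<open>g\<close> is a norm with a kink at 0.\<close>

lemma lower_slope_max_const:
  assumes c: "isCont g t" and g: "\<kappa> \<le> g t \<Longrightarrow> lower_slope g t 0"
  shows "lower_slope (\<lambda>s. max \<kappa> (g s)) t 0"
proof (cases "\<kappa> \<le> g t")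
  case True
  show ?thesis unfolding lower_slope_def
  proof (intro allI impI)
    fix \<epsilon> :: real assume e: "\<epsilon> > 0"
    obtain \<delta> where d: "\<delta> > 0"
      "\<And>u v. t - \<delta> < u \<Longrightarrow> u \<le> t \<Longrightarrow> t \<le> v \<Longrightarrow> v < t + \<delta> \<Longrightarrow> (0 - \<epsilon>) * (v - u) \<le> g v - g u"
      using lower_slopeD[OF g[OF True] e] by blast
    show "\<exists>\<delta>>0. \<forall>u v. t - \<delta> < u \<and> u \<le> t \<and> t \<le> v \<and> v < t + \<delta> \<longrightarrow> (0 - \<epsilon>) * (v - u) \<le> max \<kappa> (g v) - max \<kappa> (g u)"
    proof (intro exI[of _ \<delta>] conjI allI impI d(1))
      fix u v assume a: "t - \<delta> < u \<and> u \<le> t \<and> t \<le> v \<and> v < t + \<delta>"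
      have "(0 - \<epsilon>) * (v - u) \<le> g v - g u" using d(2) a by blast
      moreover have "(0 - \<epsilon>) * (v - u) \<le> 0" using a e by (simp add: mult_nonpos_nonneg)
      ultimately show "(0 - \<epsilon>) * (v - u) \<le> max \<kappa> (g v) - max \<kappa> (g u)" by (auto simp: max_def)
    qed
  qed
next
  case False
  then have "\<forall>\<^sub>F s in at t. g s < \<kappa>" using c unfolding isCont_def by (intro order_tendstoD) auto
  then obtain \<delta> where d: "\<delta> > 0" "\<And>s. s \<noteq> t \<Longrightarrow> \<bar>s - t\<bar> < \<delta> \<Longrightarrow> g s < \<kappa>"
    unfolding eventually_at by (auto simp: dist_real_def)
  have d2: "g s < \<kappa>" if "\<bar>s - t\<bar> < \<delta>" for s using d(2)[of s] that False by (cases "s = t") auto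
  show ?thesis
  proof (rule lower_slope_selection[where A = "{()}" and g = "\<lambda>_ _. \<kappa>" and \<delta> = \<delta>])
    show "lower_slope (\<lambda>_. \<kappa>) t 0" by (rule lower_slope_has_derivative) auto
    show "\<exists>a\<in>{()}. max \<kappa> (g s) = \<kappa> \<and> max \<kappa> (g t) = \<kappa>" if "\<bar>s - t\<bar> < \<delta>" for s
      using d2[OF that] d2[of t] d(1) by (simp add: max_absorb1)
  qed (use d(1) in auto)
qed

text \<open>The gauge is the open set \<open>U\<close> of small measure at exceptional tags and the
  slope radius at all others. Intervals with exceptional tags then contribute little by absolute
  continuity, and the remaining ones satisfy the slope bound.\<close>

lemma ae_lower_slope_mono:
  fixes f :: "real \<Rightarrow> real"
  assumes ab: "a \<le> b" and ac: "abs_cont_on {a..b} f" and N: "negligible N"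
    and sl: "\<And>t. a < t \<Longrightarrow> t < b \<Longrightarrow> t \<notin> N \<Longrightarrow> lower_slope f t 0"
  shows "f a \<le> f b"
proof (rule field_le_epsilon)
  fix e :: real assume e: "e > 0"
  \<comment> \<open>The summand 1 keeps the denominator positive when \<open>a = b\<close>.\<close>
  define \<epsilon> where "\<epsilon> = e / (2 * (b - a + 1))"
  have e0: "\<epsilon> > 0" using e ab by (simp add: \<epsilon>_def)
  have e1: "\<epsilon> * (b - a) \<le> e/2" using e ab by (simp add: \<epsilon>_def field_simps)
  obtain \<delta> where \<delta>: "\<delta> > 0" "\<And>d. d division_of \<Union>d \<Longrightarrow> \<Union>d \<subseteq> {a..b} \<Longrightarrow> (\<Sum>k\<in>d. Sup k - Inf k) < \<delta>
        \<Longrightarrow> (\<Sum>k\<in>d. norm (f (Sup k) - f (Inf k))) < e/2"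
    using ac e unfolding abs_cont_on_def by (meson half_gt_zero)
  \<comment> \<open>No slope is assumed at the end points, so they join the exceptional set.\<close>
  define N' where "N' = N \<union> {a,b}"
  have "negligible N'" using N by (simp add: N'_def)
  obtain U where U: "open U" "N' \<subseteq> U" "U \<in> lmeasurable" "measure lebesgue U < \<delta>"
  proof -
    have N': "N' \<in> lmeasurable" "emeasure lebesgue N' = 0"
      using \<open>negligible N'\<close> by (auto simp: negligible_imp_measurable negligible_iff_null_sets)
    obtain T where T: "open T" "N' \<subseteq> T" "T - N' \<in> lmeasurable" "emeasure lebesgue (T - N') < ennreal \<delta>"
      using sets_lebesgue_outer_open[OF fmeasurableD[OF N'(1)] \<delta>(1)] by blast
    have eq: "N' \<union> (T - N') = T" using T(2) by auto
    have meas: "T \<in> lmeasurable" using fmeasurable.Un[OF N'(1) T(3)] eq by simp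
    have "emeasure lebesgue T \<le> emeasure lebesgue N' + emeasure lebesgue (T - N')"
      using emeasure_subadditive[OF fmeasurableD[OF N'(1)] fmeasurableD[OF T(3)]] eq by simp
    also have "\<dots> < ennreal \<delta>" using N'(2) T(4) by simp
    finally have "measure lebesgue T < \<delta>"
      using meas \<delta>(1) by (simp add: emeasure_eq_measure2 ennreal_less_iff)
    then show thesis using T meas that by blast
  qed
  have "\<forall>t. \<exists>d>0. t \<notin> N' \<and> a < t \<and> t < b \<longrightarrow> (\<forall>u v. t - d < u \<and> u \<le> t \<and> t \<le> v \<and> v < t + d \<longrightarrow> (0 - \<epsilon>) * (v - u) \<le> f v - f u)"
    using sl e0 unfolding lower_slope_def N'_def by (metis Un_iff zero_less_one)
  then obtain D where D: "\<And>t. D t > 0" "\<And>t u v. t \<notin> N' \<Longrightarrow> a < t \<Longrightarrow> t < b \<Longrightarrow> 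
     t - D t < u \<Longrightarrow> u \<le> t \<Longrightarrow> t \<le> v \<Longrightarrow> v < t + D t \<Longrightarrow> (0 - \<epsilon>) * (v - u) \<le> f v - f u" by metis
  define \<gamma> where "\<gamma> x = (if x \<in> N' then U else ball x (D x))" for x
  have "gauge \<gamma>" unfolding gauge_def \<gamma>_def using U D(1) by auto
  then obtain p where p: "p tagged_division_of {a..b}" "\<gamma> fine p"
    using fine_division_exists_real by blast
  have fp: "finite p" using p(1) by auto
  define p1 where "p1 = {xk\<in>p. fst xk \<in> N'}"
  define p2 where "p2 = {xk\<in>p. fst xk \<notin> N'}"
  have p12: "p = p1 \<union> p2" "p1 \<inter> p2 = {}" by (auto simp: p1_def p2_def)
  have fin: "finite p1" "finite p2" using fp by (auto simp: p1_def p2_def)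
  have kform: "\<exists>u v. k = {u..v} \<and> u \<le> v \<and> x \<in> {u..v} \<and> {u..v} \<subseteq> {a..b}" if "(x,k) \<in> p" for x k
    using tagged_division_ofD(2,3,4)[OF p(1) that] by (metis atLeastatMost_empty_iff2 box_real(2) empty_iff)
  have "(\<Sum>(x,k)\<in>p. f (Sup k) - f (Inf k)) = f b - f a"
    using additive_tagged_division_1[OF ab p(1), of f] by simp
  then have tot: "f b - f a = (\<Sum>(x,k)\<in>p1. f (Sup k) - f (Inf k)) + (\<Sum>(x,k)\<in>p2. f (Sup k) - f (Inf k))"
    using p12 fin by (simp add: sum.union_disjoint)
  have p1t: "p1 tagged_partial_division_of {a..b}"
    by (rule tagged_partial_division_subset[OF conjunct1[OF p(1)[unfolded tagged_division_of_def]]]) (auto simp: p1_def)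
  have p1d: "p1 tagged_division_of \<Union>(snd ` p1)"
    by (rule tagged_partial_division_of_Union_self[OF p1t])
  then have div: "(snd ` p1) division_of \<Union>(snd ` p1)" by (rule division_of_tagged_division)
  \<comment> \<open>Passing from tagged intervals to intervals requires a function that vanishes on
    every \<open>cbox u v\<close> with empty interior, including the empty set, where
    \<open>Sup\<close> and \<open>Inf\<close> are arbitrary.\<close>
  let ?h = "\<lambda>k. if k = {} then 0 else norm (f (Sup k) - f (Inf k))"
  have "(\<Sum>(x,k)\<in>p1. norm (f (Sup k) - f (Inf k))) = (\<Sum>(x,k)\<in>p1. ?h k)"
    by (rule sum.cong) (use kform in \<open>force simp: p1_def\<close>)+
  also have "\<dots> = (\<Sum>k\<in>snd ` p1. ?h k)"
  proof (rule sum.over_tagged_division_lemma[OF p1d])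
    fix u v :: real assume "box u v = {}"
    then show "?h (cbox u v) = 0"
      by (cases "u = v") auto
  qed
  also have "\<dots> = (\<Sum>k\<in>snd ` p1. norm (f (Sup k) - f (Inf k)))"
    by (rule sum.cong) (use kform in \<open>force simp: p1_def\<close>)+
  finally have s1: "(\<Sum>(x,k)\<in>p1. norm (f (Sup k) - f (Inf k))) = (\<Sum>k\<in>snd ` p1. norm (f (Sup k) - f (Inf k)))" .
  have sub: "\<Union>(snd ` p1) \<subseteq> {a..b}" using kform by (fastforce simp: p1_def)
  have subU: "k \<subseteq> U" if "k \<in> snd ` p1" for k
    using p(2) that by (fastforce simp: p1_def fine_def \<gamma>_def)
  have "(\<Sum>k\<in>snd ` p1. Sup k - Inf k) = (\<Sum>k\<in>snd ` p1. measure lebesgue k)"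
  proof (rule sum.cong[OF refl])
    fix k assume "k \<in> snd ` p1"
    then obtain u v where "k = {u..v}" "u \<le> v" using kform by (force simp: p1_def)
    then show "Sup k - Inf k = measure lebesgue k" by simp
  qed
  also have "\<dots> = measure lebesgue (\<Union>(snd ` p1))"
    using content_division[OF div] by simp
  also have "\<dots> \<le> measure lebesgue U"
    using subU U(3) fmeasurableD[OF lmeasurable_division[OF div]] by (intro measure_mono_fmeasurable) auto
  finally have "(\<Sum>k\<in>snd ` p1. Sup k - Inf k) < \<delta>" using U(4) by simp
  then have "(\<Sum>k\<in>snd ` p1. norm (f (Sup k) - f (Inf k))) < e/2" by (intro \<delta>(2) div sub)
  moreover have "(\<Sum>(x,k)\<in>p1. f (Sup k) - f (Inf k)) \<ge> - (\<Sum>(x,k)\<in>p1. norm (f (Sup k) - f (Inf k)))"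
    unfolding sum_negf[symmetric] by (rule sum_mono) (auto simp: case_prod_beta)
  ultimately have A: "(\<Sum>(x,k)\<in>p1. f (Sup k) - f (Inf k)) \<ge> - (e/2)" using s1 by linarith
  have "(\<Sum>(x,k)\<in>p2. f (Sup k) - f (Inf k)) \<ge> (\<Sum>(x,k)\<in>p2. (0 - \<epsilon>) * (Sup k - Inf k))"
  proof (rule sum_mono, clarify)
    fix x k assume xk: "(x,k) \<in> p2"
    then have xk': "(x,k) \<in> p" "x \<notin> N'" by (auto simp: p2_def)
    obtain u v where uv: "k = {u..v}" "u \<le> v" "x \<in> {u..v}" "{u..v} \<subseteq> {a..b}" using kform[OF xk'(1)] by blast
    have "k \<subseteq> ball x (D x)" using p(2) xk' by (fastforce simp: fine_def \<gamma>_def)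
    then have "u \<in> ball x (D x)" "v \<in> ball x (D x)" using uv by fastforce+
    then have "x - D x < u" "v < x + D x" by (auto simp: dist_real_def)
    moreover have "a < x" "x < b" using xk' uv by (auto simp: N'_def less_le)
    ultimately have "(0 - \<epsilon>) * (v - u) \<le> f v - f u" using D(2) xk' uv by auto
    then show "(0 - \<epsilon>) * (Sup k - Inf k) \<le> f (Sup k) - f (Inf k)" using uv by simp
  qed
  moreover have "(\<Sum>(x,k)\<in>p2. Sup k - Inf k) \<le> (\<Sum>(x,k)\<in>p. Sup k - Inf k)"
    by (rule sum_mono2) (use fp kform in \<open>force simp: p2_def\<close>)+
  moreover have "(\<Sum>(x,k)\<in>p. Sup k - Inf k) = b - a"
    using additive_tagged_division_1[OF ab p(1), of "\<lambda>x. x"] by simp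
  moreover have "(\<Sum>(x,k)\<in>p2. (0 - \<epsilon>) * (Sup k - Inf k)) = - \<epsilon> * (\<Sum>(x,k)\<in>p2. Sup k - Inf k)"
    by (simp add: sum_distrib_left case_prod_beta)
  moreover have "\<epsilon> * (\<Sum>(x,k)\<in>p2. Sup k - Inf k) \<le> \<epsilon> * (b - a)"
    using calculation e0 by (intro mult_left_mono) auto
  ultimately have "(\<Sum>(x,k)\<in>p2. f (Sup k) - f (Inf k)) \<ge> - (e/2)" using e1 by linarith
  then show "f a \<le> f b + e" using A tot by linarith
qed


lemma lipschitz_abs_cont_on:
  assumes "L-lipschitz_on I f"
  shows "abs_cont_on I f"
  unfolding abs_cont_on_def
proof (intro allI impI)
  fix \<epsilon> :: real assume e: "\<epsilon> > 0"
  have L: "L \<ge> 0" using assms lipschitz_on_nonneg by blast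
  show "\<exists>\<delta>>0. \<forall>d. d division_of \<Union>d \<and> \<Union>d \<subseteq> I \<and> (\<Sum>k\<in>d. Sup k - Inf k) < \<delta>
        \<longrightarrow> (\<Sum>k\<in>d. norm (f (Sup k) - f (Inf k))) < \<epsilon>"
  proof (intro exI[of _ "\<epsilon> / (L + 1)"] conjI allI impI)
    show "\<epsilon> / (L + 1) > 0" using e L by simp
    fix d :: "real set set" assume d: "d division_of \<Union>d \<and> \<Union>d \<subseteq> I \<and> (\<Sum>k\<in>d. Sup k - Inf k) < \<epsilon> / (L + 1)"
    have k: "norm (f (Sup k) - f (Inf k)) \<le> L * (Sup k - Inf k) \<and> Inf k \<le> Sup k" if k: "k \<in> d" for k
    proof -
      obtain u v where "k = cbox u v" "k \<noteq> {}" using division_ofD(3,4)[OF conjunct1[OF d] k] by blast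
      then have uv: "k = {u..v}" "u \<le> v" by auto
      have "k \<subseteq> I" using d k by auto
      then have "dist (f v) (f u) \<le> L * dist v u" using uv by (intro lipschitz_onD[OF assms]) auto
      then show ?thesis using uv by (simp add: dist_norm)
    qed
    have "(\<Sum>k\<in>d. norm (f (Sup k) - f (Inf k))) \<le> (\<Sum>k\<in>d. L * (Sup k - Inf k))"
      using k by (intro sum_mono) auto
    also have "\<dots> = L * (\<Sum>k\<in>d. Sup k - Inf k)" by (simp add: sum_distrib_left)
    also have "\<dots> \<le> (L + 1) * (\<Sum>k\<in>d. Sup k - Inf k)"
      using k by (intro mult_right_mono sum_nonneg) auto
    also have "\<dots> < (L + 1) * (\<epsilon> / (L + 1))" using d L by (intro mult_strict_left_mono) auto
    also have "\<dots> = \<epsilon>" using L by simp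
    finally show "(\<Sum>k\<in>d. norm (f (Sup k) - f (Inf k))) < \<epsilon>" .
  qed
qed

lemma ae_lower_slope_lipschitz:
  fixes f :: "real \<Rightarrow> real"
  assumes ab: "a \<le> b" and L: "L-lipschitz_on {a..b} f" and N: "negligible N"
    and sl: "\<And>t. a < t \<Longrightarrow> t < b \<Longrightarrow> t \<notin> N \<Longrightarrow> lower_slope f t m"
  shows "m * (b - a) \<le> f b - f a"
proof -
  have "f a + (- m) * a \<le> f b + (- m) * b"
  proof (rule ae_lower_slope_mono[OF ab _ N])
    have "(L + \<bar>- m\<bar> * 1)-lipschitz_on {a..b} (\<lambda>s. f s + (- m) * s)"
      by (intro lipschitz_intros L)
    then show "abs_cont_on {a..b} (\<lambda>s. f s + (- m) * s)" by (rule lipschitz_abs_cont_on)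
    fix t assume "a < t" "t < b" "t \<notin> N"
    then have "lower_slope (\<lambda>s. f s + (- m) * s) t (m + (- m))"
      by (intro lower_slope_add sl lower_slope_has_derivative) (auto intro!: derivative_eq_intros)
    then show "lower_slope (\<lambda>s. f s + (- m) * s) t 0" by simp
  qed
  then show ?thesis by (simp add: algebra_simps)
qed

section \<open>Lipschitz functions of one variable are differentiable almost everywhere\<close>

text \<open>The intervals of slope at most \<open>p\<close> inside an open \<open>U\<close> around
  \<open>E\<close> form a Vitali cover. A countable disjoint subfamily misses only a null part of
  \<open>E\<close>, whose image is null because \<open>f\<close> is Lipschitz; the images of the
  chosen intervals are disjoint intervals at most \<open>p\<close> times as long.\<close>

lemma emeasure_image_small_slopes:
  fixes f :: "real \<Rightarrow> real"
  assumes f: "strict_mono f" "L-lipschitz_on UNIV f" and p: "p > 0"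
    and E: "E \<in> sets borel" and fE: "f ` E \<in> sets borel"
    and sl: "\<And>x d. x \<in> E \<Longrightarrow> d > 0 \<Longrightarrow> \<exists>u v. u < v \<and> u \<le> x \<and> x \<le> v \<and> v - u < d \<and> f v - f u \<le> p * (v - u)"
  shows "emeasure lebesgue (f ` E) \<le> ennreal p * emeasure lebesgue E"
proof (rule ennreal_le_epsilon)
  fix e :: real assume e: "e > 0"
  define \<epsilon> where "\<epsilon> = e / p"
  have e0: "\<epsilon> > 0" "p * \<epsilon> = e" using e p by (auto simp: \<epsilon>_def)
  have EL: "E \<in> sets lebesgue" using E by simp
  obtain U where U: "open U" "E \<subseteq> U" "U - E \<in> lmeasurable" "emeasure lebesgue (U - E) < ennreal \<epsilon>"
    using sets_lebesgue_outer_open[OF EL e0(1)] by blast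
  have UE: "E \<union> (U - E) = U" using U(2) by auto
  have Ule: "emeasure lebesgue U \<le> emeasure lebesgue E + ennreal \<epsilon>"
    using emeasure_subadditive[OF EL fmeasurableD[OF U(3)]] U(4) unfolding UE
    by (meson add_left_mono less_imp_le order_trans)
  define K where "K = {(u,v). u < v \<and> {u..v} \<subseteq> U \<and> f v - f u \<le> p * (v - u)}"
  \<comment> \<open>Intervals are recast as closed balls, the form in which the covering theorem is
    stated.\<close>
  define ce where "ce = (\<lambda>(u,v). (u + v) / 2 :: real)"
  define ra where "ra = (\<lambda>(u,v). (v - u) / 2 :: real)"
  have cb: "cball (ce i) (ra i) = {fst i..snd i}" for i
    by (cases i) (simp add: ce_def ra_def cball_eq_atLeastAtMost field_simps)
  have r: "0 < ra i" if "i \<in> K" for i using that by (auto simp: K_def ra_def)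
  have cov: "\<exists>i. i \<in> K \<and> x \<in> cball (ce i) (ra i) \<and> ra i < d" if x: "x \<in> E" and d: "0 < d" for x d
  proof -
    obtain \<rho> where rho: "\<rho> > 0" "ball x \<rho> \<subseteq> U" using U x open_contains_ball by blast
    obtain u v where uv: "u < v" "u \<le> x" "x \<le> v" "v - u < min \<rho> d" "f v - f u \<le> p * (v - u)"
      using sl[OF x, of "min \<rho> d"] rho d by auto
    have "{u..v} \<subseteq> ball x \<rho>" using uv by (auto simp: dist_real_def)
    then have "(u,v) \<in> K" using rho uv by (auto simp: K_def)
    then show ?thesis using uv by (intro exI[of _ "(u,v)"]) (auto simp: cb, simp add: ra_def)
  qed
  obtain C where C: "countable C" "C \<subseteq> K" "pairwise (\<lambda>i j. disjnt (cball (ce i) (ra i)) (cball (ce j) (ra j))) C"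
     "negligible (E - (\<Union>i\<in>C. cball (ce i) (ra i)))"
    using Vitali_covering_theorem_cballs[of K ra E ce, OF r cov] by blast
  define I where "I i = {fst i..snd i}" for i :: "real \<times> real"
  define J where "J i = {f (fst i)..f (snd i)}" for i :: "real \<times> real"
  define N where "N = E - (\<Union>i\<in>C. I i)"
  have N: "negligible N" using C(4) by (simp add: N_def I_def cb)
  have disjI: "disjoint_family_on I C"
    using C(3) unfolding disjoint_family_on_def pairwise_def cb I_def disjnt_def by auto
  have contf: "continuous_on UNIV f" using f(2) lipschitz_on_continuous_on by blast
  have mono: "f x \<le> f y" if "x \<le> y" for x y using f(1) that by (simp add: strict_mono_less_eq)
  have J: "J i = f ` I i" if "i \<in> K" for i
  proof
    show "J i \<subseteq> f ` I i"
    proof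
      fix y assume y: "y \<in> J i"
      have "\<exists>x\<ge>fst i. x \<le> snd i \<and> f x = y"
        using that y by (intro IVT' continuous_on_subset[OF contf]) (auto simp: K_def J_def)
      then show "y \<in> f ` I i" by (auto simp: I_def)
    qed
    show "f ` I i \<subseteq> J i" using mono by (auto simp: J_def I_def)
  qed
  have injf: "inj f" using f(1) by (simp add: strict_mono_imp_inj_on)
  have disjJ: "disjoint_family_on J C"
    unfolding disjoint_family_on_def
  proof (intro ballI impI)
    fix m n assume "m \<in> C" "n \<in> C" "m \<noteq> n"
    then show "J m \<inter> J n = {}"
      using disjI C(2) J[of m] J[of n] injf unfolding disjoint_family_on_def
      by (metis image_Int image_empty subsetD)
  qed
  have fN: "negligible (f ` N)"
  proof (rule negligible_locally_Lipschitz_image[OF _ N])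
    fix x assume "x \<in> N"
    show "\<exists>T B. open T \<and> x \<in> T \<and> (\<forall>y\<in>N \<inter> T. norm (f y - f x) \<le> B * norm (y - x))"
      using lipschitz_onD[OF f(2)] by (intro exI[of _ UNIV] exI[of _ L]) (auto simp: dist_norm)
  qed simp
  have sub: "f ` E \<subseteq> f ` N \<union> (\<Union>i\<in>C. J i)"
  proof
    fix y assume "y \<in> f ` E"
    then obtain x where x: "x \<in> E" "y = f x" by auto
    show "y \<in> f ` N \<union> (\<Union>i\<in>C. J i)"
    proof (cases "x \<in> N")
      case False
      then obtain i where i: "i \<in> C" "x \<in> I i" using x by (auto simp: N_def)
      then have "y \<in> J i" using J[of i] C(2) x by auto
      then show ?thesis using i by auto
    qed (use x in auto)
  qed
  have JL: "(\<Union>i\<in>C. J i) \<in> sets lebesgue" by (rule sets.countable_UN''[OF C(1)]) (simp add: J_def)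
  have NL: "f ` N \<in> sets lebesgue" by (rule negligible_imp_sets[OF fN])
  have "emeasure lebesgue (f ` E) \<le> emeasure lebesgue (f ` N \<union> (\<Union>i\<in>C. J i))"
    by (rule emeasure_mono[OF sub sets.Un[OF NL JL]])
  also have "\<dots> \<le> emeasure lebesgue (f ` N) + emeasure lebesgue (\<Union>i\<in>C. J i)"
    by (rule emeasure_subadditive[OF NL JL])
  also have "emeasure lebesgue (f ` N) = 0" using fN by (simp add: negligible_iff_null_sets null_setsD1)
  also have "0 + emeasure lebesgue (\<Union>i\<in>C. J i) = (\<integral>\<^sup>+i. emeasure lebesgue (J i) \<partial>count_space C)"
    using C(1) disjJ by (subst emeasure_UN_countable) (auto simp: J_def)
  also have "\<dots> \<le> (\<integral>\<^sup>+i. ennreal p * emeasure lebesgue (I i) \<partial>count_space C)"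
  proof (rule nn_integral_mono)
    fix i assume "i \<in> space (count_space C)"
    then have i: "i \<in> K" using C(2) by auto
    then have le: "fst i \<le> snd i" "f (fst i) \<le> f (snd i)" "f (snd i) - f (fst i) \<le> p * (snd i - fst i)"
      using mono by (auto simp: K_def)
    then have "emeasure lebesgue (J i) = ennreal (f (snd i) - f (fst i))" by (simp add: J_def)
    also have "\<dots> \<le> ennreal (p * (snd i - fst i))" using le by (intro ennreal_leI) auto
    also have "\<dots> = ennreal p * emeasure lebesgue (I i)" using le p by (simp add: I_def ennreal_mult)
    finally show "emeasure lebesgue (J i) \<le> ennreal p * emeasure lebesgue (I i)" .
  qed
  also have "\<dots> = ennreal p * (\<integral>\<^sup>+i. emeasure lebesgue (I i) \<partial>count_space C)"
    by (rule nn_integral_cmult) auto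
  also have "(\<integral>\<^sup>+i. emeasure lebesgue (I i) \<partial>count_space C) = emeasure lebesgue (\<Union>i\<in>C. I i)"
    using C(1) disjI by (subst emeasure_UN_countable) (auto simp: I_def)
  also have "\<dots> \<le> emeasure lebesgue U"
    by (rule emeasure_mono) (use C(2) U(1) in \<open>fastforce simp: I_def K_def\<close>)+
  also have "\<dots> \<le> emeasure lebesgue E + ennreal \<epsilon>" by (rule Ule)
  finally have "emeasure lebesgue (f ` E) \<le> ennreal p * (emeasure lebesgue E + ennreal \<epsilon>)"
    by (simp add: mult_left_mono)
  also have "\<dots> = ennreal p * emeasure lebesgue E + ennreal e"
    using e0 p by (simp add: distrib_left ennreal_mult[symmetric])
  finally show "emeasure lebesgue (f ` E) \<le> ennreal p * emeasure lebesgue E + ennreal e" .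
qed

text \<open>Let slopes below \<open>p\<close> and slopes above \<open>q > p\<close> both occur at
  all scales on \<open>E\<close>. Then \<open>f\<close>
  E\<open>has at most\<close>p\<open>times the measure of\<close>E\<open>, and\<close>E\<open>has at most\<close>1/q\<open>times the measure of\<close>f
  \<open>E\<close>, by the same lemma for the inverse. So \<open>E\<close> is null. Expansion makes
  the inverse total and 1-Lipschitz.\<close>

lemma expanding_lipschitz_ae_differentiable:
  fixes f :: "real \<Rightarrow> real"
  assumes L: "L-lipschitz_on UNIV f" and ex: "\<And>x y. x \<le> y \<Longrightarrow> y - x \<le> f y - f x"
  shows "\<exists>N. negligible N \<and> (\<forall>x. x \<notin> N \<longrightarrow> (\<exists>l. (f has_real_derivative l) (at x)))"
proof -
  have smono: "strict_mono f"
  proof (rule strict_monoI)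
    fix x y :: real assume "x < y"
    then show "f x < f y" using ex[of x y] by auto
  qed
  have contf: "continuous_on UNIV f" using L lipschitz_on_continuous_on by blast
  have "\<exists>x. f x = y" for y
  proof -
    define M where "M = \<bar>f 0\<bar> + \<bar>y\<bar>"
    have M: "M \<ge> \<bar>f 0\<bar> + \<bar>y\<bar>" "M \<ge> 0" by (auto simp: M_def)
    have 1: "f (- M) \<le> y" using ex[of "- M" 0] M by linarith
    have 2: "y \<le> f M" using ex[of 0 M] M by linarith
    have "continuous_on {- M..M} f" using contf by (rule continuous_on_subset) auto
    then show ?thesis using IVT'[of f "- M" y M] 1 2 M by auto
  qed
  then have "surj f" by (metis surjI)
  define g where "g = inv f"
  have fg: "f (g y) = y" for y using \<open>surj f\<close> by (simp add: g_def surj_f_inv_f)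
  have gf: "g (f x) = x" for x using smono by (simp add: g_def strict_mono_imp_inj_on)
  have gmono: "strict_mono g"
    by (rule strict_monoI) (metis fg smono strict_mono_less)
  have gL: "1-lipschitz_on UNIV g"
  proof (rule lipschitz_onI)
    fix x y :: real
    have *: "\<bar>g x - g y\<bar> \<le> \<bar>x - y\<bar>"
    proof (cases "g x \<le> g y")
      case True then show ?thesis using ex[of "g x" "g y"] fg by auto
    next
      case False then show ?thesis using ex[of "g y" "g x"] fg by auto
    qed
    show "dist (g x) (g y) \<le> 1 * dist x y" using * by (simp add: dist_real_def)
  qed simp
  have contg: "continuous_on UNIV g" using gL lipschitz_on_continuous_on by blast
  have image_borel: "f ` E \<in> sets borel" if "E \<in> sets borel" for E
  proof -
    have "f ` E = g -` E" using fg gf by (auto simp: image_iff) metis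
    moreover have "g \<in> borel_measurable borel" using contg by (rule borel_measurable_continuous_onI)
    ultimately show ?thesis using that measurable_sets[of g borel borel E] by simp
  qed
  \<comment> \<open>The points around which intervals of every small length have a slope satisfying
    \<open>R\<close>. Open intervals make this a countable intersection of open sets, hence Borel
    for any \<open>R\<close>.\<close>
  define S where "S R = (\<Inter>n::nat. \<Union>(u,v)\<in>{(u,v). u < v \<and> v - u < 1 / real (Suc n) \<and> R ((f v - f u) / (v - u))}. {u<..<v})"
    for R :: "real \<Rightarrow> bool"
  have S_borel: "S R \<in> sets borel" for R
    unfolding S_def by (intro sets.countable_INT) (auto intro!: borel_open open_UN)
  have S_iff: "x \<in> S R \<longleftrightarrow> (\<forall>d>0. \<exists>u v. u < x \<and> x < v \<and> v - u < d \<and> R ((f v - f u) / (v - u)))" for x R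
  proof
    assume x: "x \<in> S R"
    show "\<forall>d>0. \<exists>u v. u < x \<and> x < v \<and> v - u < d \<and> R ((f v - f u) / (v - u))"
    proof (intro allI impI)
      fix d :: real assume "d > 0"
      then obtain n where n: "1 / real (Suc n) < d" using nat_approx_posE by auto
      then show "\<exists>u v. u < x \<and> x < v \<and> v - u < d \<and> R ((f v - f u) / (v - u))"
        using x unfolding S_def by (auto 0 4 dest!: spec[of _ n])
    qed
  next
    assume *: "\<forall>d>0. \<exists>u v. u < x \<and> x < v \<and> v - u < d \<and> R ((f v - f u) / (v - u))"
    show "x \<in> S R" unfolding S_def
    proof (rule INT_I)
      fix n :: nat
      obtain u v where "u < x" "x < v" "v - u < 1 / real (Suc n)" "R ((f v - f u) / (v - u))"
        using *[rule_format, of "1 / real (Suc n)"] by auto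
      then show "x \<in> (\<Union>(u,v)\<in>{(u,v). u < v \<and> v - u < 1 / real (Suc n) \<and> R ((f v - f u) / (v - u))}. {u<..<v})"
        by (intro UN_I[of "(u,v)"]) auto
    qed
  qed
  have neg: "negligible (S (\<lambda>s. s < p) \<inter> S (\<lambda>s. q < s))" if pq: "0 < p" "p < q" for p q
  proof (rule negligible_on_intervals[THEN iffD2], intro allI)
    fix a b :: real
    define E where "E = S (\<lambda>s. s < p) \<inter> S (\<lambda>s. q < s) \<inter> cbox a b"
    have E: "E \<in> sets borel" unfolding E_def using S_borel by auto
    note fE = image_borel[OF E]
    have 1: "emeasure lebesgue (f ` E) \<le> ennreal p * emeasure lebesgue E"
    proof (rule emeasure_image_small_slopes[OF smono L pq(1) E fE])
      fix x d :: real assume "x \<in> E" "d > 0"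
      then obtain u v where uv: "u < x" "x < v" "v - u < d" "(f v - f u) / (v - u) < p"
        unfolding E_def by (auto simp: S_iff)
      then have "f v - f u \<le> p * (v - u)" by (simp add: divide_less_eq)
      then show "\<exists>u v. u < v \<and> u \<le> x \<and> x \<le> v \<and> v - u < d \<and> f v - f u \<le> p * (v - u)"
        using uv by (intro exI[of _ u] exI[of _ v]) auto
    qed
    have gfE: "g ` f ` E = E" by (auto simp: gf image_image)
    have 2: "emeasure lebesgue (g ` f ` E) \<le> ennreal (1/q) * emeasure lebesgue (f ` E)"
    proof (rule emeasure_image_small_slopes[OF gmono gL _ fE])
      show "1 / q > 0" using pq by simp
      show "g ` f ` E \<in> sets borel" using E gfE by simp
      fix y d :: real assume "y \<in> f ` E" "d > 0"
      then obtain x where x: "x \<in> E" "y = f x" by auto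
      have L0: "L \<ge> 0" using L lipschitz_on_nonneg by blast
      \<comment> \<open>An interval shorter than \<open>d'\<close> has an image shorter than
        \<open>d\<close>, since \<open>f\<close> stretches lengths by at most
        \<open>L\<close>.\<close>
      define d' where "d' = d / (L + 1)"
      have d': "d' > 0" using \<open>d > 0\<close> L0 by (simp add: d'_def)
      obtain u v where uv: "u < x" "x < v" "v - u < d'" "q < (f v - f u) / (v - u)"
        using x(1) d' unfolding E_def by (auto simp: S_iff)
      have "f u < y" "y < f v" using uv x smono by (auto simp: strict_mono_less)
      moreover have "f v - f u < d"
      proof -
        have "dist (f v) (f u) \<le> L * dist v u" by (rule lipschitz_onD[OF L]) auto
        then have "f v - f u \<le> L * (v - u)" using uv by (auto simp: dist_real_def)
        also have "\<dots> \<le> L * d'" using uv L0 by (intro mult_left_mono) auto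
        also have "\<dots> < (L + 1) * d'" using d' by simp
        finally show ?thesis using L0 by (simp add: d'_def)
      qed
      moreover have "g (f v) - g (f u) \<le> 1 / q * (f v - f u)"
        using uv pq by (simp add: gf less_divide_eq field_simps)
      ultimately show "\<exists>u v. u < v \<and> u \<le> y \<and> y \<le> v \<and> v - u < d \<and> g v - g u \<le> 1 / q * (v - u)"
        by (intro exI[of _ "f u"] exI[of _ "f v"]) auto
    qed
    have fin: "emeasure lebesgue E \<noteq> \<infinity>"
    proof -
      have "emeasure lebesgue E \<le> emeasure lebesgue (cbox a b)"
        by (rule emeasure_mono) (auto simp: E_def)
      also have "\<dots> < \<infinity>" using emeasure_lborel_cbox_finite[of a b] by (simp del: box_real)
      finally show ?thesis by simp
    qed
    define m where "m = measure lebesgue E"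
    have m: "emeasure lebesgue E = ennreal m" "m \<ge> 0"
      using fin by (auto simp: m_def emeasure_eq_ennreal_measure)
    have "ennreal m \<le> ennreal (1/q) * (ennreal p * ennreal m)"
      using 1 2 unfolding gfE m by (meson mult_left_mono order_trans zero_le)
    also have "\<dots> = ennreal (p / q * m)" using pq m by (simp add: ennreal_mult[symmetric])
    finally have "m \<le> p / q * m" using pq m by (simp add: ennreal_le_iff)
    then have "m * (q - p) \<le> 0" using pq by (simp add: field_simps)
    then have "m = 0" using m pq by (simp add: mult_le_0_iff)
    then have "E \<in> null_sets lebesgue" using m E by auto
    then show "negligible (S (\<lambda>s. s < p) \<inter> S (\<lambda>s. q < s) \<inter> cbox a b)"
      by (simp add: negligible_iff_null_sets E_def)
  qed
  \<comment> \<open>Countably many rational pairs \<open>p < q\<close> detect every oscillation of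
    the slopes.\<close>
  define N where "N = (\<Union>(p,q)\<in>{(p,q). p \<in> \<rat> \<and> q \<in> \<rat> \<and> 0 < p \<and> p < q}. S (\<lambda>s. s < p) \<inter> S (\<lambda>s. q < s))"
  have "negligible N"
    unfolding N_def
  proof (rule negligible_countable_Union)
    have "countable {(p,q::real). p \<in> \<rat> \<and> q \<in> \<rat> \<and> 0 < (p::real) \<and> p < q}"
      by (rule countable_subset[of _ "\<rat> \<times> \<rat>"]) (auto simp: countable_rat)
    then show "countable ((\<lambda>(p,q). S (\<lambda>s. s < p) \<inter> S (\<lambda>s. q < s)) ` {(p,q). p \<in> \<rat> \<and> q \<in> \<rat> \<and> 0 < p \<and> p < q})"
      by simp
  qed (use neg in auto)
  moreover have "\<exists>l. (f has_real_derivative l) (at x)" if x: "x \<notin> N" for x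
  proof -
    have L0: "L \<ge> 0" using L lipschitz_on_nonneg by blast
    have slL: "(f v - f u) / (v - u) \<le> L" if "u < v" for u v
    proof -
      have "dist (f v) (f u) \<le> L * dist v u" by (rule lipschitz_onD[OF L]) auto
      then show ?thesis using that by (auto simp: dist_real_def divide_le_eq)
    qed
    have sl1: "1 \<le> (f v - f u) / (v - u)" if "u < v" for u v
      using ex[of u v] that by (simp add: le_divide_eq)
    \<comment> \<open>The supremum \<open>l\<close> of this set is the upper limit of the straddling
      slopes at \<open>x\<close>, the candidate for the derivative.\<close>
    define A where "A = {q. x \<in> S (\<lambda>s. q < s)}"
    have A0: "0 \<in> A"
      unfolding A_def mem_Collect_eq S_iff
    proof (intro allI impI)
      fix d :: real assume "d > 0"
      have "0 < (f (x + d/3) - f (x - d/3)) / ((x + d/3) - (x - d/3))"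
        using sl1[of "x - d/3" "x + d/3"] \<open>d > 0\<close> by linarith
      then show "\<exists>u v. u < x \<and> x < v \<and> v - u < d \<and> 0 < (f v - f u) / (v - u)"
        using \<open>d > 0\<close> by (intro exI[of _ "x - d/3"] exI[of _ "x + d/3"]) auto
    qed
    have Ab: "q \<le> L" if qA: "q \<in> A" for q
    proof -
      obtain u v where "u < x" "x < v" "q < (f v - f u) / (v - u)"
        using qA zero_less_one unfolding A_def mem_Collect_eq S_iff by blast
      then show ?thesis using slL[of u v] by linarith
    qed
    define l where "l = Sup A"
    have bdd: "bdd_above A" using Ab by (intro bdd_aboveI)
    have Aup: "q \<le> l" if "q \<in> A" for q unfolding l_def by (rule cSup_upper[OF that bdd])
    have Alow: "q \<in> A" if q: "q < l" for q
    proof -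
      obtain r where r: "r \<in> A" "q < r" using q A0 less_cSup_iff[of A q] bdd unfolding l_def by auto
      show ?thesis unfolding A_def mem_Collect_eq S_iff
      proof (intro allI impI)
        fix d :: real assume "d > 0"
        then obtain u v where "u < x" "x < v" "v - u < d" "r < (f v - f u) / (v - u)"
          using r(1) unfolding A_def by (auto simp: S_iff)
        then show "\<exists>u v. u < x \<and> x < v \<and> v - u < d \<and> q < (f v - f u) / (v - u)"
          using r(2) by (meson less_trans)
      qed
    qed
    have l1: "1 \<le> l"
    proof (rule ccontr)
      assume "\<not> 1 \<le> l"
      have "(l + 1) / 2 \<in> A" unfolding A_def mem_Collect_eq S_iff
      proof (intro allI impI)
        fix d :: real assume "d > 0"
        have "(l + 1) / 2 < 1" using \<open>\<not> 1 \<le> l\<close> by simp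
        also have "1 \<le> (f (x + d/3) - f (x - d/3)) / ((x + d/3) - (x - d/3))"
          by (rule sl1) (use \<open>d > 0\<close> in simp)
        finally have "(l + 1) / 2 < (f (x + d/3) - f (x - d/3)) / ((x + d/3) - (x - d/3))" .
        then show "\<exists>u v. u < x \<and> x < v \<and> v - u < d \<and> (l + 1) / 2 < (f v - f u) / (v - u)"
          using \<open>d > 0\<close> by (intro exI[of _ "x - d/3"] exI[of _ "x + d/3"]) auto
      qed
      then show False using Aup \<open>\<not> 1 \<le> l\<close> by fastforce
    qed
    have "((\<lambda>y. (f y - f x) / (y - x)) \<longlongrightarrow> l) (at x)"
    proof (rule tendstoI)
      fix e :: real assume e: "e > 0"
      \<comment> \<open>Since \<open>1 \<le> l\<close>, the cap 1/2 keeps \<open>l - e'\<close>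
        positive, so the rationals chosen above it qualify as indices in \<open>N\<close>.\<close>
      define e' where "e' = min (e/2) (1/2)"
      have e': "e' > 0" "e' < e" "e' < 1" using e by (auto simp: e'_def)
      have "\<exists>d>0. \<forall>u v. u < x \<and> x < v \<and> v - u < d \<longrightarrow> (f v - f u) / (v - u) \<le> l + e'"
      proof -
        have "x \<notin> S (\<lambda>s. l + e' < s)" using Aup[of "l + e'"] e' by (auto simp: A_def)
        then show ?thesis unfolding S_iff not_less[symmetric] by blast
      qed
      then obtain d1 where d1: "d1 > 0" "\<And>u v. u < x \<Longrightarrow> x < v \<Longrightarrow> v - u < d1 \<Longrightarrow> (f v - f u) / (v - u) \<le> l + e'"
        by blast
      have "\<exists>d>0. \<forall>u v. u < x \<and> x < v \<and> v - u < d \<longrightarrow> l - e' \<le> (f v - f u) / (v - u)"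
      proof -
        obtain p where p: "p \<in> \<rat>" "l - e' < p" "p < l" using Rats_dense_in_real[of "l - e'" l] e' by auto
        obtain q where q: "q \<in> \<rat>" "p < q" "q < l" using Rats_dense_in_real[of p l] p by auto
        have "x \<in> S (\<lambda>s. q < s)" using Alow[OF q(3)] by (simp add: A_def)
        then have "x \<notin> S (\<lambda>s. s < p)" using x p q l1 e' unfolding N_def by auto
        then show ?thesis using p(2) unfolding S_iff by (meson less_imp_le less_le_trans not_less order_trans)
      qed
      then obtain d2 where d2: "d2 > 0" "\<And>u v. u < x \<Longrightarrow> x < v \<Longrightarrow> v - u < d2 \<Longrightarrow> l - e' \<le> (f v - f u) / (v - u)"
        by blast
      define d where "d = min d1 d2"
      have d: "d > 0" using d1 d2 by (simp add: d_def)
      have str: "(l - e') * (v - u) \<le> f v - f u \<and> f v - f u \<le> (l + e') * (v - u)" if "u < x" "x < v" "v - u < d" for u v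
      proof -
        have "v - u > 0" using that by auto
        moreover have "(f v - f u) / (v - u) \<le> l + e'" "l - e' \<le> (f v - f u) / (v - u)"
          using d1(2) d2(2) that by (auto simp: d_def)
        ultimately show ?thesis by (simp add: divide_le_eq le_divide_eq)
      qed
      have isf: "isCont f z" for z using contf by (simp add: continuous_on_eq_continuous_at)
      \<comment> \<open>One-sided quotients are limits of straddling ones: the other end point tends
        to \<open>x\<close> and \<open>f\<close> is continuous.\<close>
      have right: "(l - e') * (v - x) \<le> f v - f x \<and> f v - f x \<le> (l + e') * (v - x)" if v: "x < v" "v - x < d" for v
      proof -
        have ev: "\<forall>\<^sub>F u in at_left x. u < x \<and> v - d < u"
          using v by (intro eventually_at_leftI[of "v - d"]) auto
        have lf: "((\<lambda>u. f v - f u) \<longlongrightarrow> f v - f x) (at_left x)"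
          using isf[of x] by (intro tendsto_intros) (auto simp: isCont_def filterlim_at_split)
        have "(l - e') * (v - x) \<le> f v - f x"
          by (rule tendsto_le[OF _ lf, of "\<lambda>u. (l - e') * (v - u)"]) (use ev str v in \<open>auto intro!: tendsto_intros elim!: eventually_mono\<close>)
        moreover have "f v - f x \<le> (l + e') * (v - x)"
          by (rule tendsto_le[OF _ _ lf, of "\<lambda>u. (l + e') * (v - u)"]) (use ev str v in \<open>auto intro!: tendsto_intros elim!: eventually_mono\<close>)
        ultimately show ?thesis by simp
      qed
      have left: "(l - e') * (x - u) \<le> f x - f u \<and> f x - f u \<le> (l + e') * (x - u)" if u: "u < x" "x - u < d" for u
      proof -
        have ev: "\<forall>\<^sub>F v in at_right x. x < v \<and> v < u + d"
          using u by (intro eventually_at_rightI[of x "u + d"]) auto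
        have lf: "((\<lambda>v. f v - f u) \<longlongrightarrow> f x - f u) (at_right x)"
          using isf[of x] by (intro tendsto_intros) (auto simp: isCont_def filterlim_at_split)
        have "(l - e') * (x - u) \<le> f x - f u"
          by (rule tendsto_le[OF _ lf, of "\<lambda>v. (l - e') * (v - u)"]) (use ev str u in \<open>auto intro!: tendsto_intros elim!: eventually_mono\<close>)
        moreover have "f x - f u \<le> (l + e') * (x - u)"
          by (rule tendsto_le[OF _ _ lf, of "\<lambda>v. (l + e') * (v - u)"]) (use ev str u in \<open>auto intro!: tendsto_intros elim!: eventually_mono\<close>)
        ultimately show ?thesis by simp
      qed
      show "\<forall>\<^sub>F y in at x. dist ((f y - f x) / (y - x)) l < e"
        unfolding eventually_at
      proof (intro exI[of _ d] conjI ballI impI d)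
        fix y assume y: "y \<noteq> x \<and> dist y x < d"
        have "l - e' \<le> (f y - f x) / (y - x) \<and> (f y - f x) / (y - x) \<le> l + e'"
        proof (cases "x < y")
          case True
          then show ?thesis using right[of y] y by (simp add: dist_real_def le_divide_eq divide_le_eq)
        next
          case False
          then have "y < x" using y by simp
          moreover have "(f y - f x) / (y - x) = (f x - f y) / (x - y)" by (metis minus_diff_eq minus_divide_divide)
          ultimately show ?thesis using left[of y] y by (simp add: dist_real_def le_divide_eq divide_le_eq)
        qed
        then show "dist ((f y - f x) / (y - x)) l < e" using e' by (auto simp: dist_real_def)
      qed
    qed
    then show ?thesis by (auto simp: has_field_derivative_iff)
  qed
  ultimately show ?thesis by blast
qed

lemma lipschitz_ae_differentiable:
  fixes h :: "real \<Rightarrow> real"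
  assumes L: "L-lipschitz_on UNIV h"
  shows "\<exists>N. negligible N \<and> (\<forall>x. x \<notin> N \<longrightarrow> (\<exists>l. (h has_real_derivative l) (at x)))"
proof -
  \<comment> \<open>Slopes of \<open>h\<close> are at least \<open>- L\<close>; the shift raises
    them to at least 1, the expanding case.\<close>
  define f where "f x = h x + (L + 1) * x" for x
  have "(L + \<bar>L + 1\<bar> * 1)-lipschitz_on UNIV f"
    unfolding f_def by (intro lipschitz_intros L)
  moreover have "y - x \<le> f y - f x" if "x \<le> y" for x y
  proof -
    have "dist (h y) (h x) \<le> L * dist y x" by (rule lipschitz_onD[OF L]) auto
    then show ?thesis using that by (auto simp: f_def dist_real_def algebra_simps)
  qed
  ultimately obtain N where N: "negligible N" "\<And>x. x \<notin> N \<Longrightarrow> \<exists>l. (f has_real_derivative l) (at x)"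
    using expanding_lipschitz_ae_differentiable[of "L + \<bar>L + 1\<bar> * 1" f] by blast
  have "\<exists>l. (h has_real_derivative l) (at x)" if x: "x \<notin> N" for x
  proof -
    obtain l where "(f has_real_derivative l) (at x)" using N(2)[OF x] by blast
    then have "((\<lambda>x. f x - (L + 1) * x) has_real_derivative l - (L + 1)) (at x)"
      by (auto intro!: derivative_eq_intros)
    then show ?thesis by (auto simp: f_def)
  qed
  then show ?thesis using N(1) by blast
qed

section \<open>An invariance principle\<close>

text \<open>A diagonal sequence converges at all rational times, and the common Lipschitz constant
  carries the Cauchy property to every other time. Pointwise convergence is what the invariance
  principle consumes.\<close>

lemma lipschitz_translates_subsequence:
  fixes P :: "real \<Rightarrow> 'a::euclidean_space"
  assumes X: "compact X" and PX: "\<And>t. t \<ge> 0 \<Longrightarrow> P t \<in> X" and L: "L-lipschitz_on {0..} P"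
    and s0: "\<And>k::nat. s k \<ge> 0"
  shows "\<exists>r \<Gamma>. strict_mono (r :: nat \<Rightarrow> nat) \<and> (\<forall>\<tau>\<ge>0. (\<lambda>k. P (s (r k) + \<tau>)) \<longlonglongrightarrow> \<Gamma> \<tau>)"
proof -
  obtain B where B: "\<And>x. x \<in> X \<Longrightarrow> norm x \<le> B" using compact_imp_bounded[OF X] bounded_iff by blast
  have cQ: "countable (\<rat> \<inter> {0::real..})" by (simp add: countable_rat)
  have bnd: "norm (P (s n + \<tau>)) \<le> B" if "\<tau> \<in> \<rat> \<inter> {0::real..}" for n \<tau>
    using that s0[of n] by (intro B PX) auto
  have "\<exists>r. strict_mono (r :: nat \<Rightarrow> nat) \<and> (\<forall>\<tau>\<in>\<rat> \<inter> {0::real..}. \<exists>l. (\<lambda>k. P (s (r k) + \<tau>)) \<longlonglongrightarrow> l)"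
    by (rule function_convergent_subsequence[OF cQ, of "\<lambda>k \<tau>. P (s k + \<tau>)" B, OF bnd]) blast+
  then obtain r where r: "strict_mono (r :: nat \<Rightarrow> nat)" "\<And>\<tau>. \<tau> \<in> \<rat> \<inter> {0::real..} \<Longrightarrow> \<exists>l. (\<lambda>k. P (s (r k) + \<tau>)) \<longlonglongrightarrow> l"
    by metis
  have L0: "L \<ge> 0" using L lipschitz_on_nonneg by blast
  have "convergent (\<lambda>k. P (s (r k) + \<tau>))" if t: "\<tau> \<ge> 0" for \<tau>
  proof (rule Cauchy_convergent, rule metric_CauchyI)
    fix e :: real assume e: "e > 0"
    define d where "d = e / (4 * (L + 1))"
    have d: "d > 0" using e L0 by (simp add: d_def)
    obtain q where q: "q \<in> \<rat>" "\<tau> < q" "q < \<tau> + d" using Rats_dense_in_real[of \<tau> "\<tau> + d"] d by auto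
    then have "convergent (\<lambda>k. P (s (r k) + q))" using r(2)[of q] t by (auto simp: convergent_def)
    then have "Cauchy (\<lambda>k. P (s (r k) + q))" by (rule convergent_Cauchy)
    then obtain M where M: "\<And>m n. m \<ge> M \<Longrightarrow> n \<ge> M \<Longrightarrow> dist (P (s (r m) + q)) (P (s (r n) + q)) < e/2"
      using e unfolding Cauchy_def by (meson half_gt_zero)
    have cl: "dist (P (s (r m) + \<tau>)) (P (s (r m) + q)) \<le> e/4" for m
    proof -
      have "dist (P (s (r m) + \<tau>)) (P (s (r m) + q)) \<le> L * dist (s (r m) + \<tau>) (s (r m) + q)"
        by (rule lipschitz_onD[OF L]) (use s0 t q in \<open>auto simp: add_nonneg_nonneg\<close>)
      also have "\<dots> \<le> (L + 1) * d" using q L0 d by (intro mult_mono) (auto simp: dist_real_def)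
      also have "\<dots> = e/4" using L0 by (simp add: d_def field_simps)
      finally show ?thesis .
    qed
    show "\<exists>M. \<forall>m\<ge>M. \<forall>n\<ge>M. dist (P (s (r m) + \<tau>)) (P (s (r n) + \<tau>)) < e"
    proof (intro exI[of _ M] allI impI)
      fix m n assume "M \<le> m" "M \<le> n"
      then show "dist (P (s (r m) + \<tau>)) (P (s (r n) + \<tau>)) < e"
        using M[of m n] cl[of m] cl[of n] by metric
    qed
  qed
  then have "\<forall>\<tau>\<ge>0. (\<lambda>k. P (s (r k) + \<tau>)) \<longlonglongrightarrow> lim (\<lambda>k. P (s (r k) + \<tau>))"
    by (simp add: convergent_LIMSEQ_iff)
  then show ?thesis using r(1) by (intro exI[of _ r] exI[of _ "\<lambda>\<tau>. lim (\<lambda>k. P (s (r k) + \<tau>))"]) auto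
qed

lemma lipschitz_on_pointwise_limit:
  fixes f :: "nat \<Rightarrow> 'a::metric_space \<Rightarrow> 'b::real_normed_vector"
  assumes lip: "\<And>k. L-lipschitz_on S (f k)" and lim: "\<And>x. x \<in> S \<Longrightarrow> (\<lambda>k. f k x) \<longlonglongrightarrow> g x"
  shows "L-lipschitz_on S g"
proof (rule lipschitz_onI)
  fix x y assume xy: "x \<in> S" "y \<in> S"
  have "(\<lambda>k. dist (f k x) (f k y)) \<longlonglongrightarrow> dist (g x) (g y)" using xy by (intro tendsto_dist lim)
  moreover have "dist (f k x) (f k y) \<le> L * dist x y" for k by (rule lipschitz_onD[OF lip xy])
  ultimately show "dist (g x) (g y) \<le> L * dist x y" by (intro LIMSEQ_le_const2) auto
next
  show "0 \<le> L" using lip lipschitz_on_nonneg by blast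
qed

text \<open>
  Solutions on \<open>{0..}\<close> are maximal, so it suffices that the limits of translates of \<open>P\<close>
  are solutions that stay in the target set.
\<close>

lemma invariance_principle:
  fixes P :: "real \<Rightarrow> 'a::euclidean_space"
  assumes X: "compact X" and PX: "\<And>t. t \<ge> 0 \<Longrightarrow> P t \<in> X" and L: "L-lipschitz_on {0..} P"
    and lim: "\<And>s \<Gamma>. (\<And>k. s k \<ge> 0) \<Longrightarrow> filterlim s at_top sequentially \<Longrightarrow>
        (\<And>\<tau>. \<tau> \<ge> 0 \<Longrightarrow> (\<lambda>k. P (s k + \<tau>)) \<longlonglongrightarrow> \<Gamma> \<tau>) \<Longrightarrow>
        (AE \<tau> in lebesgue. \<tau> \<in> {0..} \<longrightarrow> (\<exists>v\<in>F (\<Gamma> \<tau>). (\<Gamma> has_vector_derivative v) (at \<tau> within {0..}))) \<and>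
        (\<forall>\<tau>\<ge>0. \<Gamma> \<tau> \<in> C)"
  shows "converges_to_set P (largest_weakly_invariant F X C)"
proof -
  \<comment> \<open>The omega-limit set of \<open>P\<close>.\<close>
  define M where "M = {x. \<exists>s. (\<forall>k::nat. s k \<ge> 0) \<and> filterlim s at_top sequentially \<and> (\<lambda>k. P (s k)) \<longlonglongrightarrow> x}"
  have curve: "\<exists>\<Gamma>. \<Gamma> 0 = x \<and> (\<forall>\<tau>\<ge>0. \<Gamma> \<tau> \<in> M \<and> \<Gamma> \<tau> \<in> C) \<and> di_solution F X {0..} \<Gamma>" if xM: "x \<in> M" for x
  proof -
    obtain s where s: "\<And>k::nat. s k \<ge> 0" "filterlim s at_top sequentially" "(\<lambda>k. P (s k)) \<longlonglongrightarrow> x"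
      using xM by (auto simp: M_def)
    have "\<exists>r \<Gamma>. strict_mono (r :: nat \<Rightarrow> nat) \<and> (\<forall>\<tau>\<ge>0. (\<lambda>k. P (s (r k) + \<tau>)) \<longlonglongrightarrow> \<Gamma> \<tau>)"
      by (rule lipschitz_translates_subsequence[OF X _ L]) (use PX s(1) in auto)
    then obtain r \<Gamma> where r: "strict_mono (r :: nat \<Rightarrow> nat)" "\<And>\<tau>. \<tau> \<ge> 0 \<Longrightarrow> (\<lambda>k. P (s (r k) + \<tau>)) \<longlonglongrightarrow> \<Gamma> \<tau>"
      by (elim exE conjE) (rule that, auto)
    have sr: "filterlim (\<lambda>k. s (r k)) at_top sequentially"
      using filterlim_compose[OF s(2) filterlim_subseq[OF r(1)]] .
    have "(\<lambda>k. P (s (r k))) \<longlonglongrightarrow> x" using LIMSEQ_subseq_LIMSEQ[OF s(3) r(1)] by (simp add: o_def)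
    then have G0: "\<Gamma> 0 = x" using r(2)[of 0] LIMSEQ_unique by auto
    \<comment> \<open>Adding \<open>\<tau>\<close> to the times gives another sequence tending to
      infinity, so the whole limit curve stays in the omega-limit set.\<close>
    have GM: "\<Gamma> \<tau> \<in> M" if "\<tau> \<ge> 0" for \<tau>
      unfolding M_def mem_Collect_eq
    proof (intro exI[of _ "\<lambda>k. s (r k) + \<tau>"] conjI allI)
      show "filterlim (\<lambda>k. s (r k) + \<tau>) at_top sequentially"
        using filterlim_tendsto_add_at_top[OF tendsto_const[of \<tau>] sr] by (simp add: add.commute)
    qed (use s(1) that r(2) in auto)
    have GX: "\<Gamma> \<tau> \<in> X" if t: "\<tau> \<ge> 0" for \<tau>
      by (rule closed_sequentially[OF compact_imp_closed[OF X] _ r(2)[OF t]]) (use PX s(1) t in auto)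
    have GL: "L-lipschitz_on {0..} \<Gamma>"
    proof (rule lipschitz_on_pointwise_limit)
      show "L-lipschitz_on {0..} (\<lambda>\<tau>. P (s (r k) + \<tau>))" for k
      proof (rule lipschitz_onI)
        fix x y :: real assume "x \<in> {0..}" "y \<in> {0..}"
        then have "dist (P (s (r k) + x)) (P (s (r k) + y)) \<le> L * dist (s (r k) + x) (s (r k) + y)"
          by (intro lipschitz_onD[OF L]) (use s(1) in auto)
        then show "dist (P (s (r k) + x)) (P (s (r k) + y)) \<le> L * dist x y" by simp
      qed (use L lipschitz_on_nonneg in blast)
    qed (use r(2) in auto)
    have *: "(AE \<tau> in lebesgue. \<tau> \<in> {0..} \<longrightarrow> (\<exists>v\<in>F (\<Gamma> \<tau>). (\<Gamma> has_vector_derivative v) (at \<tau> within {0..})))"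
       "\<forall>\<tau>\<ge>0. \<Gamma> \<tau> \<in> C"
      using lim[of "\<lambda>k. s (r k)" \<Gamma>, OF s(1) sr r(2)] by auto
    have "di_solution F X {0..} \<Gamma>"
      unfolding di_solution_def
    proof (intro conjI allI impI)
      fix a b :: real assume "{a..b} \<subseteq> {0..}"
      then show "abs_cont_on {a..b} \<Gamma>"
        using lipschitz_on_subset[OF GL] lipschitz_abs_cont_on by blast
    qed (use * GX in \<open>auto simp: is_interval_ci\<close>)
    then show ?thesis using G0 GM * by blast
  qed
  have "weakly_invariant F X M"
    unfolding weakly_invariant_def
  proof
    fix x assume "x \<in> M"
    then obtain \<Gamma> where G: "\<Gamma> 0 = x" "\<forall>\<tau>\<ge>0. \<Gamma> \<tau> \<in> M \<and> \<Gamma> \<tau> \<in> C" "di_solution F X {0..} \<Gamma>" using curve by blast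
    have "J' = {0..}" if "di_solution F X J' \<gamma>'" "{0..} \<subseteq> J'" for J' \<gamma>'
      using that unfolding di_solution_def by auto
    then have "maximal_di_solution F X {0..} \<Gamma>" using G(3) unfolding maximal_di_solution_def by auto
    then show "\<exists>J \<gamma>. maximal_di_solution F X J \<gamma> \<and> \<gamma> 0 = x \<and> (\<forall>t\<in>J. \<gamma> t \<in> M)"
      using G by (intro exI[of _ "{0..}"] exI[of _ \<Gamma>]) auto
  qed
  moreover have "M \<subseteq> C" using curve by (metis order_refl subsetI)
  ultimately have MW: "M \<subseteq> largest_weakly_invariant F X C"
    by (rule largest_weakly_invariant_is_greatest(3)[rotated])
  have acc: "\<exists>x r. x \<in> M \<and> strict_mono (r :: nat \<Rightarrow> nat) \<and> (\<lambda>k. P (s (r k))) \<longlonglongrightarrow> x"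
    if s: "\<And>k::nat. s k \<ge> 0" "filterlim s at_top sequentially" for s
  proof -
    obtain x r where xr: "strict_mono (r :: nat \<Rightarrow> nat)" "((\<lambda>k. P (s k)) \<circ> r) \<longlonglongrightarrow> x"
      using X PX s(1) unfolding compact_def by meson
    have "filterlim (\<lambda>k. s (r k)) at_top sequentially"
      using filterlim_compose[OF s(2) filterlim_subseq[OF xr(1)]] .
    then have "x \<in> M" unfolding M_def mem_Collect_eq
      by (intro exI[of _ "\<lambda>k. s (r k)"]) (use s(1) xr(2) in \<open>auto simp: o_def\<close>)
    then show ?thesis using xr by (auto simp: o_def)
  qed
  have ne: "M \<noteq> {}" using acc[of real] filterlim_real_sequentially by fastforce
  let ?W = "largest_weakly_invariant F X C"
  have "((\<lambda>t. infdist (P t) ?W) \<longlongrightarrow> 0) at_top"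
  proof (rule ccontr)
    assume "\<not> ((\<lambda>t. infdist (P t) ?W) \<longlongrightarrow> 0) at_top"
    then obtain e where e: "e > 0" "\<not> (\<forall>\<^sub>F t in at_top. dist (infdist (P t) ?W) 0 < e)"
      unfolding tendsto_iff by blast
    then have "\<forall>k::nat. \<exists>t. t \<ge> real k \<and> infdist (P t) ?W \<ge> e"
      unfolding eventually_at_top_linorder by (auto simp: infdist_nonneg not_less)
    then obtain s where s: "\<And>k::nat. s k \<ge> real k" "\<And>k. infdist (P (s k)) ?W \<ge> e" by metis
    have s0: "s k \<ge> 0" for k using s(1)[of k] by linarith
    have "filterlim s at_top sequentially"
      by (rule filterlim_at_top_mono[OF filterlim_real_sequentially]) (use s(1) in auto)
    then obtain x r where xr: "x \<in> M" "(\<lambda>k. P (s (r k))) \<longlonglongrightarrow> x" using acc[of s] s0 by blast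
    have "(\<lambda>k. infdist (P (s (r k))) ?W) \<longlonglongrightarrow> infdist x ?W" by (intro tendsto_infdist xr)
    moreover have "infdist x ?W = 0" using xr MW by auto
    ultimately have "e \<le> 0" using s(2) by (intro LIMSEQ_le_const[of _ 0]) auto
    then show False using e by simp
  qed
  then show ?thesis using ne MW unfolding converges_to_set_def by auto
qed

section \<open>Circumcenters\<close>

definition min_ball :: "'a::metric_space set \<Rightarrow> 'a \<Rightarrow> real \<Rightarrow> bool" where
  "min_ball W c r \<longleftrightarrow> W \<subseteq> cball c r \<and> (\<forall>c' r'. W \<subseteq> cball c' r' \<longrightarrow> r \<le> r')"

lemma min_ball_radius_nonneg: "min_ball W c r \<Longrightarrow> W \<noteq> {} \<Longrightarrow> r \<ge> 0"
  unfolding min_ball_def by (metis cball_eq_empty linorder_not_le subset_empty)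

text \<open>By the parallelogram identity, two distinct centers would admit a strictly smaller disk
  around their midpoint.\<close>

lemma min_ball_unique:
  fixes W :: "'a::real_inner set"
  assumes "W \<noteq> {}" "min_ball W c r" "min_ball W c' r'"
  shows "c = c'" "r = r'"
proof -
  show rr: "r = r'" using assms unfolding min_ball_def by (meson order_antisym)
  have r0: "r \<ge> 0" using assms min_ball_radius_nonneg by blast
  show "c = c'"
  proof (rule ccontr)
    assume ne: "c \<noteq> c'"
    define m where "m = (1/2) *\<^sub>R (c + c')"
    define \<rho> where "\<rho> = r\<^sup>2 - (norm (c - c'))\<^sup>2 / 4"
    have le: "(norm (q - m))\<^sup>2 \<le> \<rho>" if q: "q \<in> W" for q
    proof -
      have "norm (q - c) \<le> r" "norm (q - c') \<le> r"
        using assms q rr unfolding min_ball_def by (auto simp: dist_norm norm_minus_commute)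
      then have "(norm (q - c))\<^sup>2 \<le> r\<^sup>2" "(norm (q - c'))\<^sup>2 \<le> r\<^sup>2" by (auto intro: power_mono)
      moreover have "(norm (q - m))\<^sup>2 = ((norm (q - c))\<^sup>2 + (norm (q - c'))\<^sup>2) / 2 - (norm (c - c'))\<^sup>2 / 4"
        by (simp add: m_def power2_norm_eq_inner inner_diff inner_add inner_commute field_simps)
      ultimately show ?thesis by (simp add: \<rho>_def)
    qed
    obtain q where q: "q \<in> W" using assms by auto
    have rho0: "\<rho> \<ge> 0" using le[OF q] by (meson order_trans zero_le_power2)
    have "norm (q - m) \<le> sqrt \<rho>" if "q \<in> W" for q using le[OF that] by (simp add: real_le_rsqrt)
    then have "W \<subseteq> cball m (sqrt \<rho>)" by (auto simp: dist_norm norm_minus_commute)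
    then have "r \<le> sqrt \<rho>" using assms unfolding min_ball_def by blast
    then have "r\<^sup>2 \<le> \<rho>" using r0 rho0 by (metis power_mono real_sqrt_pow2)
    then show False using ne by (simp add: \<rho>_def)
  qed
qed

lemma min_ball_exists:
  fixes W :: "'a::euclidean_space set"
  assumes "bounded W" "W \<noteq> {}"
  shows "\<exists>c r. min_ball W c r"
proof -
  define S where "S = {r. \<exists>c. W \<subseteq> cball c r}"
  obtain w where w: "w \<in> W" using assms by auto
  have Sne: "S \<noteq> {}" using assms(1) bounded_any_center[of W w] unfolding S_def by (auto simp: subset_iff)
  have S0: "r \<ge> 0" if "r \<in> S" for r
  proof -
    obtain c where "W \<subseteq> cball c r" using \<open>r \<in> S\<close> unfolding S_def by blast
    then have "dist c w \<le> r" using w by auto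
    then show ?thesis using zero_le_dist order_trans by blast
  qed
  have bdd: "bdd_below S" using S0 by (intro bdd_belowI)
  define R where "R = Inf S"
  have "\<exists>c r. W \<subseteq> cball c r \<and> r < R + 1 / real (Suc n)" for n
  proof -
    have "Inf S < R + 1 / real (Suc n)" by (simp add: R_def)
    then show ?thesis using cInf_less_iff[OF Sne bdd] unfolding S_def by auto
  qed
  then obtain c r where cr: "\<And>n. W \<subseteq> cball (c n) (r n)" "\<And>n. r n < R + 1 / real (Suc n)" by metis
  have "c n \<in> cball w (R + 1)" for n
  proof -
    have "dist (c n) w \<le> r n" using cr(1)[of n] w by auto
    moreover have "1 / real (Suc n) \<le> 1" by simp
    ultimately show ?thesis using cr(2)[of n] unfolding mem_cball dist_commute[of w] by linarith
  qed
  then obtain l k where lk: "strict_mono (k :: nat \<Rightarrow> nat)" "(c \<circ> k) \<longlonglongrightarrow> l"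
    using compact_cball[of w "R + 1"] unfolding compact_def by meson
  have "W \<subseteq> cball l R"
  proof
    fix q assume q: "q \<in> W"
    have "(\<lambda>n. dist (c (k n)) q) \<longlonglongrightarrow> dist l q" using lk(2) by (intro tendsto_intros) (auto simp: o_def)
    moreover have "(\<lambda>n. R + 1 / real (Suc n)) \<longlonglongrightarrow> R" using LIMSEQ_inverse_real_of_nat_add by (simp add: inverse_eq_divide)
    then have "(\<lambda>n. R + 1 / real (Suc (k n))) \<longlonglongrightarrow> R" using LIMSEQ_subseq_LIMSEQ[OF _ lk(1)] by (fastforce simp: o_def)
    moreover have "dist (c (k n)) q \<le> R + 1 / real (Suc (k n))" for n
      using cr(1)[of "k n"] cr(2)[of "k n"] q by (auto dest!: subsetD)
    ultimately have "dist l q \<le> R" by (intro LIMSEQ_le) auto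
    then show "q \<in> cball l R" by simp
  qed
  moreover have "R \<le> r'" if "W \<subseteq> cball c' r'" for c' r'
    unfolding R_def by (rule cInf_lower[OF _ bdd]) (use that in \<open>auto simp: S_def\<close>)
  ultimately show ?thesis unfolding min_ball_def by blast
qed

lemma circumcenter_eq:
  fixes W :: "'a::real_inner set"
  assumes "W \<noteq> {}" "min_ball W c r"
  shows "circumcenter W = c"
  unfolding circumcenter_def
  by (rule the_equality) (use assms min_ball_unique(1)[OF assms(1)] in \<open>auto simp: min_ball_def\<close>)

lemma circumcenter_min_ball:
  fixes W :: "'a::euclidean_space set"
  assumes "bounded W" "W \<noteq> {}"
  obtains r where "min_ball W (circumcenter W) r" "r \<ge> 0"
  using min_ball_exists[OF assms] circumcenter_eq[OF assms(2)] min_ball_radius_nonneg assms(2) by metis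

text \<open>Projection onto \<open>W\<close> does not increase distances and fixes the points of
  \<open>W\<close>. The projected center therefore encloses \<open>W\<close> with the same radius,
  and uniqueness makes it the center.\<close>

lemma circumcenter_in:
  fixes W :: "'a::euclidean_space set"
  assumes W: "compact W" "convex W" "W \<noteq> {}"
  shows "circumcenter W \<in> W"
proof -
  obtain r where r: "min_ball W (circumcenter W) r"
    using circumcenter_min_ball[OF compact_imp_bounded[OF W(1)] W(3)] by blast
  define c where "c = circumcenter W"
  define p where "p = closest_point W c"
  have pW: "p \<in> W" unfolding p_def by (rule closest_point_in_set[OF compact_imp_closed[OF W(1)] W(3)])
  have "dist p q \<le> dist c q" if q: "q \<in> W" for q
    using closest_point_lipschitz[OF W(2) compact_imp_closed[OF W(1)] W(3), of c q] q
      closest_point_self[OF q] by (simp add: p_def)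
  then have "min_ball W p r" using r unfolding min_ball_def c_def by fastforce
  then have "p = c" using min_ball_unique(1)[OF W(3)] r unfolding c_def by blast
  then show ?thesis using pW by (simp add: c_def)
qed

lemma norm_diff_scaleR_squared:
  fixes a w :: "'a::real_inner"
  shows "(norm (a - t *\<^sub>R w))\<^sup>2 = (norm a)\<^sup>2 - t * (2 * (w \<bullet> a)) + t\<^sup>2 * (norm w)\<^sup>2"
  unfolding power2_norm_eq_inner
  by (simp add: inner_diff inner_commute power2_eq_square algebra_simps)

text \<open>First-order optimality of the center: after a displacement by
  \<open>s *\<^sub>R w\<close> some point of \<open>W\<close> is still at distance at least
  \<open>r\<close>. As \<open>s\<close> tends to 0 such points accumulate at a contact point that
  does not lie strictly on the side of \<open>w\<close>.\<close>

lemma min_ball_farthest_point: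
  fixes W :: "'a::euclidean_space set"
  assumes W: "compact W" "W \<noteq> {}" and mb: "min_ball W c r"
  shows "\<exists>q\<in>W. dist c q = r \<and> w \<bullet> (q - c) \<le> 0"
proof -
  define s where "s n = 1 / real (Suc n)" for n
  have s0: "s n > 0" for n by (simp add: s_def)
  have slim: "s \<longlonglongrightarrow> 0" unfolding s_def using LIMSEQ_inverse_real_of_nat by (simp add: inverse_eq_divide)
  have r0: "r \<ge> 0" using mb W min_ball_radius_nonneg by blast
  have "\<exists>q\<in>W. r \<le> dist (c + s n *\<^sub>R w) q" for n
  proof -
    have "continuous_on W (\<lambda>q. dist (c + s n *\<^sub>R w) q)" by (intro continuous_intros)
    then obtain q where q: "q \<in> W" "\<And>y. y \<in> W \<Longrightarrow> dist (c + s n *\<^sub>R w) y \<le> dist (c + s n *\<^sub>R w) q"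
      using continuous_attains_sup[OF W] by blast
    then have "W \<subseteq> cball (c + s n *\<^sub>R w) (dist (c + s n *\<^sub>R w) q)" by auto
    then show ?thesis using mb q(1) unfolding min_ball_def by blast
  qed
  then obtain q where q: "\<And>n. q n \<in> W" "\<And>n. r \<le> dist (c + s n *\<^sub>R w) (q n)" by metis
  have le: "2 * (w \<bullet> (q n - c)) \<le> s n * (norm w)\<^sup>2" for n
  proof -
    have "q n \<in> cball c r" using mb q(1)[of n] unfolding min_ball_def by blast
    then have "dist c (q n) \<le> r" by simp
    then have 1: "(norm (q n - c))\<^sup>2 \<le> r\<^sup>2" by (intro power_mono) (auto simp: dist_norm norm_minus_commute)
    have "r\<^sup>2 \<le> (norm (q n - c - s n *\<^sub>R w))\<^sup>2"
      using q(2)[of n] r0 by (intro power_mono) (auto simp: dist_norm norm_minus_commute algebra_simps)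
    also have "\<dots> = (norm (q n - c))\<^sup>2 - s n * (2 * (w \<bullet> (q n - c))) + (s n)\<^sup>2 * (norm w)\<^sup>2"
      by (rule norm_diff_scaleR_squared)
    finally have "s n * (2 * (w \<bullet> (q n - c))) \<le> s n * (s n * (norm w)\<^sup>2)"
      using 1 by (simp add: power2_eq_square algebra_simps)
    then show ?thesis using s0[of n] by simp
  qed
  obtain l k where lk: "l \<in> W" "strict_mono (k :: nat \<Rightarrow> nat)" "(q \<circ> k) \<longlonglongrightarrow> l"
    using W(1) q(1) unfolding compact_def by meson
  have sk: "(\<lambda>n. s (k n)) \<longlonglongrightarrow> 0" using LIMSEQ_subseq_LIMSEQ[OF slim lk(2)] by (simp add: o_def)
  have qk: "(\<lambda>n. q (k n)) \<longlonglongrightarrow> l" using lk(3) by (simp add: o_def)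
  have "(\<lambda>n. dist (c + s (k n) *\<^sub>R w) (q (k n))) \<longlonglongrightarrow> dist (c + 0 *\<^sub>R w) l"
    by (intro tendsto_intros sk qk)
  then have "r \<le> dist (c + 0 *\<^sub>R w) l" by (rule LIMSEQ_le_const) (use q(2) in auto)
  then have "r \<le> dist c l" by simp
  moreover have "dist c l \<le> r" using mb lk(1) unfolding min_ball_def by auto
  moreover have "2 * (w \<bullet> (l - c)) \<le> 0 * (norm w)\<^sup>2"
  proof (rule LIMSEQ_le)
    show "(\<lambda>n. 2 * (w \<bullet> (q (k n) - c))) \<longlonglongrightarrow> 2 * (w \<bullet> (l - c))" by (intro tendsto_intros qk)
    show "(\<lambda>n. s (k n) * (norm w)\<^sup>2) \<longlonglongrightarrow> 0 * (norm w)\<^sup>2" by (intro tendsto_intros sk)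
  qed (use le in auto)
  ultimately show ?thesis using lk(1) by (intro bexI[of _ l]) auto
qed

lemma real2_orthogonal_expansion:
  fixes u e x :: "real^2"
  assumes "u \<noteq> 0" "norm e = 1" "u \<bullet> e = 0" "u \<bullet> x = 0"
  shows "x = (e \<bullet> x) *\<^sub>R e"
proof -
  have e: "e$1 * e$1 + e$2 * e$2 = 1" using assms(2)
    by (simp add: norm_eq_1 inner_vec_def sum_2)
  have ue: "u$1 * e$1 + u$2 * e$2 = 0" and ux: "u$1 * x$1 + u$2 * x$2 = 0"
    using assms by (auto simp: inner_vec_def sum_2)
  have "u$1 * (e$1 * x$2 - e$2 * x$1) = 0" "u$2 * (e$1 * x$2 - e$2 * x$1) = 0"
    using ue ux by algebra+
  moreover have "u$1 \<noteq> 0 \<or> u$2 \<noteq> 0" using assms(1) by (auto simp: vec_eq_iff forall_2)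
  ultimately have "e$1 * x$2 - e$2 * x$1 = 0" by auto
  then have "x$1 = (e$1 * x$1 + e$2 * x$2) * e$1" "x$2 = (e$1 * x$1 + e$2 * x$2) * e$2"
    using e by algebra+
  then show ?thesis by (simp add: vec_eq_iff forall_2 inner_vec_def sum_2)
qed

text \<open>The directions \<open>u - s *\<^sub>R e\<close> tilt the optimality condition. Their
  contact points satisfy \<open>0 \<le> u \<bullet> (q - c) \<le> s * (e \<bullet> (q - c))\<close>,
  so in the limit they lie on the line through \<open>c\<close> and on the side of \<open>e\<close>.
  With \<open>- e\<close> for \<open>e\<close> the other end of the diameter follows.\<close>

lemma min_ball_halfplane_antipodal:
  fixes W :: "(real^2) set"
  assumes W: "compact W" "W \<noteq> {}" and mb: "min_ball W c r"
    and u: "u \<noteq> 0" and half: "\<And>q. q \<in> W \<Longrightarrow> u \<bullet> (q - c) \<ge> 0"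
    and e: "norm e = 1" "u \<bullet> e = 0"
  shows "c + r *\<^sub>R e \<in> W"
proof -
  define s where "s n = 1 / real (Suc n)" for n
  have s0: "s n > 0" for n by (simp add: s_def)
  have slim: "s \<longlonglongrightarrow> 0" unfolding s_def using LIMSEQ_inverse_real_of_nat by (simp add: inverse_eq_divide)
  have "\<exists>q\<in>W. dist c q = r \<and> (u - s n *\<^sub>R e) \<bullet> (q - c) \<le> 0" for n
    by (rule min_ball_farthest_point[OF W mb])
  then obtain q where q: "\<And>n. q n \<in> W" "\<And>n. dist c (q n) = r" "\<And>n. (u - s n *\<^sub>R e) \<bullet> (q n - c) \<le> 0" by metis
  have e0: "e \<bullet> (q n - c) \<ge> 0" for n
  proof -
    have "u \<bullet> (q n - c) \<le> s n * (e \<bullet> (q n - c))" using q(3)[of n] by (simp add: inner_diff_left)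
    then have "0 \<le> s n * (e \<bullet> (q n - c))" using half[OF q(1)[of n]] by linarith
    then show ?thesis using s0[of n] by (simp add: zero_le_mult_iff)
  qed
  obtain l k where lk: "l \<in> W" "strict_mono (k :: nat \<Rightarrow> nat)" "(q \<circ> k) \<longlonglongrightarrow> l"
    using W(1) q(1) unfolding compact_def by meson
  have sk: "(\<lambda>n. s (k n)) \<longlonglongrightarrow> 0" using LIMSEQ_subseq_LIMSEQ[OF slim lk(2)] by (simp add: o_def)
  have qk: "(\<lambda>n. q (k n)) \<longlonglongrightarrow> l" using lk(3) by (simp add: o_def)
  have "(\<lambda>n. dist c (q (k n))) \<longlonglongrightarrow> dist c l" by (intro tendsto_intros qk)
  then have dr: "dist c l = r" using q(2) LIMSEQ_unique by (simp add: LIMSEQ_const_iff)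
  have "(\<lambda>n. (u - s (k n) *\<^sub>R e) \<bullet> (q (k n) - c)) \<longlonglongrightarrow> (u - 0 *\<^sub>R e) \<bullet> (l - c)"
    by (intro tendsto_intros sk qk)
  then have "(u - 0 *\<^sub>R e) \<bullet> (l - c) \<le> 0" by (rule LIMSEQ_le_const2) (use q(3) in auto)
  then have ul: "u \<bullet> (l - c) = 0" using half[OF lk(1)] by simp
  have "(\<lambda>n. e \<bullet> (q (k n) - c)) \<longlonglongrightarrow> e \<bullet> (l - c)" by (intro tendsto_intros qk)
  then have el: "e \<bullet> (l - c) \<ge> 0" by (rule LIMSEQ_le_const) (use e0 in auto)
  have lc: "l - c = (e \<bullet> (l - c)) *\<^sub>R e" by (rule real2_orthogonal_expansion[OF u e ul])
  then have "norm (l - c) = \<bar>e \<bullet> (l - c)\<bar>" using e(1) by (metis mult.right_neutral norm_scaleR)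
  then have "e \<bullet> (l - c) = r" using el dr by (simp add: dist_norm norm_minus_commute)
  then have "l = c + r *\<^sub>R e" using lc by (metis add.commute diff_add_cancel)
  then show ?thesis using lk(1) by simp
qed

text \<open>By \<open>outer\<close>, the sets \<open>K m\<close> eventually lie in any slightly
  enlarged circumdisk of \<open>W\<close>, so their radii are asymptotically at most
  \<open>R\<close>. By \<open>inner\<close>, every limit of the centers is within \<open>R\<close>
  of \<open>D\<close>, hence of \<open>W\<close>, and uniqueness identifies it. The dense subset
  \<open>D\<close> appears because boundary points of \<open>W\<close> may lie outside all
  \<open>K m\<close>.\<close>

lemma circumcenter_tendsto:
  fixes K :: "nat \<Rightarrow> 'a::euclidean_space set"
  assumes K: "\<And>m. compact (K m)" "\<And>m. K m \<noteq> {}" and S: "bounded S" "\<And>m. K m \<subseteq> S"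
    and W: "compact W" "W \<noteq> {}"
    and outer: "\<And>k q l. strict_mono k \<Longrightarrow> (\<And>m. q m \<in> K (k m)) \<Longrightarrow> q \<longlonglongrightarrow> l \<Longrightarrow> l \<in> W"
    and inner: "\<And>q. q \<in> D \<Longrightarrow> \<forall>\<^sub>F m in sequentially. q \<in> K m" and D: "W \<subseteq> closure D"
  shows "(\<lambda>m. circumcenter (K m)) \<longlonglongrightarrow> circumcenter W"
proof (rule ccontr)
  define c where "c m = circumcenter (K m)" for m
  obtain R where R: "min_ball W (circumcenter W) R" "R \<ge> 0"
    using circumcenter_min_ball[OF compact_imp_bounded[OF W(1)] W(2)] by blast
  define z where "z = circumcenter W"
  have "\<exists>r. min_ball (K m) (c m) r" for m
    unfolding c_def using circumcenter_min_ball[OF compact_imp_bounded[OF K(1)] K(2)] by metis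
  then obtain \<rho> where rho: "\<And>m. min_ball (K m) (c m) (\<rho> m)" by metis
  obtain B where B: "S \<subseteq> cball z B" using S(1) bounded_any_center[of S z] by (auto simp: subset_iff)
  have up: "\<forall>\<^sub>F m in sequentially. K m \<subseteq> cball z (R + \<epsilon>)" if e: "\<epsilon> > 0" for \<epsilon>
  proof (rule ccontr)
    assume "\<not> ?thesis"
    then have "\<exists>\<^sub>F m in sequentially. \<not> K m \<subseteq> cball z (R + \<epsilon>)" by (simp add: not_eventually)
    then obtain k where k: "strict_mono (k :: nat \<Rightarrow> nat)" "\<And>m. \<not> K (k m) \<subseteq> cball z (R + \<epsilon>)"
      using infinite_enumerate[of "{m. \<not> K m \<subseteq> cball z (R + \<epsilon>)}"] unfolding frequently_sequentially
      by (metis (mono_tags, lifting) infinite_nat_iff_unbounded_le mem_Collect_eq)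
    then have "\<forall>m. \<exists>x. x \<in> K (k m) \<and> x \<notin> cball z (R + \<epsilon>)" by (metis subsetI)
    then obtain q where q: "\<And>m. q m \<in> K (k m)" "\<And>m. q m \<notin> cball z (R + \<epsilon>)" by metis
    have "q m \<in> cball z B" for m using q(1) S(2) B by blast
    then obtain l j where lj: "strict_mono (j :: nat \<Rightarrow> nat)" "(q \<circ> j) \<longlonglongrightarrow> l"
      using compact_cball[of z B] unfolding compact_def by meson
    have "l \<in> W" by (rule outer[OF strict_mono_o[OF k(1) lj(1)] _ lj(2)]) (use q(1) in auto)
    then have "dist z l \<le> R" using R(1) unfolding min_ball_def z_def by auto
    moreover have "(\<lambda>m. dist z ((q \<circ> j) m)) \<longlonglongrightarrow> dist z l" by (intro tendsto_intros lj(2))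
    then have "R + \<epsilon> \<le> dist z l"
      by (rule LIMSEQ_le_const) (use q(2) in \<open>auto simp: not_le less_imp_le\<close>)
    ultimately show False using e by simp
  qed
  have rup: "\<forall>\<^sub>F m in sequentially. \<rho> m \<le> R + \<epsilon>" if e: "\<epsilon> > 0" for \<epsilon>
    using up[OF e] by eventually_elim (use rho in \<open>auto simp: min_ball_def\<close>)
  assume "\<not> (\<lambda>m. circumcenter (K m)) \<longlonglongrightarrow> circumcenter W"
  then obtain \<epsilon> where e: "\<epsilon> > 0" "\<not> (\<forall>\<^sub>F m in sequentially. dist (c m) z < \<epsilon>)"
    unfolding tendsto_iff c_def z_def by blast
  then have "\<exists>\<^sub>F m in sequentially. \<epsilon> \<le> dist (c m) z \<and> \<rho> m \<le> R + 1"
    using rup[of 1] by (auto simp: not_eventually not_less intro: frequently_eventually_frequently)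
  then obtain k where k: "strict_mono (k :: nat \<Rightarrow> nat)" "\<And>m. \<epsilon> \<le> dist (c (k m)) z" "\<And>m. \<rho> (k m) \<le> R + 1"
    using infinite_enumerate[of "{m. \<epsilon> \<le> dist (c m) z \<and> \<rho> m \<le> R + 1}"] unfolding frequently_sequentially
    by (metis (mono_tags, lifting) infinite_nat_iff_unbounded_le mem_Collect_eq)
  have "c (k m) \<in> cball z (B + R + 1)" for m
  proof -
    obtain q where q: "q \<in> K (k m)" using K(2) by blast
    have "dist (c (k m)) q \<le> R + 1" using rho[of "k m"] q k(3)[of m] unfolding min_ball_def by force
    moreover have "dist z q \<le> B" using q S(2) B by fastforce
    ultimately show ?thesis using dist_triangle2[of z "c (k m)" q] by simp
  qed
  then obtain l j where lj: "strict_mono (j :: nat \<Rightarrow> nat)" "((\<lambda>m. c (k m)) \<circ> j) \<longlonglongrightarrow> l"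
    using compact_cball[of z "B + R + 1"] unfolding compact_def by meson
  have sm: "strict_mono (k \<circ> j)" by (rule strict_mono_o[OF k(1) lj(1)])
  have Dl: "dist l q \<le> R" if q: "q \<in> D" for q
  proof (rule field_le_epsilon)
    fix \<eta> :: real assume "\<eta> > 0"
    have "\<forall>\<^sub>F m in sequentially. q \<in> K m \<and> \<rho> m \<le> R + \<eta>"
      using inner[OF q] rup[OF \<open>\<eta> > 0\<close>] by eventually_elim auto
    then have "\<forall>\<^sub>F m in sequentially. q \<in> K ((k \<circ> j) m) \<and> \<rho> ((k \<circ> j) m) \<le> R + \<eta>"
      using eventually_subseq[OF sm] by blast
    then have "\<forall>\<^sub>F m in sequentially. dist (((\<lambda>m. c (k m)) \<circ> j) m) q \<le> R + \<eta>"
    proof eventually_elim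
      case (elim m)
      then show ?case using rho[of "k (j m)"] unfolding min_ball_def by force
    qed
    moreover have "(\<lambda>m. dist (((\<lambda>m. c (k m)) \<circ> j) m) q) \<longlonglongrightarrow> dist l q" by (intro tendsto_intros lj(2))
    ultimately show "dist l q \<le> R + \<eta>" by (intro tendsto_upperbound) auto
  qed
  have "W \<subseteq> cball l R"
  proof -
    have "closure D \<subseteq> cball l R" by (rule closure_minimal) (use Dl in auto)
    then show ?thesis using D by auto
  qed
  then have "min_ball W l R" using R(1) unfolding min_ball_def by auto
  then have "l = z" using min_ball_unique(1)[OF W(2)] R(1) unfolding z_def by blast
  moreover have "(\<lambda>m. dist (((\<lambda>m. c (k m)) \<circ> j) m) z) \<longlonglongrightarrow> dist l z" by (intro tendsto_intros lj(2))
  then have "\<epsilon> \<le> dist l z" by (rule LIMSEQ_le_const) (use k(2) in auto)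
  ultimately show False using e(1) by simp
qed

section \<open>Voronoi cells\<close>

lemma voronoi_cell_iff:
  "q \<in> voronoi_cell Q P i \<longleftrightarrow> q \<in> Q \<and> (\<forall>j. norm (q - P $ i) \<le> norm (q - P $ j))"
  by (auto simp: voronoi_cell_def)

lemma closer_iff_halfspace:
  fixes q a b :: "'a::real_inner"
  shows "norm (q - a) \<le> norm (q - b) \<longleftrightarrow> (a - b) \<bullet> (q - (1/2) *\<^sub>R (a + b)) \<ge> 0"
proof -
  have "norm (q - a) \<le> norm (q - b) \<longleftrightarrow> (norm (q - a))\<^sup>2 \<le> (norm (q - b))\<^sup>2"
    by (simp add: power_mono_iff)
  also have "\<dots> \<longleftrightarrow> (a - b) \<bullet> (q - (1/2) *\<^sub>R (a + b)) \<ge> 0"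
    unfolding power2_norm_eq_inner by (simp add: inner_diff inner_add inner_commute field_simps)
  finally show ?thesis .
qed

lemma voronoi_cell_eq_Int:
  "voronoi_cell Q P i = Q \<inter> (\<Inter>j. {q. (P $ i - P $ j) \<bullet> q \<ge> (P $ i - P $ j) \<bullet> ((1/2) *\<^sub>R (P $ i + P $ j))})"
  by (auto simp: voronoi_cell_iff closer_iff_halfspace inner_diff_right)

lemma voronoi_cell_cong: "P $ i = P $ j \<Longrightarrow> voronoi_cell Q P i = voronoi_cell Q P j"
  by (auto simp: voronoi_cell_iff)

lemma mem_voronoi_cell_limit:
  assumes Q: "closed Q" and q: "\<And>k::nat. q k \<in> voronoi_cell Q (P k) i" "q \<longlonglongrightarrow> l" and P: "P \<longlonglongrightarrow> R"
  shows "l \<in> voronoi_cell Q R i"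
  unfolding voronoi_cell_iff
proof (intro conjI allI)
  show "l \<in> Q" by (rule closed_sequentially[OF Q _ q(2)]) (use q(1) in \<open>auto simp: voronoi_cell_iff\<close>)
  fix j
  show "norm (l - R $ i) \<le> norm (l - R $ j)"
  proof (rule LIMSEQ_le)
    show "(\<lambda>k. norm (q k - P k $ i)) \<longlonglongrightarrow> norm (l - R $ i)" "(\<lambda>k. norm (q k - P k $ j)) \<longlonglongrightarrow> norm (l - R $ j)"
      by (intro tendsto_intros q(2) P)+
  qed (use q(1) in \<open>auto simp: voronoi_cell_iff\<close>)
qed

lemma obtain_nearest:
  fixes P :: "'a::real_normed_vector ^ 'n::finite"
  obtains i where "\<And>j. norm (q - P $ i) \<le> norm (q - P $ j)"
proof -
  have "Min (range (\<lambda>j. norm (q - P $ j))) \<in> range (\<lambda>j. norm (q - P $ j))" by (intro Min_in) auto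
  then obtain i where i: "Min (range (\<lambda>j. norm (q - P $ j))) = norm (q - P $ i)"
    unfolding image_iff by blast
  have "norm (q - P $ i) \<le> norm (q - P $ j)" for j
    unfolding i[symmetric] by (rule Min_le) auto
  then show thesis using that by blast
qed

lemma obtain_nearest_cell:
  fixes P :: "(real^2)^'n::finite"
  assumes "q \<in> Q"
  obtains i where "q \<in> voronoi_cell Q P i"
proof -
  obtain i where "\<And>j. norm (q - P $ i) \<le> norm (q - P $ j)" by (rule obtain_nearest[of q P]) blast
  then show thesis using that assms by (auto simp: voronoi_cell_iff)
qed

section \<open>Curves of generators moving towards points of their cells\<close>

lemma abs_cont_on_dominated:
  assumes f: "abs_cont_on I f" and C: "C \<ge> 0" "C' \<ge> 0"
    and g: "\<And>x y. x \<in> I \<Longrightarrow> y \<in> I \<Longrightarrow> x \<le> y \<Longrightarrow> norm (g y - g x) \<le> C * norm (f y - f x) + C' * (y - x)"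
  shows "abs_cont_on I g"
  unfolding abs_cont_on_def
proof (intro allI impI)
  fix \<epsilon> :: real assume e: "\<epsilon> > 0"
  then have e': "\<epsilon> / (2 * (C + 1)) > 0" using C by simp
  obtain \<delta> where d: "\<delta> > 0" "\<And>d. d division_of \<Union>d \<Longrightarrow> \<Union>d \<subseteq> I \<Longrightarrow> (\<Sum>k\<in>d. Sup k - Inf k) < \<delta>
      \<Longrightarrow> (\<Sum>k\<in>d. norm (f (Sup k) - f (Inf k))) < \<epsilon> / (2 * (C + 1))"
    using f e' unfolding abs_cont_on_def by meson
  show "\<exists>\<delta>>0. \<forall>d. d division_of \<Union>d \<and> \<Union>d \<subseteq> I \<and> (\<Sum>k\<in>d. Sup k - Inf k) < \<delta>
        \<longrightarrow> (\<Sum>k\<in>d. norm (g (Sup k) - g (Inf k))) < \<epsilon>"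
  proof (intro exI[of _ "min \<delta> (\<epsilon> / (2 * (C' + 1)))"] conjI allI impI)
    show "min \<delta> (\<epsilon> / (2 * (C' + 1))) > 0" using d e C by simp
    fix D :: "real set set" assume D: "D division_of \<Union>D \<and> \<Union>D \<subseteq> I \<and> (\<Sum>k\<in>D. Sup k - Inf k) < min \<delta> (\<epsilon> / (2 * (C' + 1)))"
    have k: "Inf k \<in> I \<and> Sup k \<in> I \<and> Inf k \<le> Sup k" if k: "k \<in> D" for k
    proof -
      obtain u v where "k = cbox u v" "k \<noteq> {}" using division_ofD(3,4)[OF conjunct1[OF D] k] by blast
      then have uv: "k = {u..v}" "u \<le> v" by auto
      have "k \<subseteq> I" using D k by auto
      then show ?thesis using uv by auto
    qed
    define S1 where "S1 = (\<Sum>k\<in>D. norm (f (Sup k) - f (Inf k)))"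
    define S2 where "S2 = (\<Sum>k\<in>D. Sup k - Inf k)"
    have S: "S1 < \<epsilon> / (2 * (C + 1))" "S2 < \<epsilon> / (2 * (C' + 1))" "S1 \<ge> 0" "S2 \<ge> 0"
      using d(2) D k by (auto simp: S1_def S2_def intro!: sum_nonneg)
    have "(\<Sum>k\<in>D. norm (g (Sup k) - g (Inf k))) \<le> (\<Sum>k\<in>D. C * norm (f (Sup k) - f (Inf k)) + C' * (Sup k - Inf k))"
      using k g by (intro sum_mono) auto
    also have "\<dots> = C * S1 + C' * S2"
      by (simp add: S1_def S2_def sum.distrib sum_distrib_left)
    also have "\<dots> \<le> (C + 1) * S1 + (C' + 1) * S2"
      using S by (intro add_mono mult_right_mono) auto
    also have "\<dots> < (C + 1) * (\<epsilon> / (2 * (C + 1))) + (C' + 1) * (\<epsilon> / (2 * (C' + 1)))"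
      using S C by (intro add_strict_mono mult_strict_left_mono) auto
    also have "(C + 1) * (\<epsilon> / (2 * (C + 1))) = \<epsilon> / 2" using C by (simp add: field_simps)
    also have "(C' + 1) * (\<epsilon> / (2 * (C' + 1))) = \<epsilon> / 2" using C by (simp add: field_simps)
    also have "\<epsilon> / 2 + \<epsilon> / 2 = \<epsilon>" by simp
    finally show "(\<Sum>k\<in>D. norm (g (Sup k) - g (Inf k))) < \<epsilon>" .
  qed
qed

lemma has_real_derivative_norm:
  fixes y :: "real \<Rightarrow> 'a::real_inner"
  assumes y: "(y has_vector_derivative z) (at t)" "y t \<noteq> 0"
  shows "((\<lambda>s. norm (y s)) has_real_derivative (sgn (y t) \<bullet> z)) (at t)"
proof -
  have 1: "(y has_derivative (\<lambda>h. h *\<^sub>R z)) (at t)" using y(1) by (simp add: has_vector_derivative_def)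
  have 2: "(norm has_derivative (\<lambda>h. h \<bullet> sgn (y t))) (at (y t))"
    using GDERIV_norm[OF y(2)] unfolding gderiv_def by simp
  have "((norm \<circ> y) has_derivative ((\<lambda>h. h \<bullet> sgn (y t)) \<circ> (\<lambda>h. h *\<^sub>R z))) (at t)"
    by (rule diff_chain_at[OF 1 2])
  then show ?thesis unfolding has_field_derivative_def by (simp add: o_def inner_commute mult_commute_abs)
qed

text \<open>The norm has a kink at 0, but not along a curve that is at 0 with zero velocity. This
  happens to two coincident generators that move towards the same point.\<close>

lemma has_real_derivative_norm_at_zero:
  fixes y :: "real \<Rightarrow> 'a::real_normed_vector"
  assumes y: "(y has_vector_derivative 0) (at t)" "y t = 0"
  shows "((\<lambda>s. norm (y s)) has_real_derivative 0) (at t)"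
proof -
  have "((\<lambda>s. norm ((1 / norm (s - t)) *\<^sub>R (y s - (y t + (s - t) *\<^sub>R 0)))) \<longlongrightarrow> 0) (at t)"
    using y(1) unfolding has_vector_derivative_def has_derivative_within by (intro tendsto_norm_zero) simp
  then have "((\<lambda>s. \<bar>(norm (y s) - norm (y t)) / (s - t)\<bar>) \<longlongrightarrow> 0) (at t)"
    by (simp add: y(2) abs_mult divide_inverse mult.commute)
  then show ?thesis unfolding has_field_derivative_iff by (rule tendsto_rabs_zero_cancel)
qed

lemma lipschitz_exp_times:
  fixes f :: "real \<Rightarrow> real"
  assumes f: "L-lipschitz_on {a..b} f" and B: "\<And>x. x \<in> {a..b} \<Longrightarrow> \<bar>f x\<bar> \<le> B" and ab: "a \<le> b"
  shows "(exp b * (L + B))-lipschitz_on {a..b} (\<lambda>s. exp s * f s)"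
proof (rule lipschitz_onI)
  have L0: "L \<ge> 0" using f lipschitz_on_nonneg by blast
  have B0: "B \<ge> 0" using B[of a] ab by auto
  then show "0 \<le> exp b * (L + B)" using L0 by simp
  have *: "\<bar>exp y * f y - exp x * f x\<bar> \<le> exp b * (L + B) * (y - x)" if xy: "x \<in> {a..b}" "y \<in> {a..b}" "x \<le> y" for x y
  proof -
    have 1: "\<bar>f y - f x\<bar> \<le> L * (y - x)" using lipschitz_onD[OF f xy(2,1)] xy by (simp add: dist_real_def)
    have "exp y - exp x \<le> exp y * (y - x)"
    proof -
      have "exp y * (1 + (x - y)) \<le> exp y * exp (x - y)"
        by (intro mult_left_mono exp_ge_add_one_self) auto
      then show ?thesis by (simp add: algebra_simps flip: exp_add)
    qed
    also have "\<dots> \<le> exp b * (y - x)" using xy by (intro mult_right_mono) auto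
    finally have 2: "\<bar>exp y - exp x\<bar> \<le> exp b * (y - x)" using xy by simp
    have "exp y * f y - exp x * f x = exp y * (f y - f x) + (exp y - exp x) * f x" by (simp add: algebra_simps)
    then have "\<bar>exp y * f y - exp x * f x\<bar> \<le> exp y * \<bar>f y - f x\<bar> + \<bar>exp y - exp x\<bar> * \<bar>f x\<bar>"
      by (metis abs_exp_cancel abs_mult abs_triangle_ineq)
    also have "\<dots> \<le> exp b * (L * (y - x)) + (exp b * (y - x)) * B"
      using 1 2 B[OF xy(1)] xy L0 B0 by (intro add_mono mult_mono) auto
    finally show ?thesis by (simp add: algebra_simps)
  qed
  fix x y assume "x \<in> {a..b}" "y \<in> {a..b}"
  then show "dist (exp x * f x) (exp y * f y) \<le> exp b * (L + B) * dist x y"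
    using *[of x y] *[of y x] by (cases "x \<le> y") (auto simp: dist_real_def abs_minus_commute)
qed

lemma compact_all_components:
  fixes K :: "'a::euclidean_space set"
  assumes K: "compact K"
  shows "compact {f :: 'a^'n::finite. \<forall>i. f $ i \<in> K}"
proof -
  obtain B where B: "\<And>x. x \<in> K \<Longrightarrow> norm x \<le> B" using compact_imp_bounded[OF K] bounded_iff by blast
  have "norm f \<le> (\<Sum>i\<in>(UNIV::'n set). B)" if "\<forall>i. f $ i \<in> K" for f :: "'a^'n"
  proof -
    have "norm f \<le> (\<Sum>i\<in>UNIV. norm (f $ i))" unfolding norm_vec_def by (rule L2_set_le_sum) auto
    also have "\<dots> \<le> (\<Sum>i\<in>(UNIV::'n set). B)" using that B by (intro sum_mono) auto
    finally show ?thesis .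
  qed
  then have "bounded {f :: 'a^'n. \<forall>i. f $ i \<in> K}" unfolding bounded_iff by blast
  moreover have "closed {f :: 'a^'n. \<forall>i. f $ i \<in> K}"
  proof -
    have "closed ((\<lambda>f :: 'a^'n. f $ i) -` K)" for i
      by (rule continuous_closed_vimage[OF compact_imp_closed[OF K]]) (auto intro!: continuous_intros)
    then have "closed (\<Inter>i. (\<lambda>f :: 'a^'n. f $ i) -` K)" by (intro closed_INT) auto
    moreover have "(\<Inter>i. (\<lambda>f :: 'a^'n. f $ i) -` K) = {f. \<forall>i. f $ i \<in> K}" by auto
    ultimately show ?thesis by simp
  qed
  ultimately show ?thesis by (simp add: compact_eq_bounded_closed)
qed

locale polygon =
  fixes Q :: "(real^2) set"
  assumes convex_polygon: "convex_polygon Q"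
begin

lemma Q_compact: "compact Q" and Q_convex: "convex Q" and Q_closed: "closed Q"
  and Q_polyhedron: "polyhedron Q" and Q_interior: "interior Q \<noteq> {}" and Q_nonempty: "Q \<noteq> {}"
  using convex_polygon interior_subset[of Q] unfolding convex_polygon_def
  by (auto simp: polytope_imp_compact polytope_imp_convex polytope_imp_closed polytope_imp_polyhedron)

lemma voronoi_cell_subset: "voronoi_cell Q P i \<subseteq> Q"
  by (auto simp: voronoi_cell_iff)

lemma voronoi_cell_compact: "compact (voronoi_cell Q P i)"
  unfolding voronoi_cell_eq_Int
  by (intro compact_Int_closed Q_compact closed_INT ballI closed_halfspace_ge)

lemma voronoi_cell_convex: "convex (voronoi_cell Q P i)"
  unfolding voronoi_cell_eq_Int
  by (intro convex_Int Q_convex convex_INT convex_halfspace_ge)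

lemma voronoi_cell_polyhedron: "polyhedron (voronoi_cell Q (P :: (real^2)^'n::finite) i)"
  unfolding voronoi_cell_eq_Int
  by (intro polyhedron_Int Q_polyhedron polyhedron_Inter finite_imageI) (simp, clarify, rule polyhedron_halfspace_ge)

lemma generator_in_cell: "P \<in> configurations Q \<Longrightarrow> P $ i \<in> voronoi_cell Q P i"
  by (auto simp: voronoi_cell_iff configurations_def)

lemma circumcenter_in_cell:
  "P \<in> configurations Q \<Longrightarrow> circumcenter (voronoi_cell Q P i) \<in> voronoi_cell Q P i"
  using circumcenter_in[OF voronoi_cell_compact voronoi_cell_convex] generator_in_cell by blast

lemma configurations_compact: "compact (configurations Q :: ((real^2)^'n::finite) set)"
  unfolding configurations_def by (rule compact_all_components[OF Q_compact])

text \<open>What the two dynamics share: each generator heads for some point \<open>C t $ i\<close>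
  of its cell. The exceptional set is an explicit argument so that it can be shifted along with the
  curve.\<close>

definition cell_curve :: "real \<Rightarrow> (real \<Rightarrow> (real^2)^'n::finite) \<Rightarrow> (real \<Rightarrow> (real^2)^'n) \<Rightarrow> real set \<Rightarrow> bool" where
  "cell_curve L P C N \<longleftrightarrow> negligible N \<and> L-lipschitz_on {0..} P \<and> (\<forall>t\<ge>0. P t \<in> configurations Q) \<and>
     (\<forall>t>0. t \<notin> N \<longrightarrow> (P has_vector_derivative (C t - P t)) (at t) \<and> (\<forall>i. C t $ i \<in> voronoi_cell Q (P t) i))"

lemma cell_curveD:
  assumes "cell_curve L P C N"
  shows "negligible N" "L-lipschitz_on {0..} P" "t \<ge> 0 \<Longrightarrow> P t \<in> configurations Q"
    "t > 0 \<Longrightarrow> t \<notin> N \<Longrightarrow> (P has_vector_derivative (C t - P t)) (at t)"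
    "t > 0 \<Longrightarrow> t \<notin> N \<Longrightarrow> C t $ i \<in> voronoi_cell Q (P t) i"
  using assms unfolding cell_curve_def by auto

lemma vec_nth_has_vector_derivative:
  "(P has_vector_derivative v) F \<Longrightarrow> ((\<lambda>s. P s $ i) has_vector_derivative v $ i) F"
  using bounded_linear.has_vector_derivative[OF bounded_linear_vec_nth] by blast

lemma inner_has_real_derivative:
  assumes "(y has_vector_derivative v) (at t)"
  shows "((\<lambda>s. w \<bullet> y s) has_real_derivative w \<bullet> v) (at t)"
  using bounded_linear.has_vector_derivative[OF bounded_linear_inner_right assms, of w]
  by (simp add: has_real_derivative_iff_has_vector_derivative)

text \<open>Velocities join two points of \<open>Q\<close>, so they are bounded almost everywhere;
  absolute continuity turns this into a Lipschitz bound. The predicate \<open>\<Phi>\<close> records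
  which points of the cells are chosen.\<close>

lemma di_solution_cell_curve:
  fixes P :: "real \<Rightarrow> (real^2)^'n::finite"
  assumes sol: "di_solution F (configurations Q) {0..} P"
    and F: "\<And>R v. R \<in> configurations Q \<Longrightarrow> v \<in> F R \<Longrightarrow> \<exists>c. v = c - R \<and> (\<forall>i. c $ i \<in> voronoi_cell Q R i) \<and> \<Phi> R c"
  shows "\<exists>L C N. cell_curve L P C N \<and> (\<forall>t>0. t \<notin> N \<longrightarrow> \<Phi> (P t) (C t))"
proof -
  have PX: "\<And>t. t \<ge> 0 \<Longrightarrow> P t \<in> configurations Q"
    and ac: "\<And>a b. 0 \<le> a \<Longrightarrow> abs_cont_on {a..b} P"
    and ae: "AE t in lebesgue. t \<in> {0..} \<longrightarrow> (\<exists>v\<in>F (P t). (P has_vector_derivative v) (at t within {0..}))"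
    using sol unfolding di_solution_def by auto
  obtain N where N: "N \<in> null_sets lebesgue"
    "{t \<in> space lebesgue. \<not> (t \<in> {0..} \<longrightarrow> (\<exists>v\<in>F (P t). (P has_vector_derivative v) (at t within {0..})))} \<subseteq> N"
    using ae unfolding eventually_ae_filter by blast
  have neg: "negligible N" using N by (simp add: negligible_iff_null_sets)
  have "\<exists>c. (P has_vector_derivative (c - P t)) (at t) \<and> (\<forall>i. c $ i \<in> voronoi_cell Q (P t) i) \<and> \<Phi> (P t) c"
    if t: "t > 0" "t \<notin> N" for t
  proof -
    have "\<exists>v\<in>F (P t). (P has_vector_derivative v) (at t within {0..})"
    proof (rule ccontr)
      assume "\<not> ?thesis"
      then have "t \<in> {t \<in> space lebesgue. \<not> (t \<in> {0..} \<longrightarrow> (\<exists>v\<in>F (P t). (P has_vector_derivative v) (at t within {0..})))}"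
        using t by simp
      then show False using N(2) t(2) by blast
    qed
    then obtain v where v: "v \<in> F (P t)" "(P has_vector_derivative v) (at t within {0..})" by blast
    have "at t within {0..} = at t" by (rule at_within_interior) (use t in auto)
    then show ?thesis using F[OF PX v(1)] v t by auto
  qed
  then obtain C where C: "\<And>t. t > 0 \<Longrightarrow> t \<notin> N \<Longrightarrow> (P has_vector_derivative (C t - P t)) (at t) \<and> (\<forall>i. C t $ i \<in> voronoi_cell Q (P t) i) \<and> \<Phi> (P t) (C t)"
    by metis
  obtain D where D: "D > 0" "\<And>x y. x \<in> Q \<Longrightarrow> y \<in> Q \<Longrightarrow> norm (x - y) \<le> D"
  proof -
    obtain B where B: "\<And>x. x \<in> Q \<Longrightarrow> norm x \<le> B" using compact_imp_bounded[OF Q_compact] bounded_iff by blast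
    have "norm (x - y) \<le> 2 * \<bar>B\<bar> + 1" if "x \<in> Q" "y \<in> Q" for x y
      using norm_triangle_ineq4[of x y] B[OF that(1)] B[OF that(2)] by linarith
    then show thesis by (intro that[of "2 * \<bar>B\<bar> + 1"]) auto
  qed
  have comp: "norm (P b $ i - P a $ i) \<le> D * (b - a)" if ab: "0 \<le> a" "a \<le> b" for a b i
  proof -
    \<comment> \<open>The direction of the increment to be estimated, so that its inner product with
      the increment is the norm.\<close>
    define w where "w = sgn (P b $ i - P a $ i)"
    have w: "norm w \<le> 1" by (simp add: w_def norm_sgn)
    let ?f = "\<lambda>s. D * s + (- w) \<bullet> P s $ i"
    have "?f a \<le> ?f b"
    proof (rule ae_lower_slope_mono[OF ab(2) _ neg])
      show "abs_cont_on {a..b} ?f"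
      proof (rule abs_cont_on_dominated[OF ac[OF ab(1)], of 1 D])
        fix x y assume "x \<in> {a..b}" "y \<in> {a..b}" "x \<le> y"
        have "?f y - ?f x = D * (y - x) - w \<bullet> ((P y - P x) $ i)" by (simp add: algebra_simps inner_diff_right)
        also have "norm \<dots> \<le> D * (y - x) + norm w * norm ((P y - P x) $ i)"
        proof -
          have "0 \<le> D * (y - x)" using D(1) \<open>x \<le> y\<close> by simp
          then show ?thesis using Cauchy_Schwarz_ineq2[of w "(P y - P x) $ i"] unfolding real_norm_def by linarith
        qed
        also have "\<dots> \<le> D * (y - x) + 1 * norm (P y - P x)"
          using w Finite_Cartesian_Product.norm_nth_le[of "P y - P x" i] by (intro add_left_mono mult_mono) auto
        finally show "norm (?f y - ?f x) \<le> 1 * norm (P y - P x) + D * (y - x)" by simp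
      qed (use D in auto)
      fix t assume t: "a < t" "t < b" "t \<notin> N"
      then have t0: "t > 0" using ab by simp
      have "((\<lambda>s. P s $ i) has_vector_derivative (C t - P t) $ i) (at t)"
        using C[OF t0 t(3)] vec_nth_has_vector_derivative by blast
      then have "(?f has_real_derivative D * 1 + (- w) \<bullet> ((C t - P t) $ i)) (at t)"
        by (intro derivative_intros inner_has_real_derivative) (auto intro!: derivative_eq_intros)
      then have "lower_slope ?f t (D + (- w) \<bullet> ((C t - P t) $ i))" using lower_slope_has_derivative by simp
      moreover have "w \<bullet> ((C t - P t) $ i) \<le> D"
      proof -
        have "w \<bullet> ((C t - P t) $ i) \<le> norm w * norm ((C t - P t) $ i)" by (rule norm_cauchy_schwarz)
        also have "\<dots> \<le> 1 * D"
          using w C[OF t0 t(3)] PX[of t] t0 D by (intro mult_mono) (auto simp: voronoi_cell_iff configurations_def)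
        finally show ?thesis by simp
      qed
      ultimately show "lower_slope ?f t 0" by (elim lower_slope_mono) simp
    qed
    then have "w \<bullet> (P b $ i - P a $ i) \<le> D * (b - a)" by (simp add: algebra_simps inner_diff_right)
    moreover have "w \<bullet> (P b $ i - P a $ i) = norm (P b $ i - P a $ i)"
      by (cases "P b $ i - P a $ i = 0")
        (simp_all add: w_def sgn_div_norm power2_norm_eq_inner[symmetric] power2_eq_square)
    ultimately show ?thesis by simp
  qed
  have nrm: "norm (P b - P a) \<le> (real CARD('n) * D) * (b - a)" if ab: "0 \<le> a" "a \<le> b" for a b
  proof -
    have "norm (P b - P a) \<le> (\<Sum>i\<in>UNIV. norm ((P b - P a) $ i))" unfolding norm_vec_def by (rule L2_set_le_sum) auto
    also have "\<dots> \<le> (\<Sum>i\<in>(UNIV::'n set). D * (b - a))" using comp[OF ab] by (intro sum_mono) auto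
    finally show ?thesis by (simp add: mult.assoc)
  qed
  have "(real CARD('n) * D)-lipschitz_on {0..} P"
  proof (rule lipschitz_onI)
    fix x y :: real assume "x \<in> {0..}" "y \<in> {0..}"
    then show "dist (P x) (P y) \<le> real CARD('n) * D * dist x y"
      using nrm[of x y] nrm[of y x] by (cases "x \<le> y") (auto simp: dist_norm norm_minus_commute)
  qed (use D in simp)
  then have "cell_curve (real CARD('n) * D) P C N" using neg PX C unfolding cell_curve_def by auto
  then show ?thesis using C by blast
qed

lemma cell_curve_translate:
  assumes c: "cell_curve L P C N" and s: "s \<ge> 0"
  shows "cell_curve L (\<lambda>\<tau>. P (s + \<tau>)) (\<lambda>\<tau>. C (s + \<tau>)) ((+) (- s) ` N)"
  unfolding cell_curve_def
proof (intro conjI allI impI)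
  show "negligible ((+) (- s) ` N)" using cell_curveD(1)[OF c] by (rule negligible_translation)
  show "L-lipschitz_on {0..} (\<lambda>\<tau>. P (s + \<tau>))"
  proof (rule lipschitz_onI)
    fix x y :: real assume "x \<in> {0..}" "y \<in> {0..}"
    then have "dist (P (s + x)) (P (s + y)) \<le> L * dist (s + x) (s + y)"
      by (intro lipschitz_onD[OF cell_curveD(2)[OF c]]) (use s in auto)
    then show "dist (P (s + x)) (P (s + y)) \<le> L * dist x y" by simp
  qed (use cell_curveD(2)[OF c] lipschitz_on_nonneg in blast)
  fix t :: real
  show "P (s + t) \<in> configurations Q" if "0 \<le> t" using cell_curveD(3)[OF c] that s by simp
  assume t: "0 < t" "t \<notin> (+) (- s) ` N"
  have "s + t \<notin> N"
  proof
    assume "s + t \<in> N"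
    then have "- s + (s + t) \<in> (+) (- s) ` N" by blast
    then show False using t(2) by simp
  qed
  moreover have "0 < s + t" using s t by simp
  ultimately have d: "(P has_vector_derivative (C (s + t) - P (s + t))) (at (s + t))" and
    cc: "\<And>i. C (s + t) $ i \<in> voronoi_cell Q (P (s + t)) i" using cell_curveD(4,5)[OF c] by blast+
  show "C (s + t) $ i \<in> voronoi_cell Q (P (s + t)) i" for i by (rule cc)
  have "((\<lambda>\<tau>. s + \<tau>) has_vector_derivative 1) (at t)" by (auto intro!: derivative_eq_intros)
  then have "((P \<circ> (\<lambda>\<tau>. s + \<tau>)) has_vector_derivative (1 *\<^sub>R (C (s + t) - P (s + t)))) (at t)"
    by (rule vector_diff_chain_at) (use d in simp)
  then show "((\<lambda>\<tau>. P (s + \<tau>)) has_vector_derivative C (s + t) - P (s + t)) (at t)" by (simp add: o_def)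
qed

lemma cell_curve_component_lipschitz:
  assumes c: "cell_curve L P C N" and a: "0 \<le> a"
  shows "L-lipschitz_on {a..b} (\<lambda>s. P s $ i)"
proof (rule lipschitz_onI)
  fix x y assume xy: "x \<in> {a..b}" "y \<in> {a..b}"
  have "dist (P x $ i) (P y $ i) \<le> dist (P x) (P y)" by (rule dist_vec_nth_le)
  also have "\<dots> \<le> L * dist x y" by (rule lipschitz_onD[OF cell_curveD(2)[OF c]]) (use xy a in auto)
  finally show "dist (P x $ i) (P y $ i) \<le> L * dist x y" .
qed (use cell_curveD(2)[OF c] lipschitz_on_nonneg in blast)

lemma cell_curve_dist_lipschitz:
  assumes c: "cell_curve L P C N" and a: "0 \<le> a"
  shows "(2 * L)-lipschitz_on {a..b} (\<lambda>s. norm (P s $ i - P s $ j))"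
proof (rule lipschitz_onI)
  fix x y assume xy: "x \<in> {a..b}" "y \<in> {a..b}"
  have 1: "dist (P x $ i) (P y $ i) \<le> L * dist x y" for i
    by (rule lipschitz_onD[OF cell_curve_component_lipschitz[OF c a] xy])
  have "\<bar>norm (P x $ i - P x $ j) - norm (P y $ i - P y $ j)\<bar> \<le> norm ((P x $ i - P x $ j) - (P y $ i - P y $ j))"
    by (rule norm_triangle_ineq3)
  also have "\<dots> = norm ((P x $ i - P y $ i) - (P x $ j - P y $ j))" by (simp add: algebra_simps)
  also have "\<dots> \<le> norm (P x $ i - P y $ i) + norm (P x $ j - P y $ j)" by (rule norm_triangle_ineq4)
  also have "\<dots> \<le> 2 * L * dist x y" using 1[of i] 1[of j] by (simp add: dist_norm)
  finally show "dist (norm (P x $ i - P x $ j)) (norm (P y $ i - P y $ j)) \<le> 2 * L * dist x y"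
    by (simp add: dist_real_def)
qed (use cell_curveD(2)[OF c] lipschitz_on_nonneg in \<open>auto\<close>)

lemma cell_curve_exp_dist_lipschitz:
  assumes c: "cell_curve L P C N" and a: "0 \<le> a" "a \<le> b"
  shows "\<exists>K. K-lipschitz_on {a..b} (\<lambda>s. exp s * norm (P s $ i - P s $ j))"
proof -
  have l: "(2 * L)-lipschitz_on {a..b} (\<lambda>s. norm (P s $ i - P s $ j))"
    by (rule cell_curve_dist_lipschitz[OF c a(1)])
  then have "continuous_on {a..b} (\<lambda>s. norm (P s $ i - P s $ j))" by (rule lipschitz_on_continuous_on)
  then have "bounded ((\<lambda>s. norm (P s $ i - P s $ j)) ` {a..b})"
    by (intro compact_imp_bounded compact_continuous_image) auto
  then obtain B where "\<forall>v\<in>(\<lambda>s. norm (P s $ i - P s $ j)) ` {a..b}. norm v \<le> B" unfolding bounded_iff by blast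
  then have B: "\<And>x. x \<in> {a..b} \<Longrightarrow> \<bar>norm (P x $ i - P x $ j)\<bar> \<le> B" by auto
  show ?thesis using lipschitz_exp_times[OF l B a(2)] by blast
qed

text \<open>The bisector of the two generators separates their cells, whichever points of the cells
  are taken.\<close>

lemma cell_centers_monotone:
  assumes "x \<in> voronoi_cell Q P i" "y \<in> voronoi_cell Q P j"
  shows "(P $ i - P $ j) \<bullet> (x - y) \<ge> 0"
proof -
  have "(P $ i - P $ j) \<bullet> (x - (1/2) *\<^sub>R (P $ i + P $ j)) \<ge> 0" "(P $ j - P $ i) \<bullet> (y - (1/2) *\<^sub>R (P $ j + P $ i)) \<ge> 0"
    using assms by (auto simp: voronoi_cell_iff closer_iff_halfspace)
  then show ?thesis by (simp add: inner_diff inner_add algebra_simps)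
qed

text \<open>The difference of two generators has velocity \<open>(C_i - C_j) - (P_i - P_j)\<close>;
  the factor \<open>exp s\<close> cancels the contraction by the second term. Where generators
  coincide, equal targets are assumed to avoid the kink of the norm.\<close>

lemma cell_curve_exp_dist_derivative:
  assumes c: "cell_curve L P C N" and t: "t > 0" "t \<notin> N"
    and ne: "P t $ i \<noteq> P t $ j \<or> C t $ i = C t $ j"
  shows "((\<lambda>s. exp s * norm (P s $ i - P s $ j)) has_real_derivative
           exp t * (sgn (P t $ i - P t $ j) \<bullet> (C t $ i - C t $ j))) (at t)"
proof -
  let ?y = "\<lambda>s. P s $ i - P s $ j"
  let ?z = "(C t $ i - C t $ j) - ?y t"
  have d: "((\<lambda>s. P s $ k) has_vector_derivative C t $ k - P t $ k) (at t)" for k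
    using vec_nth_has_vector_derivative[OF cell_curveD(4)[OF c t]] by simp
  have y: "(?y has_vector_derivative ?z) (at t)"
    using has_vector_derivative_diff[OF d[of i] d[of j]] by (simp add: algebra_simps)
  show ?thesis
  proof (cases "?y t = 0")
    case False
    have "((\<lambda>s. norm (?y s)) has_real_derivative (sgn (?y t) \<bullet> ?z)) (at t)"
      by (rule has_real_derivative_norm[OF y False])
    then have "((\<lambda>s. exp s * norm (?y s)) has_real_derivative exp t * norm (?y t) + (sgn (?y t) \<bullet> ?z) * exp t) (at t)"
      by (intro DERIV_mult DERIV_exp)
    moreover have "sgn (?y t) \<bullet> ?y t = norm (?y t)"
      using False by (simp add: sgn_div_norm power2_norm_eq_inner[symmetric] power2_eq_square)
    ultimately show ?thesis by (simp add: inner_diff_right algebra_simps)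
  next
    case True
    then have "?z = 0" using ne by auto
    then have y': "(?y has_vector_derivative 0) (at t)" using y by simp
    have "((\<lambda>s. norm (?y s)) has_real_derivative 0) (at t)"
      by (rule has_real_derivative_norm_at_zero[OF y' True])
    then have "((\<lambda>s. exp s * norm (?y s)) has_real_derivative exp t * norm (?y t) + 0 * exp t) (at t)"
      by (intro DERIV_mult DERIV_exp)
    then show ?thesis using True by simp
  qed
qed

text \<open>At times of coincidence the targets may differ and the derivative may fail to exist.
  Truncation at a positive level \<open>\<kappa>\<close> removes these times.\<close>

lemma cell_curve_exp_dist_mono:
  assumes c: "cell_curve L P C N" and ab: "0 \<le> a" "a \<le> b"
  shows "exp a * norm (P a $ i - P a $ j) \<le> exp b * norm (P b $ i - P b $ j)"
proof -
  let ?g = "\<lambda>s. exp s * norm (P s $ i - P s $ j)"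
  obtain K where K: "K-lipschitz_on {a..b} ?g" using cell_curve_exp_dist_lipschitz[OF c ab] by blast
  have mono: "max \<kappa> (?g a) \<le> max \<kappa> (?g b)" if \<kappa>: "\<kappa> > 0" for \<kappa>
  proof (rule ae_lower_slope_mono[OF ab(2) _ cell_curveD(1)[OF c]])
    have "K-lipschitz_on {a..b} (\<lambda>s. max \<kappa> (?g s))"
    proof (rule lipschitz_onI)
      fix x y assume xy: "x \<in> {a..b}" "y \<in> {a..b}"
      have "dist (max \<kappa> (?g x)) (max \<kappa> (?g y)) \<le> dist (?g x) (?g y)" by (auto simp: dist_real_def max_def)
      also have "\<dots> \<le> K * dist x y" by (rule lipschitz_onD[OF K xy])
      finally show "dist (max \<kappa> (?g x)) (max \<kappa> (?g y)) \<le> K * dist x y" .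
    qed (use K lipschitz_on_nonneg in blast)
    then show "abs_cont_on {a..b} (\<lambda>s. max \<kappa> (?g s))" by (rule lipschitz_abs_cont_on)
    fix t assume t: "a < t" "t < b" "t \<notin> N"
    then have t0: "t > 0" using ab by simp
    have "continuous_on {a..b} ?g" using K by (rule lipschitz_on_continuous_on)
    then have cont: "isCont ?g t" using t by (intro continuous_on_interior[of "{a..b}"]) auto
    show "lower_slope (\<lambda>s. max \<kappa> (?g s)) t 0"
    proof (rule lower_slope_max_const[OF cont])
      assume "\<kappa> \<le> ?g t"
      then have ne: "P t $ i \<noteq> P t $ j" using \<kappa> by auto
      have "sgn (P t $ i - P t $ j) \<bullet> (C t $ i - C t $ j) \<ge> 0"
        using cell_centers_monotone[OF cell_curveD(5)[OF c t0 t(3), of i] cell_curveD(5)[OF c t0 t(3), of j]]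
        by (simp add: sgn_div_norm)
      then show "lower_slope ?g t 0"
        using lower_slope_has_derivative[OF cell_curve_exp_dist_derivative[OF c t0 t(3) disjI1[OF ne]]]
        by (elim lower_slope_mono) simp
    qed
  qed
  show ?thesis
  proof (rule ccontr)
    assume "\<not> ?thesis"
    then have lt: "?g b < ?g a" by simp
    have "0 \<le> ?g b" by simp
    \<comment> \<open>A level strictly between the two end values would make the truncated function
      decrease.\<close>
    then have pos: "(?g a + ?g b) / 2 > 0"
      using le_less_trans[OF \<open>0 \<le> ?g b\<close> lt] by (intro half_gt_zero add_pos_nonneg) auto
    show False using mono[OF pos] lt by (simp add: max_def split: if_splits)
  qed
qed

end

section \<open>Auxiliary geometry: hyperplanes, disks and orthogonality in the plane\<close>

lemma open_avoids_hyperplanes: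
  fixes S :: "'a::euclidean_space set"
  assumes S: "open S" "S \<noteq> {}" and A: "finite A" "\<And>a b. (a,b) \<in> A \<Longrightarrow> a \<noteq> 0"
  shows "\<exists>q\<in>S. \<forall>(a,b)\<in>A. a \<bullet> q \<noteq> b"
proof (rule ccontr)
  assume "\<not> ?thesis"
  then have "S \<subseteq> (\<Union>(a,b)\<in>A. {x. a \<bullet> x = b})" by auto
  moreover have "negligible (\<Union>(a,b)\<in>A. {x. a \<bullet> x = b})"
    using A by (intro negligible_Union finite_imageI) (auto intro!: negligible_hyperplane)
  ultimately show False using open_not_negligible[OF S] negligible_subset by blast
qed

text \<open>Adding the squared distances from \<open>c'\<close> to the two antipodal points cancels
  the mixed terms. If two disks each contain a diameter of the other, the two resulting inequalities
  make them equal.\<close>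

lemma antipodal_in_cball:
  fixes c c' :: "'a::real_inner"
  assumes "c + r *\<^sub>R e \<in> cball c' r'" "c - r *\<^sub>R e \<in> cball c' r'" "norm e = 1" "r' \<ge> 0"
  shows "(norm (c - c'))\<^sup>2 + r\<^sup>2 \<le> r'\<^sup>2"
proof -
  have "(norm (c - c' + r *\<^sub>R e))\<^sup>2 \<le> r'\<^sup>2" "(norm (c - c' - r *\<^sub>R e))\<^sup>2 \<le> r'\<^sup>2"
    using assms by (auto intro!: power_mono simp: dist_norm norm_minus_commute algebra_simps)
  moreover have "(norm (c - c' + r *\<^sub>R e))\<^sup>2 + (norm (c - c' - r *\<^sub>R e))\<^sup>2 = 2 * ((norm (c - c'))\<^sup>2 + r\<^sup>2)"
  proof -
    have "e \<bullet> e = 1" using assms(3) by (simp add: norm_eq_1)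
    then show ?thesis unfolding power2_norm_eq_inner
      by (simp add: inner_add inner_diff inner_commute power2_eq_square algebra_simps)
  qed
  ultimately have "2 * ((norm (c - c'))\<^sup>2 + r\<^sup>2) \<le> r'\<^sup>2 + r'\<^sup>2" by (metis add_mono)
  then show ?thesis by simp
qed

lemma extreme_point_of_if_on_sphere:
  fixes c :: "'a::euclidean_space"
  assumes "W \<subseteq> cball c r" "a \<in> W" "dist c a = r"
  shows "a extreme_point_of W"
  unfolding extreme_point_of_def
proof (intro conjI ballI assms(2) notI)
  fix x y assume "x \<in> W" "y \<in> W" "a \<in> open_segment x y"
  then show False using dist_decreases_open_segment[of a x y c] assms by force
qed

lemma sgn_inner_nonneg_iff: "sgn (a::'a::real_inner) \<bullet> b \<ge> 0 \<longleftrightarrow> a \<bullet> b \<ge> 0"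
  by (cases "a = 0") (auto simp: sgn_div_norm zero_le_mult_iff)

lemma strictly_closer_iff_halfspace:
  fixes q a b :: "'a::real_inner"
  shows "norm (q - a) < norm (q - b) \<longleftrightarrow> (a - b) \<bullet> (q - (1/2) *\<^sub>R (a + b)) > 0"
proof -
  have "(b - a) \<bullet> (q - (1/2) *\<^sub>R (b + a)) = - ((a - b) \<bullet> (q - (1/2) *\<^sub>R (a + b)))"
    by (simp add: inner_diff_left add.commute)
  then show ?thesis using closer_iff_halfspace[of q b a] by auto
qed

lemma real2_unit_orthogonal:
  fixes u :: "real^2"
  obtains e where "norm e = 1" "u \<bullet> e = 0"
proof (cases "u = 0")
  case True
  have "norm (axis 1 1 :: real^2) = 1" by simp
  then show thesis using that[of "axis 1 1"] True by simp
next
  case False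
  define w :: "real^2" where "w = (\<chi> i. if i = 1 then - u $ 2 else u $ 1)"
  have uw: "u \<bullet> w = 0" by (simp add: w_def inner_vec_def sum_2)
  have "w \<noteq> 0" using False by (auto simp: w_def vec_eq_iff forall_2)
  then show thesis using that[of "sgn w"] uw by (simp add: norm_sgn sgn_div_norm)
qed

lemma real2_unit_orthogonal_cases:
  fixes u v e :: "real^2"
  assumes "norm e = 1" "norm u = 1" "norm v = 1" "u \<bullet> e = 0" "v \<bullet> e = 0"
  shows "v = u \<or> v = - u"
proof -
  have "e \<noteq> 0" using assms by auto
  then have "v = (u \<bullet> v) *\<^sub>R u"
    using real2_orthogonal_expansion[of e u v] assms by (simp add: inner_commute)
  moreover then have "\<bar>u \<bullet> v\<bar> = 1" using assms by (metis mult.right_neutral norm_scaleR)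
  ultimately show ?thesis by (metis abs_eq_iff' abs_1 scaleR_minus_left scaleR_one)
qed

lemma convex_combination_in_open_cell:
  fixes w q :: "'a::real_inner"
  assumes w: "d \<bullet> (w - m) \<ge> 0" and q: "d \<bullet> (q - m) > 0" and t: "0 < t"  "t \<le> 1"
  shows "d \<bullet> ((1 - t) *\<^sub>R w + t *\<^sub>R q - m) > 0"
proof -
  have "d \<bullet> ((1 - t) *\<^sub>R w + t *\<^sub>R q - m) = (1 - t) * (d \<bullet> (w - m)) + t * (d \<bullet> (q - m))"
    by (simp add: inner_diff_right inner_add_right algebra_simps)
  then show ?thesis using assms by (simp add: add_nonneg_pos)
qed

context polygon
begin

section \<open>Circumcenters of the cells of nearly coincident generators\<close>

text \<open>
  When the generators in \<open>C\<close> merge at \<open>p\<close>, their cells are cut out of the limit cell \<open>V\<close> by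
  lines through \<open>p\<close>. If their circumcenters get together in the directions \<open>u j l\<close> of the
  differences of the generators, then the circumcenter of a cell with nonempty limit
  interior lies on all these lines, hence it is the midpoint of a chord of \<open>V\<close> which is a
  diameter of the circumcircle of \<open>V\<close>. The generator closest to a point \<open>x\<close> off that chord
  has such a cell.
\<close>

lemma cluster_circumcenter_limit:
  fixes P :: "nat \<Rightarrow> (real^2)^'n::finite" and R :: "(real^2)^'n" and i0 :: 'n
  defines "p \<equiv> R $ i0" and "V \<equiv> voronoi_cell Q R i0" and "C \<equiv> {j. R $ j = R $ i0}"
  assumes P: "\<And>m. P m \<in> configurations Q" and R: "R \<in> configurations Q" and PR: "P \<longlonglongrightarrow> R"
    and h: "\<And>j l. j \<in> C \<Longrightarrow> l \<in> C \<Longrightarrow>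
      (\<lambda>m. sgn (P m $ j - P m $ l) \<bullet>
        (circumcenter (voronoi_cell Q (P m) j) - circumcenter (voronoi_cell Q (P m) l))) \<longlonglongrightarrow> 0"
    and u: "\<And>j l. (\<lambda>m. sgn (P m $ j - P m $ l)) \<longlonglongrightarrow> u j l"
    and c: "\<And>j. (\<lambda>m. circumcenter (voronoi_cell Q (P m) j)) \<longlonglongrightarrow> c j"
    and x: "x \<in> Q" "\<And>a b t. a extreme_point_of V \<Longrightarrow> b extreme_point_of V \<Longrightarrow> a \<noteq> b \<Longrightarrow> x \<noteq> a + t *\<^sub>R (b - a)"
    and i: "i \<in> C" "\<And>m l. l \<in> C \<Longrightarrow> norm (P m $ i - x) \<le> norm (P m $ l - x)"
  shows "c i = circumcenter V"
proof -
  have Pj: "(\<lambda>m. P m $ j) \<longlonglongrightarrow> R $ j" for j using PR by (intro tendsto_intros)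
  have RC: "R $ j = p" if "j \<in> C" for j using that by (simp add: C_def p_def)
  have i0: "i0 \<in> C" by (simp add: C_def)
  have pQ: "p \<in> Q" using R by (simp add: p_def configurations_def)
  have VQ: "V \<subseteq> Q" unfolding V_def by (rule voronoi_cell_subset)
  have Vcpt: "compact V" and Vcvx: "convex V" unfolding V_def by (rule voronoi_cell_compact voronoi_cell_convex)+
  have pV: "p \<in> V" unfolding V_def p_def by (rule generator_in_cell[OF R])
  have V_iff: "q \<in> V \<longleftrightarrow> q \<in> Q \<and> (\<forall>l. l \<notin> C \<longrightarrow> (p - R $ l) \<bullet> (q - (1/2) *\<^sub>R (p + R $ l)) \<ge> 0)" for q
    unfolding V_def voronoi_cell_iff closer_iff_halfspace p_def[symmetric]
    using RC by (metis diff_self inner_zero_left order_refl)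
  \<comment> \<open>The constraints from outside the cluster are made strict here, so that they
    persist for \<open>P m\<close> with large \<open>m\<close>.\<close>
  define V0 where "V0 = {q\<in>Q. \<forall>l. l \<notin> C \<longrightarrow> (p - R $ l) \<bullet> (q - (1/2) *\<^sub>R (p + R $ l)) > 0}"
  have V0V: "V0 \<subseteq> V" by (auto simp: V0_def V_iff less_imp_le)
  have pV0: "p \<in> V0" unfolding V0_def strictly_closer_iff_halfspace[symmetric]
    using pQ by (auto simp: C_def p_def)
  define mid where "mid j l m = (1/2) *\<^sub>R (P m $ j + P m $ l)" for j l m
  have mid: "mid j l \<longlonglongrightarrow> p" if "j \<in> C" "l \<in> C" for j l
  proof -
    have "(\<lambda>m. (1/2) *\<^sub>R (P m $ j + P m $ l)) \<longlonglongrightarrow> (1/2) *\<^sub>R (R $ j + R $ l)" by (intro tendsto_intros Pj)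
    moreover have "(1/2) *\<^sub>R (R $ j + R $ l) = p" using that RC by (simp add: scaleR_2[symmetric])
    ultimately show ?thesis unfolding mid_def by simp
  qed
  have u_norm: "u j l = 0 \<or> norm (u j l) = 1" for j l
  proof -
    have "(\<lambda>m. norm (sgn (P m $ j - P m $ l))) \<longlonglongrightarrow> norm (u j l)" by (intro tendsto_intros u)
    then have "norm (u j l) \<in> {0,1}"
      by (rule closed_sequentially[rotated 2]) (auto simp: norm_sgn)
    then show ?thesis by auto
  qed
  \<comment> \<open>The norm of \<open>sgn\<close> is 0 or 1, so a zero limit means that the two
    generators eventually coincide, rather than that a direction degenerates.\<close>
  have u_zero: "\<forall>\<^sub>F m in sequentially. P m $ j = P m $ l" if "u j l = 0" for j l
  proof -
    have "(\<lambda>m. norm (sgn (P m $ j - P m $ l))) \<longlonglongrightarrow> norm (u j l)" by (intro tendsto_intros u)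
    then have "\<forall>\<^sub>F m in sequentially. norm (sgn (P m $ j - P m $ l)) < 1"
      by (rule order_tendstoD(2)) (use that in simp)
    then show ?thesis by eventually_elim (auto simp: norm_sgn split: if_splits)
  qed
  have u_sym: "u l j = - u j l" for j l
  proof -
    have "(\<lambda>m. - sgn (P m $ j - P m $ l)) \<longlonglongrightarrow> - u j l" by (intro tendsto_intros u)
    moreover have "- sgn (P m $ j - P m $ l) = sgn (P m $ l - P m $ j)" for m by (simp flip: sgn_minus)
    ultimately have "(\<lambda>m. sgn (P m $ l - P m $ j)) \<longlonglongrightarrow> - u j l" by simp
    then show ?thesis by (rule LIMSEQ_unique[OF u])
  qed
  have c_eq: "c j = c l" if "u j l = 0" for j l
  proof -
    have "\<forall>\<^sub>F m in sequentially. circumcenter (voronoi_cell Q (P m) l) = circumcenter (voronoi_cell Q (P m) j)"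
      using u_zero[OF that]
    proof eventually_elim
      case (elim m)
      show ?case using voronoi_cell_cong[OF elim, of Q] by simp
    qed
    then have "(\<lambda>m. circumcenter (voronoi_cell Q (P m) j)) \<longlonglongrightarrow> c l" by (rule Lim_transform_eventually[OF c])
    then show ?thesis by (rule LIMSEQ_unique[OF c])
  qed
  have cc: "circumcenter (voronoi_cell Q (P m) j) \<in> voronoi_cell Q (P m) j" for m j
    by (rule circumcenter_in_cell[OF P])
  have half: "sgn (P m $ j - P m $ l) \<bullet> (q - mid j l m) \<ge> 0" if "q \<in> voronoi_cell Q (P m) j" for q m j l
    using that unfolding voronoi_cell_iff closer_iff_halfspace mid_def sgn_inner_nonneg_iff by blast
  \<comment> \<open>The cell of \<open>j\<close> in the limit: \<open>V\<close> cut by the limits of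
    the bisectors inside the cluster, all of which pass through \<open>p\<close>. It may degenerate
    to a sliver.\<close>
  define W where "W j = V \<inter> {q. \<forall>l\<in>C. u j l \<bullet> (q - p) \<ge> 0}" for j
  have W_compact: "compact (W j)" for j
  proof -
    have "closed {q. u j l \<bullet> (q - p) \<ge> 0}" for l
      by (simp add: inner_diff_right closed_halfspace_ge)
    then have "closed (\<Inter>l\<in>C. {q. u j l \<bullet> (q - p) \<ge> 0})" by (intro closed_INT) auto
    moreover have "W j = V \<inter> (\<Inter>l\<in>C. {q. u j l \<bullet> (q - p) \<ge> 0})" by (auto simp: W_def)
    ultimately show ?thesis using compact_Int_closed[OF Vcpt] by simp
  qed
  have outer: "l \<in> W j" if k: "strict_mono k" and q: "\<And>m. q m \<in> voronoi_cell Q (P (k m)) j" "q \<longlonglongrightarrow> l" and j: "j \<in> C" for k q l j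
  proof -
    have Pk: "(\<lambda>m. P (k m)) \<longlonglongrightarrow> R" using LIMSEQ_subseq_LIMSEQ[OF PR k] by (simp add: o_def)
    have "l \<in> voronoi_cell Q R j" by (rule mem_voronoi_cell_limit[OF Q_closed q Pk])
    then have "l \<in> V" unfolding V_def using voronoi_cell_cong[of R j i0] j by (simp add: C_def)
    moreover have "u j l' \<bullet> (l - p) \<ge> 0" if l': "l' \<in> C" for l'
    proof -
      have "(\<lambda>m. sgn (P (k m) $ j - P (k m) $ l') \<bullet> (q m - mid j l' (k m))) \<longlonglongrightarrow> u j l' \<bullet> (l - p)"
        using LIMSEQ_subseq_LIMSEQ[OF u k] LIMSEQ_subseq_LIMSEQ[OF mid[OF j l'] k] q(2)
        by (intro tendsto_intros) (auto simp: o_def)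
      then show ?thesis by (rule LIMSEQ_le_const) (use half[OF q(1)] in auto)
    qed
    ultimately show ?thesis by (simp add: W_def)
  qed
  \<comment> \<open>The strict version of \<open>W j\<close>; its points eventually belong to the
    cells of \<open>j\<close>. A zero direction gives no strict condition, since then both
    generators eventually share their cell.\<close>
  define D where "D j = {q\<in>V0. \<forall>l\<in>C. u j l \<noteq> 0 \<longrightarrow> u j l \<bullet> (q - p) > 0}" for j
  have inner: "\<forall>\<^sub>F m in sequentially. q \<in> voronoi_cell Q (P m) j" if q: "q \<in> D j" and j: "j \<in> C" for q j
  proof -
    have "\<forall>\<^sub>F m in sequentially. norm (q - P m $ j) \<le> norm (q - P m $ l)" for l
    proof (cases "l \<in> C")
      case False
      then have "norm (q - R $ j) < norm (q - R $ l)"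
        using q RC[OF j] unfolding D_def V0_def strictly_closer_iff_halfspace[symmetric] by auto
      moreover have "(\<lambda>m. norm (q - P m $ l) - norm (q - P m $ j)) \<longlonglongrightarrow> norm (q - R $ l) - norm (q - R $ j)"
        by (intro tendsto_intros Pj)
      ultimately have "\<forall>\<^sub>F m in sequentially. norm (q - P m $ l) - norm (q - P m $ j) > 0" by (intro order_tendstoD) auto
      then show ?thesis by eventually_elim simp
    next
      case l: True
      show ?thesis
      proof (cases "u j l = 0")
        case True show ?thesis using u_zero[OF True] by eventually_elim simp
      next
        case False
        then have "u j l \<bullet> (q - p) > 0" using q l by (auto simp: D_def)
        moreover have "(\<lambda>m. sgn (P m $ j - P m $ l) \<bullet> (q - mid j l m)) \<longlonglongrightarrow> u j l \<bullet> (q - p)"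
          by (intro tendsto_intros u mid[OF j l])
        ultimately have "\<forall>\<^sub>F m in sequentially. sgn (P m $ j - P m $ l) \<bullet> (q - mid j l m) > 0" by (intro order_tendstoD) auto
        then show ?thesis
        proof eventually_elim
          case (elim m)
          then have "sgn (P m $ j - P m $ l) \<bullet> (q - mid j l m) \<ge> 0" by simp
          then show ?case unfolding closer_iff_halfspace mid_def sgn_inner_nonneg_iff .
        qed
      qed
    qed
    then have "\<forall>\<^sub>F m in sequentially. \<forall>l. norm (q - P m $ j) \<le> norm (q - P m $ l)" by (rule eventually_all_finite)
    then show ?thesis by eventually_elim (use q in \<open>auto simp: voronoi_cell_iff D_def V0_def\<close>)
  qed
  have full_limit: "c j = circumcenter (W j)" if j: "j \<in> C" and D: "D j \<noteq> {}" for j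
  proof -
    obtain q0 where q0: "q0 \<in> D j" using D by auto
    \<comment> \<open>Moving from any point of \<open>W j\<close> towards \<open>q0\<close> makes
      all the inequalities strict at once, so a nonempty \<open>D j\<close> is dense in
      \<open>W j\<close>.\<close>
    have dense: "W j \<subseteq> closure (D j)"
    proof
      fix w assume w: "w \<in> W j"
      define t where "t n = 1 / real (Suc n)" for n
      have t: "0 < t n" "t n \<le> 1" for n by (auto simp: t_def)
      have "(1 - t n) *\<^sub>R w + t n *\<^sub>R q0 \<in> D j" for n
        unfolding D_def V0_def mem_Collect_eq
      proof (intro conjI allI impI ballI)
        show "(1 - t n) *\<^sub>R w + t n *\<^sub>R q0 \<in> Q"
          using w q0 t[of n] VQ by (intro convexD_alt[OF Q_convex]) (auto simp: W_def D_def V0_def)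
        show "(p - R $ l) \<bullet> ((1 - t n) *\<^sub>R w + t n *\<^sub>R q0 - (1/2) *\<^sub>R (p + R $ l)) > 0" if "l \<notin> C" for l
          by (rule convex_combination_in_open_cell[OF _ _ t]) (use that w q0 in \<open>auto simp: W_def V_iff D_def V0_def\<close>)
        show "u j l \<bullet> ((1 - t n) *\<^sub>R w + t n *\<^sub>R q0 - p) > 0" if "l \<in> C" "u j l \<noteq> 0" for l
          by (rule convex_combination_in_open_cell[OF _ _ t]) (use that w q0 in \<open>auto simp: W_def D_def\<close>)
      qed
      moreover have "(\<lambda>n. (1 - t n) *\<^sub>R w + t n *\<^sub>R q0) \<longlonglongrightarrow> (1 - 0) *\<^sub>R w + 0 *\<^sub>R q0"
        unfolding t_def using LIMSEQ_inverse_real_of_nat by (intro tendsto_intros) (auto simp: inverse_eq_divide)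
      ultimately show "w \<in> closure (D j)" unfolding closure_sequential
        by (intro exI[of _ "\<lambda>n. (1 - t n) *\<^sub>R w + t n *\<^sub>R q0"]) auto
    qed
    have W0: "W j \<noteq> {}" using pV by (auto simp: W_def)
    have "(\<lambda>m. circumcenter (voronoi_cell Q (P m) j)) \<longlonglongrightarrow> circumcenter (W j)"
    proof (rule circumcenter_tendsto[of "\<lambda>m. voronoi_cell Q (P m) j", where D = "D j"])
      show "bounded Q" by (rule compact_imp_bounded[OF Q_compact])
      show "voronoi_cell Q (P m) j \<noteq> {}" for m using generator_in_cell[OF P] by blast
      show "l \<in> W j" if "strict_mono k" "\<And>m. q m \<in> voronoi_cell Q (P (k m)) j" "q \<longlonglongrightarrow> l" for k q l
        by (rule outer[OF that j])
      show "\<forall>\<^sub>F m in sequentially. q \<in> voronoi_cell Q (P m) j" if "q \<in> D j" for q by (rule inner[OF that j])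
      show "voronoi_cell Q (P m) j \<subseteq> Q" for m by (rule voronoi_cell_subset)
      show "compact (voronoi_cell Q (P m) j)" for m by (rule voronoi_cell_compact)
    qed (rule W_compact W0 dense)+
    then show ?thesis using c LIMSEQ_unique by blast
  qed
  \<comment> \<open>The bisector in the limit separates the two circumcenters, and by
    \<open>h\<close> they have the same coordinate in its normal direction. Both must lie on
    it.\<close>
  have on_lines: "u j l \<bullet> (c j - p) = 0" if j: "j \<in> C" and l: "l \<in> C" for j l
  proof -
    let ?s = "\<lambda>m. sgn (P m $ j - P m $ l)" and ?c = "\<lambda>j m. circumcenter (voronoi_cell Q (P m) j)"
    have 1: "(\<lambda>m. ?s m \<bullet> (?c j m - mid j l m)) \<longlonglongrightarrow> u j l \<bullet> (c j - p)"
      by (intro tendsto_intros u c mid[OF j l])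
    have 2: "(\<lambda>m. ?s m \<bullet> (?c l m - mid j l m)) \<longlonglongrightarrow> u j l \<bullet> (c l - p)"
      by (intro tendsto_intros u c mid[OF j l])
    have "u j l \<bullet> (c j - p) \<ge> 0" by (rule LIMSEQ_le_const[OF 1]) (use half[OF cc] in auto)
    moreover have "?s m \<bullet> (?c l m - mid j l m) \<le> 0" for m
    proof -
      have "sgn (P m $ l - P m $ j) \<bullet> (?c l m - mid l j m) \<ge> 0" by (rule half[OF cc])
      moreover have "sgn (P m $ l - P m $ j) = - ?s m" by (simp flip: sgn_minus)
      moreover have "mid l j m = mid j l m" by (simp add: mid_def add.commute)
      ultimately show ?thesis by simp
    qed
    then have "u j l \<bullet> (c l - p) \<le> 0" by (intro LIMSEQ_le_const2[OF 2]) auto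
    moreover have "u j l \<bullet> (c j - c l) = 0"
    proof -
      have "(\<lambda>m. ?s m \<bullet> (?c j m - ?c l m)) \<longlonglongrightarrow> u j l \<bullet> (c j - c l)" by (intro tendsto_intros u c)
      then show ?thesis using h[OF j l] LIMSEQ_unique by blast
    qed
    ultimately show ?thesis by (simp add: inner_diff_right)
  qed
  \<comment> \<open>\<open>W j\<close> lies on one side of a line through its own circumcenter, so
    it contains a diameter of its circumcircle on that line. As both ends satisfy all constraints,
    every other bisector contains the diameter too; in the plane the normals are parallel, and a
    point of \<open>D j\<close> fixes their sign.\<close>
  have chord: "\<exists>r e. r > 0 \<and> norm e = 1 \<and> min_ball (W j) (c j) r \<and> c j + r *\<^sub>R e \<in> W j \<and> c j - r *\<^sub>R e \<in> W j \<and>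
      u j l0 \<bullet> e = 0 \<and> (\<forall>l\<in>C. u j l = 0 \<or> u j l = u j l0)"
    if j: "j \<in> C" and D: "D j \<noteq> {}" and l0: "l0 \<in> C" "u j l0 \<noteq> 0" for j l0
  proof -
    obtain q0 where q0: "q0 \<in> D j" using D by auto
    have q0W: "q0 \<in> W j" using q0 V0V unfolding D_def W_def by (auto intro: less_imp_le)
    obtain e where e: "norm e = 1" "u j l0 \<bullet> e = 0" by (rule real2_unit_orthogonal)
    have W0: "W j \<noteq> {}" using q0W by auto
    obtain r where r: "min_ball (W j) (c j) r" "r \<ge> 0"
      using circumcenter_min_ball[OF compact_imp_bounded[OF W_compact] W0] full_limit[OF j D] by metis
    have side: "u j l0 \<bullet> (q - c j) \<ge> 0" if "q \<in> W j" for q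
    proof -
      have "u j l0 \<bullet> (q - p) \<ge> 0" using that l0 by (auto simp: W_def)
      then show ?thesis using on_lines[OF j l0(1)] by (simp add: inner_diff_right)
    qed
    have a: "c j + r *\<^sub>R e \<in> W j"
      by (rule min_ball_halfplane_antipodal[OF W_compact W0 r(1) l0(2) side e])
    have b: "c j - r *\<^sub>R e \<in> W j"
      using min_ball_halfplane_antipodal[OF W_compact W0 r(1) l0(2) side, of "- e"] e by simp
    have r0: "r > 0"
    proof (rule ccontr)
      assume "\<not> r > 0"
      then have "q0 = c j" using r q0W unfolding min_ball_def by auto
      then show False using on_lines[OF j l0(1)] q0 l0 by (auto simp: D_def)
    qed
    have ue: "u j l \<bullet> e = 0" if l: "l \<in> C" for l
    proof -
      have "u j l \<bullet> (c j + r *\<^sub>R e - p) \<ge> 0" "u j l \<bullet> (c j - r *\<^sub>R e - p) \<ge> 0" using a b l by (auto simp: W_def)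
      then have "r * (u j l \<bullet> e) \<ge> 0" "r * (u j l \<bullet> e) \<le> 0"
        using on_lines[OF j l] by (auto simp: inner_diff_right inner_add_right)
      then show ?thesis using r0 by (simp add: zero_le_mult_iff mult_le_0_iff)
    qed
    have "u j l = 0 \<or> u j l = u j l0" if l: "l \<in> C" for l
    proof (cases "u j l = 0")
      case False
      then have "u j l = u j l0 \<or> u j l = - u j l0"
        using real2_unit_orthogonal_cases[OF e(1) _ _ e(2) ue[OF l]] u_norm l0(2) by blast
      moreover have "u j l \<bullet> (q0 - p) > 0" "u j l0 \<bullet> (q0 - p) > 0" using q0 l l0 False by (auto simp: D_def)
      ultimately show ?thesis by fastforce
    qed simp
    then show ?thesis using r0 e r a b by blast
  qed
  \<comment> \<open>A point off all limiting bisectors that satisfies no system \<open>D j\<close>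
    would eventually lie in no cell at all, but the cells cover \<open>Q\<close>.\<close>
  have generic: "\<exists>q\<in>S \<inter> V0. \<exists>j\<in>C. q \<in> D j" if S: "open S" "S \<inter> V0 \<noteq> {}" for S
  proof -
    define O1 where "O1 = S \<inter> {q. \<forall>l. l \<notin> C \<longrightarrow> (p - R $ l) \<bullet> (q - (1/2) *\<^sub>R (p + R $ l)) > 0}"
    have "open {q. (p - R $ l) \<bullet> (q - (1/2) *\<^sub>R (p + R $ l)) > 0}" for l
      by (simp only: inner_diff_right diff_gt_0_iff_gt open_halfspace_gt)
    then have "open (\<Inter>l\<in>- C. {q. (p - R $ l) \<bullet> (q - (1/2) *\<^sub>R (p + R $ l)) > 0})" by (intro open_INT) auto
    moreover have "O1 = S \<inter> (\<Inter>l\<in>- C. {q. (p - R $ l) \<bullet> (q - (1/2) *\<^sub>R (p + R $ l)) > 0})" by (auto simp: O1_def)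
    ultimately have O1: "open O1" using S by auto
    have "Q = closure (interior Q)"
      using convex_closure_interior[OF Q_convex Q_interior] Q_closed by simp
    moreover obtain q1 where "q1 \<in> O1" "q1 \<in> Q" using S(2) by (auto simp: O1_def V0_def)
    ultimately have "O1 \<inter> interior Q \<noteq> {}" using open_Int_closure_eq_empty[OF O1] by blast
    moreover have "open (O1 \<inter> interior Q)" using O1 by auto
    moreover have "finite ((\<lambda>(j,l). (u j l, u j l \<bullet> p)) ` {(j,l). u j l \<noteq> 0})" by simp
    ultimately obtain q where q: "q \<in> O1 \<inter> interior Q"
      "\<forall>(a,b)\<in>(\<lambda>(j,l). (u j l, u j l \<bullet> p)) ` {(j,l). u j l \<noteq> 0}. a \<bullet> q \<noteq> b"
      using open_avoids_hyperplanes[of "O1 \<inter> interior Q" "(\<lambda>(j,l). (u j l, u j l \<bullet> p)) ` {(j,l). u j l \<noteq> 0}"] by fastforce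
    have ne: "u j l \<bullet> (q - p) \<noteq> 0" if "u j l \<noteq> 0" for j l
      using q(2) that by (auto simp: inner_diff_right)
    have qQ: "q \<in> Q" using q(1) interior_subset by blast
    have qV0: "q \<in> V0" using q(1) qQ by (auto simp: O1_def V0_def)
    have "\<exists>j\<in>C. q \<in> D j"
    proof (rule ccontr)
      assume neg: "\<not> ?thesis"
      have "\<forall>\<^sub>F m in sequentially. q \<notin> voronoi_cell Q (P m) j" for j
      proof (cases "j \<in> C")
        case True
        then obtain l where l: "l \<in> C" "u j l \<noteq> 0" "\<not> u j l \<bullet> (q - p) > 0" using neg qV0 by (auto simp: D_def)
        then have "u j l \<bullet> (q - p) < 0" using ne[of j l] by linarith
        moreover have "(\<lambda>m. sgn (P m $ j - P m $ l) \<bullet> (q - mid j l m)) \<longlonglongrightarrow> u j l \<bullet> (q - p)"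
          by (intro tendsto_intros u mid[OF True l(1)])
        ultimately have "\<forall>\<^sub>F m in sequentially. sgn (P m $ j - P m $ l) \<bullet> (q - mid j l m) < 0" by (intro order_tendstoD) auto
        then show ?thesis by eventually_elim (use half[of q _ j l] in \<open>auto simp: not_le[symmetric]\<close>)
      next
        case False
        then have "norm (q - R $ i0) < norm (q - R $ j)"
          using qV0 unfolding V0_def strictly_closer_iff_halfspace[symmetric] p_def by auto
        moreover have "(\<lambda>m. norm (q - P m $ j) - norm (q - P m $ i0)) \<longlonglongrightarrow> norm (q - R $ j) - norm (q - R $ i0)"
          by (intro tendsto_intros Pj)
        ultimately have "\<forall>\<^sub>F m in sequentially. norm (q - P m $ j) - norm (q - P m $ i0) > 0" by (intro order_tendstoD) auto
        then show ?thesis by eventually_elim (auto simp: voronoi_cell_iff not_le)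
      qed
      then have "\<forall>\<^sub>F m in sequentially. \<forall>j. q \<notin> voronoi_cell Q (P m) j" by (rule eventually_all_finite)
      then obtain m where "\<forall>j. q \<notin> voronoi_cell Q (P m) j" using eventually_happens by force
      then show False using obtain_nearest_cell[OF qQ, of "P m"] by blast
    qed
    then show ?thesis using q(1) qV0 by (auto simp: O1_def)
  qed
  \<comment> \<open>A nonzero direction between \<open>j\<close> and \<open>i\<close> would be
    \<open>v\<close>; then \<open>x\<close> would eventually be strictly closer to \<open>j\<close>
    than to \<open>i\<close>.\<close>
  have closest: "c i = c j" if j: "j \<in> C" and uj: "\<And>l. l \<in> C \<Longrightarrow> u j l = 0 \<or> u j l = v" and v: "v \<bullet> (x - p) > 0" for j v
  proof (cases "u j i = 0")
    case True
    then show ?thesis using c_eq by simp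
  next
    case False
    then have uv: "u i j = - v" using uj[OF i(1)] u_sym[of i j] by simp
    have lim: "(\<lambda>m. sgn (P m $ i - P m $ j) \<bullet> (x - mid i j m)) \<longlonglongrightarrow> u i j \<bullet> (x - p)"
      by (intro tendsto_intros u mid i(1) j)
    have ge: "sgn (P m $ i - P m $ j) \<bullet> (x - mid i j m) \<ge> 0" for m
      using i(2)[OF j, of m] unfolding sgn_inner_nonneg_iff mid_def closer_iff_halfspace[symmetric]
      by (simp add: norm_minus_commute)
    have "u i j \<bullet> (x - p) \<ge> 0" by (rule LIMSEQ_le_const[OF lim]) (use ge in auto)
    then show ?thesis using v uv by simp
  qed
  \<comment> \<open>The ends of a diameter of an enclosing disk are extreme points of
    \<open>V\<close>, so the hypothesis on \<open>x\<close> keeps it off their line.\<close>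
  have off_chord: "v \<bullet> (x - p) \<noteq> 0"
    if mb: "V \<subseteq> cball z r" and r: "r > 0" and e: "norm e = 1" and ab: "z + r *\<^sub>R e \<in> V" "z - r *\<^sub>R e \<in> V"
      and v: "v \<noteq> 0" "v \<bullet> e = 0" "v \<bullet> (z - p) = 0" for z r e v
  proof
    assume "v \<bullet> (x - p) = 0"
    then have "v \<bullet> (x - z) = 0" using v(3) by (simp add: inner_diff_right)
    then have xz: "x - z = (e \<bullet> (x - z)) *\<^sub>R e" by (rule real2_orthogonal_expansion[OF v(1) e v(2)])
    have a: "z + r *\<^sub>R e extreme_point_of V" and b: "z - r *\<^sub>R e extreme_point_of V"
      by (rule extreme_point_of_if_on_sphere[OF mb]; use ab r e in \<open>simp add: dist_norm\<close>)+
    have "z + r *\<^sub>R e \<noteq> z - r *\<^sub>R e" using r e by (auto simp: eq_diff_eq add.assoc scaleR_left_distrib[symmetric])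
    \<comment> \<open>The parameter converts the coordinate of \<open>x\<close> along
      \<open>e\<close>, measured from the center, to one that is 0 and 1 at the two ends.\<close>
    then have "x \<noteq> z + r *\<^sub>R e + ((r - e \<bullet> (x - z)) / (2 * r)) *\<^sub>R (z - r *\<^sub>R e - (z + r *\<^sub>R e))"
      using x(2)[OF a b] by blast
    moreover have "z + r *\<^sub>R e + ((r - e \<bullet> (x - z)) / (2 * r)) *\<^sub>R (z - r *\<^sub>R e - (z + r *\<^sub>R e)) = z + (e \<bullet> (x - z)) *\<^sub>R e"
    proof -
      have "z - r *\<^sub>R e - (z + r *\<^sub>R e) = - (r *\<^sub>R e + r *\<^sub>R e)" by simp
      also have "\<dots> = (- (2 * r)) *\<^sub>R e"
        by (simp only: scaleR_left_distrib[symmetric] scaleR_minus_left mult_2)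
      finally have "((r - e \<bullet> (x - z)) / (2 * r)) *\<^sub>R (z - r *\<^sub>R e - (z + r *\<^sub>R e)) =
          ((r - e \<bullet> (x - z)) / (2 * r) * (- (2 * r))) *\<^sub>R e" by (simp only: scaleR_scaleR)
      also have "(r - e \<bullet> (x - z)) / (2 * r) * (- (2 * r)) = e \<bullet> (x - z) - r" using r by simp
      finally show ?thesis by (simp only: scaleR_left_diff_distrib) simp
    qed
    ultimately show False using xz by (metis add.commute diff_add_cancel)
  qed
  obtain j where j: "j \<in> C" "D j \<noteq> {}" using generic[of UNIV] pV0 by blast
  show ?thesis
  proof (cases "\<forall>l\<in>C. u j l = 0")
    case True
    then have "W j = V" by (auto simp: W_def)
    then show ?thesis using full_limit[OF j] c_eq[of j i] True i(1) by simp
  next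
    case False
    then obtain l0 where l0: "l0 \<in> C" "u j l0 \<noteq> 0" by blast
    define v where "v = u j l0"
    obtain r e where re: "r > 0" "norm e = 1" "min_ball (W j) (c j) r" "c j + r *\<^sub>R e \<in> W j" "c j - r *\<^sub>R e \<in> W j"
      "v \<bullet> e = 0" and uv: "\<And>l. l \<in> C \<Longrightarrow> u j l = 0 \<or> u j l = v"
      using chord[OF j l0] unfolding v_def by blast
    have vc: "v \<bullet> (c j - p) = 0" unfolding v_def by (rule on_lines[OF j(1) l0(1)])
    have v0: "v \<noteq> 0" using l0 by (simp add: v_def)
    have Wj: "W j = V \<inter> {q. v \<bullet> (q - p) \<ge> 0}"
    proof -
      have "(\<forall>l\<in>C. u j l \<bullet> (q - p) \<ge> 0) \<longleftrightarrow> v \<bullet> (q - p) \<ge> 0" for q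
        using uv l0 v_def by (metis inner_zero_left order_refl)
      then show ?thesis by (simp add: W_def)
    qed
    have WV: "W j \<subseteq> V" by (auto simp: W_def)
    show ?thesis
    proof (cases "\<forall>q\<in>V. v \<bullet> (q - p) \<ge> 0")
      case True
      then have WjV: "W j = V" using Wj by auto
      have ne: "v \<bullet> (x - p) \<noteq> 0"
        by (rule off_chord[of "c j" r e]) (use re WjV v0 vc in \<open>auto simp: min_ball_def\<close>)
      \<comment> \<open>\<open>p\<close> satisfies the outer constraints strictly and
        \<open>Q\<close> is convex, so \<open>V\<close> contains an initial piece of the segment
        from \<open>p\<close> to \<open>x\<close>. Since \<open>V\<close> lies on the side of
        \<open>v\<close>, so does \<open>x\<close>.\<close>
      have "\<forall>\<^sub>F t in at_right 0. p + t *\<^sub>R (x - p) \<in> V"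
      proof -
        have "\<forall>\<^sub>F t in at_right 0. (p - R $ l) \<bullet> (p + t *\<^sub>R (x - p) - (1/2) *\<^sub>R (p + R $ l)) > 0" if "l \<notin> C" for l
        proof -
          have "((\<lambda>t. (p - R $ l) \<bullet> (p + t *\<^sub>R (x - p) - (1/2) *\<^sub>R (p + R $ l))) \<longlongrightarrow>
              (p - R $ l) \<bullet> (p + 0 *\<^sub>R (x - p) - (1/2) *\<^sub>R (p + R $ l))) (at_right 0)" by (intro tendsto_intros)
          then show ?thesis by (rule order_tendstoD) (use pV0 that in \<open>auto simp: V0_def\<close>)
        qed
        then have "\<forall>\<^sub>F t in at_right 0. \<forall>l. l \<notin> C \<longrightarrow> (p - R $ l) \<bullet> (p + t *\<^sub>R (x - p) - (1/2) *\<^sub>R (p + R $ l)) > 0"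
          by (intro eventually_all_finite) (auto intro: eventually_mono)
        moreover have "\<forall>\<^sub>F t in at_right (0::real). 0 < t \<and> t < 1" by (intro eventually_at_rightI[of 0 1]) auto
        ultimately show ?thesis
        proof eventually_elim
          case (elim t)
          have "(1 - t) *\<^sub>R p + t *\<^sub>R x \<in> Q" using elim pQ x(1) by (intro convexD_alt[OF Q_convex]) auto
          then have "p + t *\<^sub>R (x - p) \<in> Q" by (simp add: algebra_simps)
          then show ?case using elim by (auto simp: V_iff less_imp_le)
        qed
      qed
      moreover have "\<forall>\<^sub>F t in at_right (0::real). 0 < t" by (simp add: eventually_at_right_less)
      ultimately have "\<forall>\<^sub>F t in at_right (0::real). 0 < t \<and> p + t *\<^sub>R (x - p) \<in> V" by eventually_elim auto
      then obtain t where t: "0 < t" "p + t *\<^sub>R (x - p) \<in> V" using eventually_happens by force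
      then have "t * (v \<bullet> (x - p)) \<ge> 0" using True by force
      then have "v \<bullet> (x - p) > 0" using ne t(1) by (simp add: zero_le_mult_iff)
      then have "c i = c j" using closest[OF j(1) uv] by blast
      then show ?thesis using full_limit[OF j] WjV by simp
    next
      case False
      then obtain q where q: "q \<in> V" "v \<bullet> (q - p) < 0" by (auto simp: not_le)
      have "(1 - 1/2) *\<^sub>R q + (1/2) *\<^sub>R p \<in> V0"
        unfolding V0_def mem_Collect_eq
      proof (intro conjI allI impI)
        show "(1 - 1/2) *\<^sub>R q + (1/2) *\<^sub>R p \<in> Q" using q pQ VQ by (intro convexD_alt[OF Q_convex]) auto
        show "(p - R $ l) \<bullet> ((1 - 1/2) *\<^sub>R q + (1/2) *\<^sub>R p - (1/2) *\<^sub>R (p + R $ l)) > 0" if "l \<notin> C" for l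
          by (rule convex_combination_in_open_cell) (use q(1) pV0 that in \<open>auto simp: V_iff V0_def\<close>)
      qed
      moreover have "v \<bullet> ((1 - 1/2) *\<^sub>R q + (1/2) *\<^sub>R p - p) < 0"
        using q(2) by (simp add: inner_diff_right inner_add_right)
      moreover have "open {q. v \<bullet> (q - p) < 0}" by (simp add: inner_diff_right open_halfspace_lt)
      ultimately obtain q2 j2 where q2: "v \<bullet> (q2 - p) < 0" "j2 \<in> C" "q2 \<in> D j2"
        using generic[of "{q. v \<bullet> (q - p) < 0}"] by blast
      have "u j j2 \<noteq> 0"
      proof
        assume z: "u j j2 = 0"
        have "\<forall>\<^sub>F m in sequentially. sgn (P m $ j - P m $ l0) = sgn (P m $ j2 - P m $ l0)"
          using u_zero[OF z] by eventually_elim simp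
        then have "(\<lambda>m. sgn (P m $ j2 - P m $ l0)) \<longlonglongrightarrow> v" unfolding v_def by (rule Lim_transform_eventually[OF u])
        then have "u j2 l0 = v" by (rule LIMSEQ_unique[OF u])
        then have "v \<bullet> (q2 - p) > 0" using q2(3) l0(1) v0 by (auto simp: D_def)
        then show False using q2(1) by simp
      qed
      then have u2: "u j2 j = - v" using uv[OF q2(2)] u_sym[of j2 j] by simp
      then have u2n: "u j2 j \<noteq> 0" using v0 by simp
      have D2: "D j2 \<noteq> {}" using q2 by auto
      obtain r' e' where re': "r' > 0" "norm e' = 1" "min_ball (W j2) (c j2) r'" "c j2 + r' *\<^sub>R e' \<in> W j2" "c j2 - r' *\<^sub>R e' \<in> W j2"
        "v \<bullet> e' = 0" and uv': "\<And>l. l \<in> C \<Longrightarrow> u j2 l = 0 \<or> u j2 l = - v"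
        using chord[OF q2(2) D2 j(1) u2n] unfolding u2 by auto
      have vc': "v \<bullet> (c j2 - p) = 0" using on_lines[OF q2(2) j(1)] u2 by simp
      have Wj2: "W j2 = V \<inter> {q. v \<bullet> (q - p) \<le> 0}"
      proof -
        have "(\<forall>l\<in>C. u j2 l \<bullet> (q - p) \<ge> 0) \<longleftrightarrow> v \<bullet> (q - p) \<le> 0" for q
        proof
          assume "\<forall>l\<in>C. u j2 l \<bullet> (q - p) \<ge> 0"
          then show "v \<bullet> (q - p) \<le> 0" using j(1) u2 by force
        next
          assume *: "v \<bullet> (q - p) \<le> 0"
          show "\<forall>l\<in>C. u j2 l \<bullet> (q - p) \<ge> 0"
          proof
            fix l assume "l \<in> C"
            then show "u j2 l \<bullet> (q - p) \<ge> 0" using uv'[of l] * by auto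
          qed
        qed
        then show ?thesis by (simp add: W_def)
      qed
      \<comment> \<open>The separating line belongs to both halves, so each half contains the
        diameter found for the other. Two applications of \<open>antipodal_in_cball\<close> identify
        the disks.\<close>
      have "c j + r *\<^sub>R e \<in> W j2" "c j - r *\<^sub>R e \<in> W j2"
        using re vc WV unfolding Wj2 by (auto simp: inner_diff_right inner_add_right)
      then have "c j + r *\<^sub>R e \<in> cball (c j2) r'" "c j - r *\<^sub>R e \<in> cball (c j2) r'"
        using re'(3) unfolding min_ball_def by blast+
      then have 1: "(norm (c j - c j2))\<^sup>2 + r\<^sup>2 \<le> r'\<^sup>2" using antipodal_in_cball[OF _ _ re(2)] re' by (meson less_imp_le)
      have "c j2 + r' *\<^sub>R e' \<in> W j" "c j2 - r' *\<^sub>R e' \<in> W j"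
        using re' vc' unfolding Wj Wj2 by (auto simp: inner_diff_right inner_add_right)
      then have "c j2 + r' *\<^sub>R e' \<in> cball (c j) r" "c j2 - r' *\<^sub>R e' \<in> cball (c j) r"
        using re(3) unfolding min_ball_def by blast+
      then have 2: "(norm (c j2 - c j))\<^sup>2 + r'\<^sup>2 \<le> r\<^sup>2" using antipodal_in_cball[OF _ _ re'(2)] re by (meson less_imp_le)
      have "(norm (c j - c j2))\<^sup>2 \<le> 0"
        using add_mono[OF 1 2] by (simp add: norm_minus_commute[of "c j2"] del: zero_eq_power2)
      then have ceq: "c j2 = c j" by simp
      then have "r\<^sup>2 = r'\<^sup>2" using 1 2 by (intro order_antisym) simp_all
      then have req: "r' = r" using re re' by (simp add: power2_eq_iff_nonneg)
      \<comment> \<open>The common disk encloses both halves and hence \<open>V\<close>; it is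
        minimal already for one half.\<close>
      have "V \<subseteq> W j \<union> W j2" unfolding Wj Wj2 by auto
      then have VB: "V \<subseteq> cball (c j) r" using re(3) re'(3) ceq req unfolding min_ball_def by auto
      have "min_ball V (c j) r" unfolding min_ball_def
        using VB re(3) WV unfolding min_ball_def by (meson order_trans)
      then have cV: "circumcenter V = c j" using circumcenter_eq pV by blast
      have "v \<bullet> (x - p) \<noteq> 0"
        by (rule off_chord[OF VB re(1,2)]) (use re WV v0 vc in auto)
      then consider "v \<bullet> (x - p) > 0" | "- v \<bullet> (x - p) > 0" by (metis inner_minus_left linorder_neqE_linordered_idom neg_0_less_iff_less)
      then have "c i = c j"
      proof cases
        case 1 then show ?thesis using closest[OF j(1) uv] by blast
      next
        case 2 then show ?thesis using closest[OF q2(2) uv'] ceq by simp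
      qed
      then show ?thesis using cV by simp
    qed
  qed
qed

end

text \<open>Half-spaces with \<open>q\<close> on their boundary are cones at \<open>q\<close>, and
  the others leave a positive distance. Hence one step length serves all directions into
  \<open>S\<close>, however close to \<open>q\<close> the point \<open>x\<close> lies; this is where
  straight sides enter.\<close>

lemma polyhedron_fixed_step:
  fixes S :: "'a::euclidean_space set"
  assumes S: "polyhedron S" and q: "q \<in> S"
  obtains \<rho> where "\<rho> > 0" "\<And>x t. x \<in> S \<Longrightarrow> 0 \<le> t \<Longrightarrow> t \<le> \<rho> \<Longrightarrow> q + t *\<^sub>R sgn (x - q) \<in> S"
proof -
  obtain F where F: "finite F" "S = \<Inter> F" "\<forall>h\<in>F. \<exists>a b. a \<noteq> 0 \<and> h = {x. a \<bullet> x \<le> b}"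
    using S unfolding polyhedron_def by blast
  have "\<exists>\<rho>>0. \<forall>x t. x \<in> h \<and> 0 \<le> t \<and> t \<le> \<rho> \<longrightarrow> q + t *\<^sub>R sgn (x - q) \<in> h" if h: "h \<in> F" for h
  proof -
    obtain a b where ab: "a \<noteq> 0" "h = {x. a \<bullet> x \<le> b}" using F h by blast
    have qh: "a \<bullet> q \<le> b" using q F h ab by auto
    show ?thesis
    proof (cases "a \<bullet> q = b")
      case True
      have "q + t *\<^sub>R sgn (x - q) \<in> h" if "x \<in> h" "0 \<le> t" for x t
      proof -
        have "a \<bullet> (x - q) \<le> 0" using that ab True by (simp add: inner_diff_right)
        then have "a \<bullet> sgn (x - q) \<le> 0" by (simp add: sgn_div_norm mult_nonneg_nonpos)
        then have "t * (a \<bullet> sgn (x - q)) \<le> 0" using that by (simp add: mult_nonneg_nonpos)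
        then show ?thesis using ab True by (simp add: inner_add_right)
      qed
      then show ?thesis by (intro exI[of _ 1]) auto
    next
      case False
      then have lt: "b - a \<bullet> q > 0" using qh by simp
      define \<rho> where "\<rho> = (b - a \<bullet> q) / norm a"
      have "q + t *\<^sub>R sgn (x - q) \<in> h" if "0 \<le> t" "t \<le> \<rho>" for x t
      proof -
        have "a \<bullet> sgn (x - q) \<le> norm a * norm (sgn (x - q))" by (rule norm_cauchy_schwarz)
        also have "\<dots> \<le> norm a * 1" by (intro mult_left_mono) (auto simp: norm_sgn)
        finally have "t * (a \<bullet> sgn (x - q)) \<le> t * norm a" using that by (intro mult_left_mono) auto
        also have "\<dots> \<le> \<rho> * norm a" using that by (intro mult_right_mono) auto
        also have "\<dots> = b - a \<bullet> q" using ab by (simp add: \<rho>_def)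
        finally show ?thesis using ab by (simp add: inner_add_right)
      qed
      moreover have "\<rho> > 0" using lt ab by (simp add: \<rho>_def)
      ultimately show ?thesis by blast
    qed
  qed
  then have "\<forall>h\<in>F. \<exists>\<rho>>0. \<forall>x t. x \<in> h \<and> 0 \<le> t \<and> t \<le> \<rho> \<longrightarrow> q + t *\<^sub>R sgn (x - q) \<in> h" by blast
  then obtain \<rho> where rho: "\<And>h. h \<in> F \<Longrightarrow> \<rho> h > 0"
    "\<And>h x t. h \<in> F \<Longrightarrow> x \<in> h \<Longrightarrow> 0 \<le> t \<Longrightarrow> t \<le> \<rho> h \<Longrightarrow> q + t *\<^sub>R sgn (x - q) \<in> h"
    unfolding bchoice_iff by blast
  define m where "m = Min (insert 1 (\<rho> ` F))"
  have m: "m > 0" "\<And>h. h \<in> F \<Longrightarrow> m \<le> \<rho> h" using F(1) rho(1) by (auto simp: m_def)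
  show thesis
  proof (rule that[OF m(1)])
    fix x t assume "x \<in> S" "0 \<le> t" "t \<le> m"
    then show "q + t *\<^sub>R sgn (x - q) \<in> S" unfolding F(2) using rho(2) m(2) by (meson InterD InterI order_trans)
  qed
qed

lemma MIN_le_norm: "(MIN i. norm (q - P $ i)) \<le> norm (q - (P :: 'a::real_normed_vector^'n::finite) $ i)"
  by (rule Min_le) auto

lemma MIN_norm_attained: "\<exists>i. (MIN i. norm (q - P $ i)) = norm (q - (P :: 'a::real_normed_vector^'n::finite) $ i)"
proof -
  have "Min (range (\<lambda>j. norm (q - P $ j))) \<in> range (\<lambda>j. norm (q - P $ j))" by (intro Min_in) auto
  then show ?thesis unfolding image_iff by blast
qed

lemma has_vector_derivative_quotient_limit:
  fixes f :: "real \<Rightarrow> 'a::real_normed_vector"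
  assumes f: "(f has_vector_derivative v) (at \<tau>)" and t: "\<And>k::nat. t k \<noteq> \<tau>" "t \<longlonglongrightarrow> \<tau>"
  shows "(\<lambda>k. (1 / (t k - \<tau>)) *\<^sub>R (f (t k) - f \<tau>)) \<longlonglongrightarrow> v"
proof (rule tendstoI)
  fix e :: real assume e: "e > 0"
  have "(f has_derivative (\<lambda>h. h *\<^sub>R v)) (at \<tau>)" using f by (simp add: has_vector_derivative_def)
  then obtain d where d: "d > 0" "\<And>s. \<bar>s - \<tau>\<bar> < d \<Longrightarrow> norm (f s - f \<tau> - (s - \<tau>) *\<^sub>R v) \<le> (e/2) * \<bar>s - \<tau>\<bar>"
    unfolding has_derivative_at_alt real_norm_def using half_gt_zero[OF e] by blast
  have "\<forall>\<^sub>F k in sequentially. dist (t k) \<tau> < d" using t(2) d(1) by (rule tendstoD)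
  then show "\<forall>\<^sub>F k in sequentially. dist ((1 / (t k - \<tau>)) *\<^sub>R (f (t k) - f \<tau>)) v < e"
  proof eventually_elim
    case (elim k)
    define h where "h = t k - \<tau>"
    have h: "h \<noteq> 0" "\<bar>h\<bar> < d" using t(1)[of k] elim by (auto simp: h_def dist_real_def)
    have "(1 / h) *\<^sub>R (f (t k) - f \<tau>) - v = (1 / h) *\<^sub>R (f (t k) - f \<tau> - h *\<^sub>R v)"
      using h by (simp add: scaleR_diff_right)
    then have "norm ((1 / h) *\<^sub>R (f (t k) - f \<tau>) - v) = norm (f (t k) - f \<tau> - h *\<^sub>R v) / \<bar>h\<bar>"
      by (simp add: divide_inverse mult.commute)
    also have "\<dots> \<le> e / 2" using d(2)[of "t k"] h by (simp add: h_def divide_le_eq)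
    finally show ?case using e by (simp add: dist_norm h_def)
  qed
qed

context polygon
begin

section \<open>The disk-covering function along circumcenter curves\<close>

lemma H_DC_witness:
  fixes P :: "(real^2)^'n::finite"
  shows "\<exists>q\<in>Q. H_DC Q P = (MIN i. norm (q - P $ i)) \<and> (\<forall>y\<in>Q. (MIN i. norm (y - P $ i)) \<le> H_DC Q P)"
proof -
  let ?f = "\<lambda>q. MIN i. norm (q - P $ i)"
  have le: "?f q \<le> ?f y + norm (q - y)" for q y
  proof -
    obtain i where i: "?f y = norm (y - P $ i)" using MIN_norm_attained by blast
    have "?f q \<le> norm (q - P $ i)" by (rule MIN_le_norm)
    also have "\<dots> \<le> norm (q - y) + norm (y - P $ i)" using norm_triangle_ineq[of "q - y" "y - P $ i"] by simp
    finally show ?thesis using i by simp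
  qed
  have "1-lipschitz_on Q ?f"
  proof (rule lipschitz_onI)
    fix x y show "dist (?f x) (?f y) \<le> 1 * dist x y"
      using le[of x y] le[of y x] by (simp add: dist_real_def dist_norm norm_minus_commute abs_le_iff)
  qed simp
  then have "continuous_on Q ?f" by (rule lipschitz_on_continuous_on)
  then obtain q where q: "q \<in> Q" "\<And>y. y \<in> Q \<Longrightarrow> ?f y \<le> ?f q"
    using continuous_attains_sup[OF Q_compact Q_nonempty] by blast
  have "H_DC Q P = ?f q" unfolding H_DC_def by (rule cSup_eq_maximum) (use q in auto)
  then show ?thesis using q by auto
qed

lemma H_DC_upper: "q \<in> Q \<Longrightarrow> \<exists>i. norm (q - P $ i) \<le> H_DC Q (P :: (real^2)^'n::finite)"
  using H_DC_witness[of P] MIN_norm_attained[of q P] by metis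

lemma H_DC_attained: "\<exists>q\<in>Q. \<forall>i. H_DC Q P \<le> norm (q - (P :: (real^2)^'n::finite) $ i)"
  using H_DC_witness[of P] MIN_le_norm by metis

lemma H_DC_le: "(\<And>q. q \<in> Q \<Longrightarrow> \<exists>i. norm (q - P $ i) \<le> h) \<Longrightarrow> H_DC Q (P :: (real^2)^'n::finite) \<le> h"
  using H_DC_attained[of P] by (meson order_trans)

lemma H_DC_ge: "q \<in> Q \<Longrightarrow> (\<And>i. h \<le> norm (q - P $ i)) \<Longrightarrow> h \<le> H_DC Q (P :: (real^2)^'n::finite)"
  using H_DC_upper[of q P] by (meson order_trans)

lemma H_DC_nonneg: "H_DC Q (P :: (real^2)^'n::finite) \<ge> 0"
  using Q_nonempty by (auto intro: H_DC_ge)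

lemma H_DC_diff_le: "H_DC Q P \<le> H_DC Q R + norm (P - (R :: (real^2)^'n::finite))"
proof (rule H_DC_le)
  fix q assume "q \<in> Q"
  then obtain i where i: "norm (q - R $ i) \<le> H_DC Q R" using H_DC_upper by blast
  have "norm (q - P $ i) \<le> norm (q - R $ i) + norm ((R - P) $ i)"
    using norm_triangle_ineq[of "q - R $ i" "R $ i - P $ i"] by simp
  also have "\<dots> \<le> H_DC Q R + norm (P - R)"
    using i Finite_Cartesian_Product.norm_nth_le[of "R - P" i] by (simp add: norm_minus_commute)
  finally show "\<exists>i. norm (q - P $ i) \<le> H_DC Q R + norm (P - R)" by blast
qed

lemma H_DC_lipschitz: "1-lipschitz_on UNIV (H_DC Q :: (real^2)^'n::finite \<Rightarrow> real)"
proof (rule lipschitz_onI)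
  fix P R :: "(real^2)^'n"
  show "dist (H_DC Q P) (H_DC Q R) \<le> 1 * dist P R"
    using H_DC_diff_le[of P R] H_DC_diff_le[of R P] by (simp add: dist_real_def dist_norm norm_minus_commute abs_le_iff)
qed simp

lemma cell_radius_le_H_DC:
  "q \<in> voronoi_cell Q P i \<Longrightarrow> norm (q - P $ i) \<le> H_DC Q (P :: (real^2)^'n::finite)"
  by (rule H_DC_ge) (auto simp: voronoi_cell_iff)

text \<open>The disk about the generator with radius \<open>H_DC\<close> encloses the cell, so the
  smallest enclosing disk is no larger.\<close>

lemma circumradius_le_H_DC:
  fixes P :: "(real^2)^'n::finite"
  assumes P: "P \<in> configurations Q" and q: "q \<in> voronoi_cell Q P i"
  shows "norm (q - circumcenter (voronoi_cell Q P i)) \<le> H_DC Q P"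
proof -
  obtain r where r: "min_ball (voronoi_cell Q P i) (circumcenter (voronoi_cell Q P i)) r"
    using circumcenter_min_ball[OF compact_imp_bounded[OF voronoi_cell_compact]] q by (metis empty_iff)
  have "voronoi_cell Q P i \<subseteq> cball (P $ i) (H_DC Q P)"
    using cell_radius_le_H_DC by (auto simp: dist_norm norm_minus_commute)
  then have "r \<le> H_DC Q P" using r unfolding min_ball_def by blast
  moreover have "q \<in> cball (circumcenter (voronoi_cell Q P i)) r" using r q unfolding min_ball_def by blast
  ultimately show ?thesis by (simp add: dist_norm norm_minus_commute)
qed

lemma G_fun_attained:
  fixes P :: "(real^2)^'n::finite"
  assumes P: "P \<in> configurations Q"
  shows "\<exists>q\<in>voronoi_cell Q P i. G_fun Q P i = norm (q - P $ i) \<and> (\<forall>y\<in>voronoi_cell Q P i. norm (y - P $ i) \<le> G_fun Q P i)"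
proof -
  have ne: "voronoi_cell Q P i \<noteq> {}" using generator_in_cell[OF P] by blast
  have "continuous_on (voronoi_cell Q P i) (\<lambda>q. norm (q - P $ i))" by (intro continuous_intros)
  then obtain q where q: "q \<in> voronoi_cell Q P i" "\<And>y. y \<in> voronoi_cell Q P i \<Longrightarrow> norm (y - P $ i) \<le> norm (q - P $ i)"
    using continuous_attains_sup[OF voronoi_cell_compact ne] by blast
  have "G_fun Q P i = norm (q - P $ i)" unfolding G_fun_def by (rule cSup_eq_maximum) (use q in auto)
  then show ?thesis using q by auto
qed

lemma I_DC_iff:
  fixes P :: "(real^2)^'n::finite"
  assumes P: "P \<in> configurations Q"
  shows "i \<in> I_DC Q P \<longleftrightarrow> (\<exists>q\<in>voronoi_cell Q P i. norm (q - P $ i) = H_DC Q P)"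
proof
  assume "i \<in> I_DC Q P"
  then show "\<exists>q\<in>voronoi_cell Q P i. norm (q - P $ i) = H_DC Q P"
    using G_fun_attained[OF P, of i] by (auto simp: I_DC_def)
next
  assume "\<exists>q\<in>voronoi_cell Q P i. norm (q - P $ i) = H_DC Q P"
  then have "H_DC Q P \<le> G_fun Q P i" using G_fun_attained[OF P, of i] by metis
  moreover have "G_fun Q P i \<le> H_DC Q P" using G_fun_attained[OF P, of i] cell_radius_le_H_DC[of _ P i] by metis
  ultimately show "i \<in> I_DC Q P" by (simp add: I_DC_def)
qed

definition dc_target :: "(real^2)^'n::finite \<Rightarrow> (real^2)^'n" where
  "dc_target P = (\<chi> i. circumcenter (voronoi_cell Q P i))"

abbreviation dc_curve :: "real \<Rightarrow> (real \<Rightarrow> (real^2)^'n::finite) \<Rightarrow> real set \<Rightarrow> bool" where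
  "dc_curve L P N \<equiv> cell_curve L P (\<lambda>t. dc_target (P t)) N"

text \<open>The two sides of \<open>t\<close> need different arguments. Afterwards, every
  \<open>q\<close> keeps a nearby generator, namely the one nearest at time \<open>t\<close>.
  Before, a single farthest point \<open>q\<close> of time \<open>t\<close> is far from all
  generators: for inactive ones by continuity, for active ones by running the motion
  backwards.\<close>

lemma H_DC_near_derivative:
  fixes P :: "real \<Rightarrow> (real^2)^'n::finite"
  assumes d: "(P has_vector_derivative (dc_target (P t) - P t)) (at t)" and PX: "P t \<in> configurations Q"
  shows "lower_slope (\<lambda>s. - H_DC Q (P s)) t 0"
  unfolding lower_slope_def
proof (intro allI impI)
  fix \<epsilon> :: real assume e: "\<epsilon> > 0"
  define H where "H = H_DC Q (P t)"
  define c where "c = dc_target (P t)"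
  have "(P has_derivative (\<lambda>h. h *\<^sub>R (c - P t))) (at t)" using d by (simp add: has_vector_derivative_def c_def)
  then obtain d1 where d1: "d1 > 0" "\<And>s. \<bar>s - t\<bar> < d1 \<Longrightarrow> norm (P s - P t - (s - t) *\<^sub>R (c - P t)) \<le> \<epsilon> * \<bar>s - t\<bar>"
    unfolding has_derivative_at_alt using e by (auto simp: real_norm_def)
  have comp: "norm (P s $ i - P t $ i - (s - t) *\<^sub>R (c $ i - P t $ i)) \<le> \<epsilon> * \<bar>s - t\<bar>" if "\<bar>s - t\<bar> < d1" for s i
    using Finite_Cartesian_Product.norm_nth_le[of "P s - P t - (s - t) *\<^sub>R (c - P t)" i] d1(2)[OF that] by simp
  have ci: "norm (q - c $ i) \<le> H" "norm (q - P t $ i) \<le> H" if "q \<in> voronoi_cell Q (P t) i" for q i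
    using circumradius_le_H_DC[OF PX that] cell_radius_le_H_DC[OF that] by (auto simp: c_def dc_target_def H_def)
  have up: "H_DC Q (P v) \<le> H + \<epsilon> * (v - t)" if v: "t \<le> v" "v < t + min d1 1" for v
  proof (rule H_DC_le)
    fix q assume "q \<in> Q"
    then obtain i where i: "q \<in> voronoi_cell Q (P t) i" by (rule obtain_nearest_cell)
    define s where "s = v - t"
    have s: "0 \<le> s" "s < 1" "\<bar>v - t\<bar> < d1" using v by (auto simp: s_def)
    \<comment> \<open>Up to the differentiation error, the new position is a convex combination of
      the old one and the circumcenter, both within \<open>H\<close> of \<open>q\<close>.\<close>
    have eq: "q - P v $ i = ((1 - s) *\<^sub>R (q - P t $ i) + s *\<^sub>R (q - c $ i)) - (P v $ i - P t $ i - (v - t) *\<^sub>R (c $ i - P t $ i))"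
      unfolding s_def[symmetric] by (simp add: algebra_simps)
    have "norm (q - P v $ i) \<le> norm ((1 - s) *\<^sub>R (q - P t $ i) + s *\<^sub>R (q - c $ i)) +
        norm (P v $ i - P t $ i - (v - t) *\<^sub>R (c $ i - P t $ i))"
      unfolding eq by (rule norm_triangle_ineq4)
    also have "\<dots> \<le> norm ((1 - s) *\<^sub>R (q - P t $ i) + s *\<^sub>R (q - c $ i)) + \<epsilon> * s"
      using comp[OF s(3), of i] s v by (simp add: s_def)
    also have "norm ((1 - s) *\<^sub>R (q - P t $ i) + s *\<^sub>R (q - c $ i)) \<le> (1 - s) * norm (q - P t $ i) + s * norm (q - c $ i)"
      using norm_triangle_ineq[of "(1 - s) *\<^sub>R (q - P t $ i)" "s *\<^sub>R (q - c $ i)"] s by simp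
    also have "\<dots> \<le> (1 - s) * H + s * H" using ci[OF i] s by (intro add_mono mult_left_mono) auto
    finally show "\<exists>i. norm (q - P v $ i) \<le> H + \<epsilon> * (v - t)" by (intro exI[of _ i]) (simp add: algebra_simps s_def)
  qed
  obtain q where q: "q \<in> Q" "\<And>i. H \<le> norm (q - P t $ i)" using H_DC_attained[of "P t"] by (auto simp: H_def)
  have contP: "isCont P t" using d by (simp add: has_vector_derivative_continuous)
  have "\<forall>\<^sub>F u in at_left t. norm (q - P u $ i) \<ge> H - \<epsilon> * (t - u)" for i
  proof (cases "norm (q - P t $ i) = H")
    case False
    then have "H < norm (q - P t $ i)" using q(2)[of i] by simp
    moreover have "((\<lambda>u. norm (q - P u $ i)) \<longlongrightarrow> norm (q - P t $ i)) (at_left t)"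
      using contP unfolding isCont_def filterlim_at_split by (intro tendsto_intros) auto
    ultimately have "\<forall>\<^sub>F u in at_left t. H < norm (q - P u $ i)" by (intro order_tendstoD) auto
    moreover have "\<forall>\<^sub>F u in at_left t. u < t" by (simp add: eventually_at_filter)
    ultimately show ?thesis
    proof eventually_elim
      case (elim u)
      have "\<epsilon> * (t - u) \<ge> 0" using e elim by simp
      then show ?case using elim by linarith
    qed
  next
    case True
    then have i: "q \<in> voronoi_cell Q (P t) i" using q by (auto simp: voronoi_cell_iff)
    have low: "norm (q - P u $ i) \<ge> H - \<epsilon> * (t - u)" if u: "u < t" "t - d1 < u" for u
    proof -
      define s where "s = t - u"
      have s: "0 < s" "\<bar>u - t\<bar> = s" "u - t = - s" "\<bar>u - t\<bar> < d1" using u by (auto simp: s_def)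
      \<comment> \<open>The same combination solved for the earlier position: \<open>u\<close> lies
        before \<open>t\<close>, so the position at \<open>t\<close> lies between those of
        \<open>P u\<close> and the circumcenter.\<close>
      have eq: "(1 + s) *\<^sub>R (q - P t $ i) = (q - P u $ i) + (P u $ i - P t $ i - (u - t) *\<^sub>R (c $ i - P t $ i)) + s *\<^sub>R (q - c $ i)"
        unfolding s(3) by (simp add: algebra_simps)
      have "(1 + s) * H = norm ((1 + s) *\<^sub>R (q - P t $ i))" using s True by simp
      also have "\<dots> \<le> norm (q - P u $ i) + norm (P u $ i - P t $ i - (u - t) *\<^sub>R (c $ i - P t $ i)) + norm (s *\<^sub>R (q - c $ i))"
        unfolding eq by (intro order_trans[OF norm_triangle_ineq] add_mono norm_triangle_ineq) auto
      also have "\<dots> \<le> norm (q - P u $ i) + \<epsilon> * s + s * H"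
        using comp[OF s(4), of i] ci(1)[OF i] s by (intro add_mono) auto
      finally show ?thesis unfolding s_def[symmetric] by (simp add: algebra_simps)
    qed
    show ?thesis by (rule eventually_at_leftI[of "t - d1"]) (use low d1 in auto)
  qed
  then have "\<forall>\<^sub>F u in at_left t. \<forall>i. norm (q - P u $ i) \<ge> H - \<epsilon> * (t - u)" by (rule eventually_all_finite)
  then obtain b where b: "b < t" "\<And>u i. b < u \<Longrightarrow> u < t \<Longrightarrow> norm (q - P u $ i) \<ge> H - \<epsilon> * (t - u)"
    unfolding eventually_at_left_field by blast
  have down: "H - \<epsilon> * (t - u) \<le> H_DC Q (P u)" if "b < u" "u \<le> t" for u
  proof (cases "u = t")
    case False
    then show ?thesis using b(2)[of u] that by (intro H_DC_ge[OF q(1)]) auto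
  qed (simp add: H_def)
  show "\<exists>\<delta>>0. \<forall>u v. t - \<delta> < u \<and> u \<le> t \<and> t \<le> v \<and> v < t + \<delta> \<longrightarrow>
      (0 - \<epsilon>) * (v - u) \<le> - H_DC Q (P v) - - H_DC Q (P u)"
  proof (intro exI[of _ "min (min d1 1) (t - b)"] conjI allI impI)
    show "0 < min (min d1 1) (t - b)" using d1 b by auto
    fix u v assume uv: "t - min (min d1 1) (t - b) < u \<and> u \<le> t \<and> t \<le> v \<and> v < t + min (min d1 1) (t - b)"
    have "b < u" using uv by auto
    then have "H - \<epsilon> * (t - u) \<le> H_DC Q (P u)" using down uv by blast
    moreover have "H_DC Q (P v) \<le> H + \<epsilon> * (v - t)" using up[of v] uv by auto
    ultimately show "(0 - \<epsilon>) * (v - u) \<le> - H_DC Q (P v) - - H_DC Q (P u)" by (simp add: algebra_simps)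
  qed
qed

lemma dc_curve_H_DC_antimono:
  assumes c: "dc_curve L P N" and ab: "0 \<le> a" "a \<le> b"
  shows "H_DC Q (P b) \<le> H_DC Q (P a)"
proof -
  have "L-lipschitz_on {a..b} (\<lambda>s. H_DC Q (P s))"
  proof (rule lipschitz_onI)
    fix x y assume xy: "x \<in> {a..b}" "y \<in> {a..b}"
    have "dist (H_DC Q (P x)) (H_DC Q (P y)) \<le> 1 * dist (P x) (P y)"
      by (rule lipschitz_onD[OF H_DC_lipschitz]) auto
    also have "\<dots> \<le> L * dist x y"
      using lipschitz_onD[OF cell_curveD(2)[OF c], of x y] xy ab by auto
    finally show "dist (H_DC Q (P x)) (H_DC Q (P y)) \<le> L * dist x y" .
  qed (use cell_curveD(2)[OF c] lipschitz_on_nonneg in blast)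
  then have "L-lipschitz_on {a..b} (\<lambda>s. - H_DC Q (P s))" by simp
  then have "0 * (b - a) \<le> - H_DC Q (P b) - - H_DC Q (P a)"
  proof (rule ae_lower_slope_lipschitz[OF ab(2) _ cell_curveD(1)[OF c]])
    fix t assume t: "a < t" "t < b" "t \<notin> N"
    then have t0: "t > 0" using ab by simp
    show "lower_slope (\<lambda>s. - H_DC Q (P s)) t 0"
      by (rule H_DC_near_derivative[OF cell_curveD(4)[OF c t0 t(3)] cell_curveD(3)[OF c]]) (use t0 in simp)
  qed
  then show ?thesis by simp
qed

text \<open>
  Farthest points \<open>q\<^sub>k\<close> of the cells of \<open>i\<close> at times \<open>\<tau>\<^sub>k\<close> decreasing to \<open>\<tau>\<close> move with
  infinite slope or converge with speed \<open>o(\<tau>\<^sub>k - \<tau>)\<close>; the first is impossible because the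
  direction of motion would lead to points of \<open>Q\<close> that are too far from all generators.
  So \<open>i\<close> cannot approach the limit of these points.
\<close>

lemma active_generator_centered:
  fixes \<Gamma> :: "real \<Rightarrow> (real^2)^'n::finite"
  assumes d: "(\<Gamma> has_vector_derivative (dc_target (\<Gamma> \<tau>) - \<Gamma> \<tau>)) (at \<tau>)"
    and X: "\<Gamma> \<tau> \<in> configurations Q" "\<And>k::nat. \<Gamma> (s k) \<in> configurations Q"
    and s: "\<And>k. s k > \<tau>" "s \<longlonglongrightarrow> \<tau>"
    and H: "H_DC Q (\<Gamma> \<tau>) = H" "\<And>k. H_DC Q (\<Gamma> (s k)) = H"
    and act: "\<And>k. i \<in> I_DC Q (\<Gamma> (s k))"
  shows "\<Gamma> \<tau> $ i = circumcenter (voronoi_cell Q (\<Gamma> \<tau>) i)"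
proof -
  define p where "p l = \<Gamma> \<tau> $ l" for l
  define v where "v l = dc_target (\<Gamma> \<tau>) $ l - p l" for l
  have cont: "isCont \<Gamma> \<tau>" using d by (rule has_vector_derivative_continuous)
  have "\<exists>q\<in>voronoi_cell Q (\<Gamma> (s k)) i. norm (q - \<Gamma> (s k) $ i) = H" for k
    using act[of k] I_DC_iff[OF X(2), of i k] H(2) by simp
  then obtain q' where q': "\<And>k. q' k \<in> voronoi_cell Q (\<Gamma> (s k)) i" "\<And>k. norm (q' k - \<Gamma> (s k) $ i) = H" by metis
  have "q' k \<in> Q" for k using q'(1) voronoi_cell_subset by blast
  then obtain q r where r: "strict_mono (r :: nat \<Rightarrow> nat)" "(q' \<circ> r) \<longlonglongrightarrow> q"
    using Q_compact unfolding compact_def by meson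
  define y where "y k = q' (r k)" for k
  define t where "t k = s (r k)" for k
  have y: "y \<longlonglongrightarrow> q" using r(2) by (simp add: y_def[abs_def] o_def)
  have t: "\<And>k. t k > \<tau>" "t \<longlonglongrightarrow> \<tau>" using s(1) LIMSEQ_subseq_LIMSEQ[OF s(2) r(1)] by (auto simp: t_def[abs_def] o_def)
  have yV: "y k \<in> voronoi_cell Q (\<Gamma> (t k)) i" "norm (y k - \<Gamma> (t k) $ i) = H" for k
    using q' by (auto simp: y_def t_def)
  have Gt: "(\<lambda>k. \<Gamma> (t k)) \<longlonglongrightarrow> \<Gamma> \<tau>" by (rule isCont_tendsto_compose[OF cont t(2)])
  have qV: "q \<in> voronoi_cell Q (\<Gamma> \<tau>) i" by (rule mem_voronoi_cell_limit[OF Q_closed yV(1) y Gt])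
  have "(\<lambda>k. norm (y k - \<Gamma> (t k) $ i)) \<longlonglongrightarrow> norm (q - \<Gamma> \<tau> $ i)" by (intro tendsto_intros y Gt)
  then have qi: "norm (q - p i) = H" using yV(2) by (simp add: LIMSEQ_const_iff p_def)
  have qQ: "q \<in> Q" using qV voronoi_cell_subset by blast
  have ge: "norm (q - p l) \<ge> H" for l using qV qi by (auto simp: voronoi_cell_iff p_def)
  have ge': "norm (y k - \<Gamma> (t k) $ l) \<ge> H" for k l using yV[of k] by (auto simp: voronoi_cell_iff)
  have H0: "H \<ge> 0" using qi by auto
  define A where "A = {l. norm (q - p l) = H}"
  have iA: "i \<in> A" using qi by (simp add: A_def)
  \<comment> \<open>The distance from \<open>q\<close> is exactly \<open>H\<close> at
    \<open>p l\<close> and at most \<open>H\<close> at its circumcenter, the end point of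
    \<open>v l\<close>.\<close>
  have kappa: "(norm (v l))\<^sup>2 \<le> 2 * ((q - p l) \<bullet> v l)" if l: "l \<in> A" for l
  proof -
    have "q \<in> voronoi_cell Q (\<Gamma> \<tau>) l" using l ge qQ by (auto simp: A_def p_def voronoi_cell_iff)
    then have "norm (q - dc_target (\<Gamma> \<tau>) $ l) \<le> H"
      using circumradius_le_H_DC[OF X(1)] H(1) by (simp add: dc_target_def)
    then have "(norm (q - dc_target (\<Gamma> \<tau>) $ l))\<^sup>2 \<le> H\<^sup>2" by (intro power_mono) auto
    also have "q - dc_target (\<Gamma> \<tau>) $ l = (q - p l) - 1 *\<^sub>R v l" by (simp add: v_def)
    finally show ?thesis using l unfolding norm_diff_scaleR_squared by (simp add: A_def inner_commute)
  qed
  obtain g where g: "g > 0" "\<And>l. l \<notin> A \<Longrightarrow> g \<le> norm (q - p l) - H"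
  proof -
    define g where "g = Min (insert 1 ((\<lambda>l. norm (q - p l) - H) ` (- A)))"
    have "norm (q - p l) - H > 0" if "l \<notin> A" for l using ge[of l] that by (auto simp: A_def)
    then have "g > 0" unfolding g_def by (subst Min_gr_iff) auto
    moreover have "g \<le> norm (q - p l) - H" if "l \<notin> A" for l using that by (auto simp: g_def)
    ultimately show thesis using that by blast
  qed
  obtain \<rho>0 where r0: "\<rho>0 > 0" "\<And>x t. x \<in> Q \<Longrightarrow> 0 \<le> t \<Longrightarrow> t \<le> \<rho>0 \<Longrightarrow> q + t *\<^sub>R sgn (x - q) \<in> Q"
    using polyhedron_fixed_step[OF Q_polyhedron qQ] by blast
  \<comment> \<open>A step shorter than \<open>g\<close> cannot bring an inactive generator within
    distance \<open>H\<close>, so the generator found after the step is active.\<close>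
  define \<rho> where "\<rho> = min \<rho>0 (g / 2)"
  have rho: "\<rho> > 0" "\<rho> \<le> \<rho>0" "\<rho> < g" using r0(1) g(1) by (auto simp: \<rho>_def)
  define w where "w k = y k - q" for k
  have w0: "w \<longlonglongrightarrow> 0" unfolding w_def using y by (simp add: LIM_zero)
  \<comment> \<open>The displaced point still lies in \<open>Q\<close>, so some active generator is
    within \<open>H\<close> of it. The displacement of \<open>y k\<close> therefore has a component
    towards that generator, at a rate bounded below.\<close>
  have step: "\<exists>l\<in>A. 2 * ((q - p l) \<bullet> w k) \<le> - \<rho> * norm (w k)" for k
  proof (cases "w k = 0")
    case True
    then show ?thesis using iA by auto
  next
    case False
    have "y k \<in> Q" using yV(1) voronoi_cell_subset by blast
    then have "q + \<rho> *\<^sub>R sgn (w k) \<in> Q" unfolding w_def using r0(2) rho by auto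
    then obtain l where l: "norm (q + \<rho> *\<^sub>R sgn (w k) - p l) \<le> H"
      using H_DC_upper[of _ "\<Gamma> \<tau>"] H(1) unfolding p_def by metis
    have sg: "norm (sgn (w k)) = 1" using False by (simp add: norm_sgn)
    have eq: "q + \<rho> *\<^sub>R sgn (w k) - p l = (q - p l) - (- \<rho>) *\<^sub>R sgn (w k)" by simp
    have "norm (q - p l) \<le> norm (q + \<rho> *\<^sub>R sgn (w k) - p l) + norm (\<rho> *\<^sub>R sgn (w k))"
      using norm_triangle_ineq4[of "q + \<rho> *\<^sub>R sgn (w k) - p l" "\<rho> *\<^sub>R sgn (w k)"] by (simp add: algebra_simps)
    also have "\<dots> < H + g" using l rho sg by simp
    finally have lA: "l \<in> A" using g(2)[of l] by force
    have "(norm (q + \<rho> *\<^sub>R sgn (w k) - p l))\<^sup>2 \<le> H\<^sup>2" using l by (intro power_mono) auto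
    then have "\<rho> * (2 * (sgn (w k) \<bullet> (q - p l))) + \<rho>\<^sup>2 \<le> 0"
      unfolding eq norm_diff_scaleR_squared using lA sg by (simp add: A_def)
    then have "\<rho> * (2 * (sgn (w k) \<bullet> (q - p l)) + \<rho>) \<le> 0" by (simp add: power2_eq_square algebra_simps)
    then have "2 * (sgn (w k) \<bullet> (q - p l)) \<le> - \<rho>" using rho(1) by (simp add: mult_le_0_iff)
    then have "norm (w k) * (2 * (sgn (w k) \<bullet> (q - p l))) \<le> norm (w k) * (- \<rho>)" by (intro mult_left_mono) auto
    moreover have "norm (w k) * (2 * (sgn (w k) \<bullet> (q - p l))) = 2 * ((q - p l) \<bullet> w k)"
      using False by (simp add: sgn_div_norm inner_commute)
    ultimately show ?thesis using lA by (intro bexI[of _ l]) (simp_all add: mult.commute)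
  qed
  define \<sigma> where "\<sigma> k = t k - \<tau>" for k
  have sig: "\<sigma> k > 0" for k using t(1) by (simp add: \<sigma>_def)
  have sig0: "\<sigma> \<longlonglongrightarrow> 0" unfolding \<sigma>_def using t(2) by (simp add: LIM_zero)
  define \<Delta> where "\<Delta> l k = \<Gamma> (t k) $ l - p l" for l k
  have quot: "(\<lambda>k. (1 / \<sigma> k) *\<^sub>R \<Delta> l k) \<longlonglongrightarrow> v l" for l
  proof -
    have "((\<lambda>s. \<Gamma> s $ l) has_vector_derivative v l) (at \<tau>)"
      using vec_nth_has_vector_derivative[OF d, of l] by (simp add: v_def p_def)
    then show ?thesis unfolding \<sigma>_def \<Delta>_def p_def
      by (rule has_vector_derivative_quotient_limit) (use t in \<open>auto simp: less_imp_neq[THEN not_sym]\<close>)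
  qed
  have far: "0 \<le> 2 * ((q - p l) \<bullet> (w k - \<Delta> l k)) + (norm (w k - \<Delta> l k))\<^sup>2" if l: "l \<in> A" for l k
  proof -
    have "H\<^sup>2 \<le> (norm (y k - \<Gamma> (t k) $ l))\<^sup>2" using ge'[of k l] H0 by (intro power_mono) auto
    also have "y k - \<Gamma> (t k) $ l = (q - p l) - (-1) *\<^sub>R (w k - \<Delta> l k)" by (simp add: w_def \<Delta>_def)
    finally show ?thesis using l unfolding norm_diff_scaleR_squared by (simp add: A_def inner_commute)
  qed
  \<comment> \<open>A bound for how much the generators in \<open>A\<close> increase their squared
    distances from \<open>q\<close>. It is \<open>o(\<sigma> k)\<close>, since by
    \<open>kappa\<close> the first-order change is a decrease or zero.\<close>
  define E where "E k = (\<Sum>l\<in>A. max 0 (- 2 * ((q - p l) \<bullet> \<Delta> l k) + 2 * (norm (\<Delta> l k))\<^sup>2))" for k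
  have wE: "norm (w k) * (\<rho> - 2 * norm (w k)) \<le> E k" for k
  proof -
    obtain l where l: "l \<in> A" "2 * ((q - p l) \<bullet> w k) \<le> - \<rho> * norm (w k)" using step by blast
    have "(norm (w k - \<Delta> l k))\<^sup>2 \<le> (norm (w k) + norm (\<Delta> l k))\<^sup>2"
      by (intro power_mono norm_triangle_ineq4) auto
    also have "\<dots> \<le> 2 * (norm (w k))\<^sup>2 + 2 * (norm (\<Delta> l k))\<^sup>2"
      using zero_le_power2[of "norm (w k) - norm (\<Delta> l k)"] by (simp add: power2_eq_square algebra_simps)
    finally have "norm (w k) * (\<rho> - 2 * norm (w k)) \<le> - 2 * ((q - p l) \<bullet> \<Delta> l k) + 2 * (norm (\<Delta> l k))\<^sup>2"
      using far[OF l(1), of k] l(2) by (simp add: inner_diff_right power2_eq_square algebra_simps)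
    also have "\<dots> \<le> max 0 (- 2 * ((q - p l) \<bullet> \<Delta> l k) + 2 * (norm (\<Delta> l k))\<^sup>2)" by simp
    also have "\<dots> \<le> E k" unfolding E_def by (rule member_le_sum) (use l in auto)
    finally show ?thesis .
  qed
  have E0: "(\<lambda>k. E k / \<sigma> k) \<longlonglongrightarrow> 0"
  proof -
    have "(\<lambda>k. \<Sum>l\<in>A. max 0 (- 2 * ((q - p l) \<bullet> ((1 / \<sigma> k) *\<^sub>R \<Delta> l k)) + 2 * \<sigma> k * (norm ((1 / \<sigma> k) *\<^sub>R \<Delta> l k))\<^sup>2))
        \<longlonglongrightarrow> (\<Sum>l\<in>A. max 0 (- 2 * ((q - p l) \<bullet> v l) + 2 * 0 * (norm (v l))\<^sup>2))"
      by (intro tendsto_intros tendsto_sum quot sig0)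
    moreover have "(\<Sum>l\<in>A. max 0 (- 2 * ((q - p l) \<bullet> v l) + 2 * 0 * (norm (v l))\<^sup>2)) = 0"
    proof (intro sum.neutral ballI)
      fix l assume "l \<in> A"
      have "0 \<le> 2 * ((q - p l) \<bullet> v l)" using kappa[OF \<open>l \<in> A\<close>] by (meson order_trans zero_le_power2)
      then show "max 0 (- 2 * ((q - p l) \<bullet> v l) + 2 * 0 * (norm (v l))\<^sup>2) = 0" by simp
    qed
    moreover have "(\<Sum>l\<in>A. max 0 (- 2 * ((q - p l) \<bullet> ((1 / \<sigma> k) *\<^sub>R \<Delta> l k)) + 2 * \<sigma> k * (norm ((1 / \<sigma> k) *\<^sub>R \<Delta> l k))\<^sup>2)) = E k / \<sigma> k" for k
      unfolding E_def sum_divide_distrib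
    proof (rule sum.cong[OF refl])
      fix l
      have "- 2 * ((q - p l) \<bullet> ((1 / \<sigma> k) *\<^sub>R \<Delta> l k)) + 2 * \<sigma> k * (norm ((1 / \<sigma> k) *\<^sub>R \<Delta> l k))\<^sup>2 =
          (- 2 * ((q - p l) \<bullet> \<Delta> l k) + 2 * (norm (\<Delta> l k))\<^sup>2) / \<sigma> k"
        using sig[of k] by (simp add: power_mult_distrib power_divide field_simps power2_eq_square)
      then show "max 0 (- 2 * ((q - p l) \<bullet> ((1 / \<sigma> k) *\<^sub>R \<Delta> l k)) + 2 * \<sigma> k * (norm ((1 / \<sigma> k) *\<^sub>R \<Delta> l k))\<^sup>2) =
          max 0 (- 2 * ((q - p l) \<bullet> \<Delta> l k) + 2 * (norm (\<Delta> l k))\<^sup>2) / \<sigma> k"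
        using sig[of k] by (simp add: max_def divide_le_0_iff zero_le_divide_iff)
    qed
    ultimately show ?thesis by simp
  qed
  \<comment> \<open>Once \<open>norm (w k)\<close> is below \<open>\<rho> / 4\<close>, the quadratic
    term in \<open>wE\<close> costs at most half of the linear one, so \<open>norm (w k)\<close> is
    bounded by a multiple of \<open>E k\<close>.\<close>
  have wsig: "(\<lambda>k. (1 / \<sigma> k) *\<^sub>R w k) \<longlonglongrightarrow> 0"
  proof (rule tendsto_norm_zero_cancel, rule tendsto_sandwich[of "\<lambda>_. 0" _ _ "\<lambda>k. 2 / \<rho> * (E k / \<sigma> k)"])
    show "(\<lambda>k. 2 / \<rho> * (E k / \<sigma> k)) \<longlonglongrightarrow> 0" using tendsto_mult_left[OF E0, of "2 / \<rho>"] by simp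
    have "(\<lambda>k. norm (w k)) \<longlonglongrightarrow> 0" using w0 by (rule tendsto_norm_zero)
    then have "\<forall>\<^sub>F k in sequentially. norm (w k) < \<rho> / 4" by (rule order_tendstoD) (use rho in simp)
    then show "\<forall>\<^sub>F k in sequentially. norm ((1 / \<sigma> k) *\<^sub>R w k) \<le> 2 / \<rho> * (E k / \<sigma> k)"
    proof eventually_elim
      case (elim k)
      have "norm (w k) * (\<rho> / 2) \<le> norm (w k) * (\<rho> - 2 * norm (w k))" using elim by (intro mult_left_mono) auto
      also have "\<dots> \<le> E k" by (rule wE)
      finally have "norm (w k) \<le> 2 / \<rho> * E k" using rho(1) by (simp add: field_simps)
      then have "norm (w k) / \<sigma> k \<le> (2 / \<rho> * E k) / \<sigma> k"
        using sig[of k] by (intro divide_right_mono) auto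
      then show ?case using sig[of k] by simp
    qed
  qed auto
  have "(\<lambda>k. 2 * ((q - p i) \<bullet> ((1 / \<sigma> k) *\<^sub>R w k - (1 / \<sigma> k) *\<^sub>R \<Delta> i k)) + \<sigma> k * (norm ((1 / \<sigma> k) *\<^sub>R w k - (1 / \<sigma> k) *\<^sub>R \<Delta> i k))\<^sup>2)
     \<longlonglongrightarrow> 2 * ((q - p i) \<bullet> (0 - v i)) + 0 * (norm (0 - v i))\<^sup>2"
    by (intro tendsto_intros quot sig0 wsig)
  \<comment> \<open>After division by \<open>\<sigma> k\<close>, the bound \<open>far\<close> says
    in the limit that \<open>i\<close> does not approach \<open>q\<close>; \<open>kappa\<close> then
    leaves no velocity.\<close>
  then have "0 \<le> 2 * ((q - p i) \<bullet> (0 - v i)) + 0 * (norm (0 - v i))\<^sup>2"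
  proof (rule LIMSEQ_le_const, intro exI[of _ 0] allI impI)
    fix k
    have "2 * ((q - p i) \<bullet> ((1 / \<sigma> k) *\<^sub>R w k - (1 / \<sigma> k) *\<^sub>R \<Delta> i k)) + \<sigma> k * (norm ((1 / \<sigma> k) *\<^sub>R w k - (1 / \<sigma> k) *\<^sub>R \<Delta> i k))\<^sup>2 =
        (2 * ((q - p i) \<bullet> (w k - \<Delta> i k)) + (norm (w k - \<Delta> i k))\<^sup>2) / \<sigma> k"
    proof -
      have "2 * (z \<bullet> ((1 / \<sigma> k) *\<^sub>R a)) + \<sigma> k * (norm ((1 / \<sigma> k) *\<^sub>R a))\<^sup>2 = (2 * (z \<bullet> a) + (norm a)\<^sup>2) / \<sigma> k" for a z :: "real^2"
        using sig[of k] by (simp add: power_mult_distrib power_divide field_simps power2_eq_square)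
      then show ?thesis unfolding scaleR_diff_right[symmetric] .
    qed
    then show "0 \<le> 2 * ((q - p i) \<bullet> ((1 / \<sigma> k) *\<^sub>R w k - (1 / \<sigma> k) *\<^sub>R \<Delta> i k)) + \<sigma> k * (norm ((1 / \<sigma> k) *\<^sub>R w k - (1 / \<sigma> k) *\<^sub>R \<Delta> i k))\<^sup>2"
      using far[OF iA, of k] sig[of k] by simp
  qed
  then have "2 * ((q - p i) \<bullet> v i) \<le> 0" by simp
  then have "(norm (v i))\<^sup>2 \<le> 0" by (rule order_trans[OF kappa[OF iA]])
  then show ?thesis by (simp add: v_def p_def dc_target_def)
qed

end

section \<open>Auxiliary analysis: componentwise derivatives, squared distances and finite
  minima\<close>

lemma has_vector_derivative_vecI:
  fixes f :: "real \<Rightarrow> 'a::euclidean_space^'n::finite"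
  assumes d: "\<And>i b. b \<in> Basis \<Longrightarrow> ((\<lambda>s. b \<bullet> f s $ i) has_real_derivative b \<bullet> v $ i) (at t)"
  shows "(f has_vector_derivative v) (at t)"
  unfolding has_vector_derivative_def
proof (subst has_derivative_componentwise_within, intro ballI)
  fix B :: "'a^'n" assume "B \<in> Basis"
  then obtain b i where b: "B = axis i b" "b \<in> Basis" by (auto simp: Basis_vec_def)
  have "((\<lambda>s. b \<bullet> f s $ i) has_derivative (*) (b \<bullet> v $ i)) (at t)"
    using d[OF b(2), of i] by (simp add: has_field_derivative_def)
  moreover have "(\<lambda>s. f s \<bullet> B) = (\<lambda>s. b \<bullet> f s $ i)" by (simp add: b inner_axis inner_commute)
  moreover have "(\<lambda>h. h *\<^sub>R v \<bullet> B) = (*) (b \<bullet> v $ i)" by (auto simp: b inner_axis inner_commute)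
  ultimately show "((\<lambda>s. f s \<bullet> B) has_derivative (\<lambda>h. h *\<^sub>R v \<bullet> B)) (at t)" by simp
qed

lemma has_real_derivative_norm_square:
  fixes y :: "real \<Rightarrow> 'a::real_inner"
  assumes y: "(y has_vector_derivative z) (at t)"
  shows "((\<lambda>s. (norm (y s - x))\<^sup>2) has_real_derivative 2 * ((y t - x) \<bullet> z)) (at t)"
proof -
  have 1: "((\<lambda>s. y s - x) has_derivative (\<lambda>h. h *\<^sub>R z)) (at t)"
    using y unfolding has_vector_derivative_def by (auto intro!: derivative_eq_intros)
  have "((\<lambda>s. (y s - x) \<bullet> (y s - x)) has_derivative (\<lambda>h. (y t - x) \<bullet> (h *\<^sub>R z) + (h *\<^sub>R z) \<bullet> (y t - x))) (at t)"
    by (rule has_derivative_inner[OF 1 1])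
  moreover have "(\<lambda>h. (y t - x) \<bullet> (h *\<^sub>R z) + (h *\<^sub>R z) \<bullet> (y t - x)) = (*) (2 * ((y t - x) \<bullet> z))"
    by (auto simp: inner_commute)
  ultimately show ?thesis unfolding has_field_derivative_def power2_norm_eq_inner by simp
qed

lemma lipschitz_on_Min:
  fixes g :: "'a \<Rightarrow> 'b::metric_space \<Rightarrow> real"
  assumes A: "finite A" "A \<noteq> {}" and g: "\<And>a. a \<in> A \<Longrightarrow> K-lipschitz_on S (g a)"
  shows "K-lipschitz_on S (\<lambda>s. Min ((\<lambda>a. g a s) ` A))"
proof (rule lipschitz_onI)
  show "0 \<le> K" using A g lipschitz_on_nonneg by blast
  have le: "Min ((\<lambda>a. g a x) ` A) \<le> Min ((\<lambda>a. g a y) ` A) + K * dist x y" if xy: "x \<in> S" "y \<in> S" for x y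
  proof -
    have "Min ((\<lambda>a. g a y) ` A) \<in> (\<lambda>a. g a y) ` A" using A by (intro Min_in) auto
    then obtain a where a: "a \<in> A" "Min ((\<lambda>a. g a y) ` A) = g a y" by auto
    have "Min ((\<lambda>a. g a x) ` A) \<le> g a x" using A a by (intro Min_le) auto
    also have "\<dots> \<le> g a y + K * dist x y" using lipschitz_onD[OF g[OF a(1)] xy] by (simp add: dist_real_def abs_le_iff)
    finally show ?thesis using a by simp
  qed
  fix x y assume xy: "x \<in> S" "y \<in> S"
  show "dist (Min ((\<lambda>a. g a x) ` A)) (Min ((\<lambda>a. g a y) ` A)) \<le> K * dist x y"
    using le[OF xy] le[OF xy(2,1)] by (simp add: dist_real_def abs_le_iff dist_commute)
qed

lemma tendsto_Min_same:
  fixes g :: "'a \<Rightarrow> 'b \<Rightarrow> real"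
  assumes A: "finite A" "A \<noteq> {}" and g: "\<And>a. a \<in> A \<Longrightarrow> (g a \<longlongrightarrow> l) F"
  shows "((\<lambda>s. Min ((\<lambda>a. g a s) ` A)) \<longlongrightarrow> l) F"
proof (rule tendstoI)
  fix e :: real assume "e > 0"
  then have "\<forall>\<^sub>F s in F. \<forall>a\<in>A. dist (g a s) l < e"
    using A g by (subst eventually_ball_finite_distrib) (auto dest: tendstoD)
  then show "\<forall>\<^sub>F s in F. dist (Min ((\<lambda>a. g a s) ` A)) l < e"
  proof eventually_elim
    case (elim s)
    have "Min ((\<lambda>a. g a s) ` A) \<in> (\<lambda>a. g a s) ` A" using A by (intro Min_in) auto
    then show ?case using elim by auto
  qed
qed

context polygon
begin

section \<open>Limits of circumcenter curves\<close>

definition off_chords :: "(real^2)^'n::finite \<Rightarrow> 'n \<Rightarrow> (real^2) set" where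
  "off_chords R i = {x\<in>Q. \<forall>a b t. a extreme_point_of voronoi_cell Q R i \<longrightarrow>
     b extreme_point_of voronoi_cell Q R i \<longrightarrow> a \<noteq> b \<longrightarrow> x \<noteq> a + t *\<^sub>R (b - a)}"

text \<open>Up to the factor \<open>exp t\<close>, the rate of growth of the sum of the weighted
  distances within \<open>C\<close>. Small spread is the quantitative form of the hypothesis
  \<open>h\<close> of \<open>cluster_circumcenter_limit\<close>.\<close>

definition spread :: "'n set \<Rightarrow> (real^2)^'n::finite \<Rightarrow> real" where
  "spread C P = (\<Sum>j\<in>C. \<Sum>l\<in>C. sgn (P $ j - P $ l) \<bullet> (dc_target P $ j - dc_target P $ l))"

lemma dc_target_in_Q: "P \<in> configurations Q \<Longrightarrow> dc_target P $ i \<in> Q"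
  using circumcenter_in_cell[of P i] voronoi_cell_subset[of P i] by (auto simp: dc_target_def)

lemma spread_summand_nonneg:
  assumes "P \<in> configurations Q"
  shows "sgn (P $ j - P $ l) \<bullet> (dc_target P $ j - dc_target P $ l) \<ge> 0"
  using cell_centers_monotone[OF circumcenter_in_cell[OF assms] circumcenter_in_cell[OF assms]]
  by (simp add: sgn_inner_nonneg_iff dc_target_def)

lemma spread_summand_le:
  assumes P: "P \<in> configurations Q" and jl: "j \<in> C" "l \<in> C"
  shows "sgn (P $ j - P $ l) \<bullet> (dc_target P $ j - dc_target P $ l) \<le> spread C P"
proof -
  have "sgn (P $ j - P $ l) \<bullet> (dc_target P $ j - dc_target P $ l) \<le>
      (\<Sum>l\<in>C. sgn (P $ j - P $ l) \<bullet> (dc_target P $ j - dc_target P $ l))"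
    by (rule member_le_sum) (use jl spread_summand_nonneg[OF P] in auto)
  also have "\<dots> \<le> spread C P" unfolding spread_def
    by (rule member_le_sum) (use jl spread_summand_nonneg[OF P] in \<open>auto intro: sum_nonneg\<close>)
  finally show ?thesis .
qed

lemma spread_nonneg: "P \<in> configurations Q \<Longrightarrow> spread C P \<ge> 0"
  unfolding spread_def by (intro sum_nonneg spread_summand_nonneg)

text \<open>Directions and circumcenters range over compact sets. A sequence of counterexamples
  would have a subsequence to which \<open>cluster_circumcenter_limit\<close> applies, so that
  sequential statement has a uniform \<open>\<delta>\<close>.\<close>

lemma cluster_circumcenter_uniform:
  fixes R :: "(real^2)^'n::finite" and i0 :: 'n
  defines "C \<equiv> {j. R $ j = R $ i0}"
  assumes R: "R \<in> configurations Q" and x: "x \<in> off_chords R i0" and e: "e > 0"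
  shows "\<exists>\<delta>>0. \<forall>P\<in>configurations Q. \<forall>i\<in>C. dist P R < \<delta> \<longrightarrow>
      (\<forall>l\<in>C. norm (P $ i - x) \<le> norm (P $ l - x)) \<longrightarrow> spread C P < \<delta> \<longrightarrow>
      dist (dc_target P $ i) (circumcenter (voronoi_cell Q R i0)) < e"
proof -
  have "\<exists>\<delta>>0. \<forall>P\<in>configurations Q. dist P R < \<delta> \<longrightarrow>
      (\<forall>l\<in>C. norm (P $ i - x) \<le> norm (P $ l - x)) \<longrightarrow> spread C P < \<delta> \<longrightarrow>
      dist (dc_target P $ i) (circumcenter (voronoi_cell Q R i0)) < e" if i: "i \<in> C" for i
  proof (rule ccontr)
    assume neg: "\<not> ?thesis"
    have "\<exists>P\<in>configurations Q. dist P R < 1 / real (Suc m) \<and> (\<forall>l\<in>C. norm (P $ i - x) \<le> norm (P $ l - x)) \<and>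
        spread C P < 1 / real (Suc m) \<and> \<not> dist (dc_target P $ i) (circumcenter (voronoi_cell Q R i0)) < e" for m
    proof (rule ccontr)
      assume "\<not> ?thesis"
      then have "\<forall>P\<in>configurations Q. dist P R < 1 / real (Suc m) \<longrightarrow>
        (\<forall>l\<in>C. norm (P $ i - x) \<le> norm (P $ l - x)) \<longrightarrow> spread C P < 1 / real (Suc m) \<longrightarrow>
        dist (dc_target P $ i) (circumcenter (voronoi_cell Q R i0)) < e" by blast
      moreover have "1 / real (Suc m) > 0" by simp
      ultimately show False using neg by blast
    qed
    then obtain P where P: "\<And>m. P m \<in> configurations Q" "\<And>m. dist (P m) R < 1 / real (Suc m)"
      "\<And>m l. l \<in> C \<Longrightarrow> norm (P m $ i - x) \<le> norm (P m $ l - x)" "\<And>m. spread C (P m) < 1 / real (Suc m)"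
      "\<And>m. \<not> dist (dc_target (P m) $ i) (circumcenter (voronoi_cell Q R i0)) < e"
      by metis
    have inv: "(\<lambda>m. 1 / real (Suc m)) \<longlonglongrightarrow> 0" using LIMSEQ_inverse_real_of_nat by (simp add: inverse_eq_divide)
    have PR: "P \<longlonglongrightarrow> R"
      by (rule metric_tendsto_imp_tendsto[OF inv]) (use P(2) in \<open>auto simp: dist_real_def less_imp_le\<close>)
    have sp: "(\<lambda>m. spread C (P m)) \<longlonglongrightarrow> 0"
    proof (rule tendsto_sandwich[OF _ _ tendsto_const inv])
      show "\<forall>\<^sub>F m in sequentially. 0 \<le> spread C (P m)" using spread_nonneg[OF P(1)] by simp
      show "\<forall>\<^sub>F m in sequentially. spread C (P m) \<le> 1 / real (Suc m)"
        using P(4) by (intro always_eventually allI less_imp_le)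
    qed
    \<comment> \<open>All directions form one compact vector, so a single subsequence makes every
      pair converge.\<close>
    define U where "U m = ((\<chi> j l. sgn (P m $ j - P m $ l)) :: ((real^2)^'n)^'n)" for m
    let ?K = "{f :: ((real^2)^'n)^'n. \<forall>j. f $ j \<in> {g. \<forall>l. g $ l \<in> cball 0 1}}"
    have "compact ?K" by (intro compact_all_components compact_cball)
    moreover have "U m \<in> ?K" for m by (simp add: U_def norm_sgn)
    ultimately obtain UL r1 where r1: "strict_mono (r1 :: nat \<Rightarrow> nat)" "(U \<circ> r1) \<longlonglongrightarrow> UL"
      unfolding compact_def by meson
    have "dc_target (P (r1 m)) \<in> configurations Q" for m
      using dc_target_in_Q[OF P(1)] by (simp add: configurations_def)
    then obtain CL r2 where r2: "strict_mono (r2 :: nat \<Rightarrow> nat)" "((\<lambda>m. dc_target (P (r1 m))) \<circ> r2) \<longlonglongrightarrow> CL"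
      using configurations_compact unfolding compact_def by meson
    define r where "r = r1 \<circ> r2"
    have r: "strict_mono r" unfolding r_def by (rule strict_mono_o[OF r1(1) r2(1)])
    have UL: "(\<lambda>m. U (r m)) \<longlonglongrightarrow> UL" using LIMSEQ_subseq_LIMSEQ[OF r1(2) r2(1)] by (simp add: r_def o_def)
    have CL: "(\<lambda>m. dc_target (P (r m))) \<longlonglongrightarrow> CL" using r2(2) by (simp add: r_def o_def)
    have "CL $ i = circumcenter (voronoi_cell Q R i0)"
    proof (rule cluster_circumcenter_limit[of "\<lambda>m. P (r m)" R i0 "\<lambda>j l. UL $ j $ l" "\<lambda>j. CL $ j" x i])
      show "(\<lambda>m. P (r m)) \<longlonglongrightarrow> R" using LIMSEQ_subseq_LIMSEQ[OF PR r] by (simp add: o_def)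
      show "(\<lambda>m. sgn (P (r m) $ j - P (r m) $ l)) \<longlonglongrightarrow> UL $ j $ l" for j l
        using tendsto_vec_nth[OF tendsto_vec_nth[OF UL, of j], of l] by (simp add: U_def)
      show "(\<lambda>m. circumcenter (voronoi_cell Q (P (r m)) j)) \<longlonglongrightarrow> CL $ j" for j
        using tendsto_vec_nth[OF CL, of j] by (simp add: dc_target_def)
      show "(\<lambda>m. sgn (P (r m) $ j - P (r m) $ l) \<bullet>
          (circumcenter (voronoi_cell Q (P (r m)) j) - circumcenter (voronoi_cell Q (P (r m)) l))) \<longlonglongrightarrow> 0"
        if "j \<in> {j. R $ j = R $ i0}" "l \<in> {j. R $ j = R $ i0}" for j l
      proof (rule tendsto_sandwich[OF _ _ tendsto_const])
        show "(\<lambda>m. spread C (P (r m))) \<longlonglongrightarrow> 0" using LIMSEQ_subseq_LIMSEQ[OF sp r] by (simp add: o_def)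
        show "\<forall>\<^sub>F m in sequentially. 0 \<le> sgn (P (r m) $ j - P (r m) $ l) \<bullet>
          (circumcenter (voronoi_cell Q (P (r m)) j) - circumcenter (voronoi_cell Q (P (r m)) l))"
          using spread_summand_nonneg[OF P(1)] by (simp add: dc_target_def)
        show "\<forall>\<^sub>F m in sequentially. sgn (P (r m) $ j - P (r m) $ l) \<bullet>
          (circumcenter (voronoi_cell Q (P (r m)) j) - circumcenter (voronoi_cell Q (P (r m)) l)) \<le> spread C (P (r m))"
          using spread_summand_le[OF P(1), of j C l] that by (simp add: dc_target_def C_def)
      qed
    qed (use P R x i in \<open>auto simp: off_chords_def C_def\<close>)
    moreover have "(\<lambda>m. dist (dc_target (P (r m)) $ i) (circumcenter (voronoi_cell Q R i0))) \<longlonglongrightarrow>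
        dist (CL $ i) (circumcenter (voronoi_cell Q R i0))" by (intro tendsto_intros CL)
    then have "e \<le> dist (CL $ i) (circumcenter (voronoi_cell Q R i0))"
      by (rule LIMSEQ_le_const) (use P(5) in \<open>auto simp: not_less\<close>)
    ultimately show False using e by simp
  qed
  then have "\<forall>i\<in>C. \<exists>\<delta>>0. \<forall>P\<in>configurations Q. dist P R < \<delta> \<longrightarrow>
      (\<forall>l\<in>C. norm (P $ i - x) \<le> norm (P $ l - x)) \<longrightarrow> spread C P < \<delta> \<longrightarrow>
      dist (dc_target P $ i) (circumcenter (voronoi_cell Q R i0)) < e" by blast
  then obtain d where d: "\<And>i. i \<in> C \<Longrightarrow> d i > 0"
     "\<And>i P. i \<in> C \<Longrightarrow> P \<in> configurations Q \<Longrightarrow> dist P R < d i \<Longrightarrow>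
      (\<forall>l\<in>C. norm (P $ i - x) \<le> norm (P $ l - x)) \<Longrightarrow> spread C P < d i \<Longrightarrow>
      dist (dc_target P $ i) (circumcenter (voronoi_cell Q R i0)) < e"
    unfolding bchoice_iff by blast
  define \<delta> where "\<delta> = Min (insert 1 (d ` C))"
  have "\<delta> > 0" unfolding \<delta>_def using d(1) by (subst Min_gr_iff) auto
  moreover have "\<delta> \<le> d i" if "i \<in> C" for i using that by (auto simp: \<delta>_def)
  ultimately show ?thesis using d(2) by (intro exI[of _ \<delta>]) (meson less_le_trans)
qed

text \<open>A polygonal cell has finitely many vertices, hence finitely many lines to avoid. A whole
  ball is produced because derivatives of the distances to neighboring points will be
  compared.\<close>

lemma off_chords_open_subset:
  fixes R :: "(real^2)^'n::finite"
  obtains x \<eta> where "\<eta> > 0" "ball x \<eta> \<subseteq> off_chords R i"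
proof -
  let ?E = "{v. v extreme_point_of voronoi_cell Q R i}"
  have fin: "finite ?E" by (rule finite_polyhedron_extreme_points[OF voronoi_cell_polyhedron])
  \<comment> \<open>A quarter turn, which makes the direction of a line into its normal.\<close>
  define rot where "rot w = ((\<chi> k. if k = 1 then - w $ 2 else w $ 1) :: real^2)" for w :: "real^2"
  have rot0: "rot w \<bullet> w = 0" for w by (simp add: rot_def inner_vec_def sum_2)
  have rotne: "rot w \<noteq> 0" if "w \<noteq> 0" for w using that by (auto simp: rot_def vec_eq_iff forall_2)
  define A where "A = (\<lambda>(a,b). (rot (b - a), rot (b - a) \<bullet> a)) ` {(a,b). a \<in> ?E \<and> b \<in> ?E \<and> a \<noteq> b}"
  have "finite {(a,b). a \<in> ?E \<and> b \<in> ?E \<and> a \<noteq> b}"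
    by (rule finite_subset[of _ "?E \<times> ?E"]) (use fin in auto)
  then have finA: "finite A" by (simp add: A_def)
  have Ane: "a \<noteq> 0" if "(a,b) \<in> A" for a b
    using that unfolding A_def
  proof (rule imageE)
    fix ab assume "(a, b) = (\<lambda>(a,b). (rot (b - a), rot (b - a) \<bullet> a)) ab" "ab \<in> {(a,b). a \<in> ?E \<and> b \<in> ?E \<and> a \<noteq> b}"
    then show "a \<noteq> 0" using rotne[of "snd ab - fst ab"] by (cases ab) auto
  qed
  have "\<exists>x\<in>interior Q. \<forall>(a,b)\<in>A. a \<bullet> x \<noteq> b"
    by (rule open_avoids_hyperplanes[OF open_interior Q_interior finA Ane])
  then obtain x where x: "x \<in> interior Q" "\<forall>(a,b)\<in>A. a \<bullet> x \<noteq> b" by blast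
  define S where "S = interior Q \<inter> (\<Inter>ab\<in>A. - {x. fst ab \<bullet> x = snd ab})"
  have "open S" unfolding S_def
    using finA by (intro open_Int open_interior open_INT) (auto simp: open_Compl closed_hyperplane)
  moreover have "x \<in> S" using x by (auto simp: S_def)
  ultimately obtain \<eta> where eta: "\<eta> > 0" "ball x \<eta> \<subseteq> S" using open_contains_ball by blast
  have "S \<subseteq> off_chords R i"
  proof
    fix y assume y: "y \<in> S"
    then have "y \<in> Q" using interior_subset by (auto simp: S_def)
    moreover have "y \<noteq> a + t *\<^sub>R (b - a)" if ab: "a \<in> ?E" "b \<in> ?E" "a \<noteq> b" for a b t
    proof -
      have "(rot (b - a), rot (b - a) \<bullet> a) \<in> A" using ab by (auto simp: A_def)
      then have "rot (b - a) \<bullet> y \<noteq> rot (b - a) \<bullet> a" using y by (force simp: S_def)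
      moreover have "rot (b - a) \<bullet> (a + t *\<^sub>R (b - a)) = rot (b - a) \<bullet> a"
        by (simp add: inner_add_right rot0)
      ultimately show ?thesis by metis
    qed
    ultimately show "y \<in> off_chords R i" by (auto simp: off_chords_def)
  qed
  then show thesis using eta that by blast
qed

text \<open>Along \<open>P k\<close>, the slope of the minimal squared distance to \<open>x\<close>
  over the cluster differs from the expected \<open>\<alpha>\<close> by at most
  \<open>e + M * spread C S\<close>. Adding \<open>M\<close> times the weighted distances
  compensates the second term. These distances tend to 0 and the minimum tends to
  \<open>\<phi>\<close>.\<close>

lemma dc_limit_sq_dist_derivative:
  fixes P :: "nat \<Rightarrow> real \<Rightarrow> (real^2)^'n::finite" and i0 :: 'n
  assumes c: "\<And>k. dc_curve L (P k) (N k)"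
    and lim: "\<And>\<tau>. \<tau> \<ge> 0 \<Longrightarrow> (\<lambda>k. P k \<tau>) \<longlonglongrightarrow> \<Gamma> \<tau>"
    and \<tau>0: "0 < \<tau>0" "\<tau>0 < b"
    and coin: "\<And>j \<tau>. \<Gamma> \<tau>0 $ j = \<Gamma> \<tau>0 $ i0 \<Longrightarrow> 0 \<le> \<tau> \<Longrightarrow> \<tau> \<le> b \<Longrightarrow> \<Gamma> \<tau> $ j = \<Gamma> \<tau> $ i0"
    and x: "x \<in> off_chords (\<Gamma> \<tau>0) i0"
  shows "((\<lambda>\<tau>. (norm (\<Gamma> \<tau> $ i0 - x))\<^sup>2) has_real_derivative
      2 * ((\<Gamma> \<tau>0 $ i0 - x) \<bullet> (dc_target (\<Gamma> \<tau>0) $ i0 - \<Gamma> \<tau>0 $ i0))) (at \<tau>0)"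
proof -
  define R where "R = \<Gamma> \<tau>0"
  define C where "C = {j. R $ j = R $ i0}"
  define p where "p = R $ i0"
  define cV where "cV = circumcenter (voronoi_cell Q R i0)"
  define \<alpha> where "\<alpha> = 2 * ((p - x) \<bullet> (cV - p))"
  define \<phi> where "\<phi> \<tau> = (norm (\<Gamma> \<tau> $ i0 - x))\<^sup>2" for \<tau>
  have CC: "finite C" "C \<noteq> {}" by (auto simp: C_def)
  have PX: "P k \<tau> \<in> configurations Q" if "\<tau> \<ge> 0" for k \<tau> using cell_curveD(3)[OF c that] .
  have RX: "R \<in> configurations Q" unfolding R_def
    by (rule closed_sequentially[OF compact_imp_closed[OF configurations_compact] _ lim]) (use PX \<tau>0 in auto)
  have xQ: "x \<in> Q" using x by (simp add: off_chords_def)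
  have L0: "L \<ge> 0" using cell_curveD(2)[OF c] lipschitz_on_nonneg by blast
  obtain B where B: "\<And>y. y \<in> Q \<Longrightarrow> norm y \<le> B" using compact_imp_bounded[OF Q_compact] bounded_iff by blast
  define D where "D = 2 * B + 1"
  have "B \<ge> 0" using B[OF xQ] norm_ge_zero order_trans by blast
  then have D0: "D > 0" by (simp add: D_def)
  have D: "norm (y - z) \<le> D" if "y \<in> Q" "z \<in> Q" for y z
    using norm_triangle_ineq4[of y z] B[OF that(1)] B[OF that(2)] by (simp add: D_def)
  have pQ: "p \<in> Q" using RX by (simp add: p_def configurations_def)
  have cQ: "cV \<in> Q" unfolding cV_def using circumcenter_in_cell[OF RX] voronoi_cell_subset by blast
  have inner_D: "\<bar>2 * ((y - x) \<bullet> (z - y))\<bar> \<le> 2 * D\<^sup>2" if "y \<in> Q" "z \<in> Q" for y z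
  proof -
    have "\<bar>(y - x) \<bullet> (z - y)\<bar> \<le> norm (y - x) * norm (z - y)" by (rule Cauchy_Schwarz_ineq2)
    also have "\<dots> \<le> D * D" using D that xQ D0 by (intro mult_mono) auto
    finally show ?thesis by (simp add: power2_eq_square)
  qed
  have main: "\<exists>d>0. \<forall>u v. \<tau>0 - d < u \<and> u \<le> v \<and> v < \<tau>0 + d \<longrightarrow> \<bar>\<phi> v - \<phi> u - \<alpha> * (v - u)\<bar> \<le> e * (v - u)" if e: "e > 0" for e
  proof -
    \<comment> \<open>Three error terms of size \<open>D * \<eta>\<close>, doubled by the derivative
      of the square.\<close>
    define \<eta> where "\<eta> = e / (6 * D)"
    have eta: "\<eta> > 0" "6 * D * \<eta> = e" using e D0 by (auto simp: \<eta>_def)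
    obtain \<delta> where \<delta>: "\<delta> > 0" "\<And>S i. S \<in> configurations Q \<Longrightarrow> i \<in> C \<Longrightarrow> dist S R < \<delta> \<Longrightarrow>
        (\<forall>l\<in>C. norm (S $ i - x) \<le> norm (S $ l - x)) \<Longrightarrow> spread C S < \<delta> \<Longrightarrow> dist (dc_target S $ i) cV < \<eta>"
      using cluster_circumcenter_uniform[OF RX x[folded R_def] eta(1)] unfolding C_def cV_def by blast
    \<comment> \<open>When the spread is at least \<open>\<delta>\<close>, only the crude bound
      \<open>4 * D\<^sup>2\<close> is available; this \<open>M\<close> makes it at most
      \<open>M * spread C S\<close>.\<close>
    define M where "M = 4 * D\<^sup>2 / \<delta>"
    have M: "M \<ge> 0" "M * \<delta> = 4 * D\<^sup>2" using \<delta>(1) by (auto simp: M_def)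
    have err: "\<bar>2 * ((S $ i - x) \<bullet> (dc_target S $ i - S $ i)) - \<alpha>\<bar> \<le> e + M * spread C S"
      if S: "S \<in> configurations Q" "dist S R < min \<delta> \<eta>" and i: "i \<in> C" "\<forall>l\<in>C. norm (S $ i - x) \<le> norm (S $ l - x)" for S i
    proof (cases "spread C S < \<delta>")
      case False
      have SQ: "S $ i \<in> Q" "dc_target S $ i \<in> Q"
        using S(1) dc_target_in_Q[OF S(1)] by (auto simp: configurations_def)
      have "\<bar>2 * ((S $ i - x) \<bullet> (dc_target S $ i - S $ i)) - \<alpha>\<bar> \<le> 2 * D\<^sup>2 + 2 * D\<^sup>2"
        using inner_D[OF SQ] inner_D[OF pQ cQ] unfolding \<alpha>_def by linarith
      also have "\<dots> = M * \<delta>" using M by simp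
      also have "\<dots> \<le> M * spread C S" using False M by (intro mult_left_mono) auto
      finally show ?thesis using e by simp
    next
      case True
      define a where "a = S $ i"
      define z where "z = dc_target S $ i"
      have zc: "norm (z - cV) \<le> \<eta>" using \<delta>(2)[OF S(1) i(1) _ i(2) True] S(2) by (simp add: dist_norm z_def)
      have "R $ i = p" using i(1) by (simp add: C_def p_def)
      then have ap: "norm (a - p) \<le> \<eta>"
        using S(2) Finite_Cartesian_Product.norm_nth_le[of "S - R" i] by (simp add: dist_norm a_def)
      have aQ: "a \<in> Q" "z \<in> Q"
        using S(1) dc_target_in_Q[OF S(1)] by (auto simp: configurations_def a_def z_def)
      have "(a - x) \<bullet> (z - a) - (p - x) \<bullet> (cV - p) = (a - p) \<bullet> (z - a) + (p - x) \<bullet> ((z - cV) - (a - p))"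
        by (simp add: inner_diff_left inner_diff_right algebra_simps)
      also have "\<bar>\<dots>\<bar> \<le> norm (a - p) * norm (z - a) + norm (p - x) * norm ((z - cV) - (a - p))"
        using Cauchy_Schwarz_ineq2[of "a - p" "z - a"] Cauchy_Schwarz_ineq2[of "p - x" "(z - cV) - (a - p)"] by linarith
      also have "\<dots> \<le> \<eta> * D + D * (\<eta> + \<eta>)"
      proof (intro add_mono mult_mono)
        show "norm (z - cV - (a - p)) \<le> \<eta> + \<eta>" using norm_triangle_ineq4[of "z - cV" "a - p"] zc ap by linarith
      qed (use ap D aQ pQ xQ D0 eta in auto)
      finally have "\<bar>2 * ((a - x) \<bullet> (z - a)) - \<alpha>\<bar> \<le> 6 * D * \<eta>" unfolding \<alpha>_def by (simp add: abs_le_iff algebra_simps)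
      then show ?thesis using eta(2) spread_nonneg[OF S(1), of C] M(1) unfolding a_def z_def
        by (simp add: add_increasing2)
    qed
    \<comment> \<open>Keeps the times inside \<open>[0, b]\<close>, and spends half of
      \<open>min \<delta> \<eta>\<close> on the motion of \<open>P k\<close>; the other half covers
      the distance of \<open>P k \<tau>0\<close> from \<open>R\<close>.\<close>
    define d where "d = min (min \<tau>0 (b - \<tau>0)) (min \<delta> \<eta> / (2 * (L + 1)))"
    have d0: "d > 0" using \<tau>0 \<delta> eta L0 by (auto simp: d_def)
    have dL: "L * d \<le> min \<delta> \<eta> / 2"
    proof -
      have "L * d \<le> (L + 1) * (min \<delta> \<eta> / (2 * (L + 1)))" using L0 d0 by (intro mult_mono) (auto simp: d_def)
      also have "\<dots> = min \<delta> \<eta> / 2" using L0 by (simp add: field_simps)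
      finally show ?thesis .
    qed
    have "\<forall>\<^sub>F k in sequentially. dist (P k \<tau>0) R < min \<delta> \<eta> / 2"
      using tendstoD[OF lim[of \<tau>0], of "min \<delta> \<eta> / 2"] \<tau>0 \<delta>(1) eta(1) by (simp add: R_def)
    then obtain k0 where k0: "\<And>k. k \<ge> k0 \<Longrightarrow> dist (P k \<tau>0) R < min \<delta> \<eta> / 2"
      unfolding eventually_sequentially by blast
    have close: "dist (P k \<tau>) R < min \<delta> \<eta>" if "k \<ge> k0" "\<bar>\<tau> - \<tau>0\<bar> < d" for k \<tau>
    proof -
      have t0: "\<tau> \<ge> 0" using that(2) by (auto simp: d_def)
      have "dist (P k \<tau>) (P k \<tau>0) \<le> L * dist \<tau> \<tau>0"
        by (rule lipschitz_onD[OF cell_curveD(2)[OF c]]) (use t0 \<tau>0 in auto)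
      also have "\<dots> \<le> L * d" using that L0 by (intro mult_left_mono) (auto simp: dist_real_def)
      finally show ?thesis using dL k0[OF that(1)] dist_triangle[of "P k \<tau>" R "P k \<tau>0"] by linarith
    qed
    define f where "f k \<tau> = Min ((\<lambda>i. (norm (P k \<tau> $ i - x))\<^sup>2) ` C)" for k \<tau>
    define E where "E k \<tau> = (\<Sum>j\<in>C. \<Sum>l\<in>C. exp \<tau> * norm (P k \<tau> $ j - P k \<tau> $ l))" for k \<tau>
    have fE: "(\<alpha> - e) * (v - u) \<le> f k v - f k u + M * (E k v - E k u) \<and>
        (- \<alpha> - e) * (v - u) \<le> - f k v + f k u + M * (E k v - E k u)"
      if k: "k \<ge> k0" and uv: "\<tau>0 - d < u" "u \<le> v" "v < \<tau>0 + d" for k u v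
    proof -
      have u0: "0 \<le> u" using uv by (auto simp: d_def)
      have comp_lip: "L-lipschitz_on {u..v} (\<lambda>s. P k s $ i)" for i by (rule cell_curve_component_lipschitz[OF c u0])
      have sq_lip: "(2 * D * L)-lipschitz_on {u..v} (\<lambda>s. (norm (P k s $ i - x))\<^sup>2)" for i
      proof (rule lipschitz_onI)
        fix s s' assume ss: "s \<in> {u..v}" "s' \<in> {u..v}"
        let ?a = "norm (P k s $ i - x)" and ?b = "norm (P k s' $ i - x)"
        have ab: "?a \<le> D" "?b \<le> D" using PX[of s k] PX[of s' k] ss u0 D xQ by (auto simp: configurations_def)
        have "\<bar>?a - ?b\<bar> \<le> norm (P k s $ i - P k s' $ i)" using norm_triangle_ineq3[of "P k s $ i - x" "P k s' $ i - x"] by simp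
        also have "\<dots> \<le> L * dist s s'" using lipschitz_onD[OF comp_lip ss] by (simp add: dist_norm)
        finally have 1: "\<bar>?a - ?b\<bar> \<le> L * dist s s'" .
        have "\<bar>?a\<^sup>2 - ?b\<^sup>2\<bar> = (?a + ?b) * \<bar>?a - ?b\<bar>"
          by (simp add: power2_eq_square square_diff_square_factored abs_mult)
        also have "\<dots> \<le> (2 * D) * (L * dist s s')" using 1 ab D0 by (intro mult_mono) auto
        finally show "dist (?a\<^sup>2) (?b\<^sup>2) \<le> 2 * D * L * dist s s'" by (simp add: dist_real_def mult.assoc)
      qed (use D0 L0 in simp)
      have f_lip: "(2 * D * L)-lipschitz_on {u..v} (f k)"
        unfolding f_def by (rule lipschitz_on_Min[OF CC sq_lip])
      have "\<exists>K. \<forall>j l. K-lipschitz_on {u..v} (\<lambda>s. exp s * norm (P k s $ j - P k s $ l))"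
      proof -
        have "\<forall>jl. \<exists>K. K-lipschitz_on {u..v} (\<lambda>s. exp s * norm (P k s $ fst jl - P k s $ snd jl))"
          by (intro allI cell_curve_exp_dist_lipschitz[OF c u0 uv(2)])
        from choice[OF this] obtain K where K: "\<And>jl. (K jl)-lipschitz_on {u..v} (\<lambda>s. exp s * norm (P k s $ fst jl - P k s $ snd jl))"
          by (elim exE) (rule that, erule spec)
        have "K jl \<le> Max (range K)" for jl by (rule Max_ge) auto
        then have "(Max (range K))-lipschitz_on {u..v} (\<lambda>s. exp s * norm (P k s $ fst jl - P k s $ snd jl))" for jl
          by (rule lipschitz_on_mono[OF K order_refl])
        from this[of "(_, _)"] have "\<forall>j l. (Max (range K))-lipschitz_on {u..v} (\<lambda>s. exp s * norm (P k s $ j - P k s $ l))"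
          by simp
        then show ?thesis by blast
      qed
      then obtain K where K: "\<And>j l. K-lipschitz_on {u..v} (\<lambda>s. exp s * norm (P k s $ j - P k s $ l))" by blast
      have sum_lip: "(\<Sum>a\<in>A. K')-lipschitz_on {u..v} (\<lambda>s. \<Sum>a\<in>A. g a s)"
        if "finite A" "\<And>a. a \<in> A \<Longrightarrow> K'-lipschitz_on {u..v} (g a)" for A :: "'n set" and g :: "'n \<Rightarrow> real \<Rightarrow> real" and K'
        using that
      proof (induction A rule: finite_induct)
        case empty
        then show ?case by (simp add: lipschitz_on_constant)
      next
        case (insert a A)
        then show ?case by (simp add: lipschitz_on_add del: sum_constant)
      qed
      have E_lip: "(\<Sum>j\<in>C. \<Sum>l\<in>C. K)-lipschitz_on {u..v} (E k)"
        unfolding E_def by (intro sum_lip CC(1) K)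
      have ME_lip: "(\<bar>M\<bar> * (\<Sum>j\<in>C. \<Sum>l\<in>C. K))-lipschitz_on {u..v} (\<lambda>s. M * E k s)"
        by (rule lipschitz_on_cmult_real[OF E_lip])
      have slopes: "lower_slope (\<lambda>s. f k s + M * E k s) t (\<alpha> - e) \<and> lower_slope (\<lambda>s. - f k s + M * E k s) t (- \<alpha> - e)"
        if t: "u < t" "t < v" "t \<notin> N k" for t
      proof -
        have t0: "t > 0" "t \<ge> 0" using t u0 by auto
        define S where "S = P k t"
        have SX: "S \<in> configurations Q" unfolding S_def by (rule PX[OF t0(2)])
        have Sclose: "dist S R < min \<delta> \<eta>" unfolding S_def by (rule close[OF k]) (use t uv in auto)
        have der: "((\<lambda>s. (norm (P k s $ i - x))\<^sup>2) has_real_derivative 2 * ((S $ i - x) \<bullet> (dc_target S $ i - S $ i))) (at t)" for i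
          using has_real_derivative_norm_square[OF vec_nth_has_vector_derivative[OF cell_curveD(4)[OF c t0(1) t(3)]], of i x]
          by (simp add: S_def)
        then have cont: "isCont (\<lambda>s. (norm (P k s $ i - x))\<^sup>2) t" for i by (rule DERIV_isCont)
        have active: "\<forall>l\<in>C. norm (S $ i - x) \<le> norm (S $ l - x)"
          if "(norm (P k t $ i - x))\<^sup>2 = Min ((\<lambda>i. (norm (P k t $ i - x))\<^sup>2) ` C)" for i
        proof
          fix l assume "l \<in> C"
          then have "(norm (S $ i - x))\<^sup>2 \<le> (norm (S $ l - x))\<^sup>2" using that CC(1) unfolding S_def by simp
          then show "norm (S $ i - x) \<le> norm (S $ l - x)" by (simp add: power_mono_iff)
        qed
        have f1: "lower_slope (f k) t (\<alpha> - e - M * spread C S)"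
          unfolding f_def
        proof (rule lower_slope_Min[OF CC cont])
          fix i assume i: "i \<in> C" "(norm (P k t $ i - x))\<^sup>2 = Min ((\<lambda>i. (norm (P k t $ i - x))\<^sup>2) ` C)"
          show "lower_slope (\<lambda>s. (norm (P k s $ i - x))\<^sup>2) t (\<alpha> - e - M * spread C S)"
            by (rule lower_slope_mono[OF lower_slope_has_derivative[OF der]])
              (use err[OF SX Sclose i(1) active[OF i(2)]] in linarith)
        qed
        have f2: "lower_slope (\<lambda>s. - f k s) t (- \<alpha> - e - M * spread C S)"
          unfolding f_def
        proof (rule lower_slope_uminus_Min[OF CC cont])
          fix i assume i: "i \<in> C" "(norm (P k t $ i - x))\<^sup>2 = Min ((\<lambda>i. (norm (P k t $ i - x))\<^sup>2) ` C)"
          show "lower_slope (\<lambda>s. - (norm (P k s $ i - x))\<^sup>2) t (- \<alpha> - e - M * spread C S)"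
            by (rule lower_slope_mono[OF lower_slope_has_derivative[OF DERIV_minus[OF der]]])
              (use err[OF SX Sclose i(1) active[OF i(2)]] in linarith)
        qed
        have E1: "lower_slope (E k) t (\<Sum>j\<in>C. \<Sum>l\<in>C. exp t * (sgn (S $ j - S $ l) \<bullet> (dc_target S $ j - dc_target S $ l)))"
          unfolding E_def S_def
        proof (intro lower_slope_sum CC lower_slope_has_derivative cell_curve_exp_dist_derivative[OF c t0(1) t(3)])
          fix j l
          \<comment> \<open>Coincident generators share their cell and so their circumcenter, which
            is the differentiable case at the kink of the norm.\<close>
          show "P k t $ j \<noteq> P k t $ l \<or> dc_target (P k t) $ j = dc_target (P k t) $ l"
            using voronoi_cell_cong[of "P k t" j l Q] by (auto simp: dc_target_def)
        qed
        have "(\<Sum>j\<in>C. \<Sum>l\<in>C. exp t * (sgn (S $ j - S $ l) \<bullet> (dc_target S $ j - dc_target S $ l))) = exp t * spread C S"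
          by (simp add: spread_def sum_distrib_left)
        \<comment> \<open>Times are positive, so \<open>exp t\<close> is at least 1 and the
          compensating term grows at least at the rate of the spread.\<close>
        moreover have "spread C S \<le> exp t * spread C S"
          using spread_nonneg[OF SX, of C] t0 by (simp add: mult_le_cancel_right1)
        ultimately have E2: "lower_slope (\<lambda>s. M * E k s) t (M * spread C S)"
          using lower_slope_mono[OF lower_slope_cmult[OF E1 M(1)], of "M * spread C S"] M(1) by (simp add: mult_left_mono)
        show ?thesis using lower_slope_add[OF f1 E2] lower_slope_add[OF f2 E2] by simp
      qed
      have "(\<alpha> - e) * (v - u) \<le> (f k v + M * E k v) - (f k u + M * E k u)"
        by (rule ae_lower_slope_lipschitz[OF uv(2) lipschitz_on_add[OF f_lip ME_lip] cell_curveD(1)[OF c]]) (use slopes in blast)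
      moreover have "(- \<alpha> - e) * (v - u) \<le> (- f k v + M * E k v) - (- f k u + M * E k u)"
        by (rule ae_lower_slope_lipschitz[OF uv(2) lipschitz_on_add[OF lipschitz_on_minus[OF f_lip] ME_lip] cell_curveD(1)[OF c]]) (use slopes in blast)
      ultimately show ?thesis by (simp add: algebra_simps)
    qed
    have lim_f: "(\<lambda>k. f k \<tau>) \<longlonglongrightarrow> \<phi> \<tau>" if t: "0 \<le> \<tau>" "\<tau> \<le> b" for \<tau>
      unfolding f_def
    proof (rule tendsto_Min_same[OF CC])
      fix i assume "i \<in> C"
      then have "\<Gamma> \<tau> $ i = \<Gamma> \<tau> $ i0" using coin[of i \<tau>] t by (simp add: C_def R_def)
      moreover have "(\<lambda>k. (norm (P k \<tau> $ i - x))\<^sup>2) \<longlonglongrightarrow> (norm (\<Gamma> \<tau> $ i - x))\<^sup>2"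
        by (intro tendsto_intros lim[OF t(1)])
      ultimately show "(\<lambda>k. (norm (P k \<tau> $ i - x))\<^sup>2) \<longlonglongrightarrow> \<phi> \<tau>" by (simp add: \<phi>_def)
    qed
    \<comment> \<open>By \<open>coin\<close> the limits of the cluster coincide throughout
      \<open>[0, b]\<close>, so the total charge disappears in the limit.\<close>
    have lim_E: "(\<lambda>k. E k \<tau>) \<longlonglongrightarrow> 0" if t: "0 \<le> \<tau>" "\<tau> \<le> b" for \<tau>
    proof -
      have "(\<lambda>k. E k \<tau>) \<longlonglongrightarrow> (\<Sum>j\<in>C. \<Sum>l\<in>C. exp \<tau> * norm (\<Gamma> \<tau> $ j - \<Gamma> \<tau> $ l))"
        unfolding E_def by (intro tendsto_intros lim[OF t(1)])
      moreover have "\<Gamma> \<tau> $ j = \<Gamma> \<tau> $ i0" if "j \<in> C" for j using coin[of j \<tau>] t that by (simp add: C_def R_def)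
      then have "(\<Sum>j\<in>C. \<Sum>l\<in>C. exp \<tau> * norm (\<Gamma> \<tau> $ j - \<Gamma> \<tau> $ l)) = 0" by simp
      ultimately show ?thesis by simp
    qed
    show ?thesis
    proof (intro exI[of _ d] conjI allI impI d0)
      fix u v assume uv: "\<tau>0 - d < u \<and> u \<le> v \<and> v < \<tau>0 + d"
      have t: "0 \<le> u" "u \<le> b" "0 \<le> v" "v \<le> b" using uv by (auto simp: d_def)
      have 1: "(\<lambda>k. f k v - f k u + M * (E k v - E k u)) \<longlonglongrightarrow> \<phi> v - \<phi> u + M * (0 - 0)"
        by (intro tendsto_intros lim_f lim_E t)
      have 2: "(\<lambda>k. - f k v + f k u + M * (E k v - E k u)) \<longlonglongrightarrow> - \<phi> v + \<phi> u + M * (0 - 0)"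
        by (intro tendsto_intros lim_f lim_E t)
      have "(\<alpha> - e) * (v - u) \<le> \<phi> v - \<phi> u + M * (0 - 0)"
        by (rule LIMSEQ_le_const[OF 1]) (use fE uv in blast)
      moreover have "(- \<alpha> - e) * (v - u) \<le> - \<phi> v + \<phi> u + M * (0 - 0)"
        by (rule LIMSEQ_le_const[OF 2]) (use fE uv in blast)
      ultimately show "\<bar>\<phi> v - \<phi> u - \<alpha> * (v - u)\<bar> \<le> e * (v - u)" by (simp add: abs_le_iff algebra_simps)
    qed
  qed
  have "(\<phi> has_derivative (*) \<alpha>) (at \<tau>0)"
    unfolding has_derivative_at_alt
  proof (intro conjI allI impI)
    fix e :: real assume "e > 0"
    then obtain d where d: "d > 0" "\<And>u v. \<tau>0 - d < u \<Longrightarrow> u \<le> v \<Longrightarrow> v < \<tau>0 + d \<Longrightarrow> \<bar>\<phi> v - \<phi> u - \<alpha> * (v - u)\<bar> \<le> e * (v - u)"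
      using main by blast
    show "\<exists>d>0. \<forall>y. norm (y - \<tau>0) < d \<longrightarrow> norm (\<phi> y - \<phi> \<tau>0 - \<alpha> * (y - \<tau>0)) \<le> e * norm (y - \<tau>0)"
    proof (intro exI[of _ d] conjI allI impI d(1))
      fix y assume "norm (y - \<tau>0) < d"
      then have y: "\<tau>0 - d < y" "y < \<tau>0 + d" by auto
      show "norm (\<phi> y - \<phi> \<tau>0 - \<alpha> * (y - \<tau>0)) \<le> e * norm (y - \<tau>0)"
      proof (cases "\<tau>0 \<le> y")
        case True
        then show ?thesis using d(2)[of \<tau>0 y] d(1) y by simp
      next
        case False
        then have "\<bar>\<phi> \<tau>0 - \<phi> y - \<alpha> * (\<tau>0 - y)\<bar> \<le> e * (\<tau>0 - y)" using d(2)[of y \<tau>0] d(1) y by simp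
        then show ?thesis using False by (simp add: abs_le_iff algebra_simps)
      qed
    qed
  qed (rule bounded_linear_mult_right)
  then show ?thesis unfolding has_field_derivative_def \<phi>_def \<alpha>_def p_def cV_def R_def by (simp add: dc_target_def)
qed

text \<open>The squared distances to \<open>x\<close> and to \<open>x + s *\<^sub>R b'\<close>
  differ by an affine function of the position, namely its coordinate along \<open>b'\<close> up to
  constants. Their derivatives thus give each component of the velocity.\<close>

lemma dc_limit_derivative:
  fixes P :: "nat \<Rightarrow> real \<Rightarrow> (real^2)^'n::finite"
  assumes c: "\<And>k. dc_curve L (P k) (N k)"
    and lim: "\<And>\<tau>. \<tau> \<ge> 0 \<Longrightarrow> (\<lambda>k. P k \<tau>) \<longlonglongrightarrow> \<Gamma> \<tau>"
    and \<tau>0: "0 < \<tau>0" "\<tau>0 < b"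
    and coin: "\<And>i j \<tau>. \<Gamma> \<tau>0 $ j = \<Gamma> \<tau>0 $ i \<Longrightarrow> 0 \<le> \<tau> \<Longrightarrow> \<tau> \<le> b \<Longrightarrow> \<Gamma> \<tau> $ j = \<Gamma> \<tau> $ i"
  shows "(\<Gamma> has_vector_derivative (dc_target (\<Gamma> \<tau>0) - \<Gamma> \<tau>0)) (at \<tau>0)"
proof (rule has_vector_derivative_vecI)
  fix i :: 'n and b' :: "real^2" assume b': "b' \<in> Basis"
  define w where "w = dc_target (\<Gamma> \<tau>0) $ i - \<Gamma> \<tau>0 $ i"
  obtain x \<eta> where x: "\<eta> > 0" "ball x \<eta> \<subseteq> off_chords (\<Gamma> \<tau>0) i" by (rule off_chords_open_subset)
  define s where "s = \<eta> / 2"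
  have s: "s > 0" using x by (simp add: s_def)
  have nb: "norm b' = 1" using b' by simp
  have xs: "x \<in> off_chords (\<Gamma> \<tau>0) i" "x + s *\<^sub>R b' \<in> off_chords (\<Gamma> \<tau>0) i"
    using x nb by (auto simp: s_def dist_norm intro!: subsetD[OF x(2)])
  have d: "((\<lambda>\<tau>. (norm (\<Gamma> \<tau> $ i - y))\<^sup>2) has_real_derivative 2 * ((\<Gamma> \<tau>0 $ i - y) \<bullet> w)) (at \<tau>0)"
    if "y \<in> off_chords (\<Gamma> \<tau>0) i" for y
    unfolding w_def by (rule dc_limit_sq_dist_derivative[OF c lim \<tau>0 coin that])
  have "((\<lambda>\<tau>. ((norm (\<Gamma> \<tau> $ i - x))\<^sup>2 - (norm (\<Gamma> \<tau> $ i - (x + s *\<^sub>R b')))\<^sup>2) / (2 * s) + (b' \<bullet> x + s / 2)) has_real_derivative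
      (2 * ((\<Gamma> \<tau>0 $ i - x) \<bullet> w) - 2 * ((\<Gamma> \<tau>0 $ i - (x + s *\<^sub>R b')) \<bullet> w)) / (2 * s) + 0) (at \<tau>0)"
    by (intro DERIV_add DERIV_cdivide DERIV_diff d xs DERIV_const)
  moreover have "((norm (\<Gamma> \<tau> $ i - x))\<^sup>2 - (norm (\<Gamma> \<tau> $ i - (x + s *\<^sub>R b')))\<^sup>2) / (2 * s) + (b' \<bullet> x + s / 2) = b' \<bullet> \<Gamma> \<tau> $ i" for \<tau>
  proof -
    have "\<Gamma> \<tau> $ i - (x + s *\<^sub>R b') = (\<Gamma> \<tau> $ i - x) - s *\<^sub>R b'" by simp
    then have eq: "(norm (\<Gamma> \<tau> $ i - (x + s *\<^sub>R b')))\<^sup>2 = (norm (\<Gamma> \<tau> $ i - x))\<^sup>2 - s * (2 * (b' \<bullet> (\<Gamma> \<tau> $ i - x))) + s\<^sup>2"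
      using nb by (simp only: norm_diff_scaleR_squared) simp
    show ?thesis unfolding eq using s by (simp add: inner_diff_right field_simps power2_eq_square)
  qed
  moreover have "(2 * ((\<Gamma> \<tau>0 $ i - x) \<bullet> w) - 2 * ((\<Gamma> \<tau>0 $ i - (x + s *\<^sub>R b')) \<bullet> w)) / (2 * s) + 0 = b' \<bullet> w"
    using s by (simp add: inner_diff_left inner_add_left field_simps)
  ultimately show "((\<lambda>\<tau>. b' \<bullet> \<Gamma> \<tau> $ i) has_real_derivative b' \<bullet> (dc_target (\<Gamma> \<tau>0) - \<Gamma> \<tau>0) $ i) (at \<tau>0)"
    by (simp add: w_def)
qed


section \<open>Convergence of the circumcenter dynamics\<close>

lemma cell_curve_limit_exp_dist_mono:
  fixes P :: "nat \<Rightarrow> real \<Rightarrow> (real^2)^'n::finite"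
  assumes c: "\<And>k. cell_curve L (P k) (C k) (N k)"
    and lim: "\<And>\<tau>. \<tau> \<ge> 0 \<Longrightarrow> (\<lambda>k. P k \<tau>) \<longlonglongrightarrow> \<Gamma> \<tau>" and ab: "0 \<le> a" "a \<le> b"
  shows "exp a * norm (\<Gamma> a $ i - \<Gamma> a $ j) \<le> exp b * norm (\<Gamma> b $ i - \<Gamma> b $ j)"
proof (rule LIMSEQ_le)
  show "(\<lambda>k. exp a * norm (P k a $ i - P k a $ j)) \<longlonglongrightarrow> exp a * norm (\<Gamma> a $ i - \<Gamma> a $ j)"
    by (intro tendsto_intros lim ab)
  show "(\<lambda>k. exp b * norm (P k b $ i - P k b $ j)) \<longlonglongrightarrow> exp b * norm (\<Gamma> b $ i - \<Gamma> b $ j)"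
    by (intro tendsto_intros lim order_trans[OF ab])
qed (use cell_curve_exp_dist_mono[OF c ab] in auto)

text \<open>
  Generators never merge in finite time, but generators that have merged in the limit
  \<open>\<Gamma>\<close> of translates may split again, because the field is discontinuous there.
\<close>

definition splitting_times :: "(real \<Rightarrow> (real^2)^'n::finite) \<Rightarrow> real set" where
  "splitting_times \<Gamma> = {\<tau>. \<exists>i j. \<Gamma> \<tau> $ i = \<Gamma> \<tau> $ j \<and> (\<forall>\<tau>'>\<tau>. \<Gamma> \<tau>' $ i \<noteq> \<Gamma> \<tau>' $ j)}"

text \<open>A pair has at most one last time of coincidence, and there are finitely many
  pairs.\<close>

lemma finite_splitting_times: "finite (splitting_times (\<Gamma> :: real \<Rightarrow> (real^2)^'n::finite))"
proof -
  have fin: "finite {\<tau>. \<Gamma> \<tau> $ i = \<Gamma> \<tau> $ j \<and> (\<forall>\<tau>'>\<tau>. \<Gamma> \<tau>' $ i \<noteq> \<Gamma> \<tau>' $ j)}" (is "finite ?S") for i j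
  proof (cases "?S = {}")
    case False
    then obtain s where s: "s \<in> ?S" by blast
    have "?S \<subseteq> {s}"
    proof
      fix t assume "t \<in> ?S"
      then show "t \<in> {s}" using s by (cases t s rule: linorder_cases) auto
    qed
    then show ?thesis using finite_subset by blast
  next
    case True
    then show ?thesis by (simp only: finite.emptyI)
  qed
  have "finite (\<Union>i. \<Union>j. {\<tau>. \<Gamma> \<tau> $ i = \<Gamma> \<tau> $ j \<and> (\<forall>\<tau>'>\<tau>. \<Gamma> \<tau>' $ i \<noteq> \<Gamma> \<tau>' $ j)})" by (rule finite_UN_I[OF finite_class.finite_UNIV], rule finite_UN_I[OF finite_class.finite_UNIV], rule fin)
  moreover have "splitting_times \<Gamma> = (\<Union>i. \<Union>j. {\<tau>. \<Gamma> \<tau> $ i = \<Gamma> \<tau> $ j \<and> (\<forall>\<tau>'>\<tau>. \<Gamma> \<tau>' $ i \<noteq> \<Gamma> \<tau>' $ j)})"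
    by (auto simp: splitting_times_def)
  ultimately show ?thesis by simp
qed

text \<open>A pair coinciding at a non-splitting time \<open>t\<close> coincides again at some later
  time. The weighted distance of the limits is monotone, so it is zero at all earlier times as well;
  the least such later time over all pairs serves as \<open>b\<close>.\<close>

lemma dc_limit_derivative_off_splitting:
  fixes P :: "nat \<Rightarrow> real \<Rightarrow> (real^2)^'n::finite"
  assumes c: "\<And>k. dc_curve L (P k) (N k)"
    and lim: "\<And>\<tau>. \<tau> \<ge> 0 \<Longrightarrow> (\<lambda>k. P k \<tau>) \<longlonglongrightarrow> \<Gamma> \<tau>"
    and t: "t > 0" "t \<notin> splitting_times \<Gamma>"
  shows "(\<Gamma> has_vector_derivative (dc_target (\<Gamma> t) - \<Gamma> t)) (at t)"
proof -
  have "\<exists>\<tau>'>t. \<Gamma> t $ i = \<Gamma> t $ j \<longrightarrow> \<Gamma> \<tau>' $ i = \<Gamma> \<tau>' $ j" for i j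
  proof (cases "\<Gamma> t $ i = \<Gamma> t $ j")
    case True
    then show ?thesis using t(2) unfolding splitting_times_def by blast
  next
    case False
    then show ?thesis using gt_ex[of t] by blast
  qed
  then have "\<forall>ij. \<exists>\<tau>'>t. \<Gamma> t $ fst ij = \<Gamma> t $ snd ij \<longrightarrow> \<Gamma> \<tau>' $ fst ij = \<Gamma> \<tau>' $ snd ij" by blast
  from choice[OF this] obtain T where T: "\<And>ij. T ij > t" "\<And>ij. \<Gamma> t $ fst ij = \<Gamma> t $ snd ij \<Longrightarrow> \<Gamma> (T ij) $ fst ij = \<Gamma> (T ij) $ snd ij"
    by blast
  define b where "b = Min (range T)"
  have b: "t < b" "\<And>ij. b \<le> T ij" using T(1) by (auto simp: b_def)
  have coin: "\<Gamma> \<tau> $ j = \<Gamma> \<tau> $ i" if "\<Gamma> t $ j = \<Gamma> t $ i" "0 \<le> \<tau>" "\<tau> \<le> b" for i j \<tau>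
  proof -
    have le: "\<tau> \<le> T (j,i)" using b(2) that(3) order_trans by blast
    have "exp \<tau> * norm (\<Gamma> \<tau> $ j - \<Gamma> \<tau> $ i) \<le> exp (T (j,i)) * norm (\<Gamma> (T (j,i)) $ j - \<Gamma> (T (j,i)) $ i)"
      by (rule cell_curve_limit_exp_dist_mono[OF c lim that(2) le])
    also have "\<dots> = 0" using T(2)[of "(j,i)"] that(1) by simp
    finally show ?thesis by (simp add: mult_le_0_iff)
  qed
  show ?thesis by (rule dc_limit_derivative[OF c lim t(1) b(1) coin])
qed

text \<open>Take a time \<open>\<tau>\<close> with the fewest active indices in a short interval.
  Active sets at nearby later times are contained in that of \<open>\<tau>\<close>, by closedness,
  and minimality makes them equal. So each active index stays active at times decreasing to
  \<open>\<tau>\<close>, as \<open>active_generator_centered\<close> requires.\<close>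

lemma A_DC_dense_on_curve:
  fixes \<Gamma> :: "real \<Rightarrow> (real^2)^'n::finite"
  assumes L: "L-lipschitz_on {0..} \<Gamma>" and X: "\<And>\<tau>. \<tau> \<ge> 0 \<Longrightarrow> \<Gamma> \<tau> \<in> configurations Q"
    and S: "finite S" and d: "\<And>t. t > 0 \<Longrightarrow> t \<notin> S \<Longrightarrow> (\<Gamma> has_vector_derivative (dc_target (\<Gamma> t) - \<Gamma> t)) (at t)"
    and H: "\<And>\<tau>. \<tau> \<ge> 0 \<Longrightarrow> H_DC Q (\<Gamma> \<tau>) = H" and t: "t \<ge> 0"
  shows "\<Gamma> t \<in> closure (A_DC Q)"
  unfolding closure_approachable
proof (intro allI impI)
  fix e :: real assume e: "e > 0"
  have L0: "L \<ge> 0" using L lipschitz_on_nonneg by blast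
  \<comment> \<open>Stops before the next exceptional time after \<open>t\<close> and keeps the
    curve within \<open>e\<close> of \<open>\<Gamma> t\<close>.\<close>
  define T where "T = Min (insert (t + e / (L + 1)) {s\<in>S. s > t})"
  have T: "t < T" "T \<le> t + e / (L + 1)" "\<And>s. s \<in> S \<Longrightarrow> s > t \<Longrightarrow> T \<le> s"
    using S e L0 by (auto simp: T_def)
  obtain \<tau> where tau: "t < \<tau>" "\<tau> < T" and
    least: "\<And>\<tau>'. t < \<tau>' \<Longrightarrow> \<tau>' < T \<Longrightarrow> card (I_DC Q (\<Gamma> \<tau>)) \<le> card (I_DC Q (\<Gamma> \<tau>'))"
  proof -
    have "t < (t + T) / 2 \<and> (t + T) / 2 < T" using T(1) by simp
    from ex_has_least_nat[of "\<lambda>\<tau>. t < \<tau> \<and> \<tau> < T", OF this, of "\<lambda>\<tau>. card (I_DC Q (\<Gamma> \<tau>))"]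
    show thesis using that by blast
  qed
  have \<tau>0: "\<tau> > 0" "\<tau> \<ge> 0" using t tau by auto
  have "\<tau> \<notin> S" using T(3) tau by force
  note d\<tau> = d[OF \<tau>0(1) this]
  have cont: "isCont \<Gamma> \<tau>" using d\<tau> by (rule has_vector_derivative_continuous)
  \<comment> \<open>The doubled \<open>Suc\<close> makes the denominator at least 2, so that
    \<open>s 0\<close> is already below \<open>T\<close>.\<close>
  define s where "s k = \<tau> + (T - \<tau>) / real (Suc (Suc k))" for k
  have s: "\<tau> < s k" "s k < T" for k
  proof -
    show "\<tau> < s k" using tau by (simp add: s_def)
    have "(T - \<tau>) / real (Suc (Suc k)) < (T - \<tau>) / 1" using tau by (intro divide_strict_left_mono) auto
    then show "s k < T" by (simp add: s_def)
  qed
  have slim: "s \<longlonglongrightarrow> \<tau>"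
  proof -
    have "(\<lambda>k. \<tau> + (T - \<tau>) * inverse (real (Suc (Suc k)))) \<longlonglongrightarrow> \<tau> + (T - \<tau>) * 0"
      by (intro tendsto_intros LIMSEQ_Suc[OF LIMSEQ_inverse_real_of_nat])
    then show ?thesis by (simp add: s_def[abs_def] divide_inverse)
  qed
  have sX: "\<Gamma> (s k) \<in> configurations Q" and sH: "H_DC Q (\<Gamma> (s k)) = H" for k using X[of "s k"] H[of "s k"] s(1)[of k] \<tau>0 by auto
  have Gs: "(\<lambda>k. \<Gamma> (s k)) \<longlonglongrightarrow> \<Gamma> \<tau>" by (rule isCont_tendsto_compose[OF cont slim])
  have usc: "\<forall>\<^sub>F k in sequentially. i \<in> I_DC Q (\<Gamma> (s k)) \<longrightarrow> i \<in> I_DC Q (\<Gamma> \<tau>)" for i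
  proof (rule ccontr)
    assume "\<not> ?thesis"
    then have *: "\<exists>\<^sub>F k in sequentially. i \<in> I_DC Q (\<Gamma> (s k)) \<and> i \<notin> I_DC Q (\<Gamma> \<tau>)"
      by (simp only: not_eventually not_imp)
    then have fr: "\<exists>\<^sub>F k in sequentially. i \<in> I_DC Q (\<Gamma> (s k))" by (rule frequently_elim1) simp
    have i: "i \<notin> I_DC Q (\<Gamma> \<tau>)" using frequently_ex[OF *] by blast
    from fr obtain r where r: "strict_mono (r :: nat \<Rightarrow> nat)" "\<And>k. i \<in> I_DC Q (\<Gamma> (s (r k)))"
      using infinite_enumerate[of "{k. i \<in> I_DC Q (\<Gamma> (s k))}"] unfolding frequently_sequentially
      by (metis (mono_tags, lifting) infinite_nat_iff_unbounded_le mem_Collect_eq)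
    have "\<exists>q\<in>voronoi_cell Q (\<Gamma> (s (r k))) i. norm (q - \<Gamma> (s (r k)) $ i) = H" for k
      using r(2)[of k] I_DC_iff[OF sX, of i "r k"] sH by simp
    then obtain q where q: "\<And>k. q k \<in> voronoi_cell Q (\<Gamma> (s (r k))) i" "\<And>k. norm (q k - \<Gamma> (s (r k)) $ i) = H" by metis
    have "q k \<in> Q" for k using q(1) voronoi_cell_subset by blast
    then obtain l r' where r': "strict_mono (r' :: nat \<Rightarrow> nat)" "(q \<circ> r') \<longlonglongrightarrow> l"
      using Q_compact unfolding compact_def by meson
    have ql: "(\<lambda>k. q (r' k)) \<longlonglongrightarrow> l" using r'(2) by (simp add: o_def)
    have Gl: "(\<lambda>k. \<Gamma> (s (r (r' k)))) \<longlonglongrightarrow> \<Gamma> \<tau>"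
      using LIMSEQ_subseq_LIMSEQ[OF Gs strict_mono_o[OF r(1) r'(1)]] by (simp add: o_def)
    have "l \<in> voronoi_cell Q (\<Gamma> \<tau>) i" by (rule mem_voronoi_cell_limit[OF Q_closed _ ql Gl]) (rule q(1))
    moreover have "(\<lambda>k. norm (q (r' k) - \<Gamma> (s (r (r' k))) $ i)) \<longlonglongrightarrow> norm (l - \<Gamma> \<tau> $ i)"
      by (intro tendsto_intros ql Gl)
    then have "norm (l - \<Gamma> \<tau> $ i) = H" using q(2) by (simp add: LIMSEQ_const_iff)
    ultimately have "i \<in> I_DC Q (\<Gamma> \<tau>)" unfolding I_DC_iff[OF X[OF \<tau>0(2)]] H[OF \<tau>0(2)] by blast
    then show False using i by simp
  qed
  have "\<forall>\<^sub>F k in sequentially. \<forall>i. i \<in> I_DC Q (\<Gamma> (s k)) \<longrightarrow> i \<in> I_DC Q (\<Gamma> \<tau>)"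
    by (rule eventually_all_finite) (rule usc)
  then obtain k0 where k0: "\<And>k. k \<ge> k0 \<Longrightarrow> I_DC Q (\<Gamma> (s k)) \<subseteq> I_DC Q (\<Gamma> \<tau>)"
    unfolding eventually_sequentially by blast
  have Ieq: "I_DC Q (\<Gamma> (s (k + k0))) = I_DC Q (\<Gamma> \<tau>)" for k
  proof (rule card_seteq)
    show "card (I_DC Q (\<Gamma> \<tau>)) \<le> card (I_DC Q (\<Gamma> (s (k + k0))))"
      using least s tau by (meson less_trans)
  qed (use k0 in auto)
  have "\<Gamma> \<tau> $ i = circumcenter (voronoi_cell Q (\<Gamma> \<tau>) i)" if i: "i \<in> I_DC Q (\<Gamma> \<tau>)" for i
  proof (rule active_generator_centered[OF d\<tau> X[OF \<tau>0(2)]])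
    show "(\<lambda>k. s (k + k0)) \<longlonglongrightarrow> \<tau>" using slim by (rule LIMSEQ_ignore_initial_segment)
    show "H_DC Q (\<Gamma> \<tau>) = H" by (rule H[OF \<tau>0(2)])
    show "i \<in> I_DC Q (\<Gamma> (s (k + k0)))" for k using i Ieq by simp
  qed (use s sX sH in auto)
  then have "\<Gamma> \<tau> \<in> A_DC Q" using X[OF \<tau>0(2)] by (auto simp: A_DC_def)
  moreover have "dist (\<Gamma> \<tau>) (\<Gamma> t) < e"
  proof -
    have "dist (\<Gamma> \<tau>) (\<Gamma> t) \<le> L * dist \<tau> t" by (rule lipschitz_onD[OF L]) (use \<tau>0 t in auto)
    also have "\<dots> \<le> (L + 1) * (\<tau> - t)" using tau L0 by (intro mult_mono) (auto simp: dist_real_def)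
    also have "\<dots> < (L + 1) * (e / (L + 1))" using tau T(2) L0 by (intro mult_strict_left_mono) auto
    finally show ?thesis using L0 by simp
  qed
  ultimately show "\<exists>y\<in>A_DC Q. dist y (\<Gamma> t) < e" by blast
qed

lemma dc_curve_H_DC_converges:
  fixes P :: "real \<Rightarrow> (real^2)^'n::finite"
  assumes c: "dc_curve L P N"
  obtains H where "((\<lambda>t. H_DC Q (P t)) \<longlongrightarrow> H) at_top"
proof -
  define H where "H = (INF t\<in>{0..}. H_DC Q (P t))"
  have bdd: "bdd_below ((\<lambda>t. H_DC Q (P t)) ` {0..})" using H_DC_nonneg by (intro bdd_belowI2)
  have "((\<lambda>t. H_DC Q (P t)) \<longlongrightarrow> H) at_top"
  proof (rule tendstoI)
    fix e :: real assume "e > 0"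
    have "\<exists>t0\<ge>0. H_DC Q (P t0) < H + e"
    proof (rule ccontr)
      assume "\<not> ?thesis"
      then have "H + e \<le> (INF t\<in>{0..}. H_DC Q (P t))" by (intro cINF_greatest) (auto simp: not_less)
      then show False using \<open>e > 0\<close> by (simp add: H_def)
    qed
    then obtain t0 where t0: "t0 \<ge> 0" "H_DC Q (P t0) < H + e" by blast
    have "dist (H_DC Q (P t)) H < e" if "t \<ge> t0" for t
    proof -
      have "H_DC Q (P t) \<le> H_DC Q (P t0)" by (rule dc_curve_H_DC_antimono[OF c t0(1) that])
      moreover have "H \<le> H_DC Q (P t)" unfolding H_def by (rule cINF_lower[OF bdd]) (use t0 that in simp)
      ultimately show ?thesis using t0(2) by (simp add: dist_real_def)
    qed
    then show "\<forall>\<^sub>F t in at_top. dist (H_DC Q (P t)) H < e" unfolding eventually_at_top_linorder by blast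
  qed
  then show thesis by (rule that)
qed

theorem dc_convergence:
  fixes P :: "real \<Rightarrow> (real^2)^'n::finite"
  assumes sol: "di_solution (DC_dynamics Q) (configurations Q) {0..} P"
  shows "converges_to_set P (largest_weakly_invariant (DC_dynamics Q) (configurations Q) (closure (A_DC Q)))"
proof -
  have dyn: "DC_dynamics Q R = {dc_target R - R}" for R :: "(real^2)^'n"
    by (auto simp: DC_dynamics_def dc_target_def vec_eq_iff)
  have "\<exists>L C N. cell_curve L P C N \<and> (\<forall>t>0. t \<notin> N \<longrightarrow> C t = dc_target (P t))"
  proof (rule di_solution_cell_curve[OF sol, where \<Phi> = "\<lambda>R c. c = dc_target R"])
    fix R v :: "(real^2)^'n" assume "R \<in> configurations Q" "v \<in> DC_dynamics Q R"
    then show "\<exists>c. v = c - R \<and> (\<forall>i. c $ i \<in> voronoi_cell Q R i) \<and> c = dc_target R"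
      using circumcenter_in_cell by (auto simp: dyn dc_target_def)
  qed
  then obtain L N where c: "dc_curve L P N" unfolding cell_curve_def by metis
  obtain H where H: "((\<lambda>t. H_DC Q (P t)) \<longlongrightarrow> H) at_top" by (rule dc_curve_H_DC_converges[OF c])
  show ?thesis
  proof (rule invariance_principle[OF configurations_compact cell_curveD(3)[OF c] cell_curveD(2)[OF c]])
    fix s :: "nat \<Rightarrow> real" and \<Gamma>
    assume s: "\<And>k. s k \<ge> 0" "filterlim s at_top sequentially"
      and lim: "\<And>\<tau>. \<tau> \<ge> 0 \<Longrightarrow> (\<lambda>k. P (s k + \<tau>)) \<longlonglongrightarrow> \<Gamma> \<tau>"
    have ck: "dc_curve L (\<lambda>\<tau>. P (s k + \<tau>)) ((+) (- s k) ` N)" for k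
      using cell_curve_translate[OF c s(1)] .
    have d: "(\<Gamma> has_vector_derivative (dc_target (\<Gamma> t) - \<Gamma> t)) (at t)" if "t > 0" "t \<notin> splitting_times \<Gamma>" for t
      by (rule dc_limit_derivative_off_splitting[OF ck lim that])
    have X: "\<Gamma> \<tau> \<in> configurations Q" if t: "\<tau> \<ge> 0" for \<tau>
      by (rule closed_sequentially[OF compact_imp_closed[OF configurations_compact] _ lim[OF t]])
        (use cell_curveD(3)[OF c] s(1) t in auto)
    have GL: "L-lipschitz_on {0..} \<Gamma>"
      by (rule lipschitz_on_pointwise_limit[OF cell_curveD(2)[OF ck]]) (use lim in auto)
    have GH: "H_DC Q (\<Gamma> \<tau>) = H" if t: "\<tau> \<ge> 0" for \<tau>
    proof -
      have "continuous_on UNIV (H_DC Q :: (real^2)^'n \<Rightarrow> real)" by (rule lipschitz_on_continuous_on[OF H_DC_lipschitz])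
      then have "isCont (H_DC Q) (\<Gamma> \<tau>)" by (simp add: continuous_on_eq_continuous_at)
      then have 1: "(\<lambda>k. H_DC Q (P (s k + \<tau>))) \<longlonglongrightarrow> H_DC Q (\<Gamma> \<tau>)" by (rule isCont_tendsto_compose[OF _ lim[OF t]])
      have "filterlim (\<lambda>k. s k + \<tau>) at_top sequentially"
        using filterlim_tendsto_add_at_top[OF tendsto_const[of \<tau>] s(2)] by (simp add: add.commute)
      then have "(\<lambda>k. H_DC Q (P (s k + \<tau>))) \<longlonglongrightarrow> H" by (rule filterlim_compose[OF H])
      then show ?thesis using 1 LIMSEQ_unique by blast
    qed
    have "negligible (insert 0 (splitting_times \<Gamma>))" using finite_splitting_times by (intro negligible_finite) auto
    then have "insert 0 (splitting_times \<Gamma>) \<in> null_sets lebesgue" by (simp add: negligible_iff_null_sets)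
    then have "AE \<tau> in lebesgue. \<tau> \<in> {0..} \<longrightarrow> (\<exists>v\<in>DC_dynamics Q (\<Gamma> \<tau>). (\<Gamma> has_vector_derivative v) (at \<tau> within {0..}))"
    proof (rule AE_I')
      show "{\<tau> \<in> space lebesgue. \<not> (\<tau> \<in> {0..} \<longrightarrow> (\<exists>v\<in>DC_dynamics Q (\<Gamma> \<tau>). (\<Gamma> has_vector_derivative v) (at \<tau> within {0..})))}
          \<subseteq> insert 0 (splitting_times \<Gamma>)"
      proof
        fix \<tau> assume *: "\<tau> \<in> {\<tau> \<in> space lebesgue. \<not> (\<tau> \<in> {0..} \<longrightarrow> (\<exists>v\<in>DC_dynamics Q (\<Gamma> \<tau>). (\<Gamma> has_vector_derivative v) (at \<tau> within {0..})))}"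
        show "\<tau> \<in> insert 0 (splitting_times \<Gamma>)"
        proof (rule ccontr)
          assume "\<tau> \<notin> insert 0 (splitting_times \<Gamma>)"
          then have "(\<Gamma> has_vector_derivative (dc_target (\<Gamma> \<tau>) - \<Gamma> \<tau>)) (at \<tau>)" using * by (intro d) auto
          then have "(\<Gamma> has_vector_derivative (dc_target (\<Gamma> \<tau>) - \<Gamma> \<tau>)) (at \<tau> within {0..})"
            by (rule has_vector_derivative_at_within)
          then show False using * by (simp add: dyn)
        qed
      qed
    qed
    moreover have "\<Gamma> \<tau> \<in> closure (A_DC Q)" if "\<tau> \<ge> 0" for \<tau>
      by (rule A_DC_dense_on_curve[OF GL X finite_splitting_times d GH that])
    ultimately show "(AE \<tau> in lebesgue. \<tau> \<in> {0..} \<longrightarrow> (\<exists>v\<in>DC_dynamics Q (\<Gamma> \<tau>). (\<Gamma> has_vector_derivative v) (at \<tau> within {0..}))) \<and>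
        (\<forall>\<tau>\<ge>0. \<Gamma> \<tau> \<in> closure (A_DC Q))" by blast
  qed
qed

end

section \<open>Disks inside half-spaces and unit normals of polyhedra\<close>

lemma cball_subset_halfspace_iff:
  fixes a :: "'a::real_inner"
  assumes "norm a = 1" "r \<ge> 0"
  shows "cball x r \<subseteq> {y. a \<bullet> y \<ge> b} \<longleftrightarrow> a \<bullet> x - b \<ge> r"
proof
  assume sub: "cball x r \<subseteq> {y. a \<bullet> y \<ge> b}"
  have "x - r *\<^sub>R a \<in> cball x r" using assms by (simp add: dist_norm)
  then have "a \<bullet> (x - r *\<^sub>R a) \<ge> b" using sub by blast
  moreover have "a \<bullet> a = 1" using assms(1) by (simp add: norm_eq_1)
  ultimately show "a \<bullet> x - b \<ge> r" by (simp add: inner_diff_right)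
next
  assume r: "a \<bullet> x - b \<ge> r"
  show "cball x r \<subseteq> {y. a \<bullet> y \<ge> b}"
  proof
    fix y assume "y \<in> cball x r"
    then have "norm (x - y) \<le> r" by (simp add: dist_norm)
    then have "a \<bullet> (x - y) \<le> r" using norm_cauchy_schwarz[of a "x - y"] assms(1) by simp
    then show "y \<in> {y. a \<bullet> y \<ge> b}" using r by (simp add: inner_diff_right)
  qed
qed

lemma polyhedron_unit_halfspaces:
  fixes S :: "'a::euclidean_space set"
  assumes "polyhedron S"
  obtains A where "finite A" "\<And>a b. (a,b) \<in> A \<Longrightarrow> norm a = 1" "S = {x. \<forall>(a,b)\<in>A. a \<bullet> x \<ge> b}"
proof -
  obtain F where F: "finite F" "S = \<Inter> F" "\<forall>h\<in>F. \<exists>a b. a \<noteq> 0 \<and> h = {x. a \<bullet> x \<le> b}"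
    using assms unfolding polyhedron_def by blast
  have "\<forall>h\<in>F. \<exists>ab. norm (fst ab) = 1 \<and> h = {x. fst ab \<bullet> x \<ge> snd ab}"
  proof
    fix h assume "h \<in> F"
    then obtain a b where ab: "a \<noteq> 0" "h = {x. a \<bullet> x \<le> b}" using F(3) by blast
    have "(- sgn a) \<bullet> x \<ge> - b / norm a \<longleftrightarrow> a \<bullet> x \<le> b" for x
      using ab(1) by (simp add: sgn_div_norm field_simps)
    then show "\<exists>ab. norm (fst ab) = 1 \<and> h = {x. fst ab \<bullet> x \<ge> snd ab}"
      using ab by (intro exI[of _ "(- sgn a, - b / norm a)"]) (simp add: norm_sgn)
  qed
  from bchoice[OF this] obtain f where f: "\<And>h. h \<in> F \<Longrightarrow> norm (fst (f h)) = 1" "\<And>h. h \<in> F \<Longrightarrow> h = {x. fst (f h) \<bullet> x \<ge> snd (f h)}"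
    by blast
  show thesis
  proof (rule that[of "f ` F"])
    show "finite (f ` F)" using F(1) by simp
    show "norm a = 1" if "(a,b) \<in> f ` F" for a b using that f(1) by (metis fst_conv imageE)
    have "x \<in> S \<longleftrightarrow> (\<forall>(a,b)\<in>f ` F. a \<bullet> x \<ge> b)" for x
    proof -
      have "x \<in> S \<longleftrightarrow> (\<forall>h\<in>F. x \<in> h)" using F(2) by auto
      also have "\<dots> \<longleftrightarrow> (\<forall>h\<in>F. fst (f h) \<bullet> x \<ge> snd (f h))" using f(2) by blast
      also have "\<dots> \<longleftrightarrow> (\<forall>(a,b)\<in>f ` F. a \<bullet> x \<ge> b)" by (simp add: case_prod_beta)
      finally show ?thesis .
    qed
    then show "S = {x. \<forall>(a,b)\<in>f ` F. a \<bullet> x \<ge> b}" by blast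
  qed
qed

context polygon
begin

section \<open>Incenter sets and the sphere-packing function\<close>

text \<open>A fixed description by unit inward normals: \<open>a \<bullet> x - b\<close> is the
  signed distance of \<open>x\<close> from the line of the side, linear in \<open>x\<close> unlike
  the distance to an edge. Redundant half-planes may occur.\<close>

definition sides :: "((real^2) \<times> real) set" where
  "sides = (SOME A. finite A \<and> (\<forall>(a,b)\<in>A. norm a = 1) \<and> Q = {x. \<forall>(a,b)\<in>A. a \<bullet> x \<ge> b})"

lemma sides_finite: "finite sides" and sides_unit: "(a,b) \<in> sides \<Longrightarrow> norm a = 1"
  and Q_eq_sides: "Q = {x. \<forall>(a,b)\<in>sides. a \<bullet> x \<ge> b}"
proof -
  obtain A where "finite A" "\<And>a b. (a,b) \<in> A \<Longrightarrow> norm a = 1" "Q = {x. \<forall>(a,b)\<in>A. a \<bullet> x \<ge> b}"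
    by (rule polyhedron_unit_halfspaces[OF Q_polyhedron]) blast
  then have "\<exists>A. finite A \<and> (\<forall>(a,b)\<in>A. norm a = 1) \<and> Q = {x. \<forall>(a,b)\<in>A. a \<bullet> x \<ge> b}" by blast
  from someI_ex[OF this]
  have "finite sides \<and> (\<forall>(a,b)\<in>sides. norm a = 1) \<and> Q = {x. \<forall>(a,b)\<in>sides. a \<bullet> x \<ge> b}"
    unfolding sides_def .
  then show "finite sides" "(a,b) \<in> sides \<Longrightarrow> norm a = 1" "Q = {x. \<forall>(a,b)\<in>sides. a \<bullet> x \<ge> b}" by auto
qed

lemma sides_nonempty: "sides \<noteq> {}"
proof
  assume "sides = {}"
  then have "Q = UNIV" using Q_eq_sides by simp
  then show False using Q_compact not_bounded_UNIV compact_imp_bounded by blast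
qed

lemma cball_subset_Q_iff: "r \<ge> 0 \<Longrightarrow> cball x r \<subseteq> Q \<longleftrightarrow> (\<forall>(a,b)\<in>sides. a \<bullet> x - b \<ge> r)"
  using cball_subset_halfspace_iff[OF sides_unit] by (subst Q_eq_sides) (fastforce simp: case_prod_beta)

text \<open>The signed distance of \<open>x\<close> from the bisector of \<open>i\<close> and
  \<open>j\<close>, positive on the side of \<open>i\<close>; it is 0 when the generators coincide,
  as \<open>sgn 0 = 0\<close>.\<close>

definition wall_dist :: "(real^2)^'n::finite \<Rightarrow> 'n \<Rightarrow> 'n \<Rightarrow> real^2 \<Rightarrow> real" where
  "wall_dist P i j x = sgn (P $ i - P $ j) \<bullet> (x - (1/2) *\<^sub>R (P $ i + P $ j))"

lemma wall_dist_self: "wall_dist P i j (P $ i) = norm (P $ i - P $ j) / 2"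
proof -
  have "P $ i - (1/2) *\<^sub>R (P $ i + P $ j) = (1/2) *\<^sub>R (P $ i - P $ j)"
    by (simp add: algebra_simps scaleR_2[symmetric] flip: scaleR_left_distrib)
  moreover have "sgn (P $ i - P $ j) \<bullet> (P $ i - P $ j) = norm (P $ i - P $ j)"
    by (cases "P $ i - P $ j = 0") (simp_all add: sgn_div_norm power2_norm_eq_inner[symmetric] power2_eq_square)
  ultimately show ?thesis by (simp add: wall_dist_def)
qed

text \<open>A disk lies in a half-plane exactly if its center has signed distance at least
  \<open>r\<close>. Coincident generators have no bisector and must be left out, since their
  \<open>wall_dist\<close> is 0.\<close>

lemma cball_subset_cell_iff:
  fixes P :: "(real^2)^'n::finite"
  assumes r: "r \<ge> 0"
  shows "cball x r \<subseteq> voronoi_cell Q P i \<longleftrightarrow>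
    (\<forall>(a,b)\<in>sides. a \<bullet> x - b \<ge> r) \<and> (\<forall>j. P $ i \<noteq> P $ j \<longrightarrow> wall_dist P i j x \<ge> r)"
proof -
  have eq: "voronoi_cell Q P i = Q \<inter> (\<Inter>j\<in>{j. P $ i \<noteq> P $ j}.
      {y. sgn (P $ i - P $ j) \<bullet> y \<ge> sgn (P $ i - P $ j) \<bullet> ((1/2) *\<^sub>R (P $ i + P $ j))})"
  proof -
    have "norm (q - P $ i) \<le> norm (q - P $ j) \<longleftrightarrow> (P $ i \<noteq> P $ j \<longrightarrow>
        sgn (P $ i - P $ j) \<bullet> q \<ge> sgn (P $ i - P $ j) \<bullet> ((1/2) *\<^sub>R (P $ i + P $ j)))" for q j
      unfolding closer_iff_halfspace sgn_inner_nonneg_iff[symmetric, of "P $ i - P $ j"]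
      by (cases "P $ i = P $ j") (simp_all add: inner_diff_right)
    then show ?thesis by (auto simp: voronoi_cell_iff)
  qed
  have "cball x r \<subseteq> {y. sgn (P $ i - P $ j) \<bullet> y \<ge> sgn (P $ i - P $ j) \<bullet> ((1/2) *\<^sub>R (P $ i + P $ j))} \<longleftrightarrow> wall_dist P i j x \<ge> r"
    if "P $ i \<noteq> P $ j" for j
    using that r by (subst cball_subset_halfspace_iff) (auto simp: norm_sgn wall_dist_def inner_diff_right)
  then have "cball x r \<subseteq> (\<Inter>j\<in>{j. P $ i \<noteq> P $ j}.
      {y. sgn (P $ i - P $ j) \<bullet> y \<ge> sgn (P $ i - P $ j) \<bullet> ((1/2) *\<^sub>R (P $ i + P $ j))}) \<longleftrightarrow>
      (\<forall>j. P $ i \<noteq> P $ j \<longrightarrow> wall_dist P i j x \<ge> r)"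
    unfolding le_INF_iff by auto
  then show ?thesis unfolding eq Int_subset_iff cball_subset_Q_iff[OF r] by blast
qed

text \<open>The generator lies strictly inside its bisectors and in the closure of the interior of
  \<open>Q\<close>, so near it both conditions hold strictly. Every cell thus has a positive
  inradius, even when generators coincide or lie on the boundary.\<close>

lemma cell_inner_ball:
  fixes P :: "(real^2)^'n::finite"
  assumes P: "P \<in> configurations Q"
  obtains c r where "r > 0" "cball c r \<subseteq> voronoi_cell Q P i"
proof -
  define S where "S = {y. \<forall>j. P $ i \<noteq> P $ j \<longrightarrow> wall_dist P i j y > 0}"
  have "open {y. wall_dist P i j y > 0}" for j
    unfolding wall_dist_def by (intro open_Collect_less continuous_intros)
  then have "open (\<Inter>j\<in>{j. P $ i \<noteq> P $ j}. {y. wall_dist P i j y > 0})" by (intro open_INT) auto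
  moreover have "(\<Inter>j\<in>{j. P $ i \<noteq> P $ j}. {y. wall_dist P i j y > 0}) = S" by (auto simp: S_def)
  ultimately have S: "open S" by simp
  have "P $ i \<in> S" by (simp add: S_def wall_dist_self)
  moreover have "P $ i \<in> closure (interior Q)"
    using convex_closure_interior[OF Q_convex Q_interior] Q_closed P by (simp add: configurations_def)
  ultimately have "S \<inter> closure (interior Q) \<noteq> {}" by blast
  then have "S \<inter> interior Q \<noteq> {}" using open_Int_closure_eq_empty[OF S] by metis
  then obtain c where "c \<in> S \<inter> interior Q" by blast
  moreover have "open (S \<inter> interior Q)" using S by auto
  ultimately obtain r where r: "r > 0" "cball c r \<subseteq> S \<inter> interior Q" using open_contains_cball by metis
  have "S \<inter> interior Q \<subseteq> voronoi_cell Q P i"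
  proof
    fix y assume y: "y \<in> S \<inter> interior Q"
    then have "cball y 0 \<subseteq> Q" using interior_subset by auto
    then have "cball y 0 \<subseteq> voronoi_cell Q P i"
      using y cball_subset_Q_iff[of 0 y] unfolding S_def cball_subset_cell_iff[OF order_refl]
      by (auto simp del: cball_trivial intro: less_imp_le)
    then show "y \<in> voronoi_cell Q P i" by simp
  qed
  then show thesis using that[OF r(1)] r(2) by blast
qed

lemma incenter_radius:
  assumes "c \<in> incenter_set W"
  obtains \<rho> where "\<rho> \<ge> 0" "cball c \<rho> \<subseteq> W" "\<And>z s. cball z s \<subseteq> W \<Longrightarrow> s \<le> \<rho>"
  using assms unfolding incenter_set_def by blast

lemma incenter_in_cell: "c \<in> incenter_set W \<Longrightarrow> c \<in> W"
  by (rule incenter_radius) (auto dest: subsetD)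

text \<open>The signed distances to the walls are affine in the center, and all incenters have the
  same radius.\<close>

lemma incenter_set_convex:
  fixes P :: "(real^2)^'n::finite"
  shows "convex (incenter_set (voronoi_cell Q P i))"
proof (rule convexI)
  fix x y :: "real^2" and u v :: real
  assume xy: "x \<in> incenter_set (voronoi_cell Q P i)" "y \<in> incenter_set (voronoi_cell Q P i)" and uv: "0 \<le> u" "0 \<le> v" "u + v = 1"
  obtain r where r: "r \<ge> 0" "cball x r \<subseteq> voronoi_cell Q P i" "\<And>z s. cball z s \<subseteq> voronoi_cell Q P i \<Longrightarrow> s \<le> r"
    using incenter_radius[OF xy(1)] by metis
  obtain r' where r': "r' \<ge> 0" "cball y r' \<subseteq> voronoi_cell Q P i" "\<And>z s. cball z s \<subseteq> voronoi_cell Q P i \<Longrightarrow> s \<le> r'"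
    using incenter_radius[OF xy(2)] by metis
  have rr: "r' = r" using r(3)[OF r'(2)] r'(3)[OF r(2)] by simp
  have comb: "a \<bullet> (u *\<^sub>R x + v *\<^sub>R y - m) \<ge> r" if "a \<bullet> (x - m) \<ge> r" "a \<bullet> (y - m) \<ge> r" for a m :: "real^2"
  proof -
    have "a \<bullet> (u *\<^sub>R x + v *\<^sub>R y - m) = a \<bullet> (u *\<^sub>R x + v *\<^sub>R y - (u + v) *\<^sub>R m)" using uv by simp
    also have "\<dots> = u * (a \<bullet> (x - m)) + v * (a \<bullet> (y - m))"
      by (simp add: inner_diff_right inner_add_right algebra_simps)
    also have "\<dots> \<ge> u * r + v * r" using that uv by (intro add_mono mult_left_mono) auto
    finally show ?thesis using uv by (metis distrib_right mult_1)
  qed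
  have comb': "a \<bullet> (u *\<^sub>R x + v *\<^sub>R y) - b \<ge> r" if "a \<bullet> x - b \<ge> r" "a \<bullet> y - b \<ge> r" for a :: "real^2" and b
  proof -
    have "a \<bullet> (u *\<^sub>R x + v *\<^sub>R y) - b = a \<bullet> (u *\<^sub>R x + v *\<^sub>R y) - (u + v) * b" using uv by simp
    also have "\<dots> = u * (a \<bullet> x - b) + v * (a \<bullet> y - b)"
      by (simp add: inner_add_right algebra_simps)
    also have "\<dots> \<ge> u * r + v * r" using that uv by (intro add_mono mult_left_mono) auto
    finally show ?thesis using uv by (metis distrib_right mult_1)
  qed
  have "cball (u *\<^sub>R x + v *\<^sub>R y) r \<subseteq> voronoi_cell Q P i"
    using r(2) r'(2) comb comb' unfolding rr cball_subset_cell_iff[OF r(1)] wall_dist_def by fastforce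
  then show "u *\<^sub>R x + v *\<^sub>R y \<in> incenter_set (voronoi_cell Q P i)"
    using r unfolding incenter_set_def by blast
qed

text \<open>
  A cell jumps when two generators merge, hence the assumption \<open>pat\<close>: the same generators
  coincide in all configurations.
\<close>

lemma incenter_closed_graph:
  fixes P :: "nat \<Rightarrow> (real^2)^'n::finite"
  assumes PR: "P \<longlonglongrightarrow> R" and pat: "\<And>m i j. P m $ i = P m $ j \<longleftrightarrow> R $ i = R $ j"
    and c: "\<And>m. c m \<in> incenter_set (voronoi_cell Q (P m) i)" and cl: "c \<longlonglongrightarrow> l"
  shows "l \<in> incenter_set (voronoi_cell Q R i)"
proof -
  have "\<exists>\<rho>\<ge>0. cball (c m) \<rho> \<subseteq> voronoi_cell Q (P m) i \<and> (\<forall>z s. cball z s \<subseteq> voronoi_cell Q (P m) i \<longrightarrow> s \<le> \<rho>)" for m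
    using c[of m] unfolding incenter_set_def by blast
  then obtain \<rho> where rho: "\<And>m. \<rho> m \<ge> 0" "\<And>m. cball (c m) (\<rho> m) \<subseteq> voronoi_cell Q (P m) i"
    "\<And>m z s. cball z s \<subseteq> voronoi_cell Q (P m) i \<Longrightarrow> s \<le> \<rho> m" by metis
  \<comment> \<open>The distance to any one side bounds all the inradii, which yields a convergent
    subsequence of radii.\<close>
  obtain a0 b0 where ab0: "(a0,b0) \<in> sides" using sides_nonempty by auto
  obtain B where B: "\<And>y. y \<in> Q \<Longrightarrow> norm y \<le> B" using compact_imp_bounded[OF Q_compact] bounded_iff by blast
  have "\<rho> m \<in> cball 0 (B + \<bar>b0\<bar>)" for m
  proof -
    have "a0 \<bullet> c m - b0 \<ge> \<rho> m" using rho(2)[of m] ab0 unfolding cball_subset_cell_iff[OF rho(1)] by auto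
    moreover have "c m \<in> Q" using incenter_in_cell[OF c] voronoi_cell_subset by blast
    then have "a0 \<bullet> c m \<le> B" using norm_cauchy_schwarz[of a0 "c m"] sides_unit[OF ab0] B by fastforce
    ultimately show ?thesis using rho(1)[of m] by auto
  qed
  then obtain r k where k: "strict_mono (k :: nat \<Rightarrow> nat)" "(\<rho> \<circ> k) \<longlonglongrightarrow> r"
    using compact_cball[of "0::real" "B + \<bar>b0\<bar>"] unfolding compact_def by meson
  have rk: "(\<lambda>m. \<rho> (k m)) \<longlonglongrightarrow> r" using k(2) by (simp add: o_def)
  have Pk: "(\<lambda>m. P (k m)) \<longlonglongrightarrow> R" using LIMSEQ_subseq_LIMSEQ[OF PR k(1)] by (simp add: o_def)
  have ck: "(\<lambda>m. c (k m)) \<longlonglongrightarrow> l" using LIMSEQ_subseq_LIMSEQ[OF cl k(1)] by (simp add: o_def)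
  have wall: "(\<lambda>m. wall_dist (P (k m)) i j (z m)) \<longlonglongrightarrow> wall_dist R i j w" if "R $ i \<noteq> R $ j" "z \<longlonglongrightarrow> w" for j z w
    unfolding wall_dist_def by (intro tendsto_intros Pk that(2)) (use that(1) in simp)
  have r0: "r \<ge> 0" by (rule LIMSEQ_le_const[OF rk]) (use rho(1) in auto)
  have "cball l r \<subseteq> voronoi_cell Q R i"
    unfolding cball_subset_cell_iff[OF r0]
  proof (intro conjI allI impI ballI, clarify)
    fix a b assume ab: "(a,b) \<in> sides"
    have slack: "\<rho> m \<le> a \<bullet> c m - b" for m
      using rho(2)[of m] ab unfolding cball_subset_cell_iff[OF rho(1)] by blast
    have "(\<lambda>m. a \<bullet> c (k m) - b) \<longlonglongrightarrow> a \<bullet> l - b" by (intro tendsto_intros ck)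
    then show "r \<le> a \<bullet> l - b"
      by (rule LIMSEQ_le[OF rk]) (use slack in auto)
  next
    fix j assume ne: "R $ i \<noteq> R $ j"
    have "\<rho> m \<le> wall_dist (P m) i j (c m)" for m
      using rho(2)[of m] ne pat[of m i j] unfolding cball_subset_cell_iff[OF rho(1)] by blast
    then show "r \<le> wall_dist R i j l"
      by (intro LIMSEQ_le[OF rk wall[OF ne ck]]) auto
  qed
  moreover have "s \<le> r" if zs: "cball z s \<subseteq> voronoi_cell Q R i" for z s
  proof (cases "s \<le> 0")
    case False
    show ?thesis
    proof (rule field_le_epsilon)
      \<comment> \<open>Shrinking the disk by \<open>e\<close> makes its wall inequalities strict,
        so they persist for the nearby cells.\<close>
      fix e :: real assume e: "e > 0"
      show "s \<le> r + e"
      proof (cases "s - e \<le> 0")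
        case True then show ?thesis using r0 by simp
      next
        case se: False
        have s0: "s \<ge> 0" using False by simp
        have "\<forall>\<^sub>F m in sequentially. R $ i \<noteq> R $ j \<longrightarrow> wall_dist (P (k m)) i j z \<ge> s - e" for j
        proof (cases "R $ i = R $ j")
          case ne: False
          have "wall_dist R i j z \<ge> s" using zs ne unfolding cball_subset_cell_iff[OF s0] by blast
          then have "wall_dist R i j z > s - e" using e by simp
          then have "\<forall>\<^sub>F m in sequentially. wall_dist (P (k m)) i j z > s - e"
            using wall[OF ne tendsto_const[of z]] by (intro order_tendstoD(1))
          then show ?thesis by eventually_elim simp
        qed simp
        then have "\<forall>\<^sub>F m in sequentially. \<forall>j. R $ i \<noteq> R $ j \<longrightarrow> wall_dist (P (k m)) i j z \<ge> s - e"
          by (rule eventually_all_finite)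
        then have "\<forall>\<^sub>F m in sequentially. s - e \<le> \<rho> (k m)"
        proof eventually_elim
          case (elim m)
          have se0: "s - e \<ge> 0" using se by simp
          have "cball z (s - e) \<subseteq> voronoi_cell Q (P (k m)) i"
            unfolding cball_subset_cell_iff[OF se0]
            using elim zs e pat unfolding cball_subset_cell_iff[OF s0] by fastforce
          then show ?case by (rule rho(3))
        qed
        then have "s - e \<le> r" using rk by (intro tendsto_lowerbound) auto
        then show ?thesis by simp
      qed
    qed
  qed (use r0 in simp)
  ultimately show ?thesis using r0 unfolding incenter_set_def by blast
qed

text \<open>Identifies \<open>F_fun\<close> as the largest radius of a disk about the generator
  inside its cell; the closed disk fits because the cell is closed.\<close>

lemma F_fun_ball:
  fixes P :: "(real^2)^'n::finite"
  assumes P: "P \<in> configurations Q"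
  shows "F_fun Q P i \<ge> 0" "cball (P $ i) (F_fun Q P i) \<subseteq> voronoi_cell Q P i"
    "cball (P $ i) r \<subseteq> voronoi_cell Q P i \<Longrightarrow> r \<le> F_fun Q P i"
proof -
  let ?V = "voronoi_cell Q P i"
  have ne: "- interior ?V \<noteq> {}"
  proof
    assume "- interior ?V = {}"
    then have "?V = UNIV" using interior_subset by blast
    then show False using compact_imp_bounded[OF voronoi_cell_compact[of P i]] not_bounded_UNIV by metis
  qed
  have bdd: "bdd_below ((\<lambda>q. norm (q - P $ i)) ` (- interior ?V))" by (intro bdd_belowI2[of _ 0]) auto
  show F0: "F_fun Q P i \<ge> 0" unfolding F_fun_def by (rule cINF_greatest[OF ne]) auto
  show "r \<le> F_fun Q P i" if r: "cball (P $ i) r \<subseteq> ?V"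
    unfolding F_fun_def
  proof (rule cINF_greatest[OF ne])
    fix q assume q: "q \<in> - interior ?V"
    have "ball (P $ i) r \<subseteq> interior ?V" using r by (intro interior_maximal) auto
    then have "q \<notin> ball (P $ i) r" using q by auto
    then show "r \<le> norm (q - P $ i)" by (simp add: dist_norm norm_minus_commute)
  qed
  show "cball (P $ i) (F_fun Q P i) \<subseteq> ?V"
  proof (cases "F_fun Q P i = 0")
    case True
    then show ?thesis using generator_in_cell[OF P] by simp
  next
    case False
    have "ball (P $ i) (F_fun Q P i) \<subseteq> ?V"
    proof
      fix y assume y: "y \<in> ball (P $ i) (F_fun Q P i)"
      have "y \<in> interior ?V"
      proof (rule ccontr)
        assume "y \<notin> interior ?V"
        then have "F_fun Q P i \<le> norm (y - P $ i)" unfolding F_fun_def by (intro cINF_lower[OF bdd]) simp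
        then show False using y by (simp add: dist_norm norm_minus_commute)
      qed
      then show "y \<in> ?V" using interior_subset by blast
    qed
    then have "closure (ball (P $ i) (F_fun Q P i)) \<subseteq> ?V"
      by (rule closure_minimal[OF _ compact_imp_closed[OF voronoi_cell_compact]])
    then show ?thesis using False F0 by simp
  qed
qed

text \<open>In dimension 2 the facets are the edges, and the interior is nonempty, so the relative
  frontier is the frontier.\<close>

lemma edges_cover_frontier: "frontier Q = \<Union>{e. e edge_of Q}"
proof -
  have "aff_dim Q = 2" using Q_interior aff_dim_nonempty_interior[of Q] by simp
  then have "{F. F facet_of Q} = {e. e edge_of Q}" by (auto simp: facet_of_def edge_of_def)
  moreover have "rel_frontier Q = frontier Q" by (rule rel_frontier_nonempty_interior[OF Q_interior])
  ultimately show ?thesis using rel_frontier_of_polyhedron[OF Q_polyhedron] by metis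
qed

text \<open>An open disk around a point of \<open>Q\<close> that misses the frontier lies in
  \<open>Q\<close> by connectedness. This ties the distances to edges in \<open>H_SP\<close> to the
  linear description by \<open>sides\<close>.\<close>

lemma cball_subset_Q_iff_edges:
  assumes p: "p \<in> Q" and r: "r \<ge> 0"
  shows "cball p r \<subseteq> Q \<longleftrightarrow> (\<forall>e. e edge_of Q \<longrightarrow> r \<le> infdist p e)"
proof
  assume sub: "cball p r \<subseteq> Q"
  show "\<forall>e. e edge_of Q \<longrightarrow> r \<le> infdist p e"
  proof (intro allI impI)
    fix e assume e: "e edge_of Q"
    then have "aff_dim e = 1" by (simp add: edge_of_def)
    then have ne: "e \<noteq> {}" by auto
    have "ball p r \<subseteq> interior Q" using sub by (intro interior_maximal) auto
    moreover have "e \<subseteq> frontier Q" using e edges_cover_frontier by blast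
    ultimately have "r \<le> dist p y" if "y \<in> e" for y using that by (force simp: frontier_def)
    then show "r \<le> infdist p e" unfolding infdist_def using ne by (auto intro: cINF_greatest)
  qed
next
  assume e: "\<forall>e. e edge_of Q \<longrightarrow> r \<le> infdist p e"
  show "cball p r \<subseteq> Q"
  proof (cases "r = 0")
    case False
    have disj: "ball p r \<inter> frontier Q = {}"
    proof (rule ccontr)
      assume "ball p r \<inter> frontier Q \<noteq> {}"
      then obtain y f where y: "dist p y < r" "y \<in> f" "f edge_of Q" using edges_cover_frontier by auto
      have "infdist p f \<le> dist p y" by (rule infdist_le[OF y(2)])
      then show False using e y by force
    qed
    have "ball p r \<subseteq> Q"
    proof (rule ccontr)
      assume "\<not> ball p r \<subseteq> Q"
      moreover have "p \<in> ball p r \<inter> Q" using p r False by simp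
      ultimately show False using connected_Int_frontier[OF connected_ball, of p r Q] disj by blast
    qed
    then have "closure (ball p r) \<subseteq> Q" by (rule closure_minimal[OF _ Q_closed])
    then show ?thesis using False r by simp
  qed (use p in simp)
qed

lemma finite_edges: "finite {e. e edge_of Q}"
  using finite_polyhedron_faces[OF Q_polyhedron] by (rule rev_finite_subset) (auto simp: edge_of_def)

lemma edges_nonempty: "{e. e edge_of Q} \<noteq> {}"
proof
  assume "{e. e edge_of Q} = {}"
  then have "frontier Q = {}" using edges_cover_frontier by simp
  then show False using frontier_eq_empty[of Q] Q_nonempty Q_compact not_bounded_UNIV compact_imp_bounded by blast
qed

lemma H_SP_ge_iff:
  fixes P :: "(real^2)^'n::finite"
  shows "r \<le> H_SP Q P \<longleftrightarrow> (\<forall>i j. i \<noteq> j \<longrightarrow> r \<le> norm (P $ i - P $ j) / 2) \<and> (\<forall>i e. e edge_of Q \<longrightarrow> r \<le> infdist (P $ i) e)"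
proof -
  let ?A = "{norm (P $ i - P $ j) / 2 | i j. i \<noteq> j}" and ?B = "{infdist (P $ i) e | i e. e edge_of Q}"
  have eqA: "?A = (\<Union>i. (\<lambda>j. norm (P $ i - P $ j) / 2) ` {j. i \<noteq> j})" by blast
  have fA: "finite ?A" unfolding eqA by (rule finite_UN_I[OF finite_class.finite_UNIV]) simp
  have eqB: "?B = (\<Union>i. (\<lambda>e. infdist (P $ i) e) ` {e. e edge_of Q})" by blast
  have fB: "finite ?B" unfolding eqB by (rule finite_UN_I[OF finite_class.finite_UNIV]) (simp add: finite_edges)
  have "?B \<noteq> {}" using edges_nonempty by auto
  then have "r \<le> H_SP Q P \<longleftrightarrow> (\<forall>x\<in>?A \<union> ?B. r \<le> x)" unfolding H_SP_def using fA fB by (intro Min_ge_iff) auto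
  also have "\<dots> \<longleftrightarrow> (\<forall>i j. i \<noteq> j \<longrightarrow> r \<le> norm (P $ i - P $ j) / 2) \<and> (\<forall>i e. e edge_of Q \<longrightarrow> r \<le> infdist (P $ i) e)"
    by blast
  finally show ?thesis .
qed

text \<open>Distinctness of the generators is essential: a coincident pair makes \<open>H_SP\<close>
  at most 0, while the cells ignore it and may still contain large disks about their
  generators.\<close>

lemma H_SP_ge_iff_balls:
  fixes P :: "(real^2)^'n::finite"
  assumes P: "P \<in> configurations Q" and inj: "\<And>i j. i \<noteq> j \<Longrightarrow> P $ i \<noteq> P $ j" and r: "r \<ge> 0"
  shows "r \<le> H_SP Q P \<longleftrightarrow> (\<forall>i. cball (P $ i) r \<subseteq> voronoi_cell Q P i)"
proof -
  have "P $ i \<in> Q" for i using P by (simp add: configurations_def)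
  then have eq1: "(\<forall>i e. e edge_of Q \<longrightarrow> r \<le> infdist (P $ i) e) \<longleftrightarrow> (\<forall>i. \<forall>(a,b)\<in>sides. a \<bullet> P $ i - b \<ge> r)"
    using cball_subset_Q_iff_edges[OF _ r] cball_subset_Q_iff[OF r] by metis
  have eq2: "(\<forall>i j. i \<noteq> j \<longrightarrow> r \<le> norm (P $ i - P $ j) / 2) \<longleftrightarrow>
     (\<forall>i j. P $ i \<noteq> P $ j \<longrightarrow> wall_dist P i j (P $ i) \<ge> r)"
  proof -
    have "P $ i \<noteq> P $ j \<longleftrightarrow> i \<noteq> j" for i j using inj[of i j] by auto
    then show ?thesis unfolding wall_dist_self by simp
  qed
  show ?thesis unfolding H_SP_ge_iff cball_subset_cell_iff[OF r] all_conj_distrib eq1 eq2 by (rule conj_commute)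
qed

end

section \<open>Almost everywhere differentiability of Lipschitz curves on the half-line\<close>

lemma lipschitz_half_line_ae_differentiable:
  fixes f :: "real \<Rightarrow> real"
  assumes L: "L-lipschitz_on {0..} f"
  shows "\<exists>N. negligible N \<and> (\<forall>x>0. x \<notin> N \<longrightarrow> (\<exists>l. (f has_real_derivative l) (at x)))"
proof -
  \<comment> \<open>Reflection extends \<open>f\<close> to the whole line with the same Lipschitz
    constant.\<close>
  have "L-lipschitz_on UNIV (\<lambda>x. f \<bar>x\<bar>)"
  proof (rule lipschitz_onI)
    fix x y :: real
    have "dist (f \<bar>x\<bar>) (f \<bar>y\<bar>) \<le> L * dist \<bar>x\<bar> \<bar>y\<bar>" by (rule lipschitz_onD[OF L]) auto
    also have "\<dots> \<le> L * dist x y"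
      using lipschitz_on_nonneg[OF L] by (intro mult_left_mono) (auto simp: dist_real_def)
    finally show "dist (f \<bar>x\<bar>) (f \<bar>y\<bar>) \<le> L * dist x y" .
  qed (rule lipschitz_on_nonneg[OF L])
  then obtain N where N: "negligible N" "\<And>x. x \<notin> N \<Longrightarrow> \<exists>l. ((\<lambda>x. f \<bar>x\<bar>) has_real_derivative l) (at x)"
    using lipschitz_ae_differentiable by metis
  have "\<exists>l. (f has_real_derivative l) (at x)" if x: "x > 0" "x \<notin> N" for x
  proof -
    obtain l where l: "((\<lambda>x. f \<bar>x\<bar>) has_real_derivative l) (at x)" using N(2)[OF x(2)] by blast
    have "(f has_real_derivative l) (at x)"
      by (rule has_field_derivative_transform_within_open[OF l, of "{0<..}"]) (use x in auto)
    then show ?thesis by blast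
  qed
  then show ?thesis using N(1) by blast
qed

lemma lipschitz_ae_vector_differentiable:
  fixes \<Gamma> :: "real \<Rightarrow> 'a::euclidean_space^'n::finite"
  assumes L: "L-lipschitz_on {0..} \<Gamma>"
  shows "\<exists>N. negligible N \<and> (\<forall>x>0. x \<notin> N \<longrightarrow> (\<exists>v. (\<Gamma> has_vector_derivative v) (at x)))"
proof -
  have L0: "L \<ge> 0" by (rule lipschitz_on_nonneg[OF L])
  have "\<exists>N. negligible N \<and> (\<forall>x>0. x \<notin> N \<longrightarrow> (\<exists>l. ((\<lambda>s. b \<bullet> \<Gamma> s $ i) has_real_derivative l) (at x)))" if b: "b \<in> Basis" for b i
  proof (rule lipschitz_half_line_ae_differentiable)
    show "L-lipschitz_on {0..} (\<lambda>s. b \<bullet> \<Gamma> s $ i)"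
    proof (rule lipschitz_onI[OF _ L0])
      fix x y :: real assume xy: "x \<in> {0..}" "y \<in> {0..}"
      have "dist (b \<bullet> \<Gamma> x $ i) (b \<bullet> \<Gamma> y $ i) = \<bar>b \<bullet> (\<Gamma> x - \<Gamma> y) $ i\<bar>" by (simp add: dist_real_def inner_diff_right)
      also have "\<dots> \<le> norm b * norm ((\<Gamma> x - \<Gamma> y) $ i)" by (rule Cauchy_Schwarz_ineq2)
      also have "\<dots> \<le> norm (\<Gamma> x - \<Gamma> y)" using b Finite_Cartesian_Product.norm_nth_le[of "\<Gamma> x - \<Gamma> y" i] by simp
      also have "\<dots> \<le> L * dist x y" using lipschitz_onD[OF L xy] by (simp add: dist_norm)
      finally show "dist (b \<bullet> \<Gamma> x $ i) (b \<bullet> \<Gamma> y $ i) \<le> L * dist x y" .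
    qed
  qed
  then have "\<forall>bi. \<exists>N. fst bi \<in> Basis \<longrightarrow> negligible N \<and> (\<forall>x>0. x \<notin> N \<longrightarrow> (\<exists>l. ((\<lambda>s. fst bi \<bullet> \<Gamma> s $ snd bi) has_real_derivative l) (at x)))"
    by blast
  from choice[OF this] obtain N where N: "\<And>bi. fst bi \<in> Basis \<Longrightarrow> negligible (N bi)"
    "\<And>bi x. fst bi \<in> Basis \<Longrightarrow> x > 0 \<Longrightarrow> x \<notin> N bi \<Longrightarrow> \<exists>l. ((\<lambda>s. fst bi \<bullet> \<Gamma> s $ snd bi) has_real_derivative l) (at x)"
    by blast
  define M where "M = (\<Union>bi\<in>Basis \<times> UNIV. N bi)"
  have "negligible M" unfolding M_def using N(1) by (intro negligible_Union finite_imageI) auto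
  moreover have "\<exists>v. (\<Gamma> has_vector_derivative v) (at x)" if x: "x > 0" "x \<notin> M" for x
  proof -
    have "\<exists>l. ((\<lambda>s. b \<bullet> \<Gamma> s $ i) has_real_derivative l) (at x)" if "b \<in> Basis" for b i
      using N(2)[of "(b,i)" x] x that by (auto simp: M_def)
    then have "\<forall>i. \<forall>b\<in>Basis. \<exists>l. ((\<lambda>s. b \<bullet> \<Gamma> s $ i) has_real_derivative l) (at x)" by blast
    then have "\<forall>i. \<exists>l. \<forall>b\<in>Basis. ((\<lambda>s. b \<bullet> \<Gamma> s $ i) has_real_derivative l b) (at x)"
      unfolding bchoice_iff .
    from choice[OF this] obtain l where l: "\<And>i b. b \<in> Basis \<Longrightarrow> ((\<lambda>s. b \<bullet> \<Gamma> s $ i) has_real_derivative l i b) (at x)" by blast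
    define v where "v = (\<chi> i. \<Sum>b\<in>Basis. l i b *\<^sub>R b)"
    have "b \<bullet> v $ i = l i b" if "b \<in> Basis" for b i
      unfolding inner_commute[of b] using that by (simp add: v_def)
    then have "(\<Gamma> has_vector_derivative v) (at x)" using l by (intro has_vector_derivative_vecI) simp
    then show ?thesis by blast
  qed
  ultimately show ?thesis by blast
qed

context polygon
begin

section \<open>Convergence of the incenter dynamics\<close>

text \<open>
  \<open>E\<close> is the set of pairs of generators that do not coincide. The margin is the
  sphere-packing function of the configuration in which coinciding generators are
  identified.
\<close>

definition has_pattern :: "('n \<times> 'n) set \<Rightarrow> (real^2)^'n::finite \<Rightarrow> bool" where
  "has_pattern E P \<longleftrightarrow> (\<forall>i j. P $ i \<noteq> P $ j \<longleftrightarrow> (i,j) \<in> E)"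

text \<open>One index type for both kinds of constraint, so that the margin is a single finite
  minimum to which the slope lemmas apply. Each gap of \<open>gap_indices E\<close> is
  differentiable along curves with pattern \<open>E\<close>.\<close>

definition gap :: "('n \<times> 'n) + ('n \<times> (real^2) \<times> real) \<Rightarrow> (real^2)^'n::finite \<Rightarrow> real" where
  "gap k P = (case k of Inl (i,j) \<Rightarrow> norm (P $ i - P $ j) / 2 | Inr (i,a,b) \<Rightarrow> a \<bullet> P $ i - b)"

definition gap_indices :: "('n \<times> 'n) set \<Rightarrow> (('n \<times> 'n) + ('n \<times> (real^2) \<times> real)) set" where
  "gap_indices E = Inl ` E \<union> Inr ` (UNIV \<times> sides)"

definition margin :: "('n \<times> 'n) set \<Rightarrow> (real^2)^'n::finite \<Rightarrow> real" where
  "margin E P = Min ((\<lambda>k. gap k P) ` gap_indices E)"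

lemma gap_indices_finite: "finite (gap_indices E :: (('n::finite \<times> 'n) + _) set)"
  and gap_indices_nonempty: "gap_indices E \<noteq> {}"
  using sides_finite sides_nonempty by (auto simp: gap_indices_def)

lemma le_margin_iff: "r \<le> margin E P \<longleftrightarrow> (\<forall>k\<in>gap_indices E. r \<le> gap k P)"
  unfolding margin_def using gap_indices_finite gap_indices_nonempty by (subst Min_ge_iff) auto

lemma ball_gap_indices:
  "(\<forall>k\<in>gap_indices E. R k) \<longleftrightarrow>
     (\<forall>i j. (i,j) \<in> E \<longrightarrow> R (Inl (i,j))) \<and> (\<forall>i a b. (a,b) \<in> sides \<longrightarrow> R (Inr (i,a,b)))"
  by (auto simp: gap_indices_def)

lemma side_le: "x \<in> Q \<Longrightarrow> (a,b) \<in> sides \<Longrightarrow> b \<le> a \<bullet> x"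
  using equalityD1[OF Q_eq_sides] by blast

lemma le_margin_iff_balls:
  fixes P :: "(real^2)^'n::finite"
  assumes "has_pattern E P" "r \<ge> 0"
  shows "r \<le> margin E P \<longleftrightarrow> (\<forall>i. cball (P $ i) r \<subseteq> voronoi_cell Q P i)"
proof -
  have "r \<le> margin E P \<longleftrightarrow> (\<forall>i j. (i,j) \<in> E \<longrightarrow> r \<le> norm (P $ i - P $ j) / 2) \<and>
      (\<forall>i a b. (a,b) \<in> sides \<longrightarrow> r \<le> a \<bullet> P $ i - b)"
    unfolding le_margin_iff ball_gap_indices gap_def by simp
  also have "(\<forall>i j. (i,j) \<in> E \<longrightarrow> r \<le> norm (P $ i - P $ j) / 2) \<longleftrightarrow>
      (\<forall>i j. P $ i \<noteq> P $ j \<longrightarrow> wall_dist P i j (P $ i) \<ge> r)"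
    using assms(1) unfolding has_pattern_def wall_dist_self by simp
  also have "(\<forall>i a b. (a,b) \<in> sides \<longrightarrow> r \<le> a \<bullet> P $ i - b) \<longleftrightarrow> (\<forall>i. \<forall>(a,b)\<in>sides. r \<le> a \<bullet> P $ i - b)"
    by auto
  finally show ?thesis unfolding cball_subset_cell_iff[OF assms(2)] all_conj_distrib by (simp only: conj_commute)
qed

lemma margin_nonneg: "P \<in> configurations Q \<Longrightarrow> margin E P \<ge> 0"
  unfolding le_margin_iff ball_gap_indices gap_def configurations_def using side_le by simp

lemma gap_lipschitz:
  assumes "k \<in> gap_indices E"
  shows "1-lipschitz_on UNIV (gap k :: (real^2)^'n::finite \<Rightarrow> real)"
proof (rule lipschitz_onI)
  fix P R :: "(real^2)^'n"
  have comp: "norm (P $ i - R $ i) \<le> dist P R" for i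
    using Finite_Cartesian_Product.norm_nth_le[of "P - R" i] by (simp add: dist_norm)
  consider i j where "k = Inl (i,j)" | i a b where "k = Inr (i,a,b)" "(a,b) \<in> sides"
    using assms by (auto simp: gap_indices_def)
  then show "dist (gap k P) (gap k R) \<le> 1 * dist P R"
  proof cases
    case (1 i j)
    have "\<bar>norm (P $ i - P $ j) - norm (R $ i - R $ j)\<bar> \<le> norm ((P $ i - P $ j) - (R $ i - R $ j))"
      by (rule norm_triangle_ineq3)
    also have "\<dots> = norm ((P $ i - R $ i) - (P $ j - R $ j))" by (simp add: algebra_simps)
    also have "\<dots> \<le> norm (P $ i - R $ i) + norm (P $ j - R $ j)" by (rule norm_triangle_ineq4)
    also have "\<dots> \<le> 2 * dist P R" using comp[of i] comp[of j] by simp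
    finally show ?thesis using 1 by (simp add: gap_def dist_real_def abs_le_iff)
  next
    case (2 i a b)
    have "\<bar>a \<bullet> (P $ i - R $ i)\<bar> \<le> norm a * norm (P $ i - R $ i)" by (rule Cauchy_Schwarz_ineq2)
    then show ?thesis using 2 comp[of i] sides_unit[OF 2(2)] by (simp add: gap_def dist_real_def inner_diff_right)
  qed
qed simp

lemma margin_lipschitz: "1-lipschitz_on UNIV (margin E :: (real^2)^'n::finite \<Rightarrow> real)"
  unfolding margin_def by (rule lipschitz_on_Min[OF gap_indices_finite gap_indices_nonempty gap_lipschitz])

definition gap_rate :: "('n \<times> 'n) + ('n \<times> (real^2) \<times> real) \<Rightarrow> (real^2)^'n::finite \<Rightarrow> (real^2)^'n \<Rightarrow> real" where
  "gap_rate k P c = (case k of Inl (i,j) \<Rightarrow> (sgn (P $ i - P $ j) \<bullet> (c $ i - c $ j) - norm (P $ i - P $ j)) / 2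
     | Inr (i,a,b) \<Rightarrow> a \<bullet> (c $ i - P $ i))"

lemma gap_has_derivative:
  fixes P :: "real \<Rightarrow> (real^2)^'n::finite"
  assumes d: "(P has_vector_derivative (c - P t)) (at t)" and pat: "has_pattern E (P t)" and k: "k \<in> gap_indices E"
  shows "((\<lambda>s. gap k (P s)) has_real_derivative gap_rate k (P t) c) (at t)"
proof -
  have comp: "((\<lambda>s. P s $ i) has_vector_derivative c $ i - P t $ i) (at t)" for i
    using vec_nth_has_vector_derivative[OF d, of i] by simp
  consider i j where "k = Inl (i,j)" "(i,j) \<in> E" | i a b where "k = Inr (i,a,b)"
    using k by (auto simp: gap_indices_def)
  then show ?thesis
  proof cases
    case (1 i j)
    let ?y = "\<lambda>s. P s $ i - P s $ j"
    have y: "(?y has_vector_derivative (c $ i - P t $ i) - (c $ j - P t $ j)) (at t)"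
      by (rule has_vector_derivative_diff[OF comp comp])
    have y0: "?y t \<noteq> 0" using 1(2) pat by (auto simp: has_pattern_def)
    have "sgn (?y t) \<bullet> ?y t = norm (?y t)"
      using y0 by (simp add: sgn_div_norm power2_norm_eq_inner[symmetric] power2_eq_square)
    then have "sgn (?y t) \<bullet> ((c $ i - P t $ i) - (c $ j - P t $ j)) = sgn (?y t) \<bullet> (c $ i - c $ j) - norm (?y t)"
      by (simp add: inner_diff_right)
    then have "((\<lambda>s. norm (?y s)) has_real_derivative sgn (?y t) \<bullet> (c $ i - c $ j) - norm (?y t)) (at t)"
      using has_real_derivative_norm[OF y y0] by simp
    then show ?thesis unfolding gap_def gap_rate_def 1(1) by (simp add: DERIV_cdivide)
  next
    case (2 i a b)
    have "((\<lambda>s. a \<bullet> P s $ i - b) has_real_derivative a \<bullet> (c $ i - P t $ i) - 0) (at t)"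
      by (intro DERIV_diff inner_has_real_derivative[OF comp] DERIV_const)
    then show ?thesis unfolding gap_def gap_rate_def 2 by simp
  qed
qed

text \<open>The disks of radii \<open>\<rho> i\<close> and \<open>\<rho> j\<close> lie on opposite
  sides of the bisector, so their centers are \<open>\<rho> i + \<rho> j\<close> apart in its normal
  direction, whereas the generators are \<open>2 * m\<close> apart. Pairs give the factor 1/2; sides
  give even \<open>\<rho> i - m\<close>.\<close>

lemma gap_rate_ge:
  fixes P c :: "(real^2)^'n::finite"
  assumes pat: "has_pattern E P" and k: "k \<in> gap_indices E"
    and \<rho>: "\<And>i. \<rho> i \<ge> 0" "\<And>i. cball (c $ i) (\<rho> i) \<subseteq> voronoi_cell Q P i"
    and i: "i = (case k of Inl (i,j) \<Rightarrow> i | Inr (i,a,b) \<Rightarrow> i)" and m: "\<And>j. m \<le> \<rho> j" "gap k P = m"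
  shows "gap_rate k P c \<ge> (\<rho> i - m) / 2"
proof -
  consider i' j where "k = Inl (i',j)" "(i',j) \<in> E" | i' a b where "k = Inr (i',a,b)" "(a,b) \<in> sides"
    using k by (auto simp: gap_indices_def)
  then show ?thesis
  proof cases
    case (1 i' j)
    then have i': "i' = i" using i by simp
    then have "P $ i \<noteq> P $ j" using 1(2) pat by (auto simp: has_pattern_def)
    then have ne: "P $ i \<noteq> P $ j" "P $ j \<noteq> P $ i" by auto
    have "wall_dist P i j (c $ i) \<ge> \<rho> i" "wall_dist P j i (c $ j) \<ge> \<rho> j"
      using \<rho>(2) ne unfolding cball_subset_cell_iff[OF \<rho>(1)] by blast+
    moreover have "wall_dist P i j (c $ i) + wall_dist P j i (c $ j) = sgn (P $ i - P $ j) \<bullet> (c $ i - c $ j)"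
    proof -
      have "sgn (P $ j - P $ i) = - sgn (P $ i - P $ j)" by (simp flip: sgn_minus)
      then show ?thesis by (simp add: wall_dist_def inner_diff_right add.commute)
    qed
    moreover have "norm (P $ i - P $ j) = 2 * m" using m(2) 1(1) i' by (simp add: gap_def)
    ultimately show ?thesis using m(1)[of j] unfolding gap_rate_def 1(1) i' by (simp add: field_simps)
  next
    case (2 i' a b)
    then have i': "i' = i" using i by simp
    have "a \<bullet> c $ i - b \<ge> \<rho> i" using \<rho>(2)[of i] 2(2) unfolding cball_subset_cell_iff[OF \<rho>(1)] by blast
    moreover have "a \<bullet> P $ i - b = m" using m(2) 2(1) i' by (simp add: gap_def)
    ultimately show ?thesis using m(1)[of i] unfolding gap_rate_def 2(1) i' by (simp add: inner_diff_right)
  qed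
qed

definition sp_curve :: "real \<Rightarrow> (real \<Rightarrow> (real^2)^'n::finite) \<Rightarrow> (real \<Rightarrow> (real^2)^'n) \<Rightarrow> real set \<Rightarrow> bool" where
  "sp_curve L P C N \<longleftrightarrow> cell_curve L P C N \<and>
     (\<forall>t>0. t \<notin> N \<longrightarrow> (\<forall>i. C t $ i \<in> incenter_set (voronoi_cell Q (P t) i)))"

lemma sp_curveD:
  assumes "sp_curve L P C N"
  shows "cell_curve L P C N" "t > 0 \<Longrightarrow> t \<notin> N \<Longrightarrow> C t $ i \<in> incenter_set (voronoi_cell Q (P t) i)"
  using assms by (auto simp: sp_curve_def)

lemma sp_curve_translate:
  assumes c: "sp_curve L P C N" and s: "s \<ge> 0"
  shows "sp_curve L (\<lambda>\<tau>. P (s + \<tau>)) (\<lambda>\<tau>. C (s + \<tau>)) ((+) (- s) ` N)"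
  unfolding sp_curve_def
proof (intro conjI allI impI cell_curve_translate[OF sp_curveD(1)[OF c] s])
  fix t i assume t: "0 < t" "t \<notin> (+) (- s) ` N"
  have "s + t \<notin> N"
  proof
    assume "s + t \<in> N"
    then have "- s + (s + t) \<in> (+) (- s) ` N" by blast
    then show False using t(2) by simp
  qed
  then show "C (s + t) $ i \<in> incenter_set (voronoi_cell Q (P (s + t)) i)"
    using sp_curveD(2)[OF c] s t(1) by simp
qed

text \<open>The disk of radius \<open>m\<close> about each generator lies in its cell, so every
  inradius is at least \<open>m\<close>, and by \<open>gap_rate_ge\<close> no active constraint
  decreases.\<close>

lemma sp_curve_margin_mono:
  fixes P :: "real \<Rightarrow> (real^2)^'n::finite"
  assumes c: "sp_curve L P C N" and pat: "\<And>t. t \<ge> 0 \<Longrightarrow> has_pattern E (P t)" and ab: "0 \<le> a" "a \<le> b"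
  shows "margin E (P a) \<le> margin E (P b)"
proof -
  note cc = sp_curveD(1)[OF c]
  have "L-lipschitz_on {a..b} (\<lambda>s. margin E (P s))"
  proof (rule lipschitz_onI)
    fix x y assume xy: "x \<in> {a..b}" "y \<in> {a..b}"
    have "dist (margin E (P x)) (margin E (P y)) \<le> 1 * dist (P x) (P y)"
      by (rule lipschitz_onD[OF margin_lipschitz]) auto
    also have "\<dots> \<le> L * dist x y" using lipschitz_onD[OF cell_curveD(2)[OF cc], of x y] xy ab by auto
    finally show "dist (margin E (P x)) (margin E (P y)) \<le> L * dist x y" .
  qed (use cell_curveD(2)[OF cc] lipschitz_on_nonneg in blast)
  then have "0 * (b - a) \<le> margin E (P b) - margin E (P a)"
  proof (rule ae_lower_slope_lipschitz[OF ab(2) _ cell_curveD(1)[OF cc]])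
    fix t assume t: "a < t" "t < b" "t \<notin> N"
    then have t0: "t > 0" using ab by simp
    define m where "m = margin E (P t)"
    have PX: "P t \<in> configurations Q" and pt: "has_pattern E (P t)" using cell_curveD(3)[OF cc] pat t0 by auto
    have m0: "m \<ge> 0" unfolding m_def by (rule margin_nonneg[OF PX])
    have "\<forall>i. cball (P t $ i) m \<subseteq> voronoi_cell Q (P t) i"
      using le_margin_iff_balls[OF pt m0] by (simp add: m_def)
    then have "\<forall>i. \<exists>r\<ge>0. cball (C t $ i) r \<subseteq> voronoi_cell Q (P t) i \<and> m \<le> r"
      using incenter_radius[OF sp_curveD(2)[OF c t0 t(3)]] by metis
    from choice[OF this] obtain \<rho> where rho: "\<And>i. \<rho> i \<ge> 0" "\<And>i. cball (C t $ i) (\<rho> i) \<subseteq> voronoi_cell Q (P t) i" "\<And>i. m \<le> \<rho> i"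
      by blast
    have d: "((\<lambda>s. gap k (P s)) has_real_derivative gap_rate k (P t) (C t)) (at t)" if "k \<in> gap_indices E" for k
      by (rule gap_has_derivative[OF cell_curveD(4)[OF cc t0 t(3)] pt that])
    show "lower_slope (\<lambda>s. margin E (P s)) t 0"
      unfolding margin_def
    proof (rule lower_slope_Min[OF gap_indices_finite gap_indices_nonempty])
      show "isCont (\<lambda>s. gap k (P s)) t" if "k \<in> gap_indices E" for k using d[OF that] by (rule DERIV_isCont)
      fix k assume k: "k \<in> gap_indices E" "gap k (P t) = Min ((\<lambda>k. gap k (P t)) ` gap_indices E)"
      define i where "i = (case k of Inl (i,j) \<Rightarrow> i | Inr (i,a,b) \<Rightarrow> i)"
      have "gap_rate k (P t) (C t) \<ge> (\<rho> i - m) / 2"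
        by (rule gap_rate_ge[OF pt k(1) rho(1,2) i_def rho(3)]) (use k(2) in \<open>simp add: m_def margin_def\<close>)
      moreover have "(\<rho> i - m) / 2 \<ge> 0" using rho(3)[of i] by simp
      ultimately have "gap_rate k (P t) (C t) \<ge> 0" by (rule order_trans[rotated])
      then show "lower_slope (\<lambda>s. gap k (P s)) t 0" by (rule lower_slope_mono[OF lower_slope_has_derivative[OF d[OF k(1)]]])
    qed
  qed
  then show ?thesis by simp
qed

text \<open>The distance to a side, weighted by \<open>exp s\<close>, grows at the rate of the
  weighted distance of the incenter, which is positive because cells have positive inradius. If it
  vanished at \<open>t\<close> it would vanish on all of \<open>[0, t]\<close>, against this
  rate.\<close>

lemma sp_curve_leaves_boundary:
  fixes P :: "real \<Rightarrow> (real^2)^'n::finite"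
  assumes c: "sp_curve L P C N" and t: "t > 0" and ab: "(a,b) \<in> sides"
  shows "a \<bullet> P t $ i - b > 0"
proof -
  note cc = sp_curveD(1)[OF c]
  let ?f = "\<lambda>s. a \<bullet> P s $ i - b"
  let ?g = "\<lambda>s. exp s * ?f s"
  have f0: "?f s \<ge> 0" if "s \<ge> 0" for s
    using cell_curveD(3)[OF cc that] side_le[OF _ ab] by (auto simp: configurations_def)
  have d: "(?g has_real_derivative exp s * (a \<bullet> C s $ i - b)) (at s) \<and> a \<bullet> C s $ i - b > 0" if s: "s > 0" "s \<notin> N" for s
  proof
    have "((\<lambda>s. P s $ i) has_vector_derivative C s $ i - P s $ i) (at s)"
      using vec_nth_has_vector_derivative[OF cell_curveD(4)[OF cc s], of i] by simp
    then have "(?f has_real_derivative a \<bullet> (C s $ i - P s $ i) - 0) (at s)"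
      by (intro DERIV_diff inner_has_real_derivative DERIV_const)
    then have "(?g has_real_derivative exp s * ?f s + (a \<bullet> (C s $ i - P s $ i) - 0) * exp s) (at s)"
      by (intro DERIV_mult DERIV_exp)
    then show "(?g has_real_derivative exp s * (a \<bullet> C s $ i - b)) (at s)" by (simp add: inner_diff_right algebra_simps)
    obtain z r where zr: "r > 0" "cball z r \<subseteq> voronoi_cell Q (P s) i"
      by (rule cell_inner_ball[OF cell_curveD(3)[OF cc less_imp_le[OF s(1)]], of i]) (rule that)
    obtain \<rho> where rho: "\<rho> \<ge> 0" "cball (C s $ i) \<rho> \<subseteq> voronoi_cell Q (P s) i" "\<And>z r. cball z r \<subseteq> voronoi_cell Q (P s) i \<Longrightarrow> r \<le> \<rho>"
      using incenter_radius[OF sp_curveD(2)[OF c s]] by metis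
    have "a \<bullet> C s $ i - b \<ge> \<rho>" using rho(2) ab unfolding cball_subset_cell_iff[OF rho(1)] by blast
    then show "a \<bullet> C s $ i - b > 0" using rho(3)[OF zr(2)] zr(1) by linarith
  qed
  have mono: "?g x \<le> ?g y" if xy: "0 \<le> x" "x \<le> y" for x y
  proof -
    have fl: "L-lipschitz_on {x..y} ?f"
    proof (rule lipschitz_onI)
      fix s s' assume ss: "s \<in> {x..y}" "s' \<in> {x..y}"
      have "\<bar>a \<bullet> (P s $ i - P s' $ i)\<bar> \<le> norm a * norm (P s $ i - P s' $ i)" by (rule Cauchy_Schwarz_ineq2)
      also have "\<dots> = dist (P s $ i) (P s' $ i)" using sides_unit[OF ab] by (simp add: dist_norm)
      also have "\<dots> \<le> L * dist s s'" by (rule lipschitz_onD[OF cell_curve_component_lipschitz[OF cc xy(1)] ss])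
      finally show "dist (?f s) (?f s') \<le> L * dist s s'" by (simp add: dist_real_def inner_diff_right)
    qed (use cell_curveD(2)[OF cc] lipschitz_on_nonneg in blast)
    obtain B where B: "\<And>y. y \<in> Q \<Longrightarrow> norm y \<le> B" using compact_imp_bounded[OF Q_compact] bounded_iff by blast
    have fb: "\<bar>?f s\<bar> \<le> B + \<bar>b\<bar>" if "s \<in> {x..y}" for s
    proof -
      have "P s $ i \<in> Q" using cell_curveD(3)[OF cc, of s] that xy by (auto simp: configurations_def)
      then have "\<bar>a \<bullet> P s $ i\<bar> \<le> B" using Cauchy_Schwarz_ineq2[of a "P s $ i"] sides_unit[OF ab] B by fastforce
      then show ?thesis by linarith
    qed
    have "0 * (y - x) \<le> ?g y - ?g x"
    proof (rule ae_lower_slope_lipschitz[OF xy(2) lipschitz_exp_times[OF fl fb xy(2)] cell_curveD(1)[OF cc]])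
      fix s assume s: "x < s" "s < y" "s \<notin> N"
      then have s0: "s > 0" using xy by simp
      show "lower_slope ?g s 0"
        by (rule lower_slope_mono[OF lower_slope_has_derivative[OF conjunct1[OF d[OF s0 s(3)]]]])
          (use conjunct2[OF d[OF s0 s(3)]] in simp)
    qed
    then show ?thesis by simp
  qed
  show ?thesis
  proof (rule ccontr)
    assume "\<not> ?f t > 0"
    then have ft: "?f t = 0" using f0[of t] t by simp
    have g0: "?g s = 0" if "0 \<le> s" "s \<le> t" for s
      using mono[OF that] ft f0[OF that(1)] by (simp add: mult_le_0_iff)
    have "\<not> {0<..<t} \<subseteq> N"
    proof
      assume "{0<..<t} \<subseteq> N"
      then have "negligible {0<..<t}" using cell_curveD(1)[OF cc] negligible_subset by blast
      then show False using open_not_negligible[of "{0<..<t}"] t by auto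
    qed
    then obtain s where "s \<in> {0<..<t}" and sN: "s \<notin> N" by blast
    then have s: "0 < s" "s < t" "s \<notin> N" by auto
    have "((\<lambda>_. 0) has_real_derivative exp s * (a \<bullet> C s $ i - b)) (at s)"
      by (rule has_field_derivative_transform_within_open[OF conjunct1[OF d[OF s(1,3)]], of "{0<..<t}"]) (use s g0 in auto)
    then have "exp s * (a \<bullet> C s $ i - b) = 0" using DERIV_const DERIV_unique by blast
    then show False using d[OF s(1,3)] by simp
  qed
qed

text \<open>Generators that are apart at some time remain apart, and there are finitely many pairs;
  so the pattern is constant from some time on. By then the boundary has been left as well, and the
  margin is positive.\<close>

lemma sp_curve_eventual_pattern:
  fixes P :: "real \<Rightarrow> (real^2)^'n::finite"
  assumes c: "sp_curve L P C N"
  obtains T E where "T \<ge> 0" "\<And>t. t \<ge> T \<Longrightarrow> has_pattern E (P t)" "margin E (P T) > 0"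
proof -
  note cc = sp_curveD(1)[OF c]
  define E where "E = {(i,j). \<exists>t\<ge>0. P t $ i \<noteq> P t $ j}"
  have "\<forall>ij. \<exists>t\<ge>0. ij \<in> E \<longrightarrow> P t $ fst ij \<noteq> P t $ snd ij" by (auto simp: E_def)
  from choice[OF this] obtain s where s: "\<And>ij. s ij \<ge> 0" "\<And>ij. ij \<in> E \<Longrightarrow> P (s ij) $ fst ij \<noteq> P (s ij) $ snd ij" by blast
  \<comment> \<open>Inserting 1 makes \<open>T\<close> positive, as needed to have left the
    boundary.\<close>
  define T where "T = Max (insert 1 (range s))"
  have T: "T \<ge> 1" unfolding T_def by (rule Max_ge) auto
  have sT: "s ij \<le> T" for ij unfolding T_def by (rule Max_ge) auto
  have pat: "has_pattern E (P t)" if t: "t \<ge> T" for t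
    unfolding has_pattern_def
  proof (intro allI iffI)
    fix i j assume ij: "(i,j) \<in> E"
    have "s (i,j) \<le> t" using sT[of "(i,j)"] t by linarith
    then have "exp (s (i,j)) * norm (P (s (i,j)) $ i - P (s (i,j)) $ j) \<le> exp t * norm (P t $ i - P t $ j)"
      by (intro cell_curve_exp_dist_mono[OF cc s(1)])
    moreover have "exp (s (i,j)) * norm (P (s (i,j)) $ i - P (s (i,j)) $ j) > 0" using s(2)[OF ij] by simp
    ultimately show "P t $ i \<noteq> P t $ j" by auto
  next
    fix i j assume "P t $ i \<noteq> P t $ j"
    then show "(i,j) \<in> E" using t T unfolding E_def by (intro CollectI case_prodI exI[of _ t]) auto
  qed
  have "gap k (P T) > 0" if k: "k \<in> gap_indices E" for k
  proof -
    consider i j where "k = Inl (i,j)" "(i,j) \<in> E" | i a b where "k = Inr (i,a,b)" "(a,b) \<in> sides"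
      using k by (auto simp: gap_indices_def)
    then show ?thesis
    proof cases
      case (1 i j)
      then show ?thesis using pat[OF order_refl] by (simp add: gap_def has_pattern_def)
    next
      case (2 i a b)
      have "T > 0" using T by simp
      then show ?thesis using sp_curve_leaves_boundary[OF c _ 2(2)] 2(1) by (simp add: gap_def)
    qed
  qed
  then have "margin E (P T) > 0" unfolding margin_def
    using gap_indices_finite gap_indices_nonempty by (subst Min_gr_iff) auto
  then show thesis using that[of T E] T pat by simp
qed

text \<open>Otherwise a line separates the end point of the velocity from the closed convex incenter
  set. Incenters of nearby configurations with the same pattern stay beyond that line, which bounds
  the slopes of \<open>a \<bullet> P k\<close> from below; the bound passes to
  \<open>\<Gamma>\<close> and contradicts its derivative.\<close>

lemma sp_limit_inclusion:
  fixes P :: "nat \<Rightarrow> real \<Rightarrow> (real^2)^'n::finite"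
  assumes c: "\<And>k. sp_curve L (P k) (C k) (N k)"
    and lim: "\<And>\<tau>. \<tau> \<ge> 0 \<Longrightarrow> (\<lambda>k. P k \<tau>) \<longlonglongrightarrow> \<Gamma> \<tau>"
    and pat: "\<And>k \<tau>. \<tau> \<ge> 0 \<Longrightarrow> has_pattern E (P k \<tau>)" "\<And>\<tau>. \<tau> \<ge> 0 \<Longrightarrow> has_pattern E (\<Gamma> \<tau>)"
    and \<tau>0: "\<tau>0 > 0" and d: "(\<Gamma> has_vector_derivative v) (at \<tau>0)"
  shows "v $ i + \<Gamma> \<tau>0 $ i \<in> incenter_set (voronoi_cell Q (\<Gamma> \<tau>0) i)"
proof (rule ccontr)
  define R where "R = \<Gamma> \<tau>0"
  define p where "p = R $ i"
  define K where "K = incenter_set (voronoi_cell Q R i)"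
  define y where "y = v $ i + p"
  assume "v $ i + \<Gamma> \<tau>0 $ i \<notin> incenter_set (voronoi_cell Q (\<Gamma> \<tau>0) i)"
  then have yK: "y \<notin> K" by (simp add: y_def p_def K_def R_def)
  have patR: "has_pattern E R" unfolding R_def using pat(2) \<tau>0 by simp
  have L0: "L \<ge> 0" using cell_curveD(2)[OF sp_curveD(1)[OF c]] lipschitz_on_nonneg by blast
  have same: "S $ i = S $ j \<longleftrightarrow> R $ i = R $ j" if "has_pattern E S" for S i j
    using that patR unfolding has_pattern_def by metis
  have "closed K" unfolding closed_sequential_limits K_def
  proof (intro allI impI, elim conjE)
    fix x l assume "\<forall>n. x n \<in> incenter_set (voronoi_cell Q R i)" "x \<longlonglongrightarrow> l"
    then show "l \<in> incenter_set (voronoi_cell Q R i)"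
      by (intro incenter_closed_graph[of "\<lambda>_. R" R x i l]) auto
  qed
  moreover have "convex K" unfolding K_def by (rule incenter_set_convex)
  ultimately obtain a \<beta> where ab: "a \<bullet> y < \<beta>" "\<And>x. x \<in> K \<Longrightarrow> \<beta> < a \<bullet> x"
    using separating_hyperplane_closed_point[OF _ _ yK] by blast
  \<comment> \<open>Half of the separation: one half is lost to the motion of the generators near
    \<open>\<tau>0\<close>, the other gives the contradiction.\<close>
  define \<epsilon> where "\<epsilon> = (\<beta> - a \<bullet> y) / 2"
  have eps: "\<epsilon> > 0" using ab(1) by (simp add: \<epsilon>_def)
  have "\<exists>\<delta>>0. \<forall>S x. has_pattern E S \<and> dist S R < \<delta> \<and> x \<in> incenter_set (voronoi_cell Q S i) \<longrightarrow> \<beta> < a \<bullet> x"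
  proof (rule ccontr)
    assume neg: "\<not> ?thesis"
    have "\<exists>S x. has_pattern E S \<and> dist S R < 1 / real (Suc m) \<and> x \<in> incenter_set (voronoi_cell Q S i) \<and> \<not> \<beta> < a \<bullet> x" for m
    proof -
      have "1 / real (Suc m) > 0" by simp
      then show ?thesis using neg by meson
    qed
    then obtain S x where Sx: "\<And>m. has_pattern E (S m)" "\<And>m. dist (S m) R < 1 / real (Suc m)"
      "\<And>m. x m \<in> incenter_set (voronoi_cell Q (S m) i)" "\<And>m. \<not> \<beta> < a \<bullet> x m" by metis
    have inv: "(\<lambda>m. 1 / real (Suc m)) \<longlonglongrightarrow> 0" using LIMSEQ_inverse_real_of_nat by (simp add: inverse_eq_divide)
    have SR: "S \<longlonglongrightarrow> R"
      by (rule metric_tendsto_imp_tendsto[OF inv]) (use Sx(2) in \<open>auto simp: dist_real_def less_imp_le\<close>)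
    have "x m \<in> Q" for m using incenter_in_cell[OF Sx(3)] voronoi_cell_subset by blast
    then obtain l r where lr: "strict_mono (r :: nat \<Rightarrow> nat)" "(x \<circ> r) \<longlonglongrightarrow> l" using Q_compact unfolding compact_def by meson
    have xr: "(\<lambda>m. x (r m)) \<longlonglongrightarrow> l" using lr(2) by (simp add: o_def)
    have Sr: "(\<lambda>m. S (r m)) \<longlonglongrightarrow> R" using LIMSEQ_subseq_LIMSEQ[OF SR lr(1)] by (simp add: o_def)
    have "l \<in> K" unfolding K_def
      by (rule incenter_closed_graph[OF Sr same[OF Sx(1)] Sx(3) xr])
    then have "\<beta> < a \<bullet> l" by (rule ab(2))
    moreover have "(\<lambda>m. a \<bullet> x (r m)) \<longlonglongrightarrow> a \<bullet> l" by (intro tendsto_intros xr)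
    then have "a \<bullet> l \<le> \<beta>" by (rule LIMSEQ_le_const2) (use Sx(4) in \<open>auto simp: not_less\<close>)
    ultimately show False by simp
  qed
  then obtain \<delta> where \<delta>: "\<delta> > 0" "\<And>S x. has_pattern E S \<Longrightarrow> dist S R < \<delta> \<Longrightarrow> x \<in> incenter_set (voronoi_cell Q S i) \<Longrightarrow> \<beta> < a \<bullet> x"
    by blast
  define \<eta> where "\<eta> = min \<delta> (\<epsilon> / (norm a + 1))"
  have na: "norm a + 1 > 0" using norm_ge_zero[of a] by linarith
  have eta: "\<eta> > 0" "\<eta> \<le> \<delta>" "norm a * \<eta> \<le> \<epsilon>"
  proof -
    show "\<eta> > 0" using \<delta>(1) eps na by (simp add: \<eta>_def)
    then have "norm a * \<eta> \<le> (norm a + 1) * (\<epsilon> / (norm a + 1))" by (intro mult_mono) (auto simp: \<eta>_def)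
    then show "norm a * \<eta> \<le> \<epsilon>" using na by simp
  qed (simp add: \<eta>_def)
  define e where "e = \<eta> / (2 * (L + 1))"
  have e0: "e > 0" using eta L0 by (simp add: e_def)
  have eL: "L * e \<le> \<eta> / 2"
  proof -
    have "L * e \<le> (L + 1) * (\<eta> / (2 * (L + 1)))" using L0 e0 by (intro mult_mono) (auto simp: e_def)
    also have "\<dots> = \<eta> / 2" using L0 by (simp add: field_simps)
    finally show ?thesis .
  qed
  have "\<forall>\<^sub>F k in sequentially. dist (P k \<tau>0) R < \<eta> / 2"
    using tendstoD[OF lim[of \<tau>0], of "\<eta> / 2"] \<tau>0 eta(1) by (simp add: R_def)
  then obtain k0 where k0: "\<And>k. k \<ge> k0 \<Longrightarrow> dist (P k \<tau>0) R < \<eta> / 2" unfolding eventually_sequentially by blast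
  have close: "dist (P k \<tau>) R < \<eta>" if "k \<ge> k0" "\<tau>0 \<le> \<tau>" "\<tau> < \<tau>0 + e" for k \<tau>
  proof -
    have "dist (P k \<tau>) (P k \<tau>0) \<le> L * dist \<tau> \<tau>0"
      by (rule lipschitz_onD[OF cell_curveD(2)[OF sp_curveD(1)[OF c]]]) (use that \<tau>0 in auto)
    also have "\<dots> \<le> L * e" using that L0 by (intro mult_left_mono) (auto simp: dist_real_def)
    finally show ?thesis using eL k0[OF that(1)] dist_triangle[of "P k \<tau>" R "P k \<tau>0"] by linarith
  qed
  \<comment> \<open>A lower bound for \<open>a \<bullet> (C k t $ i - P k t $ i)\<close>: the
    incenter exceeds \<open>\<beta>\<close>, and the generator is at most
    \<open>a \<bullet> p + \<epsilon>\<close>.\<close>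
  define m where "m = \<beta> - a \<bullet> p - \<epsilon>"
  have step: "m * (w - \<tau>0) \<le> a \<bullet> P k w $ i - a \<bullet> P k \<tau>0 $ i" if k: "k \<ge> k0" and w: "\<tau>0 \<le> w" "w < \<tau>0 + e" for k w
  proof -
    note cc = sp_curveD(1)[OF c[of k]]
    have "(norm a * L)-lipschitz_on {\<tau>0..w} (\<lambda>s. a \<bullet> P k s $ i)"
    proof (rule lipschitz_onI)
      fix s s' assume ss: "s \<in> {\<tau>0..w}" "s' \<in> {\<tau>0..w}"
      have "\<bar>a \<bullet> (P k s $ i - P k s' $ i)\<bar> \<le> norm a * norm (P k s $ i - P k s' $ i)" by (rule Cauchy_Schwarz_ineq2)
      also have "\<dots> \<le> norm a * (L * dist s s')"
        using lipschitz_onD[OF cell_curve_component_lipschitz[OF cc less_imp_le[OF \<tau>0]] ss]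
        by (intro mult_left_mono) (auto simp: dist_norm)
      finally show "dist (a \<bullet> P k s $ i) (a \<bullet> P k s' $ i) \<le> norm a * L * dist s s'"
        by (simp add: dist_real_def inner_diff_right mult.assoc)
    qed (use L0 in simp)
    then show ?thesis
    proof (rule ae_lower_slope_lipschitz[OF w(1) _ cell_curveD(1)[OF cc]])
      fix t assume t: "\<tau>0 < t" "t < w" "t \<notin> N k"
      then have t0: "t > 0" using \<tau>0 by simp
      have "((\<lambda>s. P k s $ i) has_vector_derivative C k t $ i - P k t $ i) (at t)"
        using vec_nth_has_vector_derivative[OF cell_curveD(4)[OF cc t0 t(3)], of i] by simp
      then have "((\<lambda>s. a \<bullet> P k s $ i) has_real_derivative a \<bullet> (C k t $ i - P k t $ i)) (at t)"
        by (rule inner_has_real_derivative)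
      then have ls: "lower_slope (\<lambda>s. a \<bullet> P k s $ i) t (a \<bullet> (C k t $ i - P k t $ i))" by (rule lower_slope_has_derivative)
      have cl: "dist (P k t) R < \<eta>" by (rule close[OF k]) (use t w in auto)
      have "\<beta> < a \<bullet> C k t $ i"
        by (rule \<delta>(2)[OF _ _ sp_curveD(2)[OF c t0 t(3)]]) (use pat(1) t0 cl eta in auto)
      moreover have "a \<bullet> P k t $ i \<le> a \<bullet> p + \<epsilon>"
      proof -
        have "a \<bullet> (P k t $ i - p) \<le> norm a * norm (P k t $ i - p)" by (rule norm_cauchy_schwarz)
        also have "\<dots> \<le> norm a * \<eta>"
          using cl Finite_Cartesian_Product.norm_nth_le[of "P k t - R" i] by (intro mult_left_mono) (auto simp: dist_norm p_def)
        finally show ?thesis using eta(3) by (simp add: inner_diff_right)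
      qed
      ultimately show "lower_slope (\<lambda>s. a \<bullet> P k s $ i) t m"
        by (intro lower_slope_mono[OF ls]) (simp add: m_def inner_diff_right)
    qed
  qed
  have stepG: "m * (w - \<tau>0) \<le> a \<bullet> (\<Gamma> w $ i - p)" if w: "\<tau>0 \<le> w" "w < \<tau>0 + e" for w
  proof -
    have "(\<lambda>k. a \<bullet> P k w $ i - a \<bullet> P k \<tau>0 $ i) \<longlonglongrightarrow> a \<bullet> \<Gamma> w $ i - a \<bullet> \<Gamma> \<tau>0 $ i"
      by (intro tendsto_intros lim) (use w \<tau>0 in auto)
    then have "m * (w - \<tau>0) \<le> a \<bullet> \<Gamma> w $ i - a \<bullet> \<Gamma> \<tau>0 $ i"
      by (rule LIMSEQ_le_const) (use step w in blast)
    then show ?thesis by (simp add: inner_diff_right p_def R_def)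
  qed
  define t where "t k = \<tau>0 + e / real (Suc (Suc k))" for k
  have t: "\<tau>0 < t k" "t k < \<tau>0 + e" for k
  proof -
    show "\<tau>0 < t k" using e0 by (simp add: t_def)
    have "e / real (Suc (Suc k)) < e / 1" using e0 by (intro divide_strict_left_mono) auto
    then show "t k < \<tau>0 + e" by (simp add: t_def)
  qed
  have tlim: "t \<longlonglongrightarrow> \<tau>0"
  proof -
    have "(\<lambda>k. \<tau>0 + e * inverse (real (Suc (Suc k)))) \<longlonglongrightarrow> \<tau>0 + e * 0"
      by (intro tendsto_intros LIMSEQ_Suc[OF LIMSEQ_inverse_real_of_nat])
    then show ?thesis by (simp add: t_def[abs_def] divide_inverse)
  qed
  have "(\<lambda>k. (1 / (t k - \<tau>0)) *\<^sub>R (\<Gamma> (t k) $ i - \<Gamma> \<tau>0 $ i)) \<longlonglongrightarrow> v $ i"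
    by (rule has_vector_derivative_quotient_limit[OF vec_nth_has_vector_derivative[OF d] _ tlim]) (use t in \<open>auto simp: less_imp_neq[THEN not_sym]\<close>)
  then have "(\<lambda>k. a \<bullet> ((1 / (t k - \<tau>0)) *\<^sub>R (\<Gamma> (t k) $ i - \<Gamma> \<tau>0 $ i))) \<longlonglongrightarrow> a \<bullet> v $ i"
    by (intro tendsto_intros)
  then have "m \<le> a \<bullet> v $ i"
  proof (rule LIMSEQ_le_const, intro exI[of _ 0] allI impI)
    fix k
    have "m * (t k - \<tau>0) \<le> a \<bullet> (\<Gamma> (t k) $ i - p)" by (rule stepG) (use t[of k] in auto)
    then have "m \<le> a \<bullet> (\<Gamma> (t k) $ i - p) / (t k - \<tau>0)" using t(1)[of k] by (simp add: pos_le_divide_eq)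
    then show "m \<le> a \<bullet> ((1 / (t k - \<tau>0)) *\<^sub>R (\<Gamma> (t k) $ i - \<Gamma> \<tau>0 $ i))"
      by (simp add: p_def R_def)
  qed
  then have "\<beta> - \<epsilon> \<le> a \<bullet> y" by (simp add: m_def y_def inner_add_right)
  then show False using ab(1) by (simp add: \<epsilon>_def field_simps)
qed

text \<open>If two generators coincide, \<open>H_SP\<close> is at most 0 while every
  \<open>F_fun\<close> is at least \<open>h\<close>, so no index is active. Otherwise
  \<open>H_SP\<close> equals the margin; an active generator that is no incenter would increase one
  of its tight constraints strictly, although that constraint is at its minimum over time.\<close>

lemma sp_limit_in_A_SP:
  fixes \<Gamma> :: "real \<Rightarrow> (real^2)^'n::finite"
  assumes X: "\<Gamma> \<tau>0 \<in> configurations Q" and pat: "\<And>\<tau>. \<tau> \<ge> 0 \<Longrightarrow> has_pattern E (\<Gamma> \<tau>)"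
    and h: "h > 0" "\<And>\<tau>. \<tau> \<ge> 0 \<Longrightarrow> margin E (\<Gamma> \<tau>) = h"
    and \<tau>0: "\<tau>0 > 0" and d: "(\<Gamma> has_vector_derivative v) (at \<tau>0)"
    and v: "\<And>i. v $ i + \<Gamma> \<tau>0 $ i \<in> incenter_set (voronoi_cell Q (\<Gamma> \<tau>0) i)"
  shows "\<Gamma> \<tau>0 \<in> A_SP Q"
proof -
  define R where "R = \<Gamma> \<tau>0"
  have patR: "has_pattern E R" unfolding R_def using pat \<tau>0 by simp
  have mR: "margin E R = h" unfolding R_def using h(2) \<tau>0 by simp
  have RX: "R \<in> configurations Q" using X by (simp add: R_def)
  have balls: "cball (R $ i) h \<subseteq> voronoi_cell Q R i" for i
    using le_margin_iff_balls[OF patR less_imp_le[OF h(1)]] mR by simp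
  have "R $ i \<in> incenter_set (voronoi_cell Q R i)" if i: "i \<in> I_SP Q R" for i
  proof (cases "\<forall>i j. i \<noteq> j \<longrightarrow> R $ i \<noteq> R $ j")
    case False
    then obtain i' j' where ij: "i' \<noteq> j'" "R $ i' = R $ j'" by blast
    have "H_SP Q R \<le> norm (R $ i' - R $ j') / 2" using H_SP_ge_iff[of "H_SP Q R" R] ij(1) by blast
    then have "H_SP Q R \<le> 0" using ij(2) by simp
    moreover have "h \<le> F_fun Q R i" by (rule F_fun_ball(3)[OF RX balls])
    ultimately show ?thesis using i h(1) by (simp add: I_SP_def)
  next
    case True
    have F: "F_fun Q R i = H_SP Q R" using i by (simp add: I_SP_def)
    have H0: "H_SP Q R \<ge> 0" using F F_fun_ball(1)[OF RX, of i] by simp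
    have "r \<le> H_SP Q R \<longleftrightarrow> r \<le> margin E R" if "r \<ge> 0" for r
      using H_SP_ge_iff_balls[OF RX _ that] le_margin_iff_balls[OF patR that] True by blast
    then have Hh: "H_SP Q R = h" using H0 h(1) mR by (metis less_imp_le order_antisym order_refl)
    show ?thesis
    proof (rule ccontr)
      assume notIC: "R $ i \<notin> incenter_set (voronoi_cell Q R i)"
      define c where "c = v + R"
      have cI: "c $ j \<in> incenter_set (voronoi_cell Q R j)" for j using v[of j] by (simp add: c_def R_def)
      have "\<forall>j. \<exists>r\<ge>0. cball (c $ j) r \<subseteq> voronoi_cell Q R j \<and> (\<forall>z s. cball z s \<subseteq> voronoi_cell Q R j \<longrightarrow> s \<le> r)"
        using cI unfolding incenter_set_def by blast
      from choice[OF this] obtain \<rho> where rho: "\<And>j. \<rho> j \<ge> 0" "\<And>j. cball (c $ j) (\<rho> j) \<subseteq> voronoi_cell Q R j"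
        "\<And>j z s. cball z s \<subseteq> voronoi_cell Q R j \<Longrightarrow> s \<le> \<rho> j" by blast
      have hr: "h \<le> \<rho> j" for j by (rule rho(3)[OF balls])
      obtain z s where zs: "cball z s \<subseteq> voronoi_cell Q R i" "s > h"
        using notIC balls[of i] h(1) unfolding incenter_set_def by (auto simp: not_le)
      have big: "\<rho> i > h" using rho(3)[OF zs(1)] zs(2) by simp
      obtain k where k: "k \<in> gap_indices E" "i = (case k of Inl (i,j) \<Rightarrow> i | Inr (i,a,b) \<Rightarrow> i)" "gap k R = h"
      proof -
        \<comment> \<open>If all constraints of \<open>i\<close> exceeded \<open>h\<close>, a larger
          disk about the generator would fit into the cell, against
          \<open>F_fun Q R i = h\<close>.\<close>
        have "\<exists>k\<in>gap_indices E. i = (case k of Inl (i,j) \<Rightarrow> i | Inr (i,a,b) \<Rightarrow> i) \<and> gap k R \<le> h"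
        proof (rule ccontr)
          assume neg: "\<not> ?thesis"
          define B where "B = {k\<in>gap_indices E. i = (case k of Inl (i,j) \<Rightarrow> i | Inr (i,a,b) \<Rightarrow> i)}"
          have fB: "finite B" unfolding B_def by (rule finite_subset[OF _ gap_indices_finite[of E]]) auto
          define r where "r = Min (insert (h + 1) ((\<lambda>k. gap k R) ` B))"
          have rh: "r > h" unfolding r_def using fB neg by (subst Min_gr_iff) (auto simp: B_def not_le)
          have rB: "r \<le> gap k R" if "k \<in> B" for k using fB that by (auto simp: r_def)
          have r0: "r \<ge> 0" using rh h(1) by simp
          have "cball (R $ i) r \<subseteq> voronoi_cell Q R i"
            unfolding cball_subset_cell_iff[OF r0]
          proof (intro conjI allI impI ballI, clarify)
            fix a b assume "(a,b) \<in> sides"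
            then have "Inr (i,a,b) \<in> B" by (auto simp: B_def gap_indices_def)
            then show "r \<le> a \<bullet> R $ i - b" using rB[of "Inr (i,a,b)"] by (simp add: gap_def)
          next
            fix j assume "R $ i \<noteq> R $ j"
            then have "Inl (i,j) \<in> B" using patR by (auto simp: B_def gap_indices_def has_pattern_def)
            then show "r \<le> wall_dist R i j (R $ i)" using rB[of "Inl (i,j)"] by (simp add: gap_def wall_dist_self)
          qed
          then have "r \<le> F_fun Q R i" by (rule F_fun_ball(3)[OF RX])
          then show False using F Hh rh by simp
        qed
        then obtain k where k: "k \<in> gap_indices E" "i = (case k of Inl (i,j) \<Rightarrow> i | Inr (i,a,b) \<Rightarrow> i)" "gap k R \<le> h" by blast
        moreover have "h \<le> gap k R" using le_margin_iff[of h E R] mR k(1) by simp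
        ultimately show thesis using that by simp
      qed
      have rate: "gap_rate k R c > 0"
        using gap_rate_ge[OF patR k(1) rho(1,2) k(2) hr k(3)] big by simp
      have dc: "(\<Gamma> has_vector_derivative (c - \<Gamma> \<tau>0)) (at \<tau>0)" using d by (simp add: c_def R_def)
      have der: "((\<lambda>s. gap k (\<Gamma> s)) has_real_derivative gap_rate k R c) (at \<tau>0)"
        using gap_has_derivative[OF dc _ k(1)] patR by (simp add: R_def)
      \<comment> \<open>The margin is \<open>h\<close> at all times, so the gap that equals
        \<open>h\<close> at \<open>\<tau>0\<close> has a local minimum there.\<close>
      have "gap_rate k R c = 0"
      proof (rule DERIV_local_min[OF der \<tau>0], intro allI impI)
        fix s assume "\<bar>\<tau>0 - s\<bar> < \<tau>0"
        then have "s \<ge> 0" by simp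
        then have "h \<le> gap k (\<Gamma> s)" using le_margin_iff[of h E "\<Gamma> s"] h(2) k(1) by simp
        then show "gap k (\<Gamma> \<tau>0) \<le> gap k (\<Gamma> s)" using k(3) by (simp add: R_def)
      qed
      then show False using rate by simp
    qed
  qed
  then show ?thesis using RX unfolding A_SP_def R_def by blast
qed

lemma sp_convergence_with_pattern:
  fixes P :: "real \<Rightarrow> (real^2)^'n::finite"
  assumes c: "sp_curve L P C N" and pat: "\<And>t. t \<ge> 0 \<Longrightarrow> has_pattern E (P t)" and m0: "margin E (P 0) > 0"
  shows "converges_to_set P (largest_weakly_invariant (SP_dynamics Q) (configurations Q) (closure (A_SP Q)))"
proof -
  note cc = sp_curveD(1)[OF c]
  have mmono: "margin E (P s) \<le> margin E (P t)" if "0 \<le> s" "s \<le> t" for s t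
    by (rule sp_curve_margin_mono[OF c pat that])
  have "bdd_above ((\<lambda>t. margin E (P t)) ` {0..})"
  proof -
    have "continuous_on UNIV (margin E :: (real^2)^'n \<Rightarrow> real)" by (rule lipschitz_on_continuous_on[OF margin_lipschitz])
    then have "continuous_on (configurations Q) (margin E :: (real^2)^'n \<Rightarrow> real)" by (rule continuous_on_subset) auto
    then have "compact ((margin E :: (real^2)^'n \<Rightarrow> real) ` configurations Q)" by (rule compact_continuous_image[OF _ configurations_compact])
    then have "bdd_above ((margin E :: (real^2)^'n \<Rightarrow> real) ` configurations Q)" by (intro bounded_imp_bdd_above compact_imp_bounded)
    then show ?thesis by (rule bdd_above_mono) (use cell_curveD(3)[OF cc] in auto)
  qed
  note bdd = this
  define h where "h = (SUP t\<in>{0..}. margin E (P t))"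
  have hup: "margin E (P t) \<le> h" if "t \<ge> 0" for t unfolding h_def by (rule cSUP_upper[OF _ bdd]) (use that in simp)
  have h0: "h > 0" using hup[of 0] m0 by simp
  have hlim: "((\<lambda>t. margin E (P t)) \<longlongrightarrow> h) at_top"
  proof (rule tendstoI)
    fix e :: real assume "e > 0"
    have "\<exists>t0\<ge>0. h - e < margin E (P t0)"
    proof (rule ccontr)
      assume "\<not> ?thesis"
      then have "(SUP t\<in>{0..}. margin E (P t)) \<le> h - e" by (intro cSUP_least) (auto simp: not_less)
      then show False using \<open>e > 0\<close> by (simp add: h_def)
    qed
    then obtain t0 where t0: "t0 \<ge> 0" "h - e < margin E (P t0)" by blast
    have "dist (margin E (P t)) h < e" if "t \<ge> t0" for t
      using mmono[OF t0(1) that] hup[of t] t0 that by (simp add: dist_real_def)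
    then show "\<forall>\<^sub>F t in at_top. dist (margin E (P t)) h < e" unfolding eventually_at_top_linorder by blast
  qed
  show ?thesis
  proof (rule invariance_principle[OF configurations_compact cell_curveD(3)[OF cc] cell_curveD(2)[OF cc]])
    fix s :: "nat \<Rightarrow> real" and \<Gamma>
    assume s: "\<And>k. s k \<ge> 0" "filterlim s at_top sequentially"
      and lim: "\<And>\<tau>. \<tau> \<ge> 0 \<Longrightarrow> (\<lambda>k. P (s k + \<tau>)) \<longlonglongrightarrow> \<Gamma> \<tau>"
    have ck: "sp_curve L (\<lambda>\<tau>. P (s k + \<tau>)) (\<lambda>\<tau>. C (s k + \<tau>)) ((+) (- s k) ` N)" for k
      by (rule sp_curve_translate[OF c s(1)])
    have patk: "has_pattern E (P (s k + \<tau>))" if "\<tau> \<ge> 0" for k \<tau> using pat s(1) that by simp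
    have X: "\<Gamma> \<tau> \<in> configurations Q" if t: "\<tau> \<ge> 0" for \<tau>
      by (rule closed_sequentially[OF compact_imp_closed[OF configurations_compact] _ lim[OF t]])
        (use cell_curveD(3)[OF cc] s(1) t in auto)
    have GL: "L-lipschitz_on {0..} \<Gamma>"
      by (rule lipschitz_on_pointwise_limit[OF cell_curveD(2)[OF sp_curveD(1)[OF ck]]]) (use lim in auto)
    have mG: "margin E (\<Gamma> \<tau>) = h" if t: "\<tau> \<ge> 0" for \<tau>
    proof -
      have "continuous_on UNIV (margin E :: (real^2)^'n \<Rightarrow> real)" by (rule lipschitz_on_continuous_on[OF margin_lipschitz])
      then have "isCont (margin E) (\<Gamma> \<tau>)" by (simp add: continuous_on_eq_continuous_at)
      then have 1: "(\<lambda>k. margin E (P (s k + \<tau>))) \<longlonglongrightarrow> margin E (\<Gamma> \<tau>)" by (rule isCont_tendsto_compose[OF _ lim[OF t]])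
      have "filterlim (\<lambda>k. s k + \<tau>) at_top sequentially"
        using filterlim_tendsto_add_at_top[OF tendsto_const[of \<tau>] s(2)] by (simp add: add.commute)
      then have "(\<lambda>k. margin E (P (s k + \<tau>))) \<longlonglongrightarrow> h" by (rule filterlim_compose[OF hlim])
      then show ?thesis using 1 LIMSEQ_unique by blast
    qed
    \<comment> \<open>A positive limit margin keeps separated generators apart in the limit, so no
      new coincidences arise and \<open>incenter_closed_graph\<close> stays applicable.\<close>
    have patG: "has_pattern E (\<Gamma> \<tau>)" if t: "\<tau> \<ge> 0" for \<tau>
      unfolding has_pattern_def
    proof (intro allI iffI)
      fix i j assume ij: "(i,j) \<in> E"
      then have "h \<le> gap (Inl (i,j)) (\<Gamma> \<tau>)" using le_margin_iff[of h E "\<Gamma> \<tau>"] mG[OF t] by (auto simp: gap_indices_def)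
      then show "\<Gamma> \<tau> $ i \<noteq> \<Gamma> \<tau> $ j" using h0 by (auto simp: gap_def)
    next
      fix i j assume ne: "\<Gamma> \<tau> $ i \<noteq> \<Gamma> \<tau> $ j"
      show "(i,j) \<in> E"
      proof (rule ccontr)
        assume "(i,j) \<notin> E"
        then have eq: "P (s k + \<tau>) $ i = P (s k + \<tau>) $ j" for k using patk[OF t] by (auto simp: has_pattern_def)
        have "(\<lambda>k. P (s k + \<tau>) $ i) \<longlonglongrightarrow> \<Gamma> \<tau> $ i" "(\<lambda>k. P (s k + \<tau>) $ j) \<longlonglongrightarrow> \<Gamma> \<tau> $ j" by (intro tendsto_intros lim t)+
        then show False using ne LIMSEQ_unique unfolding eq by blast
      qed
    qed
    obtain N' where N': "negligible N'" "\<And>x. x > 0 \<Longrightarrow> x \<notin> N' \<Longrightarrow> \<exists>v. (\<Gamma> has_vector_derivative v) (at x)"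
      using lipschitz_ae_vector_differentiable[OF GL] by metis
    have good: "\<exists>v\<in>SP_dynamics Q (\<Gamma> x). (\<Gamma> has_vector_derivative v) (at x) \<and> \<Gamma> x \<in> A_SP Q" if x: "x > 0" "x \<notin> N'" for x
    proof -
      obtain v where v: "(\<Gamma> has_vector_derivative v) (at x)" using N'(2)[OF x] by blast
      have inc: "v $ i + \<Gamma> x $ i \<in> incenter_set (voronoi_cell Q (\<Gamma> x) i)" for i
        by (rule sp_limit_inclusion[OF ck lim patk patG x(1) v])
      have "v \<in> SP_dynamics Q (\<Gamma> x)" unfolding SP_dynamics_def
      proof (intro CollectI allI)
        fix i show "\<exists>c\<in>incenter_set (voronoi_cell Q (\<Gamma> x) i). v $ i = c - \<Gamma> x $ i"
          using inc[of i] by (intro bexI[of _ "v $ i + \<Gamma> x $ i"]) auto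
      qed
      moreover have "\<Gamma> x \<in> A_SP Q"
        by (rule sp_limit_in_A_SP[OF X patG h0 mG x(1) v inc]) (use x in simp)
      ultimately show ?thesis using v by blast
    qed
    have "negligible (insert 0 N')" using N'(1) by simp
    then have "insert 0 N' \<in> null_sets lebesgue" by (simp add: negligible_iff_null_sets)
    then have "AE \<tau> in lebesgue. \<tau> \<in> {0..} \<longrightarrow> (\<exists>v\<in>SP_dynamics Q (\<Gamma> \<tau>). (\<Gamma> has_vector_derivative v) (at \<tau> within {0..}))"
    proof (rule AE_I')
      show "{\<tau> \<in> space lebesgue. \<not> (\<tau> \<in> {0..} \<longrightarrow> (\<exists>v\<in>SP_dynamics Q (\<Gamma> \<tau>). (\<Gamma> has_vector_derivative v) (at \<tau> within {0..})))}
          \<subseteq> insert 0 N'"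
      proof
        fix \<tau> assume *: "\<tau> \<in> {\<tau> \<in> space lebesgue. \<not> (\<tau> \<in> {0..} \<longrightarrow> (\<exists>v\<in>SP_dynamics Q (\<Gamma> \<tau>). (\<Gamma> has_vector_derivative v) (at \<tau> within {0..})))}"
        show "\<tau> \<in> insert 0 N'"
        proof (rule ccontr)
          assume "\<tau> \<notin> insert 0 N'"
          then have "\<tau> > 0" "\<tau> \<notin> N'" using * by auto
          then show False using good[of \<tau>] * has_vector_derivative_at_within by blast
        qed
      qed
    qed
    moreover have "\<Gamma> t \<in> closure (A_SP Q)" if t: "t \<ge> 0" for t
      unfolding closure_approachable
    proof (intro allI impI)
      fix e :: real assume e: "e > 0"
      have L0: "L \<ge> 0" by (rule lipschitz_on_nonneg[OF GL])
      define d where "d = e / (L + 1)"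
      have d0: "d > 0" using e L0 by (simp add: d_def)
      \<comment> \<open>Membership in \<open>A_SP\<close> holds almost everywhere, hence at times
        arbitrarily close to \<open>t\<close>.\<close>
      have "\<not> {t<..<t + d} \<subseteq> N'"
        using open_not_negligible[of "{t<..<t + d}"] d0 negligible_subset[OF N'(1)] by fastforce
      then obtain x where "x \<in> {t<..<t + d}" and xN: "x \<notin> N'" by blast
      then have x: "t < x" "x < t + d" "x \<notin> N'" by auto
      have "dist (\<Gamma> x) (\<Gamma> t) \<le> L * dist x t" by (rule lipschitz_onD[OF GL]) (use x t in auto)
      also have "\<dots> \<le> (L + 1) * (x - t)" using x L0 by (intro mult_mono) (auto simp: dist_real_def)
      also have "\<dots> < (L + 1) * d" using x L0 by (intro mult_strict_left_mono) auto
      finally have "dist (\<Gamma> x) (\<Gamma> t) < e" using L0 by (simp add: d_def)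
      moreover have "\<Gamma> x \<in> A_SP Q" using good[of x] x t by auto
      ultimately show "\<exists>y\<in>A_SP Q. dist y (\<Gamma> t) < e" by blast
    qed
    ultimately show "(AE \<tau> in lebesgue. \<tau> \<in> {0..} \<longrightarrow> (\<exists>v\<in>SP_dynamics Q (\<Gamma> \<tau>). (\<Gamma> has_vector_derivative v) (at \<tau> within {0..}))) \<and>
        (\<forall>\<tau>\<ge>0. \<Gamma> \<tau> \<in> closure (A_SP Q))" by blast
  qed
qed

theorem sp_convergence:
  fixes P :: "real \<Rightarrow> (real^2)^'n::finite"
  assumes sol: "di_solution (SP_dynamics Q) (configurations Q) {0..} P"
  shows "converges_to_set P (largest_weakly_invariant (SP_dynamics Q) (configurations Q) (closure (A_SP Q)))"
proof -
  have "\<exists>L C N. cell_curve L P C N \<and> (\<forall>t>0. t \<notin> N \<longrightarrow> (\<forall>i. C t $ i \<in> incenter_set (voronoi_cell Q (P t) i)))"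
  proof (rule di_solution_cell_curve[OF sol, where \<Phi> = "\<lambda>R c. \<forall>i. c $ i \<in> incenter_set (voronoi_cell Q R i)"])
    fix R v :: "(real^2)^'n" assume "R \<in> configurations Q" and v: "v \<in> SP_dynamics Q R"
    have "(v + R) $ i \<in> incenter_set (voronoi_cell Q R i)" for i
    proof -
      obtain c where "c \<in> incenter_set (voronoi_cell Q R i)" "v $ i = c - R $ i" using v unfolding SP_dynamics_def by blast
      then show ?thesis by simp
    qed
    then show "\<exists>c. v = c - R \<and> (\<forall>i. c $ i \<in> voronoi_cell Q R i) \<and> (\<forall>i. c $ i \<in> incenter_set (voronoi_cell Q R i))"
      using incenter_in_cell by (intro exI[of _ "v + R"]) auto
  qed
  then obtain L C N where c: "sp_curve L P C N" unfolding sp_curve_def by blast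
  obtain T E where T: "T \<ge> 0" "\<And>t. t \<ge> T \<Longrightarrow> has_pattern E (P t)" "margin E (P T) > 0"
    by (rule sp_curve_eventual_pattern[OF c]) blast
  let ?W = "largest_weakly_invariant (SP_dynamics Q) (configurations Q) (closure (A_SP Q)) :: ((real^2)^'n) set"
  \<comment> \<open>Convergence does not depend on the initial piece before \<open>T\<close>, so the
    curve may start when its pattern is final.\<close>
  have "converges_to_set (\<lambda>\<tau>. P (T + \<tau>)) ?W"
    by (rule sp_convergence_with_pattern[OF sp_curve_translate[OF c T(1)]]) (use T in auto)
  then have W: "?W \<noteq> {}" "((\<lambda>\<tau>. infdist (P (T + \<tau>)) ?W) \<longlongrightarrow> 0) at_top" by (auto simp: converges_to_set_def)
  have "filterlim (\<lambda>t. t - T) at_top at_top"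
    using filterlim_tendsto_add_at_top[OF tendsto_const[of "- T"] filterlim_ident] by (simp add: add.commute)
  from filterlim_compose[OF W(2) this] have "((\<lambda>t. infdist (P t) ?W) \<longlongrightarrow> 0) at_top" by simp
  then show ?thesis using W(1) by (simp add: converges_to_set_def)
qed

end

theorem proposition5p11:
  fixes Q :: "(real^2) set"
  assumes "convex_polygon Q"
  shows "(\<forall>P :: real \<Rightarrow> (real^2)^'n::finite.
            di_solution (DC_dynamics Q) (configurations Q) {0..} P \<longrightarrow>
            converges_to_set P
              (largest_weakly_invariant (DC_dynamics Q) (configurations Q) (closure (A_DC Q)))) \<and>
         (\<forall>P :: real \<Rightarrow> (real^2)^'n::finite.
            di_solution (SP_dynamics Q) (configurations Q) {0..} P \<longrightarrow>
            converges_to_set P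
              (largest_weakly_invariant (SP_dynamics Q) (configurations Q) (closure (A_SP Q))))"
proof -
  interpret polygon Q by unfold_locales (rule assms)
  show ?thesis by (intro conjI allI impI dc_convergence sp_convergence)
qed

end
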